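(* Let $n\ge 1$, let $G=C_n$ be the cyclic group of order $n$, and let $a,b$ be positive divisors of $n$. In the category of $\underline{\mathbb{Z}}_{C_n}$-modules there are isomorphisms of $\underline{\mathbb{Z}}_{C_n}$-modules: (a) $\underline{\mathrm{Tor}}_i(\underline{\mathbb{Z}}/I_a,\underline{\mathbb{Z}}/I_b)\cong \underline{\mathbb{Z}}/I_{(a,b)}$ if $i=0$ or $i=3$, and $\cong 0$ otherwise. (b) $\underline{\mathrm{Ext}}^i(\underline{\mathbb{Z}}/I_a,\underline{\mathbb{Z}}/I_b)\cong \underline{\mathbb{Z}}/I_{(a,b)}$ if $i=0$ or $i=3$, and $\cong 0$ otherwise. (c) $\underline{\mathrm{Ext}}^i(\underline{\mathbb{Z}}/I_a,\underline{\mathbb{Z}})\cong \underline{\mathbb{Z}}/I_{a}$ if $i=3$, and $\cong 0$ otherwise.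
   Context: For a finite group $G$, let $\mathcal{B}\mathbb{Z}_G$ be the category whose objects are finite $G$-sets and with morphisms $\mathcal{B}\mathbb{Z}_G(S,T)=\mathrm{Hom}_{\mathbb{Z}[G]}(\mathbb{Z}\langle S\rangle,\mathbb{Z}\langle T\rangle)$. A $\underline{\mathbb{Z}}$-module is an additive functor $M\colon \mathcal{B}\mathbb{Z}_G^{op}\to \mathcal{A}b$ (equivalently, a module over the constant Mackey functor $\underline{\mathbb{Z}}=\underline{\mathbb{Z}}_G$ in $G$-Mackey functors). For a map of $G$-sets $f\colon S\to T$, $f^*\colon M(T)\to M(S)$ is induced by the linearization of $f$ and $f_*\colon M(S)\to M(T)$ is induced by the fiber-sum map $\mathbb{Z}\langle T\rangle\to\mathbb{Z}\langle S\rangle$, $y\mapsto\sum_{x\in f^{-1}(y)}x$; for quotient maps of orbits these are the restriction and transfer maps. $\underline{\mathbb{Z}}$ itself is $S\mapsto \mathrm{Hom}_{\mathbb{Z}[G]}(\mathbb{Z}\langle S\rangle,\mathbb{Z})$: its value at every orbit $G/H$ is $\mathbb{Z}$ with generator $1_{G/H}$, restrictions are identities, and the transfer for $K\le H$ is multiplication by $[H:K]$. Kernels, cokernels and exactness are computed objectwise. Submodules of $\underline{\mathbb{Z}}$ are called ideals. The free modules are $F_X=\mathcal{B}\mathbb{Z}_G(-,X)$. The box product $\Box$ is Day convolution with respect to Cartesian product of $G$-sets, with unit $\underline{\mathbb{Z}}$; the internal hom is $\underline{\mathrm{Hom}}(M,N)(X)=\mathrm{Hom}(F_X\Box M,N)$.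 $\underline{\mathrm{Tor}}_i$ and $\underline{\mathrm{Ext}}^i$ are the derived functors of $\Box$ and $\underline{\mathrm{Hom}}$ (again $\underline{\mathbb{Z}}$-modules). For $G=C_n$ and $d\mid n$, let $\mathcal{F}_d$ be the family of all subgroups of $C_n$ whose order divides $\frac{n}{d}$, and let $I_d\subseteq\underline{\mathbb{Z}}$ be the ideal generated by the elements $1_{G/H}\in\underline{\mathbb{Z}}(G/H)$ for $H\in\mathcal{F}_d$. $(a,b)$ denotes the gcd. *)

theory Defs
  imports "HOL-Algebra.Free_Abelian_Groups" "HOL-Algebra.Elementary_Groups"
    "HOL-Algebra.Group_Action" "HOL-Algebra.Generated_Groups"
begin

section \<open>The category of finite G-sets and linearized maps\<close>

text \<open>
  The points of all G-sets live in one infinite type that contains the cosets of subgroups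
  of \<open>G\<close> and is closed under pairing. Every finite G-set is isomorphic to one
  whose points are in this type, so nothing is lost by taking these G-sets as the objects.
\<close>

datatype 'g pt = Cos "'g set" | Tup "'g pt" "'g pt"

record 'g gset =
  pts :: "'g pt set"
  act :: "'g \<Rightarrow> 'g pt \<Rightarrow> 'g pt"

definition gsets :: "'g monoid \<Rightarrow> 'g gset set" where
  "gsets G = {X. finite (pts X) \<and> group_action G (pts X) (act X)}"

definition orbit_gset :: "'g monoid \<Rightarrow> 'g set \<Rightarrow> 'g gset" where
  "orbit_gset G H =
    (let E = {Cos (a <#\<^bsub>G\<^esub> H) | a. a \<in> carrier G} in
     \<lparr>pts = E, act = (\<lambda>g. \<lambda>p\<in>E. case p of Cos C \<Rightarrow> Cos (g <#\<^bsub>G\<^esub> C) | Tup s t \<Rightarrow> p)\<rparr>)"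

definition prod_gset :: "'g gset \<Rightarrow> 'g gset \<Rightarrow> 'g gset" where
  "prod_gset S T =
    (let E = {Tup s t | s t. s \<in> pts S \<and> t \<in> pts T} in
     \<lparr>pts = E,
      act = (\<lambda>g. \<lambda>p\<in>E. case p of Cos C \<Rightarrow> p | Tup s t \<Rightarrow> Tup (act S g s) (act T g t))\<rparr>)"

type_synonym 'g lmap = "('g pt \<Rightarrow>\<^sub>0 int) \<Rightarrow> ('g pt \<Rightarrow>\<^sub>0 int)"

definition lin :: "'g gset \<Rightarrow> ('g pt \<Rightarrow>\<^sub>0 int) monoid" where
  "lin X = free_Abelian_group (pts X)"

definition lin_act :: "'g gset \<Rightarrow> 'g \<Rightarrow> 'g lmap" where
  "lin_act X g = frag_extend (\<lambda>s. frag_of (act X g s))"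

definition BZ :: "'g monoid \<Rightarrow> 'g gset \<Rightarrow> 'g gset \<Rightarrow> 'g lmap set" where
  "BZ G X Y = {f \<in> hom (lin X) (lin Y) \<inter> extensional (carrier (lin X)).
     \<forall>g\<in>carrier G. \<forall>x\<in>carrier (lin X). f (lin_act X g x) = lin_act Y g (f x)}"

definition bz_id :: "'g gset \<Rightarrow> 'g lmap" where
  "bz_id X = (\<lambda>x\<in>carrier (lin X). x)"

definition bz_comp :: "'g gset \<Rightarrow> 'g lmap \<Rightarrow> 'g lmap \<Rightarrow> 'g lmap" where
  "bz_comp X g f = compose (carrier (lin X)) g f"

definition bz_add :: "'g gset \<Rightarrow> 'g lmap \<Rightarrow> 'g lmap \<Rightarrow> 'g lmap" where
  "bz_add X f g = (\<lambda>x\<in>carrier (lin X). f x + g x)"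

definition BZ_group :: "'g monoid \<Rightarrow> 'g gset \<Rightarrow> 'g gset \<Rightarrow> 'g lmap monoid" where
  "BZ_group G X Y = \<lparr>carrier = BZ G X Y, monoid.mult = bz_add X,
     one = (\<lambda>x\<in>carrier (lin X). 0)\<rparr>"

text \<open>The Cartesian product on morphisms is the tensor product, under
  the identification of the linearization of \<open>S \<times> T\<close> with the tensor product of
  the linearizations of \<open>S\<close> and \<open>T\<close>.\<close>

definition lin_tensor :: "('g pt \<Rightarrow>\<^sub>0 int) \<Rightarrow> ('g pt \<Rightarrow>\<^sub>0 int) \<Rightarrow> ('g pt \<Rightarrow>\<^sub>0 int)" where
  "lin_tensor x y = frag_extend (\<lambda>s. frag_extend (\<lambda>t. frag_of (Tup s t)) y) x"

definition bz_prod :: "'g gset \<Rightarrow> 'g gset \<Rightarrow> 'g lmap \<Rightarrow> 'g lmap \<Rightarrow> 'g lmap" where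
  "bz_prod S T \<alpha> \<beta> = (\<lambda>x\<in>carrier (lin (prod_gset S T)).
     frag_extend (\<lambda>p. case p of Cos C \<Rightarrow> 0
        | Tup s t \<Rightarrow> lin_tensor (\<alpha> (frag_of s)) (\<beta> (frag_of t))) x)"

section \<open>Modules\<close>

text \<open>Abelian groups are written multiplicatively, as in HOL-Algebra. In \<open>mor M X Y f\<close>,
  \<open>f\<close> is a morphism from \<open>X\<close> to \<open>Y\<close> and the result is a map from
  \<open>M(Y)\<close> to \<open>M(X)\<close>.\<close>

record ('g, 'm) zmod =
  ob :: "'g gset \<Rightarrow> 'm monoid"
  mor :: "'g gset \<Rightarrow> 'g gset \<Rightarrow> 'g lmap \<Rightarrow> 'm \<Rightarrow> 'm"

locale zmodule =
  fixes G :: "'g monoid" and M :: "('g, 'm) zmod"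
  assumes comm_group_ob: "X \<in> gsets G \<Longrightarrow> comm_group (ob M X)"
    and mor_hom: "\<lbrakk>X \<in> gsets G; Y \<in> gsets G; f \<in> BZ G X Y\<rbrakk>
      \<Longrightarrow> mor M X Y f \<in> hom (ob M Y) (ob M X)"
    and mor_id: "\<lbrakk>X \<in> gsets G; m \<in> carrier (ob M X)\<rbrakk> \<Longrightarrow> mor M X X (bz_id X) m = m"
    and mor_comp: "\<lbrakk>X \<in> gsets G; Y \<in> gsets G; Z \<in> gsets G; f \<in> BZ G X Y; g \<in> BZ G Y Z;
        m \<in> carrier (ob M Z)\<rbrakk>
      \<Longrightarrow> mor M X Z (bz_comp X g f) m = mor M X Y f (mor M Y Z g m)"
    and mor_add: "\<lbrakk>X \<in> gsets G; Y \<in> gsets G; f \<in> BZ G X Y; g \<in> BZ G X Y;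
        m \<in> carrier (ob M Y)\<rbrakk>
      \<Longrightarrow> mor M X Y (bz_add X f g) m = mor M X Y f m \<otimes>\<^bsub>ob M X\<^esub> mor M X Y g m"

type_synonym ('g, 'm, 'n) nat_trans = "'g gset \<Rightarrow> 'm \<Rightarrow> 'n"

definition zhom :: "'g monoid \<Rightarrow> ('g, 'm) zmod \<Rightarrow> ('g, 'n) zmod \<Rightarrow> ('g, 'm, 'n) nat_trans set" where
  "zhom G M N = {\<eta> \<in> extensional (gsets G).
     (\<forall>X\<in>gsets G. \<eta> X \<in> hom (ob M X) (ob N X) \<inter> extensional (carrier (ob M X))) \<and>
     (\<forall>X\<in>gsets G. \<forall>Y\<in>gsets G. \<forall>f\<in>BZ G X Y. \<forall>m\<in>carrier (ob M Y).
        \<eta> X (mor M X Y f m) = mor N X Y f (\<eta> Y m))}"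

definition zid :: "'g monoid \<Rightarrow> ('g, 'm) zmod \<Rightarrow> ('g, 'm, 'm) nat_trans" where
  "zid G M = (\<lambda>X\<in>gsets G. \<lambda>m\<in>carrier (ob M X). m)"

definition zcomp :: "'g monoid \<Rightarrow> ('g, 'l) zmod \<Rightarrow> ('g, 'm, 'n) nat_trans
    \<Rightarrow> ('g, 'l, 'm) nat_trans \<Rightarrow> ('g, 'l, 'n) nat_trans" where
  "zcomp G L \<theta> \<eta> = (\<lambda>X\<in>gsets G. compose (carrier (ob L X)) (\<theta> X) (\<eta> X))"

definition zhom_group :: "'g monoid \<Rightarrow> ('g, 'm) zmod \<Rightarrow> ('g, 'n) zmod
    \<Rightarrow> ('g, 'm, 'n) nat_trans monoid" where
  "zhom_group G M N = \<lparr>carrier = zhom G M N,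
     monoid.mult = (\<lambda>\<eta> \<theta>. \<lambda>X\<in>gsets G. \<lambda>m\<in>carrier (ob M X). \<eta> X m \<otimes>\<^bsub>ob N X\<^esub> \<theta> X m),
     one = (\<lambda>X\<in>gsets G. \<lambda>m\<in>carrier (ob M X). \<one>\<^bsub>ob N X\<^esub>)\<rparr>"

definition zmod_iso :: "'g monoid \<Rightarrow> ('g, 'm) zmod \<Rightarrow> ('g, 'n) zmod \<Rightarrow> bool" where
  "zmod_iso G M N \<longleftrightarrow> zmodule G M \<and> zmodule G N \<and>
     (\<exists>\<eta>\<in>zhom G M N. \<forall>X\<in>gsets G. bij_betw (\<eta> X) (carrier (ob M X)) (carrier (ob N X)))"

definition zero_mod :: "('g, unit) zmod" where
  "zero_mod = \<lparr>ob = (\<lambda>X. singleton_group ()), mor = (\<lambda>X Y f m. m)\<rparr>"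

text \<open>The subquotient \<open>Z/B\<close> of \<open>M\<close> for objectwise subgroups \<open>B \<le> Z \<le> M\<close> that
  are stable under \<open>mor M\<close>. The product of the subgroup \<open>B(X)\<close> with the image of a coset
  is the coset containing that image.\<close>

definition subquot :: "('g, 'm) zmod \<Rightarrow> ('g gset \<Rightarrow> 'm set) \<Rightarrow> ('g gset \<Rightarrow> 'm set)
    \<Rightarrow> ('g, 'm set) zmod" where
  "subquot M Z B =
    \<lparr>ob = (\<lambda>X. (ob M X)\<lparr>carrier := Z X\<rparr> Mod B X),
     mor = (\<lambda>X Y f C. B X <#>\<^bsub>ob M X\<^esub> (mor M X Y f ` C))\<rparr>"

definition quot :: "('g, 'm) zmod \<Rightarrow> ('g gset \<Rightarrow> 'm set) \<Rightarrow> ('g, 'm set) zmod" where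
  "quot M I = subquot M (\<lambda>X. carrier (ob M X)) I"

definition submodule_of :: "'g monoid \<Rightarrow> ('g, 'm) zmod \<Rightarrow> ('g gset \<Rightarrow> 'm set) \<Rightarrow> bool" where
  "submodule_of G M I \<longleftrightarrow> (\<forall>X\<in>gsets G. subgroup (I X) (ob M X)) \<and>
     (\<forall>X\<in>gsets G. \<forall>Y\<in>gsets G. \<forall>f\<in>BZ G X Y. mor M X Y f ` I Y \<subseteq> I X)"

definition gen_submodule :: "'g monoid \<Rightarrow> ('g, 'm) zmod \<Rightarrow> ('g gset \<Rightarrow> 'm set)
    \<Rightarrow> 'g gset \<Rightarrow> 'm set" where
  "gen_submodule G M E X =
     \<Inter> {I X | I. submodule_of G M I \<and> (\<forall>Y\<in>gsets G. E Y \<subseteq> I Y)}"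

section \<open>The constant module and its ideals\<close>

definition constZ :: "'g monoid \<Rightarrow> ('g, ('g pt \<Rightarrow>\<^sub>0 int) \<Rightarrow> int) zmod" where
  "constZ G =
    \<lparr>ob = (\<lambda>X.
       \<lparr>carrier = {u \<in> hom (lin X) integer_group \<inter> extensional (carrier (lin X)).
          \<forall>g\<in>carrier G. \<forall>x\<in>carrier (lin X). u (lin_act X g x) = u x},
        monoid.mult = (\<lambda>u v. \<lambda>x\<in>carrier (lin X). u x + v x),
        one = (\<lambda>x\<in>carrier (lin X). 0)\<rparr>),
     mor = (\<lambda>X Y f u. compose (carrier (lin X)) u f)\<rparr>"

definition one_elt :: "'g gset \<Rightarrow> ('g pt \<Rightarrow>\<^sub>0 int) \<Rightarrow> int" where
  "one_elt X = (\<lambda>x\<in>carrier (lin X). \<Sum>s\<in>Poly_Mapping.keys x. Poly_Mapping.lookup x s)"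

definition family :: "'g monoid \<Rightarrow> nat \<Rightarrow> 'g set set" where
  "family G d = {H. subgroup H G \<and> card H dvd order G div d}"

definition ideal_of :: "'g monoid \<Rightarrow> nat \<Rightarrow> 'g gset \<Rightarrow> (('g pt \<Rightarrow>\<^sub>0 int) \<Rightarrow> int) set" where
  "ideal_of G d = gen_submodule G (constZ G)
     (\<lambda>X. {one_elt X | H. H \<in> family G d \<and> X = orbit_gset G H})"

definition Zquot :: "'g monoid \<Rightarrow> nat \<Rightarrow> ('g, (('g pt \<Rightarrow>\<^sub>0 int) \<Rightarrow> int) set) zmod" where
  "Zquot G d = quot (constZ G) (ideal_of G d)"

section \<open>Free modules, box product and internal hom\<close>

definition rep :: "'g monoid \<Rightarrow> 'g gset \<Rightarrow> ('g, 'g lmap) zmod" where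
  "rep G X = \<lparr>ob = (\<lambda>W. BZ_group G W X), mor = (\<lambda>V W f \<phi>. bz_comp V \<phi> f)\<rparr>"

definition rep_map :: "'g monoid \<Rightarrow> 'g gset \<Rightarrow> 'g gset \<Rightarrow> 'g lmap
    \<Rightarrow> ('g, 'g lmap, 'g lmap) nat_trans" where
  "rep_map G X Y f = (\<lambda>W\<in>gsets G. \<lambda>\<phi>\<in>BZ G W X. bz_comp W f \<phi>)"

text \<open>The value of the box product at \<open>X\<close> is the coend over finite G-sets \<open>S\<close> and \<open>T\<close> of
  \<open>BZ(X, S \<times> T) \<otimes> M(S) \<otimes> N(T)\<close>. It is presented by generators \<open>(S, T, \<phi>, m, n)\<close>
  subject to additivity in \<open>\<phi>\<close>, \<open>m\<close> and \<open>n\<close> and to the coend relations.\<close>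

type_synonym ('g, 'm, 'n) box_gen = "'g gset \<times> 'g gset \<times> 'g lmap \<times> 'm \<times> 'n"

definition box_gens :: "'g monoid \<Rightarrow> ('g, 'm) zmod \<Rightarrow> ('g, 'n) zmod \<Rightarrow> 'g gset
    \<Rightarrow> ('g, 'm, 'n) box_gen set" where
  "box_gens G M N X = {(S, T, \<phi>, m, n) | S T \<phi> m n. S \<in> gsets G \<and> T \<in> gsets G \<and>
     \<phi> \<in> BZ G X (prod_gset S T) \<and> m \<in> carrier (ob M S) \<and> n \<in> carrier (ob N T)}"

definition pre_box :: "'g monoid \<Rightarrow> ('g, 'm) zmod \<Rightarrow> ('g, 'n) zmod
    \<Rightarrow> ('g, ('g, 'm, 'n) box_gen \<Rightarrow>\<^sub>0 int) zmod" where
  "pre_box G M N =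
    \<lparr>ob = (\<lambda>X. free_Abelian_group (box_gens G M N X)),
     mor = (\<lambda>X Y f. frag_extend (\<lambda>(S, T, \<phi>, m, n). frag_of (S, T, bz_comp X \<phi> f, m, n)))\<rparr>"

definition box_rels :: "'g monoid \<Rightarrow> ('g, 'm) zmod \<Rightarrow> ('g, 'n) zmod \<Rightarrow> 'g gset
    \<Rightarrow> (('g, 'm, 'n) box_gen \<Rightarrow>\<^sub>0 int) set" where
  "box_rels G M N X =
     {frag_of (S, T, bz_add X \<phi> \<phi>', m, n) - frag_of (S, T, \<phi>, m, n) - frag_of (S, T, \<phi>', m, n)
       | S T \<phi> \<phi>' m n. S \<in> gsets G \<and> T \<in> gsets G \<and>
         \<phi> \<in> BZ G X (prod_gset S T) \<and> \<phi>' \<in> BZ G X (prod_gset S T) \<and>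
         m \<in> carrier (ob M S) \<and> n \<in> carrier (ob N T)} \<union>
     {frag_of (S, T, \<phi>, m \<otimes>\<^bsub>ob M S\<^esub> m', n) - frag_of (S, T, \<phi>, m, n) - frag_of (S, T, \<phi>, m', n)
       | S T \<phi> m m' n. S \<in> gsets G \<and> T \<in> gsets G \<and> \<phi> \<in> BZ G X (prod_gset S T) \<and>
         m \<in> carrier (ob M S) \<and> m' \<in> carrier (ob M S) \<and> n \<in> carrier (ob N T)} \<union>
     {frag_of (S, T, \<phi>, m, n \<otimes>\<^bsub>ob N T\<^esub> n') - frag_of (S, T, \<phi>, m, n) - frag_of (S, T, \<phi>, m, n')
       | S T \<phi> m n n'. S \<in> gsets G \<and> T \<in> gsets G \<and> \<phi> \<in> BZ G X (prod_gset S T) \<and>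
         m \<in> carrier (ob M S) \<and> n \<in> carrier (ob N T) \<and> n' \<in> carrier (ob N T)} \<union>
     {frag_of (S, T, bz_comp X (bz_prod S' T' \<alpha> \<beta>) \<phi>, m, n)
        - frag_of (S', T', \<phi>, mor M S' S \<alpha> m, mor N T' T \<beta> n)
       | S T S' T' \<alpha> \<beta> \<phi> m n. S \<in> gsets G \<and> T \<in> gsets G \<and> S' \<in> gsets G \<and> T' \<in> gsets G \<and>
         \<alpha> \<in> BZ G S' S \<and> \<beta> \<in> BZ G T' T \<and> \<phi> \<in> BZ G X (prod_gset S' T') \<and>
         m \<in> carrier (ob M S) \<and> n \<in> carrier (ob N T)}"

definition box_relsub :: "'g monoid \<Rightarrow> ('g, 'm) zmod \<Rightarrow> ('g, 'n) zmod \<Rightarrow> 'g gset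
    \<Rightarrow> (('g, 'm, 'n) box_gen \<Rightarrow>\<^sub>0 int) set" where
  "box_relsub G M N X = generate (ob (pre_box G M N) X) (box_rels G M N X)"

definition box :: "'g monoid \<Rightarrow> ('g, 'm) zmod \<Rightarrow> ('g, 'n) zmod
    \<Rightarrow> ('g, (('g, 'm, 'n) box_gen \<Rightarrow>\<^sub>0 int) set) zmod" where
  "box G M N = quot (pre_box G M N) (box_relsub G M N)"

definition box_map :: "'g monoid \<Rightarrow> ('g, 'm) zmod \<Rightarrow> ('g, 'n) zmod
    \<Rightarrow> ('g, 'k) zmod \<Rightarrow> ('g, 'l) zmod
    \<Rightarrow> ('g, 'm, 'k) nat_trans \<Rightarrow> ('g, 'n, 'l) nat_trans
    \<Rightarrow> ('g, (('g, 'm, 'n) box_gen \<Rightarrow>\<^sub>0 int) set, (('g, 'k, 'l) box_gen \<Rightarrow>\<^sub>0 int) set) nat_trans"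
  where
  "box_map G M N K L \<eta> \<theta> = (\<lambda>X\<in>gsets G. \<lambda>C\<in>carrier (ob (box G M N) X).
     box_relsub G K L X <#>\<^bsub>ob (pre_box G K L) X\<^esub>
       (frag_extend (\<lambda>(S, T, \<phi>, m, n). frag_of (S, T, \<phi>, \<eta> S m, \<theta> T n)) ` C))"

definition ihom :: "'g monoid \<Rightarrow> ('g, 'm) zmod \<Rightarrow> ('g, 'n) zmod
    \<Rightarrow> ('g, ('g, (('g, 'g lmap, 'm) box_gen \<Rightarrow>\<^sub>0 int) set, 'n) nat_trans) zmod" where
  "ihom G M N =
    \<lparr>ob = (\<lambda>X. zhom_group G (box G (rep G X) M) N),
     mor = (\<lambda>X Y f \<eta>. zcomp G (box G (rep G X) M) \<eta>
        (box_map G (rep G X) M (rep G Y) M (rep_map G X Y f) (zid G M)))\<rparr>"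

text \<open>The map from \<open>Hom(L, N)\<close> to \<open>Hom(M, N)\<close> induced by \<open>\<theta>\<close> from \<open>M\<close> to \<open>L\<close>.\<close>

definition ihom_pre :: "'g monoid \<Rightarrow> ('g, 'm) zmod \<Rightarrow> ('g, 'l) zmod \<Rightarrow> ('g, 'n) zmod
    \<Rightarrow> ('g, 'm, 'l) nat_trans
    \<Rightarrow> ('g, ('g, (('g, 'g lmap, 'l) box_gen \<Rightarrow>\<^sub>0 int) set, 'n) nat_trans,
            ('g, (('g, 'g lmap, 'm) box_gen \<Rightarrow>\<^sub>0 int) set, 'n) nat_trans) nat_trans" where
  "ihom_pre G M L N \<theta> = (\<lambda>X\<in>gsets G. \<lambda>\<eta>\<in>carrier (ob (ihom G L N) X).
     zcomp G (box G (rep G X) M) \<eta>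
       (box_map G (rep G X) M (rep G X) L (zid G (rep G X)) \<theta>))"

section \<open>Derived functors\<close>

text \<open>\<open>P\<close> is a direct sum of representable modules: there is a set \<open>B\<close> of
  elements \<open>e\<close> of \<open>P(X)\<close>, for varying \<open>X\<close>, such that the Yoneda map from the direct sum of the
  \<open>BZ(Y, X)\<close> over \<open>(X, e) \<in> B\<close> to \<open>P(Y)\<close> is bijective for all \<open>Y\<close>.\<close>

definition free_mod :: "'g monoid \<Rightarrow> ('g, 'p) zmod \<Rightarrow> bool" where
  "free_mod G P \<longleftrightarrow> zmodule G P \<and>
     (\<exists>B \<subseteq> {(X, e). X \<in> gsets G \<and> e \<in> carrier (ob P X)}. \<forall>Y\<in>gsets G.
        bij_betw (\<lambda>c. gfinprod (ob P Y) (\<lambda>(X, e). mor P Y X (c (X, e)) e) B)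
          {c \<in> (\<Pi>\<^sub>E (X, e)\<in>B. BZ G Y X).
             finite {b \<in> B. c b \<noteq> \<one>\<^bsub>BZ_group G Y (fst b)\<^esub>}}
          (carrier (ob P Y)))"

definition free_resolution :: "'g monoid \<Rightarrow> ('g, 'm) zmod \<Rightarrow> (nat \<Rightarrow> ('g, 'p) zmod)
    \<Rightarrow> (nat \<Rightarrow> ('g, 'p, 'p) nat_trans) \<Rightarrow> ('g, 'p, 'm) nat_trans \<Rightarrow> bool" where
  "free_resolution G M P d \<epsilon> \<longleftrightarrow>
     (\<forall>k. free_mod G (P k)) \<and>
     (\<forall>k. d k \<in> zhom G (P (Suc k)) (P k)) \<and> \<epsilon> \<in> zhom G (P 0) M \<and>
     (\<forall>X\<in>gsets G.
        \<epsilon> X ` carrier (ob (P 0) X) = carrier (ob M X) \<and>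
        d 0 X ` carrier (ob (P (Suc 0)) X) = kernel (ob (P 0) X) (ob M X) (\<epsilon> X) \<and>
        (\<forall>k. d (Suc k) X ` carrier (ob (P (Suc (Suc k))) X)
               = kernel (ob (P (Suc k)) X) (ob (P k) X) (d k X)))"

text \<open>A chosen free resolution of \<open>M\<close>. Free modules are projective, so it computes derived
  functors, and any choice gives the same result up to isomorphism. The type of its elements
  is large enough for a free resolution to exist for every module \<open>M\<close> with values in \<open>'m\<close>, since
  there are only countably many isomorphism classes of finite G-sets.\<close>

definition some_resolution :: "'g monoid \<Rightarrow> ('g, 'm) zmod
    \<Rightarrow> (nat \<Rightarrow> ('g, 'm \<times> nat \<Rightarrow> int) zmod)
      \<times> (nat \<Rightarrow> ('g, 'm \<times> nat \<Rightarrow> int, 'm \<times> nat \<Rightarrow> int) nat_trans)" where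
  "some_resolution G M = (SOME (P, d). \<exists>\<epsilon>. free_resolution G M P d \<epsilon>)"

text \<open>Homology of a chain complex with \<open>\<delta> k\<close> from \<open>C (Suc k)\<close> to \<open>C k\<close>, and cohomology of a
  cochain complex with \<open>\<delta> k\<close> from \<open>C k\<close> to \<open>C (Suc k)\<close>.\<close>

definition chain_homology :: "(nat \<Rightarrow> ('g, 'm) zmod) \<Rightarrow> (nat \<Rightarrow> ('g, 'm, 'm) nat_trans)
    \<Rightarrow> nat \<Rightarrow> ('g, 'm set) zmod" where
  "chain_homology C \<delta> i = subquot (C i)
     (\<lambda>X. case i of 0 \<Rightarrow> carrier (ob (C 0) X)
                  | Suc k \<Rightarrow> kernel (ob (C (Suc k)) X) (ob (C k) X) (\<delta> k X))
     (\<lambda>X. \<delta> i X ` carrier (ob (C (Suc i)) X))"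

definition cochain_cohomology :: "(nat \<Rightarrow> ('g, 'm) zmod) \<Rightarrow> (nat \<Rightarrow> ('g, 'm, 'm) nat_trans)
    \<Rightarrow> nat \<Rightarrow> ('g, 'm set) zmod" where
  "cochain_cohomology C \<delta> i = subquot (C i)
     (\<lambda>X. kernel (ob (C i) X) (ob (C (Suc i)) X) (\<delta> i X))
     (\<lambda>X. case i of 0 \<Rightarrow> {\<one>\<^bsub>ob (C 0) X\<^esub>}
                  | Suc k \<Rightarrow> \<delta> k X ` carrier (ob (C k) X))"

definition Tor :: "'g monoid \<Rightarrow> nat \<Rightarrow> ('g, 'm) zmod \<Rightarrow> ('g, 'n) zmod
    \<Rightarrow> ('g, (('g, 'm \<times> nat \<Rightarrow> int, 'n) box_gen \<Rightarrow>\<^sub>0 int) set set) zmod" where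
  "Tor G i M N = (case some_resolution G M of (P, d) \<Rightarrow>
     chain_homology (\<lambda>k. box G (P k) N)
       (\<lambda>k. box_map G (P (Suc k)) N (P k) N (d k) (zid G N)) i)"

definition Ext :: "'g monoid \<Rightarrow> nat \<Rightarrow> ('g, 'm) zmod \<Rightarrow> ('g, 'n) zmod
    \<Rightarrow> ('g, ('g, (('g, 'g lmap, 'm \<times> nat \<Rightarrow> int) box_gen \<Rightarrow>\<^sub>0 int) set, 'n) nat_trans set) zmod"
  where
  "Ext G i M N = (case some_resolution G M of (P, d) \<Rightarrow>
     cochain_cohomology (\<lambda>k. ihom G (P k) N)
       (\<lambda>k. ihom_pre G (P (Suc k)) (P k) N (d k)) i)"

end

theory Submission
  imports Defs "HOL-Algebra.Multiplicative_Group" "HOL-Computational_Algebra.Primes"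
begin

text \<open>
  Let \<open>c\<close> generate \<open>G\<close> and let \<open>S\<close> be the orbit with \<open>a\<close> points. Since \<open>I\<^sub>a\<close> is generated by the unit at
  \<open>S\<close>, the module \<open>\<int>/I\<^sub>a\<close> has the free resolution \<open>F\<^sub>* \<leftarrow> F\<^sub>S \<leftarrow> F\<^sub>S \<leftarrow> F\<^sub>* \<leftarrow> 0\<close> with maps
  augmentation, \<open>1 - c\<close> and norm. Permutation modules are self-dual, so that the box product and the internal
  hom of \<open>F\<^sub>T\<close> with \<open>N\<close> both have the value \<open>N(T \<times> X)\<close> at \<open>X\<close>. For \<open>N = \<int>/I\<^sub>b\<close> this is the group of invariant
  functions \<open>F\<close> on \<open>T \<times> X\<close>, where \<open>F\<close> counts modulo \<open>b / gcd(b, p)\<close> on the orbits of size \<open>p\<close>, and \<open>b = 0\<close>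
  gives \<open>N = \<int>\<close>. Restricted to the points over a fixed \<open>x\<close>, invariant functions are periodic sequences, for
  which the exactness in the middle and the two outer homology groups are elementary divisibility statements.
  Hom and box product with a fixed module preserve chain homotopies, so this resolution computes
  Tor and Ext.
\<close>

section \<open>Linear maps between permutation modules\<close>

text \<open>The numerical core is the identity p * \<open>weight a p\<close> = lcm(a, p). Orbits of
  S x X over an orbit of p points have lcm(a, p) points, and a sum over all of S is
  \<open>weight a p\<close> times a sum over one period. So the full sum is divisible by
  \<open>weight b p\<close> exactly when the period sum is divisible by
  \<open>weight b (lcm a p)\<close>, the modulus that applies over S x X. This forces degrees 1 and
  2 to vanish. In degree 3 the kernel consists of the multiples of b / gcd(a, b) modulo
  \<open>weight b p\<close>, whence the constant \<open>weight b a\<close>; for b = 0 the kernel is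
  trivial, so one computation proves that the resolution is exact, and another use of it settles
  coefficients in \<int>. Two obstacles shape the rest. Tor and Ext use an unspecified resolution
  with elements of a prescribed type, so representable modules must be encoded in that type and the
  comparison theorem is proved for natural transformations. The box product is a coend over all
  finite G-sets, so its elements are reachable only through generators, and inverse maps must be
  checked against four families of relations.\<close>

lemma lin_simps [simp]:
  "u \<in> carrier (lin X) \<longleftrightarrow> Poly_Mapping.keys u \<subseteq> pts X"
  "monoid.mult (lin X) = (+)" "\<one>\<^bsub>lin X\<^esub> = 0"
  by (auto simp: lin_def free_Abelian_group_def)

lemma keys_add_subset:
  "\<lbrakk>Poly_Mapping.keys u \<subseteq> A; Poly_Mapping.keys v \<subseteq> A\<rbrakk> \<Longrightarrow> Poly_Mapping.keys (u + v) \<subseteq> A"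
  using keys_add by fastforce

lemma keys_diff_subset:
  "\<lbrakk>Poly_Mapping.keys u \<subseteq> A; Poly_Mapping.keys (v :: 'a \<Rightarrow>\<^sub>0 int) \<subseteq> A\<rbrakk>
    \<Longrightarrow> Poly_Mapping.keys (u - v) \<subseteq> A"
  using keys_diff by fastforce

lemma keys_sum_subset:
  "(\<And>i. i \<in> I \<Longrightarrow> Poly_Mapping.keys (u i :: 'a \<Rightarrow>\<^sub>0 int) \<subseteq> A) \<Longrightarrow> Poly_Mapping.keys (sum u I) \<subseteq> A"
  using keys_sum by fastforce

lemma keys_extend_subset:
  "\<lbrakk>Poly_Mapping.keys u \<subseteq> A; \<And>x. x \<in> A \<Longrightarrow> Poly_Mapping.keys (f x) \<subseteq> B\<rbrakk>
    \<Longrightarrow> Poly_Mapping.keys (frag_extend f u) \<subseteq> B"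
  using keys_frag_extend[of f u] by blast

lemma lin_induct [consumes 1, case_names zero one diff]:
  assumes "Poly_Mapping.keys (u :: 'a \<Rightarrow>\<^sub>0 int) \<subseteq> S" "P 0" "\<And>x. x \<in> S \<Longrightarrow> P (frag_of x)"
    "\<And>u v. \<lbrakk>Poly_Mapping.keys u \<subseteq> S; Poly_Mapping.keys v \<subseteq> S; P u; P v\<rbrakk> \<Longrightarrow> P (u - v)"
  shows "P u"
  by (rule free_Abelian_group_induct[of u S]) (use assms in auto)

lemma frag_extend_sum': "frag_extend f (\<Sum>i\<in>I. g i) = (\<Sum>i\<in>I. frag_extend f (g i))"
  by (induction I rule: infinite_finite_induct) (auto simp: frag_extend_add)

lemmas frag_extend_linear =
  frag_extend_0 frag_extend_of frag_extend_cmul frag_extend_minus frag_extend_add frag_extend_diff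
  frag_extend_sum'

lemma frag_extend_frag_extend:
  "frag_extend f (frag_extend h c) = frag_extend (\<lambda>x. frag_extend f (h x)) c"
  using subset_UNIV by (induction c rule: frag_induction) (auto simp: frag_extend_diff)

lemma frag_extend_zero_fun [simp]: "frag_extend (\<lambda>x. 0) c = 0"
  by (simp add: frag_extend_def)

lemma frag_extend_delta:
  assumes "Poly_Mapping.keys u \<subseteq> A" "finite A"
  shows "frag_extend f u = (\<Sum>x\<in>A. frag_cmul (Poly_Mapping.lookup u x) (f x))"
  unfolding frag_extend_def
  by (rule sum.mono_neutral_left) (use assms in \<open>auto simp: in_keys_iff\<close>)

lemma frag_sum_expansion:
  assumes "Poly_Mapping.keys u \<subseteq> A" "finite A"
  shows "(\<Sum>x\<in>A. frag_cmul (Poly_Mapping.lookup u x) (frag_of x)) = u"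
  using frag_extend_delta[OF assms, of frag_of] frag_expansion[of u] by simp

lemma lin_act_simps [simp]:
  "lin_act X g 0 = 0" "lin_act X g (frag_of x) = frag_of (act X g x)"
  "lin_act X g (u + v) = lin_act X g u + lin_act X g v"
  "lin_act X g (u - v) = lin_act X g u - lin_act X g v"
  "lin_act X g (- u) = - lin_act X g u"
  "lin_act X g (frag_cmul c u) = frag_cmul c (lin_act X g u)"
  "lin_act X g (\<Sum>i\<in>I. w i) = (\<Sum>i\<in>I. lin_act X g (w i))"
  by (simp_all add: lin_act_def frag_extend_linear)

lemma hom_extend:
  assumes "f \<in> hom (lin X) (lin Y)" "Poly_Mapping.keys u \<subseteq> pts X"
  shows "f u = frag_extend (\<lambda>x. f (frag_of x)) u"
  using assms(2)
proof (induction u rule: lin_induct)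
  case zero
  have "f (0 + 0) = f 0 + f 0" using assms(1) hom_frag_add[of f "pts X" "pts Y" 0 0] by (simp add: lin_def)
  then show ?case by simp
next
  case (diff x y)
  then show ?case using hom_frag_diff[of f "pts X" "pts Y" x y] assms(1)
    by (simp add: lin_def frag_extend_diff)
qed auto

lemma BZ_extend:
  assumes "f \<in> BZ G X Y" "Poly_Mapping.keys u \<subseteq> pts X"
  shows "f u = frag_extend (\<lambda>x. f (frag_of x)) u"
  using assms hom_extend unfolding BZ_def by blast

lemma BZ_eqI:
  assumes "f \<in> BZ G X Y" "h \<in> BZ G X Y" "\<And>x. x \<in> pts X \<Longrightarrow> f (frag_of x) = h (frag_of x)"
  shows "f = h"
proof (rule extensionalityI)
  show "f \<in> extensional (carrier (lin X))" "h \<in> extensional (carrier (lin X))"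
    using assms by (auto simp: BZ_def)
  fix u assume "u \<in> carrier (lin X)"
  then have u: "Poly_Mapping.keys u \<subseteq> pts X" by simp
  show "f u = h u"
    unfolding BZ_extend[OF assms(1) u] BZ_extend[OF assms(2) u]
    by (rule frag_extend_eq) (use u assms(3) in auto)
qed

lemma BZ_keys:
  "\<lbrakk>f \<in> BZ G X Y; Poly_Mapping.keys u \<subseteq> pts X\<rbrakk> \<Longrightarrow> Poly_Mapping.keys (f u) \<subseteq> pts Y"
  unfolding BZ_def hom_def by (auto simp: Pi_iff)

lemma BZ_keys_of: "\<lbrakk>f \<in> BZ G X Y; x \<in> pts X\<rbrakk> \<Longrightarrow> Poly_Mapping.keys (f (frag_of x)) \<subseteq> pts Y"
  by (rule BZ_keys) auto

lemma BZ_act: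
  "\<lbrakk>f \<in> BZ G X Y; g \<in> carrier G; x \<in> pts X\<rbrakk>
    \<Longrightarrow> f (frag_of (act X g x)) = lin_act Y g (f (frag_of x))"
  unfolding BZ_def by (force simp: lin_act_simps(2)[symmetric] simp del: lin_act_simps(2))

lemma BZ_add:
  "\<lbrakk>f \<in> BZ G X Y; Poly_Mapping.keys u \<subseteq> pts X; Poly_Mapping.keys v \<subseteq> pts X\<rbrakk> \<Longrightarrow> f (u + v) = f u + f v"
  unfolding BZ_def hom_def by auto

text \<open>Linear extension from points, cut down to the carrier because \<open>BZ\<close> contains
  only extensional functions.\<close>

definition bzl :: "'g gset \<Rightarrow> ('g pt \<Rightarrow> 'g pt \<Rightarrow>\<^sub>0 int) \<Rightarrow> 'g lmap" where
  "bzl X \<phi> = (\<lambda>u\<in>carrier (lin X). frag_extend \<phi> u)"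

lemma bzl_apply: "Poly_Mapping.keys u \<subseteq> pts X \<Longrightarrow> bzl X \<phi> u = frag_extend \<phi> u"
  by (simp add: bzl_def)

lemma bzl_of [simp]: "x \<in> pts X \<Longrightarrow> bzl X \<phi> (frag_of x) = \<phi> x"
  by (simp add: bzl_apply)

section \<open>Actions on finite sets of points\<close>

lemma gsets_group: "X \<in> gsets G \<Longrightarrow> group G"
  by (auto simp: gsets_def group_action_def group_hom_def)

lemma gsets_finite: "X \<in> gsets G \<Longrightarrow> finite (pts X)"
  by (simp add: gsets_def)

lemma gsets_action: "X \<in> gsets G \<Longrightarrow> group_action G (pts X) (act X)"
  by (simp add: gsets_def)

lemma act_closed: "\<lbrakk>X \<in> gsets G; g \<in> carrier G; x \<in> pts X\<rbrakk> \<Longrightarrow> act X g x \<in> pts X"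
  by (rule group_action.element_image[OF gsets_action]) auto

lemma act_mult:
  "\<lbrakk>X \<in> gsets G; g \<in> carrier G; h \<in> carrier G; x \<in> pts X\<rbrakk>
    \<Longrightarrow> act X (g \<otimes>\<^bsub>G\<^esub> h) x = act X g (act X h x)"
  by (rule group_action.composition_rule[OF gsets_action])

lemma act_one: "\<lbrakk>X \<in> gsets G; x \<in> pts X\<rbrakk> \<Longrightarrow> act X \<one>\<^bsub>G\<^esub> x = x"
  using group_action.id_eq_one[OF gsets_action, of X G] by (metis restrict_apply')

lemma act_inv:
  assumes "X \<in> gsets G" "g \<in> carrier G" "x \<in> pts X"
  shows "act X (inv\<^bsub>G\<^esub> g) (act X g x) = x" "act X g (act X (inv\<^bsub>G\<^esub> g) x) = x"
proof -
  interpret group G using gsets_group assms(1) .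
  show "act X (inv\<^bsub>G\<^esub> g) (act X g x) = x" "act X g (act X (inv\<^bsub>G\<^esub> g) x) = x"
    using assms act_mult[OF assms(1), of "inv\<^bsub>G\<^esub> g" g x] act_mult[OF assms(1), of g "inv\<^bsub>G\<^esub> g" x]
      act_one[OF assms(1,3)]
    by auto
qed

text \<open>\<open>group_action\<close> demands a homomorphism into \<open>BijGroup\<close>, whose
  elements are extensional bijections. Bijectivity comes from the inverse group element,
  extensionality from the last premise.\<close>

lemma gsetI:
  assumes "group G" "finite E"
    and "\<And>g x. \<lbrakk>g \<in> carrier G; x \<in> E\<rbrakk> \<Longrightarrow> \<phi> g x \<in> E"
    and "\<And>x. x \<in> E \<Longrightarrow> \<phi> \<one>\<^bsub>G\<^esub> x = x"
    and "\<And>g h x. \<lbrakk>g \<in> carrier G; h \<in> carrier G; x \<in> E\<rbrakk> \<Longrightarrow> \<phi> (g \<otimes>\<^bsub>G\<^esub> h) x = \<phi> g (\<phi> h x)"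
    and "\<And>g. \<phi> g \<in> extensional E"
  shows "\<lparr>pts = E, act = \<phi>\<rparr> \<in> gsets G"
proof -
  interpret group G by fact
  have bij: "\<phi> g \<in> Bij E" if "g \<in> carrier G" for g
  proof -
    have "bij_betw (\<phi> g) E E"
      by (rule bij_betw_byWitness[where f' = "\<phi> (inv\<^bsub>G\<^esub> g)"])
        (use assms that in \<open>auto simp: assms(5)[symmetric]\<close>)
    then show ?thesis using assms(6) by (simp add: Bij_def)
  qed
  have "group_hom G (BijGroup E) \<phi>"
    unfolding group_hom_def group_hom_axioms_def
  proof (intro conjI homI)
    fix g h assume gh: "g \<in> carrier G" "h \<in> carrier G"
    have "\<phi> (g \<otimes>\<^bsub>G\<^esub> h) = compose E (\<phi> g) (\<phi> h)"
      by (rule extensionalityI[of _ E]) (use assms gh in \<open>auto simp: compose_def\<close>)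
    then show "\<phi> (g \<otimes>\<^bsub>G\<^esub> h) = \<phi> g \<otimes>\<^bsub>BijGroup E\<^esub> \<phi> h" using bij gh by (simp add: BijGroup_def)
  qed (use assms bij group_BijGroup in \<open>auto simp: BijGroup_def\<close>)
  then show ?thesis using assms(2) by (simp add: gsets_def group_action_def)
qed

lemma keys_lin_act:
  assumes "X \<in> gsets G" "g \<in> carrier G" "Poly_Mapping.keys u \<subseteq> pts X"
  shows "Poly_Mapping.keys (lin_act X g u) \<subseteq> pts X"
  unfolding lin_act_def by (rule keys_extend_subset) (use assms act_closed in auto)

lemma frag_extend_hom:
  "(\<And>x. x \<in> pts X \<Longrightarrow> Poly_Mapping.keys (\<phi> x) \<subseteq> pts Y) \<Longrightarrow> bzl X \<phi> \<in> hom (lin X) (lin Y)"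
  by (rule homI) (simp_all add: bzl_apply frag_extend_add keys_add_subset keys_extend_subset[of _ "pts X"])

lemma bzl_in:
  assumes X: "X \<in> gsets G"
    and k: "\<And>x. x \<in> pts X \<Longrightarrow> Poly_Mapping.keys (\<phi> x) \<subseteq> pts Y"
    and e: "\<And>g x. \<lbrakk>g \<in> carrier G; x \<in> pts X\<rbrakk> \<Longrightarrow> \<phi> (act X g x) = lin_act Y g (\<phi> x)"
  shows "bzl X \<phi> \<in> BZ G X Y"
  unfolding BZ_def
proof (intro CollectI conjI IntI ballI)
  show "bzl X \<phi> \<in> hom (lin X) (lin Y)" using k by (rule frag_extend_hom)
  show "bzl X \<phi> \<in> extensional (carrier (lin X))" by (simp add: bzl_def)
  fix g u assume g: "g \<in> carrier G" and u: "u \<in> carrier (lin X)"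
  then have u: "Poly_Mapping.keys u \<subseteq> pts X" by simp
  have "frag_extend \<phi> (lin_act X g u) = lin_act Y g (frag_extend \<phi> u)"
    using u by (induction u rule: lin_induct) (auto simp: frag_extend_diff e g)
  then show "bzl X \<phi> (lin_act X g u) = lin_act Y g (bzl X \<phi> u)"
    using u keys_lin_act[OF X g u] by (simp add: bzl_apply)
qed

section \<open>The preadditive category of finite G-sets\<close>

lemma bz_id_in [simp]: "X \<in> gsets G \<Longrightarrow> bz_id X \<in> BZ G X X"
  by (simp add: BZ_def bz_id_def hom_def keys_lin_act keys_add_subset)

lemma bz_id_apply [simp]: "Poly_Mapping.keys u \<subseteq> pts X \<Longrightarrow> bz_id X u = u"
  by (simp add: bz_id_def)

lemma bz_comp_apply [simp]: "Poly_Mapping.keys u \<subseteq> pts X \<Longrightarrow> bz_comp X h f u = h (f u)"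
  by (simp add: bz_comp_def compose_def)

lemma bz_add_apply [simp]: "Poly_Mapping.keys u \<subseteq> pts X \<Longrightarrow> bz_add X h f u = h u + f u"
  by (simp add: bz_add_def)

lemma bz_comp_in [simp]:
  assumes "f \<in> BZ G X Y" "h \<in> BZ G Y Z" "X \<in> gsets G"
  shows "bz_comp X h f \<in> BZ G X Z"
proof -
  have "f \<in> hom (lin X) (lin Y)" "h \<in> hom (lin Y) (lin Z)" using assms by (auto simp: BZ_def)
  then have "bz_comp X h f \<in> hom (lin X) (lin Z)"
    by (simp add: hom_def bz_comp_def compose_def Pi_iff keys_add_subset)
  moreover have "bz_comp X h f (lin_act X g u) = lin_act Z g (bz_comp X h f u)"
    if "g \<in> carrier G" "u \<in> carrier (lin X)" for g u
    using assms(1,2) that keys_lin_act[OF assms(3) that(1)] BZ_keys[OF assms(1), of u] by (auto simp: BZ_def)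
  ultimately show ?thesis by (simp add: BZ_def bz_comp_def)
qed

lemma bz_add_in [simp]:
  assumes "f \<in> BZ G X Y" "h \<in> BZ G X Y" "X \<in> gsets G"
  shows "bz_add X f h \<in> BZ G X Y"
proof -
  have fh: "f \<in> hom (lin X) (lin Y)" "h \<in> hom (lin X) (lin Y)" using assms by (auto simp: BZ_def)
  have "bz_add X f h \<in> hom (lin X) (lin Y)"
    by (rule homI) (use fh in \<open>simp_all add: hom_def Pi_iff keys_add_subset add_ac\<close>)
  moreover have "bz_add X f h (lin_act X g u) = lin_act Y g (bz_add X f h u)"
    if "g \<in> carrier G" "u \<in> carrier (lin X)" for g u
    using assms(1,2) that keys_lin_act[OF assms(3) that(1)] by (auto simp: BZ_def)
  ultimately show ?thesis by (simp add: BZ_def bz_add_def)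
qed

definition bz_zero :: "'g gset \<Rightarrow> 'g lmap" where
  "bz_zero X = (\<lambda>x\<in>carrier (lin X). 0)"

lemma bz_zero_apply [simp]: "Poly_Mapping.keys u \<subseteq> pts X \<Longrightarrow> bz_zero X u = 0"
  by (simp add: bz_zero_def)

lemma bz_zero_in [simp]: "X \<in> gsets G \<Longrightarrow> bz_zero X \<in> BZ G X Y"
  by (simp add: BZ_def bz_zero_def hom_def keys_lin_act keys_add_subset)

definition bz_neg :: "'g gset \<Rightarrow> 'g lmap \<Rightarrow> 'g lmap" where
  "bz_neg X f = bzl X (\<lambda>x. - f (frag_of x))"

lemma bz_neg_in [simp]: "\<lbrakk>f \<in> BZ G X Y; X \<in> gsets G\<rbrakk> \<Longrightarrow> bz_neg X f \<in> BZ G X Y"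
  unfolding bz_neg_def by (rule bzl_in) (auto simp: BZ_act dest: subsetD[OF BZ_keys_of])

lemma bz_neg_of [simp]: "x \<in> pts X \<Longrightarrow> bz_neg X f (frag_of x) = - f (frag_of x)"
  by (simp add: bz_neg_def)

lemma BZ_group_comm_group:
  assumes X: "X \<in> gsets G"
  shows "comm_group (BZ_group G X Y)"
proof (rule comm_groupI)
  fix f assume "f \<in> carrier (BZ_group G X Y)"
  then have f: "f \<in> BZ G X Y" by (simp add: BZ_group_def)
  have "bz_add X (bz_neg X f) f = bz_zero X"
    by (rule BZ_eqI[of _ G X Y]) (use f X in auto)
  with f X show "\<exists>y\<in>carrier (BZ_group G X Y). y \<otimes>\<^bsub>BZ_group G X Y\<^esub> f = \<one>\<^bsub>BZ_group G X Y\<^esub>"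
    by (auto simp: BZ_group_def bz_zero_def intro!: bexI[of _ "bz_neg X f"])
qed (use X in \<open>auto simp: BZ_group_def bz_zero_def[symmetric] add_ac intro!: BZ_eqI[of _ G X Y]\<close>)

lemma BZ_group_simps [simp]:
  "carrier (BZ_group G X Y) = BZ G X Y" "monoid.mult (BZ_group G X Y) = bz_add X"
  "\<one>\<^bsub>BZ_group G X Y\<^esub> = bz_zero X"
  by (auto simp: BZ_group_def bz_zero_def)

lemma bz_comp_assoc:
  "\<lbrakk>X \<in> gsets G; Y \<in> gsets G; f \<in> BZ G X Y; g \<in> BZ G Y Z; h \<in> BZ G Z W\<rbrakk>
    \<Longrightarrow> bz_comp X h (bz_comp X g f) = bz_comp X (bz_comp Y h g) f"
  by (rule BZ_eqI[of _ G X W]) (auto simp: bz_comp_in[of _ G X Z] bz_comp_in[of _ G X Y] bz_comp_in[of _ G Y Z] BZ_keys_of)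

lemma bz_comp_id [simp]:
  "\<lbrakk>X \<in> gsets G; Y \<in> gsets G; f \<in> BZ G X Y\<rbrakk> \<Longrightarrow> bz_comp X (bz_id Y) f = f"
  "\<lbrakk>X \<in> gsets G; f \<in> BZ G X Y\<rbrakk> \<Longrightarrow> bz_comp X f (bz_id X) = f"
  by (rule BZ_eqI[of _ G X Y]; auto simp: bz_comp_in[of _ G X Y] bz_comp_in[of _ G X X] BZ_keys_of)+

lemma bz_comp_add_left:
  "\<lbrakk>X \<in> gsets G; Y \<in> gsets G; f \<in> BZ G X Y; g \<in> BZ G Y Z; h \<in> BZ G Y Z\<rbrakk>
    \<Longrightarrow> bz_comp X (bz_add Y g h) f = bz_add X (bz_comp X g f) (bz_comp X h f)"
  by (rule BZ_eqI[of _ G X Z]) (auto simp: bz_comp_in[of _ G X Y] bz_add_in BZ_keys_of)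

lemma bz_comp_add_right:
  "\<lbrakk>X \<in> gsets G; Y \<in> gsets G; f \<in> BZ G X Y; f' \<in> BZ G X Y; g \<in> BZ G Y Z\<rbrakk>
    \<Longrightarrow> bz_comp X g (bz_add X f f') = bz_add X (bz_comp X g f) (bz_comp X g f')"
  by (rule BZ_eqI[of _ G X Z]) (auto simp: bz_comp_in[of _ G X Y] BZ_keys_of BZ_add[of g])

subsection \<open>Products\<close>

lemma lin_tensor_of [simp]: "lin_tensor (frag_of s) (frag_of t) = frag_of (Tup s t)"
  by (simp add: lin_tensor_def)

lemma lin_tensor_left:
  "lin_tensor 0 v = 0" "lin_tensor (u + u') v = lin_tensor u v + lin_tensor u' v"
  "lin_tensor (u - u') v = lin_tensor u v - lin_tensor u' v" "lin_tensor (- u) v = - lin_tensor u v"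
  "lin_tensor (frag_cmul c u) v = frag_cmul c (lin_tensor u v)"
  "lin_tensor (\<Sum>i\<in>I. w i) v = (\<Sum>i\<in>I. lin_tensor (w i) v)"
  by (simp_all add: lin_tensor_def frag_extend_linear)

text \<open>Interchange of two finite sums. Linearity in the second argument then follows in the
  same way as in the first.\<close>

lemma lin_tensor_swap:
  "lin_tensor u v = frag_extend (\<lambda>t. frag_extend (\<lambda>s. frag_of (Tup s t)) u) v"
  unfolding lin_tensor_def frag_extend_def
  by (simp add: frag_cmul_sum sum.swap[of _ "Poly_Mapping.keys u"] mult.commute)

lemma lin_tensor_right:
  "lin_tensor v 0 = 0" "lin_tensor v (u + u') = lin_tensor v u + lin_tensor v u'"
  "lin_tensor v (u - u') = lin_tensor v u - lin_tensor v u'" "lin_tensor v (- u) = - lin_tensor v u"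
  "lin_tensor v (frag_cmul c u) = frag_cmul c (lin_tensor v u)"
  "lin_tensor v (\<Sum>i\<in>I. w i) = (\<Sum>i\<in>I. lin_tensor v (w i))"
  by (simp_all add: lin_tensor_swap frag_extend_linear)

lemma lin_tensor_extend_left:
  "lin_tensor (frag_extend f u) v = frag_extend (\<lambda>s. lin_tensor (f s) v) u"
  by (simp add: frag_extend_def lin_tensor_left)

lemma lin_tensor_extend_right:
  "lin_tensor u (frag_extend f v) = frag_extend (\<lambda>s. lin_tensor u (f s)) v"
  by (simp add: frag_extend_def lin_tensor_right)

lemma pts_prod: "pts (prod_gset S T) = {Tup s t | s t. s \<in> pts S \<and> t \<in> pts T}"
  by (simp add: prod_gset_def Let_def)

lemma Tup_in_prod [simp]: "Tup s t \<in> pts (prod_gset S T) \<longleftrightarrow> s \<in> pts S \<and> t \<in> pts T"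
  by (simp add: pts_prod)

lemma pts_prodE [elim!]:
  assumes "p \<in> pts (prod_gset S T)"
  obtains s t where "p = Tup s t" "s \<in> pts S" "t \<in> pts T"
  using assms by (auto simp: pts_prod)

lemma act_prod [simp]:
  "\<lbrakk>s \<in> pts S; t \<in> pts T\<rbrakk> \<Longrightarrow> act (prod_gset S T) g (Tup s t) = Tup (act S g s) (act T g t)"
  by (simp add: prod_gset_def Let_def)

lemma prod_gset_in [simp]:
  assumes "S \<in> gsets G" "T \<in> gsets G" shows "prod_gset S T \<in> gsets G"
  unfolding prod_gset_def Let_def
proof (rule gsetI)
  show "finite {Tup s t |s t. s \<in> pts S \<and> t \<in> pts T}"
    using gsets_finite assms by (intro finite_image_set2) auto
  show "group G" using gsets_group assms(1) .
  fix g h x assume g: "g \<in> carrier G" "h \<in> carrier G" and "x \<in> {Tup s t |s t. s \<in> pts S \<and> t \<in> pts T}"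
  then obtain s t where st: "x = Tup s t" "s \<in> pts S" "t \<in> pts T" by auto
  then show "(\<lambda>p\<in>{Tup s t |s t. s \<in> pts S \<and> t \<in> pts T}.
      case p of Cos C \<Rightarrow> p | Tup s t \<Rightarrow> Tup (act S (g \<otimes>\<^bsub>G\<^esub> h) s) (act T (g \<otimes>\<^bsub>G\<^esub> h) t)) x =
    (\<lambda>p\<in>{Tup s t |s t. s \<in> pts S \<and> t \<in> pts T}.
      case p of Cos C \<Rightarrow> p | Tup s t \<Rightarrow> Tup (act S g s) (act T g t))
    ((\<lambda>p\<in>{Tup s t |s t. s \<in> pts S \<and> t \<in> pts T}.
      case p of Cos C \<Rightarrow> p | Tup s t \<Rightarrow> Tup (act S h s) (act T h t)) x)"
    using act_mult[OF assms(1) g st(2)] act_mult[OF assms(2) g st(3)]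
      act_closed[OF assms(1) g(2) st(2)] act_closed[OF assms(2) g(2) st(3)] by simp
qed (use assms in \<open>auto simp: act_one act_closed[OF assms(1)] act_closed[OF assms(2)]\<close>)

lemma keys_lin_tensor:
  "\<lbrakk>Poly_Mapping.keys u \<subseteq> pts S; Poly_Mapping.keys v \<subseteq> pts T\<rbrakk>
    \<Longrightarrow> Poly_Mapping.keys (lin_tensor u v) \<subseteq> pts (prod_gset S T)"
  unfolding lin_tensor_def by (intro keys_extend_subset) auto

lemma lin_act_tensor:
  assumes "Poly_Mapping.keys u \<subseteq> pts S" "Poly_Mapping.keys v \<subseteq> pts T"
  shows "lin_act (prod_gset S T) g (lin_tensor u v) = lin_tensor (lin_act S g u) (lin_act T g v)"
  using assms(1)
proof (induction u rule: lin_induct)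
  case (one s)
  show ?case using assms(2)
    by (induction v rule: lin_induct) (use one in \<open>auto simp: lin_tensor_right\<close>)
qed (auto simp: lin_tensor_left)

lemma bz_prod_bzl:
  "bz_prod S T \<alpha> \<beta> = bzl (prod_gset S T) (\<lambda>p. case p of Cos C \<Rightarrow> 0
        | Tup s t \<Rightarrow> lin_tensor (\<alpha> (frag_of s)) (\<beta> (frag_of t)))"
  by (simp add: bz_prod_def bzl_def)

lemma bz_prod_of [simp]:
  "\<lbrakk>s \<in> pts S; t \<in> pts T\<rbrakk>
    \<Longrightarrow> bz_prod S T \<alpha> \<beta> (frag_of (Tup s t)) = lin_tensor (\<alpha> (frag_of s)) (\<beta> (frag_of t))"
  by (simp add: bz_prod_bzl)

lemma bz_prod_in [simp]:
  assumes "\<alpha> \<in> BZ G S S'" "\<beta> \<in> BZ G T T'" "S \<in> gsets G" "T \<in> gsets G"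
  shows "bz_prod S T \<alpha> \<beta> \<in> BZ G (prod_gset S T) (prod_gset S' T')"
  unfolding bz_prod_bzl
proof (rule bzl_in)
  fix x assume x: "x \<in> pts (prod_gset S T)"
  then obtain s t where st: "x = Tup s t" "s \<in> pts S" "t \<in> pts T" by auto
  show "Poly_Mapping.keys (case x of Cos C \<Rightarrow> 0 | Tup s t \<Rightarrow> lin_tensor (\<alpha> (frag_of s)) (\<beta> (frag_of t)))
      \<subseteq> pts (prod_gset S' T')"
    using st assms by (simp add: keys_lin_tensor BZ_keys_of)
  fix g assume "g \<in> carrier G"
  then show "(case act (prod_gset S T) g x of Cos C \<Rightarrow> 0
        | Tup s t \<Rightarrow> lin_tensor (\<alpha> (frag_of s)) (\<beta> (frag_of t))) =
      lin_act (prod_gset S' T') g (case x of Cos C \<Rightarrow> 0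
        | Tup s t \<Rightarrow> lin_tensor (\<alpha> (frag_of s)) (\<beta> (frag_of t)))"
    using st assms by (simp add: lin_act_tensor BZ_keys_of BZ_act)
qed (use assms in auto)

text \<open>\<open>bz_prod\<close> is prescribed on pairs of points only; both sides are bilinear,
  so the formula reaches all tensors. Functoriality of the product rests on it, since the image of a
  point is a tensor and no longer a point.\<close>

lemma bz_prod_tensor:
  assumes \<alpha>: "\<alpha> \<in> BZ G S S'" and \<beta>: "\<beta> \<in> BZ G T T'"
    and u: "Poly_Mapping.keys u \<subseteq> pts S" and v: "Poly_Mapping.keys v \<subseteq> pts T"
  shows "bz_prod S T \<alpha> \<beta> (lin_tensor u v) = lin_tensor (\<alpha> u) (\<beta> v)"
proof -
  have "bz_prod S T \<alpha> \<beta> (lin_tensor u v) = frag_extend (\<lambda>p. case p of Cos C \<Rightarrow> 0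
        | Tup s t \<Rightarrow> lin_tensor (\<alpha> (frag_of s)) (\<beta> (frag_of t))) (lin_tensor u v)"
    using keys_lin_tensor[OF u v] by (simp add: bz_prod_bzl bzl_apply)
  also have "\<dots> = lin_tensor (\<alpha> u) (\<beta> v)"
    unfolding lin_tensor_def[of u v] frag_extend_frag_extend BZ_extend[OF \<alpha> u] BZ_extend[OF \<beta> v]
        lin_tensor_extend_left by (simp add: lin_tensor_extend_right frag_extend_frag_extend)
  finally show ?thesis .
qed

lemma bz_prod_comp:
  assumes "\<alpha>' \<in> BZ G S S'" "\<beta>' \<in> BZ G T T'" "\<alpha> \<in> BZ G S' S''" "\<beta> \<in> BZ G T' T''"
    "S \<in> gsets G" "T \<in> gsets G" "S' \<in> gsets G" "T' \<in> gsets G"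
  shows "bz_comp (prod_gset S T) (bz_prod S' T' \<alpha> \<beta>) (bz_prod S T \<alpha>' \<beta>')
    = bz_prod S T (bz_comp S \<alpha> \<alpha>') (bz_comp T \<beta> \<beta>')"
proof (rule BZ_eqI[of _ G "prod_gset S T" "prod_gset S'' T''"])
  fix x assume "x \<in> pts (prod_gset S T)"
  then obtain s t where st: "x = Tup s t" "s \<in> pts S" "t \<in> pts T" by auto
  show "bz_comp (prod_gset S T) (bz_prod S' T' \<alpha> \<beta>) (bz_prod S T \<alpha>' \<beta>') (frag_of x)
    = bz_prod S T (bz_comp S \<alpha> \<alpha>') (bz_comp T \<beta> \<beta>') (frag_of x)"
    using assms st by (simp add: bz_prod_tensor[OF assms(3,4)] BZ_keys_of)
qed (use assms in \<open>auto intro!: bz_comp_in[of _ G] bz_prod_in\<close>)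

lemma bz_prod_id:
  assumes "S \<in> gsets G" "T \<in> gsets G"
  shows "bz_prod S T (bz_id S) (bz_id T) = bz_id (prod_gset S T)"
  by (rule BZ_eqI[of _ G "prod_gset S T" "prod_gset S T"]) (use assms in auto)

lemma bz_prod_add_left:
  assumes "\<alpha> \<in> BZ G S S'" "\<alpha>' \<in> BZ G S S'" "\<beta> \<in> BZ G T T'" "S \<in> gsets G" "T \<in> gsets G"
  shows "bz_prod S T (bz_add S \<alpha> \<alpha>') \<beta> = bz_add (prod_gset S T) (bz_prod S T \<alpha> \<beta>) (bz_prod S T \<alpha>' \<beta>)"
  by (rule BZ_eqI[of _ G "prod_gset S T" "prod_gset S' T'"]) (use assms in \<open>auto simp: lin_tensor_left\<close>)

lemma bz_prod_add_right:
  assumes "\<alpha> \<in> BZ G S S'" "\<beta> \<in> BZ G T T'" "\<beta>' \<in> BZ G T T'" "S \<in> gsets G" "T \<in> gsets G"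
  shows "bz_prod S T \<alpha> (bz_add T \<beta> \<beta>') = bz_add (prod_gset S T) (bz_prod S T \<alpha> \<beta>) (bz_prod S T \<alpha> \<beta>')"
  by (rule BZ_eqI[of _ G "prod_gset S T" "prod_gset S' T'"]) (use assms in \<open>auto simp: lin_tensor_right\<close>)

subsection \<open>Self-duality of permutation modules\<close>

text \<open>Contraction of the first tensor factor against the coordinate functional of
  \<open>s\<close>.\<close>

definition slice :: "'g pt \<Rightarrow> ('g pt \<Rightarrow>\<^sub>0 int) \<Rightarrow> ('g pt \<Rightarrow>\<^sub>0 int)" where
  "slice s = frag_extend (\<lambda>p. case p of Cos C \<Rightarrow> 0 | Tup s' t \<Rightarrow> if s' = s then frag_of t else 0)"

text \<open>The adjoint S \<otimes> X \<rightarrow> T of a map X \<rightarrow> S \<otimes> T, formed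
  with the pairing for which the points of \<open>S\<close> are orthonormal. The group permutes the
  points, so this pairing is invariant and \<open>S\<close> is its own dual.\<close>

definition dual :: "'g gset \<Rightarrow> 'g gset \<Rightarrow> 'g lmap \<Rightarrow> 'g lmap" where
  "dual S X \<phi> = bzl (prod_gset S X)
    (\<lambda>p. case p of Cos C \<Rightarrow> 0 | Tup s x \<Rightarrow> slice s (\<phi> (frag_of x)))"

text \<open>The copairing, the sum of all s \<otimes> s, put in front of x. The first copy of s is
  there to be contracted, the second to remember which summand was selected.\<close>

definition coev :: "'g gset \<Rightarrow> 'g gset \<Rightarrow> 'g lmap" where
  "coev S X = bzl X (\<lambda>x. \<Sum>s\<in>pts S. frag_of (Tup s (Tup s x)))"

lemma slice_simps:
  "slice s (frag_of (Tup s' t)) = (if s' = s then frag_of t else 0)"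
  "slice s 0 = 0" "slice s (u + v) = slice s u + slice s v" "slice s (u - v) = slice s u - slice s v"
  "slice s (frag_cmul c u) = frag_cmul c (slice s u)"
  "slice s (\<Sum>i\<in>I. w i) = (\<Sum>i\<in>I. slice s (w i))"
  by (simp_all add: slice_def frag_extend_linear)

lemma slice_tensor: "slice s (lin_tensor u v) = frag_cmul (Poly_Mapping.lookup u s) v"
proof -
  have v: "frag_extend (\<lambda>t. if s' = s then frag_of t else 0) v = (if s' = s then v else 0)" for s'
    using frag_expansion[of v] by simp
  have "slice s (lin_tensor u v) = frag_extend (\<lambda>s'. if s' = s then v else 0) u"
    by (simp add: slice_def lin_tensor_def frag_extend_frag_extend v)
  also have "\<dots> = frag_cmul (Poly_Mapping.lookup u s) v"
    by (auto simp: frag_extend_def if_distrib sum.delta' in_keys_iff cong: if_cong)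
  finally show ?thesis .
qed

lemma keys_slice:
  "Poly_Mapping.keys z \<subseteq> pts (prod_gset S T) \<Longrightarrow> Poly_Mapping.keys (slice s z) \<subseteq> pts T"
  unfolding slice_def by (rule keys_extend_subset) (auto split: if_splits)

text \<open>Expansion along the basis of points in the first factor: of a basis tensor only the
  slice at its own first entry survives.\<close>

lemma slice_sum:
  assumes "Poly_Mapping.keys z \<subseteq> pts (prod_gset S T)" "finite (pts S)"
  shows "(\<Sum>s\<in>pts S. lin_tensor (frag_of s) (slice s z)) = z"
  using assms(1)
proof (induction z rule: lin_induct)
  case (one p)
  then obtain s t where "p = Tup s t" "s \<in> pts S" by auto
  then show ?case using assms(2)
    by (simp add: slice_simps if_distrib lin_tensor_right cong: if_cong)
qed (auto simp: slice_simps lin_tensor_right sum_subtractf)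

lemma act_inj:
  "\<lbrakk>X \<in> gsets G; g \<in> carrier G; x \<in> pts X; y \<in> pts X; act X g x = act X g y\<rbrakk> \<Longrightarrow> x = y"
  by (metis act_inv(1))

text \<open>The group permutes the coordinate functionals; injectivity of the action ensures that
  the functional of g s selects exactly the translates of what that of s selects.\<close>

lemma slice_act:
  assumes "Poly_Mapping.keys z \<subseteq> pts (prod_gset S T)" "S \<in> gsets G" "g \<in> carrier G" "s \<in> pts S"
  shows "slice (act S g s) (lin_act (prod_gset S T) g z) = lin_act T g (slice s z)"
  using assms(1)
proof (induction z rule: lin_induct)
  case (one p)
  then show ?case using assms(2-) by (auto simp: slice_simps dest: act_inj)
qed (auto simp: slice_simps)

lemma dual_of [simp]:
  "\<lbrakk>s \<in> pts S; x \<in> pts X\<rbrakk> \<Longrightarrow> dual S X \<phi> (frag_of (Tup s x)) = slice s (\<phi> (frag_of x))"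
  by (simp add: dual_def)

lemma dual_in [simp]:
  assumes "\<phi> \<in> BZ G X (prod_gset S T)" "S \<in> gsets G" "X \<in> gsets G"
  shows "dual S X \<phi> \<in> BZ G (prod_gset S X) T"
  unfolding dual_def
proof (rule bzl_in)
  fix p assume p: "p \<in> pts (prod_gset S X)"
  then obtain s x where sx: "p = Tup s x" "s \<in> pts S" "x \<in> pts X" by auto
  show "Poly_Mapping.keys (case p of Cos C \<Rightarrow> 0 | Tup s x \<Rightarrow> slice s (\<phi> (frag_of x))) \<subseteq> pts T"
    using sx keys_slice[OF BZ_keys_of[OF assms(1) sx(3)]] by simp
  fix g assume "g \<in> carrier G"
  then show "(case act (prod_gset S X) g p of Cos C \<Rightarrow> 0 | Tup s x \<Rightarrow> slice s (\<phi> (frag_of x))) =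
      lin_act T g (case p of Cos C \<Rightarrow> 0 | Tup s x \<Rightarrow> slice s (\<phi> (frag_of x)))"
    using sx assms BZ_keys_of[OF assms(1)] BZ_act[OF assms(1)] by (simp add: slice_act)
qed (use assms in auto)

lemma coev_of [simp]:
  "x \<in> pts X \<Longrightarrow> coev S X (frag_of x) = (\<Sum>s\<in>pts S. frag_of (Tup s (Tup s x)))"
  by (simp add: coev_def)

lemma sum_act:
  assumes "S \<in> gsets G" "g \<in> carrier G"
  shows "(\<Sum>s\<in>pts S. f (act S g s)) = (\<Sum>s\<in>pts S. f s)"
proof (rule sum.reindex_bij_betw)
  interpret group G using gsets_group assms(1) .
  show "bij_betw (act S g) (pts S) (pts S)"
    by (rule bij_betw_byWitness[where f' = "act S (inv\<^bsub>G\<^esub> g)"])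
      (use assms in \<open>auto simp: act_inv act_closed\<close>)
qed

lemma coev_in [simp]:
  assumes "S \<in> gsets G" "X \<in> gsets G"
  shows "coev S X \<in> BZ G X (prod_gset S (prod_gset S X))"
  unfolding coev_def
proof (rule bzl_in)
  fix g x assume "g \<in> carrier G" "x \<in> pts X"
  then show "(\<Sum>s\<in>pts S. frag_of (Tup s (Tup s (act X g x)))) =
      lin_act (prod_gset S (prod_gset S X)) g (\<Sum>s\<in>pts S. frag_of (Tup s (Tup s x)))"
    using sum_act[OF assms(1), of g "\<lambda>s. frag_of (Tup s (Tup s (act X g x)))"] by simp
qed (use assms in \<open>auto intro!: keys_sum_subset\<close>)

lemma slice_coev:
  assumes "s \<in> pts S" "finite (pts S)"
  shows "slice s (\<Sum>s\<in>pts S. frag_of (Tup s (f s))) = frag_of (f s)"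
  using assms by (simp add: slice_simps)

text \<open>One triangle identity of the self-duality: contracting the copairing at s leaves the
  summand of s. It is what makes \<open>cb\<close> injective later on.\<close>

lemma dual_coev:
  assumes "S \<in> gsets G" "X \<in> gsets G"
  shows "dual S X (coev S X) = bz_id (prod_gset S X)"
proof (rule BZ_eqI[of _ G "prod_gset S X" "prod_gset S X"])
  fix p assume "p \<in> pts (prod_gset S X)"
  then obtain s x where "p = Tup s x" "s \<in> pts S" "x \<in> pts X" by auto
  then show "dual S X (coev S X) (frag_of p) = bz_id (prod_gset S X) (frag_of p)"
    using slice_coev[of s S "\<lambda>s. Tup s x"] gsets_finite[OF assms(1)] by simp
qed (use assms in auto)

lemma BZ_sum:
  "\<lbrakk>f \<in> BZ G X Y; \<And>i. i \<in> I \<Longrightarrow> Poly_Mapping.keys (w i) \<subseteq> pts X\<rbrakk>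
    \<Longrightarrow> f (\<Sum>i\<in>I. w i) = (\<Sum>i\<in>I. f (w i))"
  by (simp add: BZ_extend[of f G X Y] keys_sum_subset frag_extend_sum')

text \<open>The other triangle identity: contracting at each s and tensoring back is the basis
  expansion \<open>slice_sum\<close>. Every \<phi> is thus the coevaluation followed by a map on the
  second factor, and this gives classes in the box product a normal form.\<close>

lemma coev_dual:
  assumes "\<phi> \<in> BZ G X (prod_gset S T)" "S \<in> gsets G" "X \<in> gsets G" "T \<in> gsets G"
  shows "bz_comp X (bz_prod S (prod_gset S X) (bz_id S) (dual S X \<phi>)) (coev S X) = \<phi>"
proof (rule BZ_eqI[of _ G X "prod_gset S T"])
  have i: "bz_prod S (prod_gset S X) (bz_id S) (dual S X \<phi>)
      \<in> BZ G (prod_gset S (prod_gset S X)) (prod_gset S T)"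
    using assms by auto
  fix x assume x: "x \<in> pts X"
  have "bz_prod S (prod_gset S X) (bz_id S) (dual S X \<phi>) (\<Sum>s\<in>pts S. frag_of (Tup s (Tup s x)))
     = (\<Sum>s\<in>pts S. bz_prod S (prod_gset S X) (bz_id S) (dual S X \<phi>) (frag_of (Tup s (Tup s x))))"
    by (rule BZ_sum[OF i]) (use x in auto)
  also have "\<dots> = (\<Sum>s\<in>pts S. lin_tensor (frag_of s) (slice s (\<phi> (frag_of x))))"
    by (rule sum.cong) (use x in auto)
  also have "\<dots> = \<phi> (frag_of x)"
    by (rule slice_sum) (use assms x gsets_finite BZ_keys_of[OF assms(1)] in auto)
  finally show "bz_comp X (bz_prod S (prod_gset S X) (bz_id S) (dual S X \<phi>)) (coev S X) (frag_of x)
      = \<phi> (frag_of x)"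
    using x by simp
qed (use assms in \<open>auto intro!: bz_comp_in[of _ G] bz_prod_in coev_in dual_in\<close>)

lemma slice_prod:
  assumes z: "Poly_Mapping.keys z \<subseteq> pts (prod_gset S T)" and b: "\<beta> \<in> BZ G T T'"
  shows "slice s (bz_prod S T (bz_id S) \<beta> z) = \<beta> (slice s z)"
proof -
  have "slice s (frag_extend (\<lambda>p. case p of Cos C \<Rightarrow> 0
        | Tup s t \<Rightarrow> lin_tensor (bz_id S (frag_of s)) (\<beta> (frag_of t))) z) = frag_extend (\<lambda>x. \<beta> (frag_of x)) (slice s z)"
    using z
  proof (induction z rule: lin_induct)
    case (one p)
    then show ?case by (auto simp: slice_simps slice_tensor lookup_single)
  qed (auto simp: slice_simps frag_extend_diff)
  then show ?thesis using z b keys_slice[OF z] by (simp add: bz_prod_bzl bzl_apply BZ_extend[OF b])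
qed

text \<open>Contraction touches the first factor and \<open>\<beta>\<close> the second, so they
  commute. This is naturality of the adjunction in \<open>T\<close>.\<close>

lemma dual_prod:
  assumes "\<phi> \<in> BZ G X (prod_gset S T)" "\<beta> \<in> BZ G T T'" "S \<in> gsets G" "X \<in> gsets G" "T \<in> gsets G"
  shows "dual S X (bz_comp X (bz_prod S T (bz_id S) \<beta>) \<phi>) = bz_comp (prod_gset S X) \<beta> (dual S X \<phi>)"
proof (rule BZ_eqI[of _ G "prod_gset S X" T'])
  fix x assume "x \<in> pts (prod_gset S X)"
  then obtain s t where st: "x = Tup s t" "s \<in> pts S" "t \<in> pts X" by auto
  show "dual S X (bz_comp X (bz_prod S T (bz_id S) \<beta>) \<phi>) (frag_of x)
    = bz_comp (prod_gset S X) \<beta> (dual S X \<phi>) (frag_of x)"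
    using assms st by (simp add: slice_prod[OF BZ_keys_of[OF assms(1)]])
qed (use assms in \<open>auto intro!: bz_comp_in[of _ G] bz_prod_in coev_in dual_in\<close>)

lemma dual_add:
  assumes "\<phi> \<in> BZ G X (prod_gset S T)" "\<phi>' \<in> BZ G X (prod_gset S T)" "S \<in> gsets G" "X \<in> gsets G"
  shows "dual S X (bz_add X \<phi> \<phi>') = bz_add (prod_gset S X) (dual S X \<phi>) (dual S X \<phi>')"
  by (rule BZ_eqI[of _ G "prod_gset S X" T])
    (use assms in \<open>auto simp: slice_simps\<close>)

text \<open>The copairing does not involve X, so a map f out of X acts on the last tensor factor
  alone.\<close>

lemma coev_natural:
  assumes f: "f \<in> BZ G X Y" and G: "S \<in> gsets G" "X \<in> gsets G" "Y \<in> gsets G"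
  shows "bz_comp X (coev S Y) f
    = bz_comp X (bz_prod S (prod_gset S X) (bz_id S) (bz_prod S X (bz_id S) f)) (coev S X)"
proof (rule BZ_eqI[of _ G X "prod_gset S (prod_gset S Y)"])
  have i: "bz_prod S (prod_gset S X) (bz_id S) (bz_prod S X (bz_id S) f)
      \<in> BZ G (prod_gset S (prod_gset S X)) (prod_gset S (prod_gset S Y))"
    using assms by auto
  fix x assume x: "x \<in> pts X"
  \<comment> \<open>The image of a point under \<open>f\<close> is a linear combination, so the
    coevaluation is needed in a form that is linear in \<open>u\<close>.\<close>
  have 1: "coev S Y u = (\<Sum>s\<in>pts S. lin_tensor (frag_of s) (lin_tensor (frag_of s) u))"
    if "Poly_Mapping.keys u \<subseteq> pts Y" for u
    using that unfolding BZ_extend[OF coev_in[OF G(1,3)] that]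
    by (induction u rule: lin_induct)
      (auto simp: lin_tensor_right frag_extend_diff sum_subtractf)
  have "bz_prod S (prod_gset S X) (bz_id S) (bz_prod S X (bz_id S) f) (\<Sum>s\<in>pts S. frag_of (Tup s (Tup s x)))
     = (\<Sum>s\<in>pts S. bz_prod S (prod_gset S X) (bz_id S) (bz_prod S X (bz_id S) f) (frag_of (Tup s (Tup s x))))"
    by (rule BZ_sum[OF i]) (use x in auto)
  also have "\<dots> = (\<Sum>s\<in>pts S. lin_tensor (frag_of s) (lin_tensor (frag_of s) (f (frag_of x))))"
    by (rule sum.cong) (use x in auto)
  finally show "bz_comp X (coev S Y) f (frag_of x) = bz_comp X (bz_prod S (prod_gset S X) (bz_id S)
      (bz_prod S X (bz_id S) f)) (coev S X) (frag_of x)"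
    using x f by (simp add: 1 BZ_keys_of)
qed (use assms in \<open>auto intro!: bz_comp_in[of _ G] bz_prod_in coev_in dual_in\<close>)

section \<open>Modules, submodules and subquotients\<close>

context zmodule begin

lemma group_ob: "X \<in> gsets G \<Longrightarrow> group (ob M X)"
  using comm_group_ob comm_group.axioms(2) by blast

lemma mor_closed:
  "\<lbrakk>X \<in> gsets G; Y \<in> gsets G; f \<in> BZ G X Y; m \<in> carrier (ob M Y)\<rbrakk> \<Longrightarrow> mor M X Y f m \<in> carrier (ob M X)"
  using mor_hom[of X Y f] by (auto simp: hom_def)

lemma mor_mult:
  "\<lbrakk>X \<in> gsets G; Y \<in> gsets G; f \<in> BZ G X Y; m \<in> carrier (ob M Y); m' \<in> carrier (ob M Y)\<rbrakk>
    \<Longrightarrow> mor M X Y f (m \<otimes>\<^bsub>ob M Y\<^esub> m') = mor M X Y f m \<otimes>\<^bsub>ob M X\<^esub> mor M X Y f m'"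
  using mor_hom[of X Y f] by (auto simp: hom_def)

lemma mor_one:
  "\<lbrakk>X \<in> gsets G; Y \<in> gsets G; f \<in> BZ G X Y\<rbrakk> \<Longrightarrow> mor M X Y f \<one>\<^bsub>ob M Y\<^esub> = \<one>\<^bsub>ob M X\<^esub>"
  using hom_one[OF mor_hom, of X Y f] group_ob by simp

lemma mor_zero:
  assumes "X \<in> gsets G" "Y \<in> gsets G" "m \<in> carrier (ob M Y)"
  shows "mor M X Y (bz_zero X) m = \<one>\<^bsub>ob M X\<^esub>"
proof -
  interpret X: comm_group "ob M X" using comm_group_ob assms by blast
  have z: "bz_zero X \<in> BZ G X Y" using assms by simp
  have "bz_add X (bz_zero X) (bz_zero X) = bz_zero X"
    by (rule BZ_eqI[of _ G X Y]) (use assms in auto)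
  then show ?thesis
    using mor_add[OF assms(1,2) z z assms(3)] mor_closed[OF assms(1,2) z assms(3)]
    by (metis X.l_cancel_one')
qed

end

section \<open>Natural transformations\<close>

lemma zhom_hom: "\<lbrakk>\<eta> \<in> zhom G M N; X \<in> gsets G\<rbrakk> \<Longrightarrow> \<eta> X \<in> hom (ob M X) (ob N X)"
  by (auto simp: zhom_def)

lemma zhom_closed:
  "\<lbrakk>\<eta> \<in> zhom G M N; X \<in> gsets G; m \<in> carrier (ob M X)\<rbrakk> \<Longrightarrow> \<eta> X m \<in> carrier (ob N X)"
  using zhom_hom[of \<eta> G M N X] by (auto simp: hom_def)

lemma zhom_mult:
  "\<lbrakk>\<eta> \<in> zhom G M N; X \<in> gsets G; m \<in> carrier (ob M X); m' \<in> carrier (ob M X)\<rbrakk>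
    \<Longrightarrow> \<eta> X (m \<otimes>\<^bsub>ob M X\<^esub> m') = \<eta> X m \<otimes>\<^bsub>ob N X\<^esub> \<eta> X m'"
  using zhom_hom[of \<eta> G M N X] by (auto simp: hom_def)

lemma zhom_one:
  "\<lbrakk>\<eta> \<in> zhom G M N; X \<in> gsets G; zmodule G M; zmodule G N\<rbrakk> \<Longrightarrow> \<eta> X \<one>\<^bsub>ob M X\<^esub> = \<one>\<^bsub>ob N X\<^esub>"
  using hom_one[OF zhom_hom, of \<eta> G M N X] zmodule.group_ob[of G M X] zmodule.group_ob[of G N X] by simp

lemma zhom_inv:
  "\<lbrakk>\<eta> \<in> zhom G M N; X \<in> gsets G; zmodule G M; zmodule G N; m \<in> carrier (ob M X)\<rbrakk>
    \<Longrightarrow> \<eta> X (inv\<^bsub>ob M X\<^esub> m) = inv\<^bsub>ob N X\<^esub> (\<eta> X m)"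
  using zhom_hom[of \<eta> G M N X] zmodule.group_ob[of G M X] zmodule.group_ob[of G N X]
    group_hom.hom_inv[of "ob M X" "ob N X" "\<eta> X" m]
  by (auto simp: group_hom_def group_hom_axioms_def)

lemma zhom_natural:
  "\<lbrakk>\<eta> \<in> zhom G M N; X \<in> gsets G; Y \<in> gsets G; f \<in> BZ G X Y; m \<in> carrier (ob M Y)\<rbrakk>
    \<Longrightarrow> \<eta> X (mor M X Y f m) = mor N X Y f (\<eta> Y m)"
  by (auto simp: zhom_def)

text \<open>Elements of \<open>zhom\<close> are extensional both in the G-set and in the module
  element. A family of maps given by a formula has to be cut down twice before it can be
  one.\<close>

definition zrestrict where
  "zrestrict G M \<eta> = (\<lambda>X\<in>gsets G. \<lambda>m\<in>carrier (ob M X). \<eta> X m)"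

lemma zrestrict_apply [simp]:
  "\<lbrakk>X \<in> gsets G; m \<in> carrier (ob M X)\<rbrakk> \<Longrightarrow> zrestrict G M \<eta> X m = \<eta> X m"
  by (simp add: zrestrict_def)

lemma zrestrict_in:
  assumes "zmodule G M"
    and "\<And>X m. \<lbrakk>X \<in> gsets G; m \<in> carrier (ob M X)\<rbrakk> \<Longrightarrow> \<eta> X m \<in> carrier (ob N X)"
    and "\<And>X m m'. \<lbrakk>X \<in> gsets G; m \<in> carrier (ob M X); m' \<in> carrier (ob M X)\<rbrakk>
      \<Longrightarrow> \<eta> X (m \<otimes>\<^bsub>ob M X\<^esub> m') = \<eta> X m \<otimes>\<^bsub>ob N X\<^esub> \<eta> X m'"
    and "\<And>X Y f m. \<lbrakk>X \<in> gsets G; Y \<in> gsets G; f \<in> BZ G X Y; m \<in> carrier (ob M Y)\<rbrakk>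
      \<Longrightarrow> \<eta> X (mor M X Y f m) = mor N X Y f (\<eta> Y m)"
  shows "zrestrict G M \<eta> \<in> zhom G M N"
proof -
  interpret zmodule G M by fact
  have "m \<otimes>\<^bsub>ob M X\<^esub> m' \<in> carrier (ob M X)" if "X \<in> gsets G" "m \<in> carrier (ob M X)" "m' \<in> carrier (ob M X)" for X m m'
    using that group_ob by (simp add: group.is_monoid monoid.m_closed)
  then show ?thesis
    using assms(2-) by (auto simp: zhom_def zrestrict_def hom_def mor_closed)
qed

lemma zhom_eqI:
  assumes "\<eta> \<in> zhom G M N" "\<theta> \<in> zhom G M N"
    "\<And>X m. \<lbrakk>X \<in> gsets G; m \<in> carrier (ob M X)\<rbrakk> \<Longrightarrow> \<eta> X m = \<theta> X m"
  shows "\<eta> = \<theta>"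
proof (rule extensionalityI[of _ "gsets G"])
  fix X assume X: "X \<in> gsets G"
  show "\<eta> X = \<theta> X"
    by (rule extensionalityI[of _ "carrier (ob M X)"]) (use assms X in \<open>auto simp: zhom_def\<close>)
qed (use assms in \<open>auto simp: zhom_def\<close>)

lemma zid_apply [simp]: "\<lbrakk>X \<in> gsets G; m \<in> carrier (ob M X)\<rbrakk> \<Longrightarrow> zid G M X m = m"
  by (simp add: zid_def)

lemma zid_in [simp]: "zmodule G M \<Longrightarrow> zid G M \<in> zhom G M M"
  using zrestrict_in[of G M "\<lambda>X m. m" M] by (simp add: zrestrict_def zid_def)

lemma zcomp_apply [simp]:
  "\<lbrakk>X \<in> gsets G; m \<in> carrier (ob M X)\<rbrakk> \<Longrightarrow> zcomp G M \<theta> \<eta> X m = \<theta> X (\<eta> X m)"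
  by (simp add: zcomp_def compose_def)

lemma zcomp_in:
  assumes "\<eta> \<in> zhom G L M" "\<theta> \<in> zhom G M N" "zmodule G L"
  shows "zcomp G L \<theta> \<eta> \<in> zhom G L N"
proof -
  have "zcomp G L \<theta> \<eta> = zrestrict G L (\<lambda>X m. \<theta> X (\<eta> X m))"
    by (simp add: zcomp_def zrestrict_def compose_def)
  then show ?thesis
    using zrestrict_in[of G L "\<lambda>X m. \<theta> X (\<eta> X m)" N] assms
    by (simp add: zhom_closed[OF assms(1)] zhom_closed[OF assms(2)] zhom_mult[OF assms(1)]
        zhom_mult[OF assms(2)] zhom_natural[OF assms(1)] zhom_natural[OF assms(2)])
qed

section \<open>Subquotients of modules\<close>

lemma (in comm_group) subquotient_group:
  assumes Z: "subgroup Z G" and B: "subgroup B G" and le: "B \<subseteq> Z"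
  defines "Q \<equiv> G\<lparr>carrier := Z\<rparr> Mod B"
  shows "carrier Q = (\<lambda>z. B #> z) ` Z" "comm_group Q" "\<one>\<^bsub>Q\<^esub> = B"
    and "\<And>z z'. \<lbrakk>z \<in> Z; z' \<in> Z\<rbrakk> \<Longrightarrow> (B #> z) \<otimes>\<^bsub>Q\<^esub> (B #> z') = B #> (z \<otimes> z')"
proof -
  interpret ZG: comm_group "G\<lparr>carrier := Z\<rparr>"
    by (rule group.group_comm_groupI[OF subgroup_imp_group[OF Z]])
      (use subgroup.mem_carrier[OF Z] in \<open>auto simp: m_comm\<close>)
  have BZ: "subgroup B (G\<lparr>carrier := Z\<rparr>)" using subgroup_incl[OF B Z le] .
  show "carrier Q = (\<lambda>z. B #> z) ` Z"
    by (simp add: Q_def carrier_FactGroup)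
  show "comm_group Q" unfolding Q_def using ZG.abelian_FactGroup[OF BZ] .
  show "\<one>\<^bsub>Q\<^esub> = B" by (simp add: Q_def)
  have "B \<lhd> G" using subgroup_imp_normal[OF B] .
  then show "(B #> z) \<otimes>\<^bsub>Q\<^esub> (B #> z') = B #> (z \<otimes> z')" if "z \<in> Z" "z' \<in> Z" for z z'
    using normal.rcos_sum[of B G z z'] that subgroup.mem_carrier[OF Z] by (simp add: Q_def)
qed

lemma (in group) rcos_eq_iff:
  assumes "subgroup B G" "z \<in> carrier G" "z' \<in> carrier G"
  shows "B #> z = B #> z' \<longleftrightarrow> z \<otimes> inv z' \<in> B"
proof
  assume "B #> z = B #> z'"
  then have "z \<in> B #> z'" using rcos_self[OF assms(2,1)] by simp
  then obtain b where "b \<in> B" "z = b \<otimes> z'" by (auto simp: r_coset_def)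
  then show "z \<otimes> inv z' \<in> B"
    using assms subgroup.mem_carrier[OF assms(1)] by (simp add: m_assoc)
next
  assume h: "z \<otimes> inv z' \<in> B"
  then have "z \<in> B #> z'"
    unfolding r_coset_def using assms by (auto intro!: bexI[OF _ h] simp: m_assoc)
  then show "B #> z = B #> z'" using repr_independence[OF _ assms(3,1)] by simp
qed

text \<open>The image of a coset of \<open>B\<close> lies in one coset of \<open>C\<close> but need
  not fill it; multiplication by \<open>C\<close> completes it. This is the recipe by which
  \<open>subquot\<close> and \<open>box_map\<close> act on cosets.\<close>

lemma coset_image:
  assumes G: "group G" and H: "group H" and h: "h \<in> hom G H"
    and B: "subgroup B G" and C: "subgroup C H" and sub: "h ` B \<subseteq> C" and z: "z \<in> carrier G"
  shows "C <#>\<^bsub>H\<^esub> (h ` (B #>\<^bsub>G\<^esub> z)) = C #>\<^bsub>H\<^esub> h z" (is "?L = ?R")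
proof
  interpret G: group G by fact
  interpret H: group H by fact
  interpret B: subgroup B G by fact
  interpret C: subgroup C H by fact
  have hz: "h z \<in> carrier H" using h z by (auto simp: hom_def)
  show "?L \<subseteq> ?R"
  proof
    fix y assume "y \<in> ?L"
    then obtain b b' where b: "b \<in> C" "b' \<in> B" "y = b \<otimes>\<^bsub>H\<^esub> h (b' \<otimes>\<^bsub>G\<^esub> z)"
      by (auto simp: set_mult_def r_coset_def)
    have "h b' \<in> C" using b sub by blast
    then have "y = (b \<otimes>\<^bsub>H\<^esub> h b') \<otimes>\<^bsub>H\<^esub> h z"
      using z hz b by (simp add: hom_mult[OF h] H.m_assoc)
    then show "y \<in> ?R" using b \<open>h b' \<in> C\<close> by (auto simp: r_coset_def)
  qed
  show "?R \<subseteq> ?L"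
  proof
    fix y assume "y \<in> ?R"
    then obtain b where "b \<in> C" "y = b \<otimes>\<^bsub>H\<^esub> h z" by (auto simp: r_coset_def)
    moreover have "z \<in> B #>\<^bsub>G\<^esub> z" using G.rcos_self[OF z B] .
    ultimately show "y \<in> ?L" by (auto simp: set_mult_def)
  qed
qed

lemma submodule_mor:
  "\<lbrakk>submodule_of G M I; X \<in> gsets G; Y \<in> gsets G; f \<in> BZ G X Y; z \<in> I Y\<rbrakk> \<Longrightarrow> mor M X Y f z \<in> I X"
  unfolding submodule_of_def by blast

text \<open>The ambient family consists of abelian groups and homomorphisms and may fall short of a
  module: \<open>pre_box\<close> becomes additive in the morphism only after division by the
  relations. Accordingly \<open>zmodule_subquot\<close> asks for the module laws modulo
  \<open>B\<close>.\<close>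

locale subquot_data =
  fixes G :: "'g monoid" and M :: "('g, 'm) zmod" and Z B
  assumes ob: "\<And>X. X \<in> gsets G \<Longrightarrow> comm_group (ob M X)"
    and hom: "\<And>X Y f. \<lbrakk>X \<in> gsets G; Y \<in> gsets G; f \<in> BZ G X Y\<rbrakk> \<Longrightarrow> mor M X Y f \<in> hom (ob M Y) (ob M X)"
    and Z: "submodule_of G M Z" and B: "submodule_of G M B"
    and le: "\<And>X. X \<in> gsets G \<Longrightarrow> B X \<subseteq> Z X"
begin

abbreviation "cl X z \<equiv> B X #>\<^bsub>ob M X\<^esub> z"

lemma subgroups: "X \<in> gsets G \<Longrightarrow> subgroup (Z X) (ob M X)" "X \<in> gsets G \<Longrightarrow> subgroup (B X) (ob M X)"
  using Z B by (auto simp: submodule_of_def)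

lemma Z_carrier: "\<lbrakk>X \<in> gsets G; z \<in> Z X\<rbrakk> \<Longrightarrow> z \<in> carrier (ob M X)"
  using subgroup.mem_carrier[OF subgroups(1)] by blast

lemma carrier_subquot: "X \<in> gsets G \<Longrightarrow> carrier (ob (subquot M Z B) X) = cl X ` Z X"
  using comm_group.subquotient_group(1)[OF ob subgroups le] by (simp add: subquot_def)

lemma one_subquot: "X \<in> gsets G \<Longrightarrow> \<one>\<^bsub>ob (subquot M Z B) X\<^esub> = B X"
  using comm_group.subquotient_group(3)[OF ob subgroups le] by (simp add: subquot_def)

lemma comm_group_subquot: "X \<in> gsets G \<Longrightarrow> comm_group (ob (subquot M Z B) X)"
  using comm_group.subquotient_group(2)[OF ob subgroups le] by (simp add: subquot_def)

lemma mult_subquot: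
  "\<lbrakk>X \<in> gsets G; z \<in> Z X; z' \<in> Z X\<rbrakk> \<Longrightarrow> cl X z \<otimes>\<^bsub>ob (subquot M Z B) X\<^esub> cl X z' = cl X (z \<otimes>\<^bsub>ob M X\<^esub> z')"
  using comm_group.subquotient_group(4)[OF ob subgroups le] by (simp add: subquot_def)

lemma cl_eq_iff:
  "\<lbrakk>X \<in> gsets G; z \<in> Z X; z' \<in> Z X\<rbrakk> \<Longrightarrow> cl X z = cl X z' \<longleftrightarrow> z \<otimes>\<^bsub>ob M X\<^esub> inv\<^bsub>ob M X\<^esub> z' \<in> B X"
  using group.rcos_eq_iff[OF comm_group.axioms(2)[OF ob] subgroups(2)] Z_carrier by blast

lemma cl_one_iff: "\<lbrakk>X \<in> gsets G; z \<in> Z X\<rbrakk> \<Longrightarrow> cl X z = B X \<longleftrightarrow> z \<in> B X"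
proof -
  assume X: "X \<in> gsets G" and z: "z \<in> Z X"
  interpret comm_group "ob M X" using ob X .
  show ?thesis
    using coset_join1[of "B X" z] coset_join2[of z "B X"] subgroups[OF X] Z_carrier[OF X z]
      subgroup.subset by blast
qed

lemma mor_Z: "\<lbrakk>X \<in> gsets G; Y \<in> gsets G; f \<in> BZ G X Y; z \<in> Z Y\<rbrakk> \<Longrightarrow> mor M X Y f z \<in> Z X"
  by (rule submodule_mor[OF Z])

lemma mor_subquot:
  assumes X: "X \<in> gsets G" and Y: "Y \<in> gsets G" and f: "f \<in> BZ G X Y" and z: "z \<in> Z Y"
  shows "mor (subquot M Z B) X Y f (cl Y z) = cl X (mor M X Y f z)"
proof -
  have "mor M X Y f b \<in> B X" if "b \<in> B Y" for b
    using submodule_mor[OF B X Y f that] .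
  then show ?thesis
    using coset_image[OF ob[OF Y, THEN comm_group.axioms(2)] ob[OF X, THEN comm_group.axioms(2)] hom[OF X Y f]
        subgroups(2)[OF Y] subgroups(2)[OF X] _ Z_carrier[OF Y z]]
    by (auto simp: subquot_def)
qed

lemma zmodule_subquot:
  assumes "\<And>X z. \<lbrakk>X \<in> gsets G; z \<in> Z X\<rbrakk> \<Longrightarrow> cl X (mor M X X (bz_id X) z) = cl X z"
    and "\<And>X Y W f g z. \<lbrakk>X \<in> gsets G; Y \<in> gsets G; W \<in> gsets G; f \<in> BZ G X Y; g \<in> BZ G Y W; z \<in> Z W\<rbrakk>
      \<Longrightarrow> cl X (mor M X W (bz_comp X g f) z) = cl X (mor M X Y f (mor M Y W g z))"
    and "\<And>X Y f g z. \<lbrakk>X \<in> gsets G; Y \<in> gsets G; f \<in> BZ G X Y; g \<in> BZ G X Y; z \<in> Z Y\<rbrakk>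
      \<Longrightarrow> cl X (mor M X Y (bz_add X f g) z) = cl X (mor M X Y f z \<otimes>\<^bsub>ob M X\<^esub> mor M X Y g z)"
  shows "zmodule G (subquot M Z B)"
proof (rule zmodule.intro)
  have m: "z \<otimes>\<^bsub>ob M X\<^esub> z' \<in> Z X" if "X \<in> gsets G" "z \<in> Z X" "z' \<in> Z X" for X z z'
    using subgroup.m_closed[OF subgroups(1)] that by blast
  fix X Y f assume X: "X \<in> gsets G" and Y: "Y \<in> gsets G" and f: "f \<in> BZ G X Y"
  have h: "mor M X Y f \<in> hom (ob M Y) (ob M X)" using hom X Y f .
  show "mor (subquot M Z B) X Y f \<in> Group.hom (ob (subquot M Z B) Y) (ob (subquot M Z B) X)"
  proof (rule homI)
    fix C D assume "C \<in> carrier (ob (subquot M Z B) Y)" "D \<in> carrier (ob (subquot M Z B) Y)"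
    then obtain c d where "C = cl Y c" "D = cl Y d" "c \<in> Z Y" "d \<in> Z Y" using carrier_subquot[OF Y] by auto
    then show "mor (subquot M Z B) X Y f (C \<otimes>\<^bsub>ob (subquot M Z B) Y\<^esub> D)
      = mor (subquot M Z B) X Y f C \<otimes>\<^bsub>ob (subquot M Z B) X\<^esub> mor (subquot M Z B) X Y f D"
      using X Y f m by (simp add: mor_subquot mult_subquot mor_Z Z_carrier hom_mult[OF h])
  qed (use X Y f in \<open>auto simp: carrier_subquot mor_subquot mor_Z\<close>)
next
  fix X m assume "X \<in> gsets G" "m \<in> carrier (ob (subquot M Z B) X)"
  then show "mor (subquot M Z B) X X (bz_id X) m = m"
    using assms(1) by (auto simp: carrier_subquot mor_subquot)
next
  fix X Y W f g m assume "X \<in> gsets G" "Y \<in> gsets G" "W \<in> gsets G" "f \<in> BZ G X Y" "g \<in> BZ G Y W"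
    "m \<in> carrier (ob (subquot M Z B) W)"
  then show "mor (subquot M Z B) X W (bz_comp X g f) m
      = mor (subquot M Z B) X Y f (mor (subquot M Z B) Y W g m)"
    using assms(2)[of X Y W f g] bz_comp_in[of f G X Y g W] by (auto simp: carrier_subquot mor_subquot mor_Z)
next
  fix X Y f g m assume "X \<in> gsets G" "Y \<in> gsets G" "f \<in> BZ G X Y" "g \<in> BZ G X Y"
    "m \<in> carrier (ob (subquot M Z B) Y)"
  then show "mor (subquot M Z B) X Y (bz_add X f g) m
      = mor (subquot M Z B) X Y f m \<otimes>\<^bsub>ob (subquot M Z B) X\<^esub> mor (subquot M Z B) X Y g m"
    using assms(3)[of X Y f g] bz_add_in[of f G X Y g] by (auto simp: carrier_subquot mor_subquot mor_Z mult_subquot)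
qed (rule comm_group_subquot)

end

lemma subquot_dataI:
  assumes "zmodule G M" "submodule_of G M Z" "submodule_of G M B" "\<And>X. X \<in> gsets G \<Longrightarrow> B X \<subseteq> Z X"
  shows "subquot_data G M Z B"
  using assms by (auto simp: subquot_data_def zmodule.comm_group_ob zmodule.mor_hom)

lemma zmodule_subquot:
  assumes "zmodule G M" "submodule_of G M Z" "submodule_of G M B" "\<And>X. X \<in> gsets G \<Longrightarrow> B X \<subseteq> Z X"
  shows "zmodule G (subquot M Z B)"
proof -
  interpret subquot_data G M Z B using subquot_dataI assms .
  interpret zmodule G M by fact
  show ?thesis by (rule zmodule_subquot) (simp_all add: mor_id mor_comp mor_add Z_carrier)
qed

lemma submodule_carrier: "zmodule G M \<Longrightarrow> submodule_of G M (\<lambda>X. carrier (ob M X))"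
  by (auto simp: submodule_of_def zmodule.mor_closed group.subgroup_self zmodule.group_ob)

lemma submodule_trivial: "zmodule G M \<Longrightarrow> submodule_of G M (\<lambda>X. {\<one>\<^bsub>ob M X\<^esub>})"
  by (auto simp: submodule_of_def zmodule.mor_one group.triv_subgroup zmodule.group_ob)

lemma submodule_kernel:
  assumes "zmodule G M" "zmodule G N" "\<eta> \<in> zhom G M N"
  shows "submodule_of G M (\<lambda>X. kernel (ob M X) (ob N X) (\<eta> X))"
proof -
  interpret M: zmodule G M by fact
  interpret N: zmodule G N by fact
  have "group_hom (ob M X) (ob N X) (\<eta> X)" if "X \<in> gsets G" for X
    using that zhom_hom[OF assms(3)] M.group_ob N.group_ob by (simp add: group_hom_def group_hom_axioms_def)
  then have "subgroup (kernel (ob M X) (ob N X) (\<eta> X)) (ob M X)" if "X \<in> gsets G" for X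
    using that group_hom.subgroup_kernel by blast
  moreover have "mor M X Y f ` kernel (ob M Y) (ob N Y) (\<eta> Y) \<subseteq> kernel (ob M X) (ob N X) (\<eta> X)"
    if "X \<in> gsets G" "Y \<in> gsets G" "f \<in> BZ G X Y" for X Y f
    using that by (auto simp: kernel_def M.mor_closed zhom_natural[OF assms(3)] N.mor_one)
  ultimately show ?thesis by (simp add: submodule_of_def)
qed

lemma submodule_image:
  assumes "zmodule G M" "zmodule G N" "\<eta> \<in> zhom G M N"
  shows "submodule_of G N (\<lambda>X. \<eta> X ` carrier (ob M X))"
proof -
  interpret M: zmodule G M by fact
  interpret N: zmodule G N by fact
  have "group_hom (ob M X) (ob N X) (\<eta> X)" if "X \<in> gsets G" for X
    using that zhom_hom[OF assms(3)] M.group_ob N.group_ob by (simp add: group_hom_def group_hom_axioms_def)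
  then show ?thesis
    by (auto simp: submodule_of_def group_hom.img_is_subgroup M.mor_closed
        zhom_natural[OF assms(3), symmetric])
qed

section \<open>Isomorphisms of modules and of subquotients\<close>

lemma zmod_iso_trans:
  assumes "zmod_iso G L M" "zmod_iso G M N" shows "zmod_iso G L N"
proof -
  obtain \<eta> \<theta> where \<eta>: "\<eta> \<in> zhom G L M" "\<forall>X\<in>gsets G. bij_betw (\<eta> X) (carrier (ob L X)) (carrier (ob M X))"
    and \<theta>: "\<theta> \<in> zhom G M N" "\<forall>X\<in>gsets G. bij_betw (\<theta> X) (carrier (ob M X)) (carrier (ob N X))"
    using assms by (auto simp: zmod_iso_def)
  have "bij_betw (zcomp G L \<theta> \<eta> X) (carrier (ob L X)) (carrier (ob N X))" if "X \<in> gsets G" for X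
    using bij_betw_trans[of "\<eta> X" _ _ "\<theta> X"] \<eta>(2) \<theta>(2) that
    by (subst bij_betw_cong[of _ _ "\<theta> X \<circ> \<eta> X"]) auto
  then show ?thesis
    using assms zcomp_in[OF \<eta>(1) \<theta>(1)] unfolding zmod_iso_def by blast
qed

lemma zmod_iso_sym:
  assumes "zmod_iso G M N" shows "zmod_iso G N M"
proof -
  obtain \<eta> where \<eta>: "\<eta> \<in> zhom G M N" "\<And>X. X \<in> gsets G \<Longrightarrow> bij_betw (\<eta> X) (carrier (ob M X)) (carrier (ob N X))"
    and M: "zmodule G M" and N: "zmodule G N"
    using assms by (auto simp: zmod_iso_def)
  interpret M: zmodule G M by fact
  interpret N: zmodule G N by fact
  define \<theta> where "\<theta> X = inv_into (carrier (ob M X)) (\<eta> X)" for X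
  have b: "bij_betw (\<theta> X) (carrier (ob N X)) (carrier (ob M X))" if "X \<in> gsets G" for X
    unfolding \<theta>_def using bij_betw_inv_into[OF \<eta>(2)[OF that]] .
  have c: "\<theta> X n \<in> carrier (ob M X)" if "X \<in> gsets G" "n \<in> carrier (ob N X)" for X n
    using b that bij_betwE by blast
  have r: "\<eta> X (\<theta> X n) = n" if "X \<in> gsets G" "n \<in> carrier (ob N X)" for X n
    unfolding \<theta>_def using bij_betw_inv_into_right[OF \<eta>(2)] that by blast
  have i: "\<theta> X (\<eta> X m) = m" if "X \<in> gsets G" "m \<in> carrier (ob M X)" for X m
    unfolding \<theta>_def using bij_betw_inv_into_left[OF \<eta>(2)] that by blast
  have "zrestrict G N \<theta> \<in> zhom G N M"
  proof (rule zrestrict_in)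
    fix X m m' assume h: "X \<in> gsets G" "m \<in> carrier (ob N X)" "m' \<in> carrier (ob N X)"
    have "\<theta> X (\<eta> X (\<theta> X m \<otimes>\<^bsub>ob M X\<^esub> \<theta> X m')) = \<theta> X (m \<otimes>\<^bsub>ob N X\<^esub> m')"
      using h c r by (simp add: zhom_mult[OF \<eta>(1)])
    moreover have "\<theta> X m \<otimes>\<^bsub>ob M X\<^esub> \<theta> X m' \<in> carrier (ob M X)"
      using h c M.group_ob[of X] by (simp add: group.is_monoid monoid.m_closed)
    ultimately show "\<theta> X (m \<otimes>\<^bsub>ob N X\<^esub> m') = \<theta> X m \<otimes>\<^bsub>ob M X\<^esub> \<theta> X m'" using h i by simp
  next
    fix X Y f m assume h: "X \<in> gsets G" "Y \<in> gsets G" "f \<in> BZ G X Y" "m \<in> carrier (ob N Y)"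
    have "\<theta> X (\<eta> X (mor M X Y f (\<theta> Y m))) = \<theta> X (mor N X Y f m)"
      using h c r by (simp add: zhom_natural[OF \<eta>(1)])
    then show "\<theta> X (mor N X Y f m) = mor M X Y f (\<theta> Y m)" using h i c M.mor_closed by simp
  qed (use c N in auto)
  moreover have "bij_betw (zrestrict G N \<theta> X) (carrier (ob N X)) (carrier (ob M X))" if "X \<in> gsets G" for X
    using b[OF that] that by (subst bij_betw_cong[of _ _ "\<theta> X"]) auto
  ultimately show ?thesis using M N unfolding zmod_iso_def by blast
qed

text \<open>A map of the ambient modules induces an isomorphism when it respects the numerators,
  reflects membership in the denominators, and reaches every class of the target. All conditions
  concern representatives, which is the form in which the homology computations deliver
  them.\<close>

lemma subquot_iso:
  assumes M: "zmodule G M" "submodule_of G M Z" "submodule_of G M B" "\<And>X. X \<in> gsets G \<Longrightarrow> B X \<subseteq> Z X"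
    and M': "zmodule G M'" "submodule_of G M' Z'" "submodule_of G M' B'" "\<And>X. X \<in> gsets G \<Longrightarrow> B' X \<subseteq> Z' X"
    and \<eta>: "\<eta> \<in> zhom G M M'"
    and map: "\<And>X z. \<lbrakk>X \<in> gsets G; z \<in> Z X\<rbrakk> \<Longrightarrow> \<eta> X z \<in> Z' X"
    and ker: "\<And>X z. \<lbrakk>X \<in> gsets G; z \<in> Z X\<rbrakk> \<Longrightarrow> \<eta> X z \<in> B' X \<longleftrightarrow> z \<in> B X"
    and surj: "\<And>X z'. \<lbrakk>X \<in> gsets G; z' \<in> Z' X\<rbrakk>
      \<Longrightarrow> \<exists>z\<in>Z X. \<eta> X z \<otimes>\<^bsub>ob M' X\<^esub> inv\<^bsub>ob M' X\<^esub> z' \<in> B' X"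
  shows "zmod_iso G (subquot M Z B) (subquot M' Z' B')"
proof -
  interpret M: zmodule G M by fact
  interpret M': zmodule G M' by fact
  interpret s: subquot_data G M Z B using subquot_dataI M .
  interpret s': subquot_data G M' Z' B' using subquot_dataI M' .
  \<comment> \<open>A coset goes to the class of an arbitrary representative. The equivalence
    \<open>eq\<close> makes the choice harmless in one direction and gives injectivity in the
    other.\<close>
  define \<psi> where "\<psi> X C = s'.cl X (\<eta> X (SOME z. z \<in> Z X \<and> C = s.cl X z))" for X C
  have eq: "s'.cl X (\<eta> X z) = s'.cl X (\<eta> X w) \<longleftrightarrow> s.cl X z = s.cl X w"
    if h: "X \<in> gsets G" "z \<in> Z X" "w \<in> Z X" for X z w
  proof -
    interpret X: group "ob M X" using M.group_ob h by blast
    have "s'.cl X (\<eta> X z) = s'.cl X (\<eta> X w) \<longleftrightarrow> \<eta> X (z \<otimes>\<^bsub>ob M X\<^esub> inv\<^bsub>ob M X\<^esub> w) \<in> B' X"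
      using h s.Z_carrier map
      by (simp add: s'.cl_eq_iff zhom_mult[OF \<eta>] zhom_inv[OF \<eta> _ M(1) M'(1)])
    also have "\<dots> \<longleftrightarrow> z \<otimes>\<^bsub>ob M X\<^esub> inv\<^bsub>ob M X\<^esub> w \<in> B X"
      using h s.subgroups(1)[OF h(1)] by (intro ker) (auto simp: subgroup.m_closed subgroup.m_inv_closed)
    finally show ?thesis using s.cl_eq_iff h by simp
  qed
  have \<psi>: "\<psi> X (s.cl X z) = s'.cl X (\<eta> X z)" if h: "X \<in> gsets G" "z \<in> Z X" for X z
  proof -
    have "\<exists>w. w \<in> Z X \<and> s.cl X z = s.cl X w" using h by blast
    from someI_ex[OF this] show ?thesis unfolding \<psi>_def using eq h by blast
  qed
  have mZ: "z \<otimes>\<^bsub>ob M X\<^esub> z' \<in> Z X" if "X \<in> gsets G" "z \<in> Z X" "z' \<in> Z X" for X z z'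
    using subgroup.m_closed[OF s.subgroups(1)] that by blast
  have z: "zmodule G (subquot M Z B)" "zmodule G (subquot M' Z' B')"
    using zmodule_subquot M M' by blast+
  have "zrestrict G (subquot M Z B) \<psi> \<in> zhom G (subquot M Z B) (subquot M' Z' B')"
  proof (rule zrestrict_in)
    fix X m m' assume h: "X \<in> gsets G" "m \<in> carrier (ob (subquot M Z B) X)" "m' \<in> carrier (ob (subquot M Z B) X)"
    then obtain c d where "m = s.cl X c" "m' = s.cl X d" "c \<in> Z X" "d \<in> Z X" using s.carrier_subquot by auto
    then show "\<psi> X (m \<otimes>\<^bsub>ob (subquot M Z B) X\<^esub> m') = \<psi> X m \<otimes>\<^bsub>ob (subquot M' Z' B') X\<^esub> \<psi> X m'"
      using h mZ map s.Z_carrier by (simp add: \<psi> s.mult_subquot s'.mult_subquot zhom_mult[OF \<eta>])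
  next
    fix X Y f m assume h: "X \<in> gsets G" "Y \<in> gsets G" "f \<in> BZ G X Y" "m \<in> carrier (ob (subquot M Z B) Y)"
    then obtain c where "m = s.cl Y c" "c \<in> Z Y" using s.carrier_subquot by auto
    then show "\<psi> X (mor (subquot M Z B) X Y f m) = mor (subquot M' Z' B') X Y f (\<psi> Y m)"
      using h map s.mor_Z s.Z_carrier by (simp add: \<psi> s.mor_subquot s'.mor_subquot zhom_natural[OF \<eta>])
  qed (use map z in \<open>auto simp: s.carrier_subquot s'.carrier_subquot \<psi>\<close>)
  moreover have "bij_betw (zrestrict G (subquot M Z B) \<psi> X) (carrier (ob (subquot M Z B) X))
      (carrier (ob (subquot M' Z' B') X))" if X: "X \<in> gsets G" for X
  proof -
    have "bij_betw (\<psi> X) (s.cl X ` Z X) (s'.cl X ` Z' X)"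
      unfolding bij_betw_def
    proof
      show "inj_on (\<psi> X) (s.cl X ` Z X)" using X \<psi> eq by (auto intro!: inj_onI)
      have "s'.cl X z' \<in> \<psi> X ` s.cl X ` Z X" if z': "z' \<in> Z' X" for z'
      proof -
        obtain z where "z \<in> Z X" "\<eta> X z \<otimes>\<^bsub>ob M' X\<^esub> inv\<^bsub>ob M' X\<^esub> z' \<in> B' X" using surj X z' by blast
        then have "s'.cl X z' = \<psi> X (s.cl X z)"
          using X z' map s'.cl_eq_iff[of X "\<eta> X z" z'] by (simp add: \<psi>)
        then show ?thesis using \<open>z \<in> Z X\<close> by blast
      qed
      then show "\<psi> X ` s.cl X ` Z X = s'.cl X ` Z' X" using X map by (auto simp: \<psi>)
    qed
    then show ?thesis using X by (subst bij_betw_cong[of _ _ "\<psi> X"]) (auto simp: s.carrier_subquot s'.carrier_subquot)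
  qed
  ultimately show ?thesis using z unfolding zmod_iso_def by blast
qed

lemma zmodule_zero_mod: "zmodule G zero_mod"
  by (rule zmodule.intro) (auto simp: zero_mod_def hom_def singleton_group_def[THEN arg_cong[of _ _ monoid.mult]])

lemma subquot_zero:
  assumes M: "zmodule G M" "submodule_of G M Z" and eq: "\<And>X. X \<in> gsets G \<Longrightarrow> B X = Z X"
  shows "zmod_iso G (subquot M Z B) zero_mod"
proof -
  have B: "submodule_of G M B" using M eq by (simp add: submodule_of_def)
  have le: "\<And>X. X \<in> gsets G \<Longrightarrow> B X \<subseteq> Z X" using eq by simp
  interpret s: subquot_data G M Z B using subquot_dataI[OF M B le] .
  have z: "zmodule G (subquot M Z B)" using zmodule_subquot[OF M B le] .
  have c: "carrier (ob (subquot M Z B) X) = {B X}" if X: "X \<in> gsets G" for X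
  proof -
    have "Z X \<noteq> {}" using subgroup.one_closed[OF s.subgroups(1)[OF X]] by blast
    moreover have "s.cl X z = B X" if "z \<in> Z X" for z using s.cl_one_iff X that eq by blast
    ultimately show ?thesis using X by (auto simp: s.carrier_subquot)
  qed
  have "zrestrict G (subquot M Z B) (\<lambda>X C. ()) \<in> zhom G (subquot M Z B) zero_mod"
    by (rule zrestrict_in) (use z in \<open>auto simp: zero_mod_def\<close>)
  moreover have "bij_betw (zrestrict G (subquot M Z B) (\<lambda>X C. ()) X) (carrier (ob (subquot M Z B) X))
      (carrier (ob zero_mod X))" if "X \<in> gsets G" for X
    using that by (auto simp: c zero_mod_def bij_betw_def)
  ultimately show ?thesis using z zmodule_zero_mod unfolding zmod_iso_def by blast
qed

definition zproj :: "'g monoid \<Rightarrow> ('g, 'm) zmod \<Rightarrow> ('g gset \<Rightarrow> 'm set) \<Rightarrow> ('g, 'm, 'm set) nat_trans" where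
  "zproj G M I = zrestrict G M (\<lambda>X m. I X #>\<^bsub>ob M X\<^esub> m)"

lemma zproj:
  assumes M: "zmodule G M" and I: "submodule_of G M I"
  shows "zmodule G (quot M I)" "zproj G M I \<in> zhom G M (quot M I)"
    and "\<And>X. X \<in> gsets G \<Longrightarrow> zproj G M I X ` carrier (ob M X) = carrier (ob (quot M I) X)"
    and "\<And>X m. \<lbrakk>X \<in> gsets G; m \<in> carrier (ob M X)\<rbrakk> \<Longrightarrow> zproj G M I X m = \<one>\<^bsub>ob (quot M I) X\<^esub> \<longleftrightarrow> m \<in> I X"
proof -
  have le: "\<And>X. X \<in> gsets G \<Longrightarrow> I X \<subseteq> carrier (ob M X)"
    using I by (auto simp: submodule_of_def dest: subgroup.mem_carrier)
  interpret zmodule G M by fact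
  interpret s: subquot_data G M "\<lambda>X. carrier (ob M X)" I
    using subquot_dataI[OF M submodule_carrier[OF M] I le] .
  show "zmodule G (quot M I)"
    unfolding quot_def using zmodule_subquot[OF M submodule_carrier[OF M] I le] .
  show "zproj G M I \<in> zhom G M (quot M I)"
    unfolding zproj_def quot_def
    by (rule zrestrict_in) (use M in \<open>auto simp: s.carrier_subquot s.mult_subquot s.mor_subquot\<close>)
  show "zproj G M I X ` carrier (ob M X) = carrier (ob (quot M I) X)" if "X \<in> gsets G" for X
    using that by (simp add: zproj_def quot_def s.carrier_subquot)
  show "zproj G M I X m = \<one>\<^bsub>ob (quot M I) X\<^esub> \<longleftrightarrow> m \<in> I X" if "X \<in> gsets G" "m \<in> carrier (ob M X)" for X m
    using that s.cl_one_iff by (simp add: zproj_def quot_def s.one_subquot)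
qed

section \<open>The box product\<close>

lemma hom_minus_frag:
  assumes "group H" "h \<in> hom (free_Abelian_group S) H" "Poly_Mapping.keys u \<subseteq> S" "Poly_Mapping.keys v \<subseteq> S"
  shows "h (u - v) = h u \<otimes>\<^bsub>H\<^esub> inv\<^bsub>H\<^esub> (h v)"
proof -
  interpret group_hom "free_Abelian_group S" H h
    using assms by (simp add: group_hom_def group_hom_axioms_def)
  show ?thesis using hom_mult[of u "- v"] hom_inv[of v] assms by simp
qed

lemma frag_extend_hom_free:
  assumes "\<And>x. x \<in> S \<Longrightarrow> Poly_Mapping.keys (f x) \<subseteq> T"
  shows "frag_extend f \<in> hom (free_Abelian_group S) (free_Abelian_group T)"
  by (rule homI) (use assms in \<open>auto simp: frag_extend_add dest!: subsetD[OF keys_frag_extend]\<close>)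

lemma (in comm_group) mult_inv_interchange:
  "\<lbrakk>p \<in> carrier G; q \<in> carrier G; r \<in> carrier G; s \<in> carrier G\<rbrakk>
    \<Longrightarrow> (p \<otimes> q) \<otimes> inv (r \<otimes> s) = (p \<otimes> inv r) \<otimes> (q \<otimes> inv s)"
  by (simp add: inv_mult m_ac)

locale box_data = M: zmodule G M + N: zmodule G N
  for G :: "'g monoid" and M :: "('g, 'm) zmod" and N :: "('g, 'n) zmod"
begin

abbreviation "gens \<equiv> box_gens G M N"
abbreviation "rels \<equiv> box_relsub G M N"

definition bx where
  "bx X S T \<phi> m n = rels X #>\<^bsub>free_Abelian_group (gens X)\<^esub> frag_of (S, T, \<phi>, m, n)"

lemma gens_iff [simp]:
  "(S, T, \<phi>, m, n) \<in> gens X \<longleftrightarrow> S \<in> gsets G \<and> T \<in> gsets G \<and>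
     \<phi> \<in> BZ G X (prod_gset S T) \<and> m \<in> carrier (ob M S) \<and> n \<in> carrier (ob N T)"
  by (simp add: box_gens_def)

lemma ob_pre [simp]: "ob (pre_box G M N) X = free_Abelian_group (gens X)"
  by (simp add: pre_box_def)

lemma M_mult: "\<lbrakk>S \<in> gsets G; m \<in> carrier (ob M S); m' \<in> carrier (ob M S)\<rbrakk>
    \<Longrightarrow> m \<otimes>\<^bsub>ob M S\<^esub> m' \<in> carrier (ob M S)"
  using M.group_ob by (simp add: group.is_monoid monoid.m_closed)

lemma N_mult: "\<lbrakk>S \<in> gsets G; m \<in> carrier (ob N S); m' \<in> carrier (ob N S)\<rbrakk>
    \<Longrightarrow> m \<otimes>\<^bsub>ob N S\<^esub> m' \<in> carrier (ob N S)"
  using N.group_ob by (simp add: group.is_monoid monoid.m_closed)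

lemma box_rels_cases:
  assumes "r \<in> box_rels G M N X"
  obtains (add1) S T \<phi> \<phi>' m n where
      "r = frag_of (S, T, bz_add X \<phi> \<phi>', m, n) - frag_of (S, T, \<phi>, m, n) - frag_of (S, T, \<phi>', m, n)"
      "S \<in> gsets G" "T \<in> gsets G" "\<phi> \<in> BZ G X (prod_gset S T)" "\<phi>' \<in> BZ G X (prod_gset S T)"
      "m \<in> carrier (ob M S)" "n \<in> carrier (ob N T)"
    | (add2) S T \<phi> m m' n where
      "r = frag_of (S, T, \<phi>, m \<otimes>\<^bsub>ob M S\<^esub> m', n) - frag_of (S, T, \<phi>, m, n) - frag_of (S, T, \<phi>, m', n)"
      "S \<in> gsets G" "T \<in> gsets G" "\<phi> \<in> BZ G X (prod_gset S T)" "m \<in> carrier (ob M S)"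
      "m' \<in> carrier (ob M S)" "n \<in> carrier (ob N T)"
    | (add3) S T \<phi> m n n' where
      "r = frag_of (S, T, \<phi>, m, n \<otimes>\<^bsub>ob N T\<^esub> n') - frag_of (S, T, \<phi>, m, n) - frag_of (S, T, \<phi>, m, n')"
      "S \<in> gsets G" "T \<in> gsets G" "\<phi> \<in> BZ G X (prod_gset S T)" "m \<in> carrier (ob M S)"
      "n \<in> carrier (ob N T)" "n' \<in> carrier (ob N T)"
    | (coend) S T S' T' \<alpha> \<beta> \<phi> m n where
      "r = frag_of (S, T, bz_comp X (bz_prod S' T' \<alpha> \<beta>) \<phi>, m, n)
        - frag_of (S', T', \<phi>, mor M S' S \<alpha> m, mor N T' T \<beta> n)"
      "S \<in> gsets G" "T \<in> gsets G" "S' \<in> gsets G" "T' \<in> gsets G"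
      "\<alpha> \<in> BZ G S' S" "\<beta> \<in> BZ G T' T" "\<phi> \<in> BZ G X (prod_gset S' T')"
      "m \<in> carrier (ob M S)" "n \<in> carrier (ob N T)"
  using assms unfolding box_rels_def
  apply (elim UnE)
     apply (elim CollectE exE conjE, erule add1, assumption+)
    apply (elim CollectE exE conjE, erule add2, assumption+)
   apply (elim CollectE exE conjE, erule add3, assumption+)
  apply (elim CollectE exE conjE, erule coend, assumption+)
  done

lemma rel_add1: "\<lbrakk>S \<in> gsets G; T \<in> gsets G; \<phi> \<in> BZ G X (prod_gset S T); \<phi>' \<in> BZ G X (prod_gset S T);
      m \<in> carrier (ob M S); n \<in> carrier (ob N T)\<rbrakk>
    \<Longrightarrow> frag_of (S, T, bz_add X \<phi> \<phi>', m, n) - frag_of (S, T, \<phi>, m, n) - frag_of (S, T, \<phi>', m, n)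
      \<in> box_rels G M N X"
  unfolding box_rels_def
  by (rule UnI1, rule UnI1, rule UnI1, intro CollectI exI conjI, rule refl, assumption+)

lemma rel_add2: "\<lbrakk>S \<in> gsets G; T \<in> gsets G; \<phi> \<in> BZ G X (prod_gset S T); m \<in> carrier (ob M S);
      m' \<in> carrier (ob M S); n \<in> carrier (ob N T)\<rbrakk>
    \<Longrightarrow> frag_of (S, T, \<phi>, m \<otimes>\<^bsub>ob M S\<^esub> m', n) - frag_of (S, T, \<phi>, m, n) - frag_of (S, T, \<phi>, m', n)
      \<in> box_rels G M N X"
  unfolding box_rels_def
  by (rule UnI1, rule UnI1, rule UnI2, intro CollectI exI conjI, rule refl, assumption+)

lemma rel_add3: "\<lbrakk>S \<in> gsets G; T \<in> gsets G; \<phi> \<in> BZ G X (prod_gset S T); m \<in> carrier (ob M S);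
      n \<in> carrier (ob N T); n' \<in> carrier (ob N T)\<rbrakk>
    \<Longrightarrow> frag_of (S, T, \<phi>, m, n \<otimes>\<^bsub>ob N T\<^esub> n') - frag_of (S, T, \<phi>, m, n) - frag_of (S, T, \<phi>, m, n')
      \<in> box_rels G M N X"
  unfolding box_rels_def
  by (rule UnI1, rule UnI2, intro CollectI exI conjI, rule refl, assumption+)

lemma rel_coend: "\<lbrakk>S \<in> gsets G; T \<in> gsets G; S' \<in> gsets G; T' \<in> gsets G;
      \<alpha> \<in> BZ G S' S; \<beta> \<in> BZ G T' T; \<phi> \<in> BZ G X (prod_gset S' T'); m \<in> carrier (ob M S); n \<in> carrier (ob N T)\<rbrakk>
    \<Longrightarrow> frag_of (S, T, bz_comp X (bz_prod S' T' \<alpha> \<beta>) \<phi>, m, n)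
        - frag_of (S', T', \<phi>, mor M S' S \<alpha> m, mor N T' T \<beta> n) \<in> box_rels G M N X"
  unfolding box_rels_def
  by (rule UnI2, intro CollectI exI conjI, rule refl, assumption+)

lemma rels_subset:
  assumes X: "X \<in> gsets G"
  shows "box_rels G M N X \<subseteq> carrier (free_Abelian_group (gens X))"
proof
  fix r assume "r \<in> box_rels G M N X"
  then show "r \<in> carrier (free_Abelian_group (gens X))"
  proof (cases rule: box_rels_cases)
    case (coend S T S' T' \<alpha> \<beta> \<phi> m n)
    have "bz_comp X (bz_prod S' T' \<alpha> \<beta>) \<phi> \<in> BZ G X (prod_gset S T)"
      by (rule bz_comp_in[OF coend(8) bz_prod_in]) (use coend X in auto)
    then show ?thesis using coend X by (simp add: keys_diff_subset M.mor_closed N.mor_closed)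
  qed (use X in \<open>simp_all add: keys_diff_subset M_mult N_mult\<close>)
qed

lemma rels_subgroup: "X \<in> gsets G \<Longrightarrow> subgroup (rels X) (free_Abelian_group (gens X))"
  using group.generate_is_subgroup[OF group_free_Abelian_group rels_subset]
  by (simp add: box_relsub_def)

lemma rels_incl: "r \<in> box_rels G M N X \<Longrightarrow> r \<in> rels X"
  by (simp add: box_relsub_def generate.incl)

text \<open>The relation subgroup is generated by the four families, so a homomorphism need only be
  tested on them.\<close>

lemma rels_image:
  assumes X: "X \<in> gsets G" and h: "h \<in> hom (free_Abelian_group (gens X)) H" and H: "group H"
    and L: "subgroup L H" and r: "\<And>r. r \<in> box_rels G M N X \<Longrightarrow> h r \<in> L"
  shows "h ` rels X \<subseteq> L"
proof -
  interpret h: group_hom "free_Abelian_group (gens X)" H h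
    using h H by (simp add: group_hom_def group_hom_axioms_def)
  have "h ` rels X = generate H (h ` box_rels G M N X)"
    using h.generate_img[OF rels_subset[OF X]] by (simp add: box_relsub_def)
  also have "\<dots> \<subseteq> L" by (rule h.H.generate_subgroup_incl[OF _ L]) (use r in auto)
  finally show ?thesis .
qed

abbreviation pmor where
  "pmor X f \<equiv> frag_extend (\<lambda>(S, T, \<phi>, m, n). frag_of (S, T, bz_comp X \<phi> f, m, n))"

lemma mor_pre [simp]: "mor (pre_box G M N) X Y f = pmor X f"
  by (simp add: pre_box_def)

lemma pmor_hom:
  assumes "X \<in> gsets G" "f \<in> BZ G X Y"
  shows "pmor X f \<in> hom (free_Abelian_group (gens Y)) (free_Abelian_group (gens X))"
  by (rule frag_extend_hom_free) (use assms in \<open>auto simp: box_gens_def bz_comp_in[OF assms(2)]\<close>)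

lemma pmor_rels:
  assumes X: "X \<in> gsets G" and Y: "Y \<in> gsets G" and f: "f \<in> BZ G X Y"
  shows "pmor X f ` rels Y \<subseteq> rels X"
proof (rule rels_image[OF Y pmor_hom[OF X f] group_free_Abelian_group rels_subgroup[OF X]])
  fix r assume "r \<in> box_rels G M N Y"
  then show "pmor X f r \<in> rels X"
  proof (cases rule: box_rels_cases)
    case (add1 S T \<phi> \<phi>' m n)
    then show ?thesis using X Y f bz_comp_in[OF f _ X]
      by (auto simp: frag_extend_diff bz_comp_add_left[OF X Y f] intro!: rels_incl rel_add1)
  next
    case (add2 S T \<phi> m m' n)
    then show ?thesis using X Y f bz_comp_in[OF f _ X]
      by (auto simp: frag_extend_diff intro!: rels_incl rel_add2)
  next
    case (add3 S T \<phi> m n n')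
    then show ?thesis using X Y f bz_comp_in[OF f _ X]
      by (auto simp: frag_extend_diff intro!: rels_incl rel_add3)
  next
    case (coend S T S' T' \<alpha> \<beta> \<phi> m n)
    have "bz_comp X (bz_comp Y (bz_prod S' T' \<alpha> \<beta>) \<phi>) f = bz_comp X (bz_prod S' T' \<alpha> \<beta>) (bz_comp X \<phi> f)"
      using bz_comp_assoc[OF X Y f coend(8) bz_prod_in[OF coend(6,7,4,5)]] by simp
    then show ?thesis using coend X Y f bz_comp_in[OF f coend(8) X]
      by (auto simp: frag_extend_diff intro!: rels_incl rel_coend)
  qed
qed

sublocale pre: subquot_data G "pre_box G M N" "\<lambda>X. carrier (ob (pre_box G M N) X)" rels
proof (rule subquot_data.intro)
  show "submodule_of G (pre_box G M N) (\<lambda>X. carrier (ob (pre_box G M N) X))"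
    unfolding submodule_of_def
  proof (intro conjI ballI)
    fix X Y f assume "X \<in> gsets G" "f \<in> BZ G X Y"
    then show "mor (pre_box G M N) X Y f ` carrier (ob (pre_box G M N) Y) \<subseteq> carrier (ob (pre_box G M N) X)"
      using hom_carrier[OF pmor_hom] by simp
  qed (simp add: group.subgroup_self)
  show "submodule_of G (pre_box G M N) rels"
    unfolding submodule_of_def using rels_subgroup pmor_rels by simp
  show "rels X \<subseteq> carrier (ob (pre_box G M N) X)" if "X \<in> gsets G" for X
    using subgroup.subset[OF rels_subgroup[OF that]] by simp
qed (simp_all add: abelian_free_Abelian_group pmor_hom)

lemma box_subquot: "box G M N = subquot (pre_box G M N) (\<lambda>X. carrier (ob (pre_box G M N) X)) rels"
  by (simp add: box_def quot_def)

lemma cl_gen: "rels X #>\<^bsub>free_Abelian_group (gens X)\<^esub> frag_of (S, T, \<phi>, m, n) = bx X S T \<phi> m n"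
  by (simp add: bx_def)

abbreviation cls where "cls X z \<equiv> rels X #>\<^bsub>free_Abelian_group (gens X)\<^esub> z"

lemma cls_in: "\<lbrakk>X \<in> gsets G; Poly_Mapping.keys z \<subseteq> gens X\<rbrakk> \<Longrightarrow> cls X z \<in> carrier (ob (box G M N) X)"
  using pre.carrier_subquot by (auto simp: box_subquot)

lemma box_carrier: "X \<in> gsets G \<Longrightarrow> carrier (ob (box G M N) X) = cls X ` {z. Poly_Mapping.keys z \<subseteq> gens X}"
  using pre.carrier_subquot by (auto simp: box_subquot)

lemma bx_in:
  "\<lbrakk>X \<in> gsets G; S \<in> gsets G; T \<in> gsets G; \<phi> \<in> BZ G X (prod_gset S T); m \<in> carrier (ob M S); n \<in> carrier (ob N T)\<rbrakk>
    \<Longrightarrow> bx X S T \<phi> m n \<in> carrier (ob (box G M N) X)"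
  unfolding bx_def by (rule cls_in) auto

lemma comm_group_box: "X \<in> gsets G \<Longrightarrow> comm_group (ob (box G M N) X)"
  using pre.comm_group_subquot by (simp add: box_subquot)

lemma cls_add:
  "\<lbrakk>X \<in> gsets G; Poly_Mapping.keys z \<subseteq> gens X; Poly_Mapping.keys w \<subseteq> gens X\<rbrakk>
    \<Longrightarrow> cls X (z + w) = cls X z \<otimes>\<^bsub>ob (box G M N) X\<^esub> cls X w"
  using pre.mult_subquot[of X z w] by (simp add: box_subquot)

lemma cls_hom: "X \<in> gsets G \<Longrightarrow> cls X \<in> hom (free_Abelian_group (gens X)) (ob (box G M N) X)"
  by (rule homI) (auto simp: cls_add cls_in)

lemma cls_diff:
  "\<lbrakk>X \<in> gsets G; Poly_Mapping.keys z \<subseteq> gens X; Poly_Mapping.keys w \<subseteq> gens X\<rbrakk>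
    \<Longrightarrow> cls X (z - w) = cls X z \<otimes>\<^bsub>ob (box G M N) X\<^esub> inv\<^bsub>ob (box G M N) X\<^esub> cls X w"
  by (rule hom_minus_frag[OF comm_group.axioms(2)[OF comm_group_box] cls_hom])

lemma cls_eqI:
  assumes "X \<in> gsets G" "Poly_Mapping.keys z \<subseteq> gens X" "Poly_Mapping.keys w \<subseteq> gens X" "z - w \<in> rels X"
  shows "cls X z = cls X w"
  using pre.cl_eq_iff[of X z w] assms by simp

lemma bx_add1:
  assumes "X \<in> gsets G" "S \<in> gsets G" "T \<in> gsets G" "\<phi> \<in> BZ G X (prod_gset S T)" "\<phi>' \<in> BZ G X (prod_gset S T)"
    "m \<in> carrier (ob M S)" "n \<in> carrier (ob N T)"
  shows "bx X S T (bz_add X \<phi> \<phi>') m n = bx X S T \<phi> m n \<otimes>\<^bsub>ob (box G M N) X\<^esub> bx X S T \<phi>' m n"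
proof -
  have "bx X S T (bz_add X \<phi> \<phi>') m n = cls X (frag_of (S, T, \<phi>, m, n) + frag_of (S, T, \<phi>', m, n))"
    unfolding bx_def using assms rels_incl[OF rel_add1[OF assms(2-)]]
    by (intro cls_eqI) (auto simp: keys_add_subset algebra_simps)
  then show ?thesis using assms by (simp add: cls_add bx_def)
qed

lemma bx_add2:
  assumes "X \<in> gsets G" "S \<in> gsets G" "T \<in> gsets G" "\<phi> \<in> BZ G X (prod_gset S T)"
    "m \<in> carrier (ob M S)" "m' \<in> carrier (ob M S)" "n \<in> carrier (ob N T)"
  shows "bx X S T \<phi> (m \<otimes>\<^bsub>ob M S\<^esub> m') n = bx X S T \<phi> m n \<otimes>\<^bsub>ob (box G M N) X\<^esub> bx X S T \<phi> m' n"
proof -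
  have "bx X S T \<phi> (m \<otimes>\<^bsub>ob M S\<^esub> m') n = cls X (frag_of (S, T, \<phi>, m, n) + frag_of (S, T, \<phi>, m', n))"
    unfolding bx_def using assms rels_incl[OF rel_add2[OF assms(2-)]]
    by (intro cls_eqI) (auto simp: keys_add_subset algebra_simps M_mult)
  then show ?thesis using assms by (simp add: cls_add bx_def)
qed

lemma bx_add3:
  assumes "X \<in> gsets G" "S \<in> gsets G" "T \<in> gsets G" "\<phi> \<in> BZ G X (prod_gset S T)"
    "m \<in> carrier (ob M S)" "n \<in> carrier (ob N T)" "n' \<in> carrier (ob N T)"
  shows "bx X S T \<phi> m (n \<otimes>\<^bsub>ob N T\<^esub> n') = bx X S T \<phi> m n \<otimes>\<^bsub>ob (box G M N) X\<^esub> bx X S T \<phi> m n'"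
proof -
  have "bx X S T \<phi> m (n \<otimes>\<^bsub>ob N T\<^esub> n') = cls X (frag_of (S, T, \<phi>, m, n) + frag_of (S, T, \<phi>, m, n'))"
    unfolding bx_def using assms rels_incl[OF rel_add3[OF assms(2-)]]
    by (intro cls_eqI) (auto simp: keys_add_subset algebra_simps N_mult)
  then show ?thesis using assms by (simp add: cls_add bx_def)
qed

lemma bx_coend:
  assumes "X \<in> gsets G" "S \<in> gsets G" "T \<in> gsets G" "S' \<in> gsets G" "T' \<in> gsets G"
    "\<alpha> \<in> BZ G S' S" "\<beta> \<in> BZ G T' T" "\<phi> \<in> BZ G X (prod_gset S' T')" "m \<in> carrier (ob M S)" "n \<in> carrier (ob N T)"
  shows "bx X S T (bz_comp X (bz_prod S' T' \<alpha> \<beta>) \<phi>) m n = bx X S' T' \<phi> (mor M S' S \<alpha> m) (mor N T' T \<beta> n)"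
proof -
  have "bz_comp X (bz_prod S' T' \<alpha> \<beta>) \<phi> \<in> BZ G X (prod_gset S T)"
    by (rule bz_comp_in[OF assms(8) bz_prod_in]) (use assms in auto)
  then show ?thesis
    unfolding bx_def using assms rels_incl[OF rel_coend[OF assms(2-)]]
    by (intro cls_eqI) (auto simp: M.mor_closed N.mor_closed)
qed

lemma mor_cls:
  "\<lbrakk>X \<in> gsets G; Y \<in> gsets G; f \<in> BZ G X Y; Poly_Mapping.keys z \<subseteq> gens Y\<rbrakk>
    \<Longrightarrow> mor (box G M N) X Y f (cls Y z) = cls X (pmor X f z)"
  using pre.mor_subquot[of X Y f z] by (simp add: box_subquot)

lemma mor_bx:
  "\<lbrakk>X \<in> gsets G; Y \<in> gsets G; f \<in> BZ G X Y; S \<in> gsets G; T \<in> gsets G; \<phi> \<in> BZ G Y (prod_gset S T);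
    m \<in> carrier (ob M S); n \<in> carrier (ob N T)\<rbrakk>
    \<Longrightarrow> mor (box G M N) X Y f (bx Y S T \<phi> m n) = bx X S T (bz_comp X \<phi> f) m n"
  by (simp add: bx_def mor_cls)

text \<open>Unit and composition laws hold in \<open>pre_box\<close> already. Additivity in the
  morphism holds only modulo relations: on a generator it is the first family, and both sides are
  homomorphisms in the remaining argument.\<close>

lemma zmodule_box: "zmodule G (box G M N)"
  unfolding box_subquot
proof (rule pre.zmodule_subquot)
  fix X z assume X: "X \<in> gsets G" and "z \<in> carrier (ob (pre_box G M N) X)"
  then have "Poly_Mapping.keys z \<subseteq> gens X" by simp
  then have "pmor X (bz_id X) z = z"
    by (induction z rule: lin_induct) (auto simp: frag_extend_diff box_gens_def X bz_comp_id(2)[OF X])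
  then show "pre.cl X (mor (pre_box G M N) X X (bz_id X) z) = pre.cl X z" by simp
next
  fix X Y W f g z assume h: "X \<in> gsets G" "Y \<in> gsets G" "W \<in> gsets G" "f \<in> BZ G X Y" "g \<in> BZ G Y W"
    and "z \<in> carrier (ob (pre_box G M N) W)"
  then have "Poly_Mapping.keys z \<subseteq> gens W" by simp
  then have "pmor X (bz_comp X g f) z = pmor X f (pmor Y g z)"
    by (induction z rule: lin_induct) (auto simp: frag_extend_diff box_gens_def bz_comp_assoc[OF h(1,2,4,5)])
  then show "pre.cl X (mor (pre_box G M N) X W (bz_comp X g f) z)
      = pre.cl X (mor (pre_box G M N) X Y f (mor (pre_box G M N) Y W g z))" by simp
next
  fix X Y f g z assume h: "X \<in> gsets G" "Y \<in> gsets G" "f \<in> BZ G X Y" "g \<in> BZ G X Y"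
    and "z \<in> carrier (ob (pre_box G M N) Y)"
  then have "Poly_Mapping.keys z \<subseteq> gens Y" by simp
  have k: "Poly_Mapping.keys (pmor X f z) \<subseteq> gens X" if "f \<in> BZ G X Y" "Poly_Mapping.keys z \<subseteq> gens Y" for f z
    using hom_in_carrier[OF pmor_hom[OF h(1) that(1)], of z] that(2) by simp
  interpret B: comm_group "ob (box G M N) X" using comm_group_box h by blast
  have "cls X (pmor X (bz_add X f g) z) = cls X (pmor X f z) \<otimes>\<^bsub>ob (box G M N) X\<^esub> cls X (pmor X g z)"
    using \<open>Poly_Mapping.keys z \<subseteq> gens Y\<close>
  proof (induction z rule: lin_induct)
    case zero
    have "cls X 0 = \<one>\<^bsub>ob (box G M N) X\<^esub>"
      using hom_one[OF cls_hom[OF h(1)]] by (simp add: B.is_group)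
    then show ?case by simp
  next
    case (one x)
    then obtain S T \<phi> m n where x: "x = (S, T, \<phi>, m, n)" by (cases x)
    have t: "S \<in> gsets G" "T \<in> gsets G" "\<phi> \<in> BZ G Y (prod_gset S T)" "m \<in> carrier (ob M S)" "n \<in> carrier (ob N T)"
      using one x by auto
    show ?case
      using bx_add1[OF h(1) t(1,2) bz_comp_in[OF h(3) t(3) h(1)] bz_comp_in[OF h(4) t(3) h(1)] t(4,5)]
      by (simp add: x cl_gen bz_comp_add_right[OF h t(3)])
  next
    case (diff u v)
    have "cls X (pmor X f u) \<in> carrier (ob (box G M N) X)" "cls X (pmor X g u) \<in> carrier (ob (box G M N) X)"
      "cls X (pmor X f v) \<in> carrier (ob (box G M N) X)" "cls X (pmor X g v) \<in> carrier (ob (box G M N) X)"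
      by (intro cls_in h(1) k[OF h(3)] k[OF h(4)] diff(1,2))+
    note c = this
    have ku: "Poly_Mapping.keys (pmor X e u) \<subseteq> gens X" "Poly_Mapping.keys (pmor X e v) \<subseteq> gens X"
      if "e \<in> BZ G X Y" for e
      using k that diff(1,2) by auto
    have d: "cls X (pmor X e (u - v)) = cls X (pmor X e u) \<otimes>\<^bsub>ob (box G M N) X\<^esub> inv\<^bsub>ob (box G M N) X\<^esub> cls X (pmor X e v)"
      if "e \<in> BZ G X Y" for e
      using cls_diff[OF h(1) ku[OF that]] by (simp add: frag_extend_diff)
    show ?case
      unfolding d[OF h(3)] d[OF h(4)] d[OF bz_add_in[OF h(3,4,1)]] diff(3,4)
      by (rule B.mult_inv_interchange[OF c])
  qed
  then show "pre.cl X (mor (pre_box G M N) X Y (bz_add X f g) z) =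
       pre.cl X (mor (pre_box G M N) X Y f z \<otimes>\<^bsub>ob (pre_box G M N) X\<^esub> mor (pre_box G M N) X Y g z)"
    using cls_add[OF h(1) k[OF h(3)] k[OF h(4)]] \<open>Poly_Mapping.keys z \<subseteq> gens Y\<close> by simp
qed

lemma box_induct [consumes 2, case_names one gen diff]:
  assumes X: "X \<in> gsets G" and c: "c \<in> carrier (ob (box G M N) X)"
    and one: "P \<one>\<^bsub>ob (box G M N) X\<^esub>"
    and gen: "\<And>S T \<phi> m n. \<lbrakk>S \<in> gsets G; T \<in> gsets G; \<phi> \<in> BZ G X (prod_gset S T);
      m \<in> carrier (ob M S); n \<in> carrier (ob N T)\<rbrakk> \<Longrightarrow> P (bx X S T \<phi> m n)"
    and diff: "\<And>c d. \<lbrakk>c \<in> carrier (ob (box G M N) X); d \<in> carrier (ob (box G M N) X); P c; P d\<rbrakk>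
      \<Longrightarrow> P (c \<otimes>\<^bsub>ob (box G M N) X\<^esub> inv\<^bsub>ob (box G M N) X\<^esub> d)"
  shows "P c"
proof -
  obtain z where z: "Poly_Mapping.keys z \<subseteq> gens X" "c = cls X z" using c X by (auto simp: box_carrier)
  have "P (cls X z)" using z(1)
  proof (induction z rule: lin_induct)
    case zero
    show ?case using one hom_one[OF cls_hom[OF X]] comm_group.axioms(2)[OF comm_group_box[OF X]] by simp
  next
    case (one x)
    then show ?case using gen by (cases x) (auto simp: bx_def[symmetric])
  next
    case (diff u v)
    then show ?case using assms(5) cls_in X by (simp add: cls_diff)
  qed
  then show ?thesis using z by simp
qed

lemma box_hom_eqI:
  assumes X: "X \<in> gsets G" and H: "group H" and h: "h \<in> hom (ob (box G M N) X) H" and k: "k \<in> hom (ob (box G M N) X) H"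
    and gen: "\<And>S T \<phi> m n. \<lbrakk>S \<in> gsets G; T \<in> gsets G; \<phi> \<in> BZ G X (prod_gset S T);
      m \<in> carrier (ob M S); n \<in> carrier (ob N T)\<rbrakk> \<Longrightarrow> h (bx X S T \<phi> m n) = k (bx X S T \<phi> m n)"
    and c: "c \<in> carrier (ob (box G M N) X)"
  shows "h c = k c"
proof -
  interpret B: comm_group "ob (box G M N) X" using comm_group_box X .
  interpret h: group_hom "ob (box G M N) X" H h using B.is_group H h by (simp add: group_hom_def group_hom_axioms_def)
  interpret k: group_hom "ob (box G M N) X" H k using B.is_group H k by (simp add: group_hom_def group_hom_axioms_def)
  show ?thesis using X c
    by (induction c rule: box_induct) (auto simp: gen)
qed

text \<open>Universal property of the coend: a family that is additive in each of its three
  arguments and balanced over \<open>BZ\<close> extends to the free group and kills all four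
  families of relations. It supplies the left inverses in \<open>bx_represented\<close> and
  \<open>cb_inj\<close>.\<close>

lemma box_universal:
  assumes X: "X \<in> gsets G" and H: "comm_group H"
    and c: "\<And>S T \<phi> m n. (S, T, \<phi>, m, n) \<in> gens X \<Longrightarrow> \<beta> S T \<phi> m n \<in> carrier H"
    and a1: "\<And>S T \<phi> \<phi>' m n. \<lbrakk>(S, T, \<phi>, m, n) \<in> gens X; \<phi>' \<in> BZ G X (prod_gset S T)\<rbrakk>
      \<Longrightarrow> \<beta> S T (bz_add X \<phi> \<phi>') m n = \<beta> S T \<phi> m n \<otimes>\<^bsub>H\<^esub> \<beta> S T \<phi>' m n"
    and a2: "\<And>S T \<phi> m m' n. \<lbrakk>(S, T, \<phi>, m, n) \<in> gens X; m' \<in> carrier (ob M S)\<rbrakk>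
      \<Longrightarrow> \<beta> S T \<phi> (m \<otimes>\<^bsub>ob M S\<^esub> m') n = \<beta> S T \<phi> m n \<otimes>\<^bsub>H\<^esub> \<beta> S T \<phi> m' n"
    and a3: "\<And>S T \<phi> m n n'. \<lbrakk>(S, T, \<phi>, m, n) \<in> gens X; n' \<in> carrier (ob N T)\<rbrakk>
      \<Longrightarrow> \<beta> S T \<phi> m (n \<otimes>\<^bsub>ob N T\<^esub> n') = \<beta> S T \<phi> m n \<otimes>\<^bsub>H\<^esub> \<beta> S T \<phi> m n'"
    and ce: "\<And>S T S' T' \<alpha> \<beta>' \<phi> m n. \<lbrakk>S \<in> gsets G; T \<in> gsets G; S' \<in> gsets G; T' \<in> gsets G;
      \<alpha> \<in> BZ G S' S; \<beta>' \<in> BZ G T' T; \<phi> \<in> BZ G X (prod_gset S' T'); m \<in> carrier (ob M S); n \<in> carrier (ob N T)\<rbrakk>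
      \<Longrightarrow> \<beta> S T (bz_comp X (bz_prod S' T' \<alpha> \<beta>') \<phi>) m n = \<beta> S' T' \<phi> (mor M S' S \<alpha> m) (mor N T' T \<beta>' n)"
  obtains h where "h \<in> hom (ob (box G M N) X) H"
    "\<And>S T \<phi> m n. (S, T, \<phi>, m, n) \<in> gens X \<Longrightarrow> h (bx X S T \<phi> m n) = \<beta> S T \<phi> m n"
proof -
  interpret H: comm_group H by fact
  let ?F = "free_Abelian_group (gens X)"
  obtain k where k: "k \<in> hom ?F H"
    and kf: "\<And>x. x \<in> gens X \<Longrightarrow> k (frag_of x) = (case x of (S, T, \<phi>, m, n) \<Rightarrow> \<beta> S T \<phi> m n)"
    by (rule H.free_Abelian_group_universal[of "\<lambda>x. case x of (S, T, \<phi>, m, n) \<Rightarrow> \<beta> S T \<phi> m n" "gens X"])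
      (use c in auto)
  have kd: "k (u - v) = k u \<otimes>\<^bsub>H\<^esub> inv\<^bsub>H\<^esub> (k v)" if "Poly_Mapping.keys u \<subseteq> gens X" "Poly_Mapping.keys v \<subseteq> gens X" for u v
    using hom_minus_frag[OF H.is_group k that] .
  have "k ` rels X \<subseteq> {\<one>\<^bsub>H\<^esub>}"
  proof (rule rels_image[OF X k H.is_group H.triv_subgroup])
    fix r assume "r \<in> box_rels G M N X"
    then show "k r \<in> {\<one>\<^bsub>H\<^esub>}"
    proof (cases rule: box_rels_cases)
      case (add1 S T \<phi> \<phi>' m n)
      then show ?thesis using X c[of S T \<phi> m n] c[of S T \<phi>' m n]
        by (simp add: kd kf a1 keys_diff_subset H.m_assoc H.m_comm[of "\<beta> S T \<phi> m n"] H.inv_solve_right')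
    next
      case (add2 S T \<phi> m m' n)
      then show ?thesis using X c[of S T \<phi> m n] c[of S T \<phi> m' n]
        by (simp add: kd kf a2 keys_diff_subset M_mult H.m_assoc H.m_comm[of "\<beta> S T \<phi> m n"] H.inv_solve_right')
    next
      case (add3 S T \<phi> m n n')
      then show ?thesis using X c[of S T \<phi> m n] c[of S T \<phi> m n']
        by (simp add: kd kf a3 keys_diff_subset N_mult H.m_assoc H.m_comm[of "\<beta> S T \<phi> m n"] H.inv_solve_right')
    next
      case (coend S T S' T' \<alpha> \<beta>' \<phi> m n)
      have "bz_comp X (bz_prod S' T' \<alpha> \<beta>') \<phi> \<in> BZ G X (prod_gset S T)"
        by (rule bz_comp_in[OF coend(8) bz_prod_in]) (use coend X in auto)
      then show ?thesis using coend X c[of S' T' \<phi> "mor M S' S \<alpha> m" "mor N T' T \<beta>' n"]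
        by (simp add: kd kf ce M.mor_closed N.mor_closed)
    qed
  qed
  then have "k x = k y" if "x \<in> carrier ?F" "y \<in> carrier ?F" "cls X x = cls X y" for x y
  proof -
    have "x - y \<in> rels X" using pre.cl_eq_iff[of X x y] that X by simp
    then have "k x \<otimes>\<^bsub>H\<^esub> inv\<^bsub>H\<^esub> (k y) = \<one>\<^bsub>H\<^esub>" using kd[of x y] that \<open>k ` rels X \<subseteq> {\<one>\<^bsub>H\<^esub>}\<close> by auto
    moreover have "k x \<in> carrier H" "k y \<in> carrier H" using k that by (auto simp: hom_def)
    ultimately show ?thesis using H.inv_solve_right'[of "\<one>\<^bsub>H\<^esub>" "k x" "k y"] by simp
  qed
  moreover have "rels X \<lhd> ?F"
    using comm_group.subgroup_imp_normal[OF abelian_free_Abelian_group rels_subgroup[OF X]] .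
  ultimately obtain h where h: "h \<in> hom (?F Mod rels X) H" "\<And>x. x \<in> carrier ?F \<Longrightarrow> h (cls X x) = k x"
    using FactGroup_universal[OF k, of "rels X"] by blast
  have e: "ob (box G M N) X = ?F Mod rels X"
    by (simp add: box_def quot_def subquot_def)
  show thesis
    by (rule that[of h]) (use h kf in \<open>auto simp: e bx_def\<close>)
qed

end

section \<open>Functoriality of the box product\<close>

locale box_map_data = s: box_data G M N + t: box_data G K L
  for G :: "'g monoid" and M :: "('g, 'm) zmod" and N :: "('g, 'n) zmod"
    and K :: "('g, 'k) zmod" and L :: "('g, 'l) zmod" +
  fixes \<eta> \<theta>
  assumes \<eta>: "\<eta> \<in> zhom G M K" and \<theta>: "\<theta> \<in> zhom G N L"
begin

abbreviation "F \<equiv> frag_extend (\<lambda>(S, T, \<phi>, m, n). frag_of (S, T, \<phi>, \<eta> S m, \<theta> T n))"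

lemma F_hom: "F \<in> hom (free_Abelian_group (s.gens X)) (free_Abelian_group (t.gens X))"
  by (rule frag_extend_hom_free) (auto simp: box_gens_def zhom_closed[OF \<eta>] zhom_closed[OF \<theta>])

lemma F_rels:
  assumes X: "X \<in> gsets G" shows "F ` s.rels X \<subseteq> t.rels X"
proof (rule s.rels_image[OF X F_hom group_free_Abelian_group t.rels_subgroup[OF X]])
  fix r assume "r \<in> box_rels G M N X"
  then show "F r \<in> t.rels X"
  proof (cases rule: s.box_rels_cases)
    case (add1 S T \<phi> \<phi>' m n)
    then show ?thesis
      by (auto simp: frag_extend_diff zhom_closed[OF \<eta>] zhom_closed[OF \<theta>] intro!: t.rels_incl t.rel_add1)
  next
    case (add2 S T \<phi> m m' n)
    then show ?thesis
      by (auto simp: frag_extend_diff zhom_closed[OF \<eta>] zhom_closed[OF \<theta>] zhom_mult[OF \<eta>] intro!: t.rels_incl t.rel_add2)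
  next
    case (add3 S T \<phi> m n n')
    then show ?thesis
      by (auto simp: frag_extend_diff zhom_closed[OF \<eta>] zhom_closed[OF \<theta>] zhom_mult[OF \<theta>] intro!: t.rels_incl t.rel_add3)
  next
    case (coend S T S' T' \<alpha> \<beta> \<phi> m n)
    then show ?thesis
      by (auto simp: frag_extend_diff zhom_closed[OF \<eta>] zhom_closed[OF \<theta>] zhom_natural[OF \<eta>] zhom_natural[OF \<theta>]
          intro!: t.rels_incl t.rel_coend)
  qed
qed

lemma box_map_cls:
  assumes X: "X \<in> gsets G" and z: "Poly_Mapping.keys z \<subseteq> s.gens X"
  shows "box_map G M N K L \<eta> \<theta> X (s.cls X z) = t.cls X (F z)"
  using coset_image[OF group_free_Abelian_group group_free_Abelian_group F_hom s.rels_subgroup[OF X]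
      t.rels_subgroup[OF X] F_rels[OF X], of z] X z s.cls_in[OF X z]
  by (simp add: box_map_def)

lemma box_map_bx:
  "\<lbrakk>X \<in> gsets G; S \<in> gsets G; T \<in> gsets G; \<phi> \<in> BZ G X (prod_gset S T); m \<in> carrier (ob M S); n \<in> carrier (ob N T)\<rbrakk>
    \<Longrightarrow> box_map G M N K L \<eta> \<theta> X (s.bx X S T \<phi> m n) = t.bx X S T \<phi> (\<eta> S m) (\<theta> T n)"
  by (simp add: s.bx_def t.bx_def box_map_cls)

lemma F_keys: "Poly_Mapping.keys z \<subseteq> s.gens X \<Longrightarrow> Poly_Mapping.keys (F z) \<subseteq> t.gens X"
  using hom_in_carrier[OF F_hom, of z X] by simp

lemma box_map_in: "box_map G M N K L \<eta> \<theta> \<in> zhom G (box G M N) (box G K L)"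
proof -
  have "zrestrict G (box G M N) (box_map G M N K L \<eta> \<theta>) \<in> zhom G (box G M N) (box G K L)"
  proof (rule zrestrict_in[OF s.zmodule_box])
    fix X m assume X: "X \<in> gsets G" and "m \<in> carrier (ob (box G M N) X)"
    then show "box_map G M N K L \<eta> \<theta> X m \<in> carrier (ob (box G K L) X)"
      by (auto simp: s.box_carrier box_map_cls t.cls_in F_keys)
  next
    fix X m m' assume X: "X \<in> gsets G" and "m \<in> carrier (ob (box G M N) X)" "m' \<in> carrier (ob (box G M N) X)"
    then show "box_map G M N K L \<eta> \<theta> X (m \<otimes>\<^bsub>ob (box G M N) X\<^esub> m')
        = box_map G M N K L \<eta> \<theta> X m \<otimes>\<^bsub>ob (box G K L) X\<^esub> box_map G M N K L \<eta> \<theta> X m'"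
      by (auto simp: s.box_carrier box_map_cls s.cls_add[symmetric] t.cls_add[symmetric] F_keys keys_add_subset frag_extend_add)
  next
    fix X Y f m assume X: "X \<in> gsets G" and Y: "Y \<in> gsets G" and f: "f \<in> BZ G X Y"
      and "m \<in> carrier (ob (box G M N) Y)"
    then obtain z where z: "Poly_Mapping.keys z \<subseteq> s.gens Y" "m = s.cls Y z" by (auto simp: s.box_carrier)
    have "F (s.pmor X f z) = t.pmor X f (F z)" using z(1)
      by (induction z rule: lin_induct) (auto simp: frag_extend_diff)
    moreover have "Poly_Mapping.keys (s.pmor X f z) \<subseteq> s.gens X"
      using hom_in_carrier[OF s.pmor_hom[OF X f], of z] z(1) by simp
    ultimately show "box_map G M N K L \<eta> \<theta> X (mor (box G M N) X Y f m)
        = mor (box G K L) X Y f (box_map G M N K L \<eta> \<theta> Y m)"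
      using X Y f z by (simp add: s.mor_cls t.mor_cls box_map_cls F_keys)
  qed
  moreover have "zrestrict G (box G M N) (box_map G M N K L \<eta> \<theta>) = box_map G M N K L \<eta> \<theta>"
    by (auto simp: zrestrict_def box_map_def fun_eq_iff)
  ultimately show ?thesis by simp
qed

end

section \<open>Representable modules\<close>

lemma zmodule_rep:
  assumes X: "X \<in> gsets G" shows "zmodule G (rep G X)"
proof (rule zmodule.intro)
  fix W V f assume h: "W \<in> gsets G" "V \<in> gsets G" "f \<in> BZ G W V"
  show "mor (rep G X) W V f \<in> hom (ob (rep G X) V) (ob (rep G X) W)"
    by (rule homI) (use h in \<open>auto simp: rep_def bz_comp_in[OF h(3) _ h(1)] bz_comp_add_left[OF h]\<close>)
next
  fix W V U f g m assume h: "W \<in> gsets G" "V \<in> gsets G" "U \<in> gsets G" "f \<in> BZ G W V" "g \<in> BZ G V U"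
    "m \<in> carrier (ob (rep G X) U)"
  then show "mor (rep G X) W U (bz_comp W g f) m = mor (rep G X) W V f (mor (rep G X) V U g m)"
    using bz_comp_assoc[OF h(1,2,4,5), of m X] by (simp add: rep_def)
next
  fix W V f g m assume h: "W \<in> gsets G" "V \<in> gsets G" "f \<in> BZ G W V" "g \<in> BZ G W V"
    "m \<in> carrier (ob (rep G X) V)"
  then show "mor (rep G X) W V (bz_add W f g) m
      = mor (rep G X) W V f m \<otimes>\<^bsub>ob (rep G X) W\<^esub> mor (rep G X) W V g m"
    using bz_comp_add_right[OF h(1-4), of m X] by (simp add: rep_def)
qed (auto simp: rep_def BZ_group_comm_group bz_comp_id(2)[of _ G])

text \<open>A universal element takes the place of the module \<open>rep G S\<close>. The terms of
  the resolution represent the same functors but have elements of another type, and a box product of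
  represented modules is represented only up to isomorphism.\<close>

locale represented = zmodule G M for G :: "'g monoid" and M :: "('g, 'm) zmod" +
  fixes S e
  assumes S: "S \<in> gsets G" and e: "e \<in> carrier (ob M S)"
    and bij: "\<And>Y. Y \<in> gsets G \<Longrightarrow> bij_betw (\<lambda>f. mor M Y S f e) (BZ G Y S) (carrier (ob M Y))"
begin

definition crd where "crd Y m = inv_into (BZ G Y S) (\<lambda>f. mor M Y S f e) m"

lemma crd_in: "\<lbrakk>Y \<in> gsets G; m \<in> carrier (ob M Y)\<rbrakk> \<Longrightarrow> crd Y m \<in> BZ G Y S"
  unfolding crd_def using bij_betwE[OF bij_betw_inv_into[OF bij]] by blast

lemma mor_crd: "\<lbrakk>Y \<in> gsets G; m \<in> carrier (ob M Y)\<rbrakk> \<Longrightarrow> mor M Y S (crd Y m) e = m"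
  unfolding crd_def using bij_betw_inv_into_right[OF bij] by blast

lemma crd_mor: "\<lbrakk>Y \<in> gsets G; f \<in> BZ G Y S\<rbrakk> \<Longrightarrow> crd Y (mor M Y S f e) = f"
  unfolding crd_def using bij_betw_inv_into_left[OF bij] by blast

lemma crd_eqI: "\<lbrakk>Y \<in> gsets G; f \<in> BZ G Y S; mor M Y S f e = m\<rbrakk> \<Longrightarrow> crd Y m = f"
  using crd_mor by blast

lemma crd_mult:
  assumes Y: "Y \<in> gsets G" and m: "m \<in> carrier (ob M Y)" "m' \<in> carrier (ob M Y)"
  shows "crd Y (m \<otimes>\<^bsub>ob M Y\<^esub> m') = bz_add Y (crd Y m) (crd Y m')"
  using mor_add[OF Y S crd_in[OF Y m(1)] crd_in[OF Y m(2)] e] bz_add_in[OF crd_in[OF Y m(1)] crd_in[OF Y m(2)] Y]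
    mor_crd[OF Y] m
  by (intro crd_eqI[OF Y]) auto

lemma crd_nat:
  assumes X: "X \<in> gsets G" and Y: "Y \<in> gsets G" and f: "f \<in> BZ G X Y" and m: "m \<in> carrier (ob M Y)"
  shows "crd X (mor M X Y f m) = bz_comp X (crd Y m) f"
  using mor_comp[OF X Y S f crd_in[OF Y m] e] bz_comp_in[OF f crd_in[OF Y m] X] mor_crd[OF Y m]
  by (intro crd_eqI[OF X]) auto

lemma crd_e: "crd S e = bz_id S"
  by (rule crd_eqI) (use S e mor_id in auto)

text \<open>The map that Yoneda attaches to \<open>n\<close>: write m as a restriction of the
  universal element and restrict \<open>n\<close> along the same morphism.\<close>

definition yo where "yo N n = zrestrict G M (\<lambda>Y m. mor N Y S (crd Y m) n)"

lemma yo: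
  assumes N: "zmodule G N" and n: "n \<in> carrier (ob N S)"
  shows "yo N n \<in> zhom G M N" "yo N n S e = n"
proof -
  interpret N: zmodule G N by fact
  show "yo N n \<in> zhom G M N"
    unfolding yo_def
  proof (rule zrestrict_in)
    fix X m m' assume "X \<in> gsets G" "m \<in> carrier (ob M X)" "m' \<in> carrier (ob M X)"
    then show "mor N X S (crd X (m \<otimes>\<^bsub>ob M X\<^esub> m')) n = mor N X S (crd X m) n \<otimes>\<^bsub>ob N X\<^esub> mor N X S (crd X m') n"
      using N.mor_add[OF _ S crd_in crd_in n] by (simp add: crd_mult)
  next
    fix X Y f m assume "X \<in> gsets G" "Y \<in> gsets G" "f \<in> BZ G X Y" "m \<in> carrier (ob M Y)"
    then show "mor N X S (crd X (mor M X Y f m)) n = mor N X Y f (mor N Y S (crd Y m) n)"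
      using N.mor_comp[OF _ _ S _ crd_in n] by (simp add: crd_nat)
  qed (use S n N.mor_closed crd_in zmodule_axioms in auto)
  show "yo N n S e = n" using S e n N.mor_id by (simp add: yo_def crd_e)
qed

lemma zhom_rep_eqI:
  assumes h: "\<eta> \<in> zhom G M N" "\<theta> \<in> zhom G M N" and eq: "\<eta> S e = \<theta> S e"
  shows "\<eta> = \<theta>"
proof (rule zhom_eqI[OF h])
  fix X m assume h': "X \<in> gsets G" "m \<in> carrier (ob M X)"
  then show "\<eta> X m = \<theta> X m"
    using zhom_natural[OF h(1) h'(1) S crd_in[OF h'] e] zhom_natural[OF h(2) h'(1) S crd_in[OF h'] e] eq
    by (simp add: mor_crd)
qed

end

lemma represented_rep: "X \<in> gsets G \<Longrightarrow> represented G (rep G X) X (bz_id X)"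
proof -
  assume X: "X \<in> gsets G"
  have "bij_betw (\<lambda>f. mor (rep G X) Y X f (bz_id X)) (BZ G Y X) (carrier (ob (rep G X) Y))"
    if Y: "Y \<in> gsets G" for Y
  proof -
    have "bij_betw (\<lambda>f. f) (BZ G Y X) (BZ G Y X)" by (simp add: bij_betw_def)
    moreover have "\<And>f. f \<in> BZ G Y X \<Longrightarrow> mor (rep G X) Y X f (bz_id X) = f"
      using bz_comp_id(1)[OF Y X] by (simp add: rep_def)
    ultimately show ?thesis using X Y by (subst bij_betw_cong[of _ _ "\<lambda>f. f"]) (auto simp: rep_def)
  qed
  then show ?thesis using X zmodule_rep[OF X]
    by (simp add: represented_def represented_axioms_def) (simp add: rep_def)
qed

text \<open>Day convolution of representables is the representable of the product. The inverse sends
  the class of (A, B, \<phi>, m, n) to (m x n) \<circ> \<phi>, with m and n read as morphisms to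
  \<open>S\<close> and \<open>T\<close>; bilinearity and functoriality of \<open>bz_prod\<close> are
  precisely the four relations.\<close>

lemma (in box_data) bx_represented:
  assumes "represented G M S e" and "represented G N T e'"
  shows "represented G (box G M N) (prod_gset S T) (bx (prod_gset S T) S T (bz_id (prod_gset S T)) e e')"
proof -
  interpret MS: represented G M S e by fact
  interpret NT: represented G N T e' by fact
  have ST: "prod_gset S T \<in> gsets G" using MS.S NT.S by simp
  let ?e = "bx (prod_gset S T) S T (bz_id (prod_gset S T)) e e'"
  have m: "mor (box G M N) Y (prod_gset S T) f ?e = bx Y S T f e e'"
    if "Y \<in> gsets G" "f \<in> BZ G Y (prod_gset S T)" for Y f
    using that ST MS.S NT.S MS.e NT.e bz_comp_id(1)[OF that(1) ST that(2)] by (simp add: mor_bx)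
  have "bij_betw (\<lambda>f. mor (box G M N) Y (prod_gset S T) f ?e) (BZ G Y (prod_gset S T)) (carrier (ob (box G M N) Y))"
    if Y: "Y \<in> gsets G" for Y
  proof -
    let ?\<beta> = "\<lambda>A B \<phi> m n. bz_comp Y (bz_prod A B (MS.crd A m) (NT.crd B n)) \<phi>"
    have pin: "bz_prod A B (MS.crd A m) (NT.crd B n) \<in> BZ G (prod_gset A B) (prod_gset S T)"
      if "A \<in> gsets G" "B \<in> gsets G" "m \<in> carrier (ob M A)" "n \<in> carrier (ob N B)" for A B m n
      using that by (intro bz_prod_in MS.crd_in NT.crd_in)
    obtain h where h: "h \<in> hom (ob (box G M N) Y) (BZ_group G Y (prod_gset S T))"
      "\<And>A B \<phi> m n. (A, B, \<phi>, m, n) \<in> gens Y \<Longrightarrow> h (bx Y A B \<phi> m n) = ?\<beta> A B \<phi> m n"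
    proof (rule box_universal[OF Y BZ_group_comm_group[OF Y, of "prod_gset S T"], of ?\<beta>])
      fix A B \<phi> m n assume "(A, B, \<phi>, m, n) \<in> gens Y"
      then show "?\<beta> A B \<phi> m n \<in> carrier (BZ_group G Y (prod_gset S T))"
        using bz_comp_in[OF _ pin Y] by auto
    next
      fix A B \<phi> \<phi>' m n assume "(A, B, \<phi>, m, n) \<in> gens Y" "\<phi>' \<in> BZ G Y (prod_gset A B)"
      then show "?\<beta> A B (bz_add Y \<phi> \<phi>') m n = ?\<beta> A B \<phi> m n \<otimes>\<^bsub>BZ_group G Y (prod_gset S T)\<^esub> ?\<beta> A B \<phi>' m n"
        using bz_comp_add_right[OF Y prod_gset_in _ _ pin] by auto
    next
      fix A B \<phi> m m' n assume a: "(A, B, \<phi>, m, n) \<in> gens Y" "m' \<in> carrier (ob M A)"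
      then have "bz_prod A B (MS.crd A (m \<otimes>\<^bsub>ob M A\<^esub> m')) (NT.crd B n)
        = bz_add (prod_gset A B) (bz_prod A B (MS.crd A m) (NT.crd B n)) (bz_prod A B (MS.crd A m') (NT.crd B n))"
        using bz_prod_add_left[OF MS.crd_in MS.crd_in NT.crd_in] by (simp add: MS.crd_mult)
      then show "?\<beta> A B \<phi> (m \<otimes>\<^bsub>ob M A\<^esub> m') n = ?\<beta> A B \<phi> m n \<otimes>\<^bsub>BZ_group G Y (prod_gset S T)\<^esub> ?\<beta> A B \<phi> m' n"
        using bz_comp_add_left[OF Y prod_gset_in _ pin pin] a by simp
    next
      fix A B \<phi> m n n' assume a: "(A, B, \<phi>, m, n) \<in> gens Y" "n' \<in> carrier (ob N B)"
      then have "bz_prod A B (MS.crd A m) (NT.crd B (n \<otimes>\<^bsub>ob N B\<^esub> n'))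
        = bz_add (prod_gset A B) (bz_prod A B (MS.crd A m) (NT.crd B n)) (bz_prod A B (MS.crd A m) (NT.crd B n'))"
        using bz_prod_add_right[OF MS.crd_in NT.crd_in NT.crd_in] by (simp add: NT.crd_mult)
      then show "?\<beta> A B \<phi> m (n \<otimes>\<^bsub>ob N B\<^esub> n') = ?\<beta> A B \<phi> m n \<otimes>\<^bsub>BZ_group G Y (prod_gset S T)\<^esub> ?\<beta> A B \<phi> m n'"
        using bz_comp_add_left[OF Y prod_gset_in _ pin pin] a by simp
    next
      fix A B A' B' \<alpha> \<beta>' \<phi> m n
      assume a: "A \<in> gsets G" "B \<in> gsets G" "A' \<in> gsets G" "B' \<in> gsets G" "\<alpha> \<in> BZ G A' A"
        "\<beta>' \<in> BZ G B' B" "\<phi> \<in> BZ G Y (prod_gset A' B')" "m \<in> carrier (ob M A)" "n \<in> carrier (ob N B)"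
      show "?\<beta> A B (bz_comp Y (bz_prod A' B' \<alpha> \<beta>') \<phi>) m n = ?\<beta> A' B' \<phi> (mor M A' A \<alpha> m) (mor N B' B \<beta>' n)"
        using bz_comp_assoc[OF Y prod_gset_in[OF a(3,4)] a(7) bz_prod_in[OF a(5,6,3,4)] pin[OF a(1,2,8,9)]]
          bz_prod_comp[OF a(5,6) MS.crd_in NT.crd_in, of m n] a
        by (simp add: MS.crd_nat NT.crd_nat)
    next
    fix h assume "h \<in> hom (ob (box G M N) Y) (BZ_group G Y (prod_gset S T))" "\<And>A B \<phi> m n. (A, B, \<phi>, m, n) \<in> gens Y \<Longrightarrow> h (bx Y A B \<phi> m n) = ?\<beta> A B \<phi> m n"
    then show thesis by (rule that)
    qed
    have hb: "h (bx Y S T f e e') = f" if "f \<in> BZ G Y (prod_gset S T)" for f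
      using h(2)[of S T f e e'] that MS.S NT.S MS.e NT.e bz_comp_id(1)[OF Y ST that]
      by (simp add: MS.crd_e NT.crd_e bz_prod_id[OF MS.S NT.S])
    \<comment> \<open>Surjectivity: the coend relation moves the coordinates of m and n into \<phi>,
      leaving the two universal elements behind. Classes of this shape are closed under differences
      because the class is additive in its morphism.\<close>
    have "\<exists>f \<in> BZ G Y (prod_gset S T). c = bx Y S T f e e'" if "c \<in> carrier (ob (box G M N) Y)" for c
      using Y that
    proof (induction c rule: box_induct)
      case one
      have "\<one>\<^bsub>ob (box G M N) Y\<^esub> = mor (box G M N) Y (prod_gset S T) (bz_zero Y) ?e"
        using zmodule.mor_zero[OF zmodule_box Y ST] bx_in[OF ST MS.S NT.S _ MS.e NT.e] ST by simp
      then show ?case using m[OF Y] bz_zero_in[OF Y] by metis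
    next
      case (gen A B \<phi> m n)
      have "bx Y S T (?\<beta> A B \<phi> m n) e e' = bx Y A B \<phi> (mor M A S (MS.crd A m) e) (mor N B T (NT.crd B n) e')"
        using gen Y MS.S NT.S MS.e NT.e by (intro bx_coend) (auto intro: MS.crd_in NT.crd_in)
      then show ?case using gen Y bz_comp_in[OF gen(3) pin[OF gen(1,2,4,5)] Y] by (auto simp: MS.mor_crd NT.mor_crd)
    next
      case (diff c d)
      then obtain f g where fg: "f \<in> BZ G Y (prod_gset S T)" "g \<in> BZ G Y (prod_gset S T)"
        "c = bx Y S T f e e'" "d = bx Y S T g e e'" by blast
      interpret B: comm_group "ob (box G M N) Y" using comm_group_box Y .
      have n: "bz_neg Y g \<in> BZ G Y (prod_gset S T)" using fg Y by simp
      have "bz_add Y (bz_add Y f (bz_neg Y g)) g = f"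
        by (rule BZ_eqI[of _ G Y "prod_gset S T"]) (use fg n Y in auto)
      then have "c = bx Y S T (bz_add Y f (bz_neg Y g)) e e' \<otimes>\<^bsub>ob (box G M N) Y\<^esub> d"
        using bx_add1[OF Y MS.S NT.S bz_add_in[OF fg(1) n Y] fg(2) MS.e NT.e] fg by simp
      then have "c \<otimes>\<^bsub>ob (box G M N) Y\<^esub> inv\<^bsub>ob (box G M N) Y\<^esub> d = bx Y S T (bz_add Y f (bz_neg Y g)) e e'"
        using bx_in[OF Y MS.S NT.S bz_add_in[OF fg(1) n Y] MS.e NT.e] diff by (simp add: B.m_assoc)
      then show ?case using fg n Y by (intro bexI[of _ "bz_add Y f (bz_neg Y g)"]) auto
    qed
    then show ?thesis
      unfolding bij_betw_def using m[OF Y] hb bx_in[OF Y MS.S NT.S _ MS.e NT.e]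
      by (auto intro!: inj_onI) metis+
  qed
  then show ?thesis
    using zmodule_box ST bx_in[OF ST MS.S NT.S _ MS.e NT.e]
    by (simp add: represented_def represented_axioms_def)
qed

section \<open>Box product with a represented module\<close>

locale box_repr = box_data G M N + MS: represented G M S e
  for G :: "'g monoid" and M :: "('g, 'm) zmod" and N :: "('g, 'n) zmod" and S e
begin

text \<open>The normal form of a class: universal element, coevaluation, and everything else stored
  in \<open>n\<close>.\<close>

definition cb where "cb X n = bx X S (prod_gset S X) (coev S X) e n"

lemma cb_in: "\<lbrakk>X \<in> gsets G; n \<in> carrier (ob N (prod_gset S X))\<rbrakk> \<Longrightarrow> cb X n \<in> carrier (ob (box G M N) X)"
  unfolding cb_def using MS.S MS.e by (intro bx_in) auto

lemma cb_mult:
  "\<lbrakk>X \<in> gsets G; n \<in> carrier (ob N (prod_gset S X)); n' \<in> carrier (ob N (prod_gset S X))\<rbrakk>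
    \<Longrightarrow> cb X (n \<otimes>\<^bsub>ob N (prod_gset S X)\<^esub> n') = cb X n \<otimes>\<^bsub>ob (box G M N) X\<^esub> cb X n'"
  unfolding cb_def using MS.S MS.e by (intro bx_add3) auto

lemma cb_hom: "X \<in> gsets G \<Longrightarrow> cb X \<in> hom (ob N (prod_gset S X)) (ob (box G M N) X)"
  by (rule homI) (auto simp: cb_in cb_mult)

text \<open>By \<open>coev_dual\<close>, \<phi> is the coevaluation followed by its transpose on the
  second factor; the coend relation shifts the transpose onto n.\<close>

lemma bx_eq_cb:
  assumes X: "X \<in> gsets G" and T: "T \<in> gsets G" and \<phi>: "\<phi> \<in> BZ G X (prod_gset S T)" and n: "n \<in> carrier (ob N T)"
  shows "bx X S T \<phi> e n = cb X (mor N (prod_gset S X) T (dual S X \<phi>) n)"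
  using bx_coend[OF X MS.S T MS.S prod_gset_in[OF MS.S X] bz_id_in[OF MS.S] dual_in[OF \<phi> MS.S X]
      coev_in[OF MS.S X] MS.e n] coev_dual[OF \<phi> MS.S X T] M.mor_id[OF MS.S MS.e]
  by (simp add: cb_def)

lemma bx_eq_cb':
  assumes X: "X \<in> gsets G" and A: "A \<in> gsets G" and T: "T \<in> gsets G" and \<phi>: "\<phi> \<in> BZ G X (prod_gset A T)"
    and h: "h \<in> BZ G A S" and n: "n \<in> carrier (ob N T)"
  shows "bx X A T \<phi> (mor M A S h e) n
    = cb X (mor N (prod_gset S X) T (dual S X (bz_comp X (bz_prod A T h (bz_id T)) \<phi>)) n)"
proof -
  have "bx X S T (bz_comp X (bz_prod A T h (bz_id T)) \<phi>) e n = bx X A T \<phi> (mor M A S h e) (mor N T T (bz_id T) n)"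
    by (rule bx_coend) (use assms MS.S MS.e in auto)
  moreover have "bz_comp X (bz_prod A T h (bz_id T)) \<phi> \<in> BZ G X (prod_gset S T)"
    by (rule bz_comp_in[OF \<phi> bz_prod_in]) (use assms in auto)
  ultimately show ?thesis using bx_eq_cb[OF X T _ n] N.mor_id[OF T n] by simp
qed

text \<open>The element m of a generator is a restriction of the universal element, so
  \<open>bx_eq_cb'\<close> brings the generator to normal form. Differences are no obstacle because
  \<open>cb\<close> is a homomorphism.\<close>

lemma cb_surj:
  assumes X: "X \<in> gsets G" and c: "c \<in> carrier (ob (box G M N) X)"
  shows "\<exists>n\<in>carrier (ob N (prod_gset S X)). c = cb X n"
  using X c
proof (induction c rule: box_induct)
  case one
  interpret group "ob N (prod_gset S X)" using N.group_ob MS.S X by simp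
  show ?case using hom_one[OF cb_hom[OF X]] comm_group.axioms(2)[OF comm_group_box[OF X]] is_group by auto
next
  case (gen A T \<phi> m n)
  have "MS.crd A m \<in> BZ G A S" using gen MS.crd_in by simp
  then have i: "bz_comp X (bz_prod A T (MS.crd A m) (bz_id T)) \<phi> \<in> BZ G X (prod_gset S T)"
    using gen X by (intro bz_comp_in[OF gen(3) bz_prod_in]) auto
  show ?case
    using bx_eq_cb'[OF X gen(1-3) MS.crd_in[OF gen(1,4)] gen(5)] N.mor_closed[OF _ gen(2) dual_in[OF i MS.S X] gen(5)]
      MS.mor_crd[OF gen(1,4)] MS.S X by auto
next
  case (diff c d)
  interpret h: group_hom "ob N (prod_gset S X)" "ob (box G M N) X" "cb X"
    using N.group_ob MS.S X comm_group.axioms(2)[OF comm_group_box] cb_hom[OF X]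
    by (simp add: group_hom_def group_hom_axioms_def)
  obtain n n' where "n \<in> carrier (ob N (prod_gset S X))" "n' \<in> carrier (ob N (prod_gset S X))" "c = cb X n" "d = cb X n'"
    using diff by blast
  then show ?case
    by (intro bexI[of _ "n \<otimes>\<^bsub>ob N (prod_gset S X)\<^esub> inv\<^bsub>ob N (prod_gset S X)\<^esub> n'"]) auto
qed

text \<open>Under self-duality of \<open>S\<close>, the inverse of \<open>cb\<close> sends the class of \<open>(A, T, \<phi>, m, n)\<close> to the
  restriction of \<open>n\<close> along the transpose of \<open>(m \<otimes> 1) \<circ> \<phi>\<close>.\<close>

lemma cb_inj:
  assumes X: "X \<in> gsets G" shows "inj_on (cb X) (carrier (ob N (prod_gset S X)))"
proof -
  let ?p = "\<lambda>A T \<phi> m. bz_comp X (bz_prod A T (MS.crd A m) (bz_id T)) \<phi>"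
  let ?\<beta> = "\<lambda>A T \<phi> m n. mor N (prod_gset S X) T (dual S X (?p A T \<phi> m)) n"
  have SX: "prod_gset S X \<in> gsets G" using MS.S X by simp
  have qi: "bz_prod A T (MS.crd A m) (bz_id T) \<in> BZ G (prod_gset A T) (prod_gset S T)"
    if "A \<in> gsets G" "T \<in> gsets G" "m \<in> carrier (ob M A)" for A T m
    using that by (intro bz_prod_in MS.crd_in) auto
  have pi: "?p A T \<phi> m \<in> BZ G X (prod_gset S T)"
    if "A \<in> gsets G" "T \<in> gsets G" "\<phi> \<in> BZ G X (prod_gset A T)" "m \<in> carrier (ob M A)" for A T \<phi> m
    using bz_comp_in[OF that(3) qi X] that by blast
  have di: "dual S X (?p A T \<phi> m) \<in> BZ G (prod_gset S X) T"
    if "A \<in> gsets G" "T \<in> gsets G" "\<phi> \<in> BZ G X (prod_gset A T)" "m \<in> carrier (ob M A)" for A T \<phi> m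
    using dual_in[OF pi MS.S X] that by blast
  obtain h where h: "h \<in> hom (ob (box G M N) X) (ob N (prod_gset S X))"
    "\<And>A T \<phi> m n. (A, T, \<phi>, m, n) \<in> gens X \<Longrightarrow> h (bx X A T \<phi> m n) = ?\<beta> A T \<phi> m n"
  proof (rule box_universal[OF X N.comm_group_ob[OF SX], of ?\<beta>])
    fix A T \<phi> m n assume "(A, T, \<phi>, m, n) \<in> gens X"
    then show "?\<beta> A T \<phi> m n \<in> carrier (ob N (prod_gset S X))" using di SX by (auto intro: N.mor_closed)
  next
    fix A T \<phi> \<phi>' m n assume a: "(A, T, \<phi>, m, n) \<in> gens X" "\<phi>' \<in> BZ G X (prod_gset A T)"
    have "?p A T (bz_add X \<phi> \<phi>') m = bz_add X (?p A T \<phi> m) (?p A T \<phi>' m)"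
      using bz_comp_add_right[OF X prod_gset_in _ _ qi, of A T \<phi> \<phi>' m] a by auto
    then have "dual S X (?p A T (bz_add X \<phi> \<phi>') m) = bz_add (prod_gset S X) (dual S X (?p A T \<phi> m)) (dual S X (?p A T \<phi>' m))"
      using dual_add[OF pi pi MS.S X, of A T \<phi> m A \<phi>' m] a by simp
    then show "?\<beta> A T (bz_add X \<phi> \<phi>') m n = ?\<beta> A T \<phi> m n \<otimes>\<^bsub>ob N (prod_gset S X)\<^esub> ?\<beta> A T \<phi>' m n"
      using N.mor_add[OF SX _ di di] a by simp
  next
    fix A T \<phi> m m' n assume a: "(A, T, \<phi>, m, n) \<in> gens X" "m' \<in> carrier (ob M A)"
    have "bz_prod A T (MS.crd A (m \<otimes>\<^bsub>ob M A\<^esub> m')) (bz_id T)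
        = bz_add (prod_gset A T) (bz_prod A T (MS.crd A m) (bz_id T)) (bz_prod A T (MS.crd A m') (bz_id T))"
      using bz_prod_add_left[OF MS.crd_in MS.crd_in bz_id_in] a by (simp add: MS.crd_mult)
    then have "?p A T \<phi> (m \<otimes>\<^bsub>ob M A\<^esub> m') = bz_add X (?p A T \<phi> m) (?p A T \<phi> m')"
      using bz_comp_add_left[OF X prod_gset_in _ qi qi] a by simp
    then have "dual S X (?p A T \<phi> (m \<otimes>\<^bsub>ob M A\<^esub> m')) = bz_add (prod_gset S X) (dual S X (?p A T \<phi> m)) (dual S X (?p A T \<phi> m'))"
      using dual_add[OF pi pi MS.S X, of A T \<phi> m A \<phi> m'] a by simp
    then show "?\<beta> A T \<phi> (m \<otimes>\<^bsub>ob M A\<^esub> m') n = ?\<beta> A T \<phi> m n \<otimes>\<^bsub>ob N (prod_gset S X)\<^esub> ?\<beta> A T \<phi> m' n"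
      using N.mor_add[OF SX _ di di] a by simp
  next
    fix A T \<phi> m n n' assume a: "(A, T, \<phi>, m, n) \<in> gens X" "n' \<in> carrier (ob N T)"
    then show "?\<beta> A T \<phi> m (n \<otimes>\<^bsub>ob N T\<^esub> n') = ?\<beta> A T \<phi> m n \<otimes>\<^bsub>ob N (prod_gset S X)\<^esub> ?\<beta> A T \<phi> m n'"
      using N.mor_mult[OF SX _ di] by simp
  next
    fix A T A' T' \<alpha> \<beta>' \<phi> m n
    assume a: "A \<in> gsets G" "T \<in> gsets G" "A' \<in> gsets G" "T' \<in> gsets G" "\<alpha> \<in> BZ G A' A"
      "\<beta>' \<in> BZ G T' T" "\<phi> \<in> BZ G X (prod_gset A' T')" "m \<in> carrier (ob M A)" "n \<in> carrier (ob N T)"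
    let ?q = "bz_prod A' T' (MS.crd A' (mor M A' A \<alpha> m)) (bz_id T')"
    have ma: "mor M A' A \<alpha> m \<in> carrier (ob M A')" using a M.mor_closed by blast
    have c1: "bz_comp A' (MS.crd A m) \<alpha> \<in> BZ G A' S" using a MS.crd_in[OF a(1,8)] by auto
    have p2: "?p A' T' \<phi> (mor M A' A \<alpha> m) \<in> BZ G X (prod_gset S T')" using pi a ma by blast
    \<comment> \<open>Balancing. First \<open>\<alpha>\<close> is absorbed into the coordinate of m,
      then \<open>\<beta>'\<close> is pulled out on the left, where \<open>dual_prod\<close> can
      move it past the transpose and onto n.\<close>
    have "?p A T (bz_comp X (bz_prod A' T' \<alpha> \<beta>') \<phi>) m
        = bz_comp X (bz_comp (prod_gset A' T') (bz_prod A T (MS.crd A m) (bz_id T)) (bz_prod A' T' \<alpha> \<beta>')) \<phi>"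
      using bz_comp_assoc[OF X prod_gset_in[OF a(3,4)] a(7) bz_prod_in[OF a(5,6,3,4)] qi[OF a(1,2,8)]] .
    also have "\<dots> = bz_comp X (bz_prod A' T' (bz_comp A' (MS.crd A m) \<alpha>) \<beta>') \<phi>"
      using bz_prod_comp[OF a(5,6) MS.crd_in[OF a(1,8)] bz_id_in[OF a(2)] a(3,4,1,2)] bz_comp_id(1)[OF a(4,2,6)] by simp
    also have "\<dots> = bz_comp X (bz_comp (prod_gset A' T') (bz_prod S T' (bz_id S) \<beta>')
          (bz_prod A' T' (bz_comp A' (MS.crd A m) \<alpha>) (bz_id T'))) \<phi>"
      using bz_prod_comp[OF c1 bz_id_in[OF a(4)] bz_id_in[OF MS.S] a(6) a(3,4) MS.S a(4)]
        bz_comp_id(1)[OF a(3) MS.S c1] bz_comp_id(2)[OF a(4,6)] by simp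
    also have "\<dots> = bz_comp X (bz_prod S T' (bz_id S) \<beta>') (?p A' T' \<phi> (mor M A' A \<alpha> m))"
      using bz_comp_assoc[OF X prod_gset_in[OF a(3,4)] a(7) qi[OF a(3,4) ma] bz_prod_in[OF bz_id_in[OF MS.S] a(6) MS.S a(4)]]
        MS.crd_nat[OF a(3,1,5,8)] by simp
    finally have "dual S X (?p A T (bz_comp X (bz_prod A' T' \<alpha> \<beta>') \<phi>) m)
        = bz_comp (prod_gset S X) \<beta>' (dual S X (?p A' T' \<phi> (mor M A' A \<alpha> m)))"
      using dual_prod[OF p2 a(6) MS.S X a(4)] by simp
    then show "?\<beta> A T (bz_comp X (bz_prod A' T' \<alpha> \<beta>') \<phi>) m n = ?\<beta> A' T' \<phi> (mor M A' A \<alpha> m) (mor N T' T \<beta>' n)"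
      using N.mor_comp[OF SX a(4,2) di[OF a(3,4,7) ma] a(6,9)] by simp
  next
    fix h assume "h \<in> hom (ob (box G M N) X) (ob N (prod_gset S X))" "\<And>A B \<phi> m n. (A, B, \<phi>, m, n) \<in> gens X \<Longrightarrow> h (bx X A B \<phi> m n) = ?\<beta> A B \<phi> m n"
    then show thesis by (rule that)
    qed
  have "h (cb X n) = n" if n: "n \<in> carrier (ob N (prod_gset S X))" for n
  proof -
    have "h (cb X n) = ?\<beta> S (prod_gset S X) (coev S X) e n"
      unfolding cb_def using n MS.S X MS.e by (intro h(2)) auto
    also have "?p S (prod_gset S X) (coev S X) e = coev S X"
      using bz_comp_id(1)[OF X _ coev_in[OF MS.S X]] MS.S SX by (simp add: MS.crd_e bz_prod_id)
    finally show ?thesis using n by (simp add: dual_coev[OF MS.S X] N.mor_id SX)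
  qed
  then show ?thesis by (rule inj_on_inverseI)
qed

text \<open>Precomposing the coevaluation with f is the same as applying f to its last factor, and
  the coend relation transfers that to n.\<close>

lemma cb_natural:
  assumes f: "f \<in> BZ G X Y" and X: "X \<in> gsets G" and Y: "Y \<in> gsets G" and n: "n \<in> carrier (ob N (prod_gset S Y))"
  shows "mor (box G M N) X Y f (cb Y n) = cb X (mor N (prod_gset S X) (prod_gset S Y) (bz_prod S X (bz_id S) f) n)"
proof -
  have p: "bz_prod S X (bz_id S) f \<in> BZ G (prod_gset S X) (prod_gset S Y)" using f X MS.S by auto
  have "mor (box G M N) X Y f (cb Y n) = bx X S (prod_gset S Y) (bz_comp X (coev S Y) f) e n"
    unfolding cb_def using assms MS.S MS.e by (intro mor_bx) auto
  also have "\<dots> = bx X S (prod_gset S X) (coev S X) (mor M S S (bz_id S) e)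
      (mor N (prod_gset S X) (prod_gset S Y) (bz_prod S X (bz_id S) f) n)"
    unfolding coev_natural[OF f MS.S X Y] using p assms MS.S MS.e by (intro bx_coend) auto
  finally show ?thesis by (simp add: cb_def M.mor_id MS.S MS.e)
qed

end

section \<open>Free modules are projective\<close>

text \<open>A \<open>gfinprod\<close> carries meaning only when its support is finite. The
  homomorphism is applied over the support of \<open>f\<close>; factors that it sends to the
  identity, and those outside the support, are neutral in the product over \<open>B\<close>.\<close>

lemma hom_gfinprod:
  assumes G: "comm_group G" and H: "comm_group H" and h: "h \<in> hom G H"
    and f: "\<And>b. b \<in> B \<Longrightarrow> f b \<in> carrier G" and fin: "finite {b \<in> B. f b \<noteq> \<one>\<^bsub>G\<^esub>}"
  shows "h (gfinprod G f B) = gfinprod H (\<lambda>b. h (f b)) B"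
proof -
  interpret G: comm_group G by fact
  interpret H: comm_group H by fact
  interpret h: group_hom G H h using h by (simp add: group_hom_def group_hom_axioms_def)
  let ?F = "{b \<in> B. f b \<noteq> \<one>\<^bsub>G\<^esub>}"
  have "h (finprod G f F) = finprod H (\<lambda>b. h (f b)) F" if "finite F" "F \<subseteq> B" for F
    using that by (induction F) (auto simp: f Pi_iff subset_iff G.finprod_insert H.finprod_insert)
  then have "h (finprod G f ?F) = finprod H (\<lambda>b. h (f b)) ?F" using fin by auto
  also have "\<dots> = gfinprod H (\<lambda>b. h (f b)) ?F" using fin f by (simp add: Pi_iff)
  also have "\<dots> = gfinprod H (\<lambda>b. h (f b)) B"
    by (rule H.gfinprod_mono_neutral_cong_left) (use f in auto)
  finally show ?thesis using fin by (simp add: gfinprod_def)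
qed

definition coeffs where
  "coeffs G B Y = {c \<in> (\<Pi>\<^sub>E (X, e)\<in>B. BZ G Y X). finite {b \<in> B. c b \<noteq> \<one>\<^bsub>BZ_group G Y (fst b)\<^esub>}}"

text \<open>The sum occurring in \<open>free_mod\<close>, with the basis elements replaced by an
  arbitrary assignment \<open>a\<close>. The same coefficients can then be used in the module into
  which a free module is mapped.\<close>

definition combine where
  "combine A a B Y c = gfinprod (ob A Y) (\<lambda>b. mor A Y (fst b) (c b) (a b)) B"

lemma coeffs_in: "\<lbrakk>c \<in> coeffs G B Y; b \<in> B\<rbrakk> \<Longrightarrow> c b \<in> BZ G Y (fst b)"
  by (cases b) (auto simp: coeffs_def)

lemma coeffs_finite: "c \<in> coeffs G B Y \<Longrightarrow> finite {b \<in> B. c b \<noteq> bz_zero Y}"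
  by (simp add: coeffs_def)

lemma coeffsI:
  "\<lbrakk>\<And>b. b \<in> B \<Longrightarrow> c b \<in> BZ G Y (fst b); finite {b \<in> B. c b \<noteq> bz_zero Y}\<rbrakk> \<Longrightarrow> restrict c B \<in> coeffs G B Y"
  by (auto simp: coeffs_def elim: rev_finite_subset)

locale combination = zmodule G A for G :: "'g monoid" and A :: "('g, 'a) zmod" +
  fixes B :: "('g gset \<times> 'b) set" and a :: "'g gset \<times> 'b \<Rightarrow> 'a"
  assumes B: "\<And>b. b \<in> B \<Longrightarrow> fst b \<in> gsets G" and a: "\<And>b. b \<in> B \<Longrightarrow> a b \<in> carrier (ob A (fst b))"
begin

lemma term_in:
  "\<lbrakk>Y \<in> gsets G; c \<in> coeffs G B Y; b \<in> B\<rbrakk> \<Longrightarrow> mor A Y (fst b) (c b) (a b) \<in> carrier (ob A Y)"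
  using mor_closed coeffs_in B a by blast

lemma term_finite:
  assumes "Y \<in> gsets G" "c \<in> coeffs G B Y"
  shows "finite {b \<in> B. mor A Y (fst b) (c b) (a b) \<noteq> \<one>\<^bsub>ob A Y\<^esub>}"
  by (rule finite_subset[OF _ coeffs_finite[OF assms(2)]]) (use assms B a mor_zero in auto)

lemma combine_in: "\<lbrakk>Y \<in> gsets G; c \<in> coeffs G B Y\<rbrakk> \<Longrightarrow> combine A a B Y c \<in> carrier (ob A Y)"
  unfolding combine_def
  by (rule comm_monoid.gfinprod_closed) (auto intro!: comm_group.axioms(1) comm_group_ob term_in)

lemma combine_add:
  assumes Y: "Y \<in> gsets G" and c: "c \<in> coeffs G B Y" "c' \<in> coeffs G B Y"
  shows "(\<lambda>b\<in>B. bz_add Y (c b) (c' b)) \<in> coeffs G B Y"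
    and "combine A a B Y (\<lambda>b\<in>B. bz_add Y (c b) (c' b)) = combine A a B Y c \<otimes>\<^bsub>ob A Y\<^esub> combine A a B Y c'"
proof -
  interpret comm_group "ob A Y" using comm_group_ob Y .
  have z: "bz_add Y (bz_zero Y) (bz_zero Y) = bz_zero Y"
    by (rule BZ_eqI[of _ G Y Y]) (use Y in auto)
  show 1: "(\<lambda>b\<in>B. bz_add Y (c b) (c' b)) \<in> coeffs G B Y"
  proof (rule coeffsI)
    show "finite {b \<in> B. bz_add Y (c b) (c' b) \<noteq> bz_zero Y}"
      by (rule finite_subset[OF _ finite_UnI[OF coeffs_finite[OF c(1)] coeffs_finite[OF c(2)]]]) (use z in auto)
  qed (use c Y coeffs_in bz_add_in in blast)
  have "combine A a B Y (\<lambda>b\<in>B. bz_add Y (c b) (c' b))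
      = gfinprod (ob A Y) (\<lambda>b. mor A Y (fst b) (c b) (a b) \<otimes>\<^bsub>ob A Y\<^esub> mor A Y (fst b) (c' b) (a b)) B"
    unfolding combine_def
    by (rule gfinprod_cong)
      (use term_in[OF Y c(1)] term_in[OF Y c(2)] mor_add[OF Y B coeffs_in[OF c(1)] coeffs_in[OF c(2)] a]
        in \<open>auto simp: simp_implies_def\<close>)
  also have "\<dots> = combine A a B Y c \<otimes>\<^bsub>ob A Y\<^esub> combine A a B Y c'"
    unfolding combine_def by (rule gfinprod_distrib) (use term_in term_finite c Y in auto)
  finally show "combine A a B Y (\<lambda>b\<in>B. bz_add Y (c b) (c' b))
      = combine A a B Y c \<otimes>\<^bsub>ob A Y\<^esub> combine A a B Y c'" .
qed

lemma combine_natural: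
  assumes X: "X \<in> gsets G" and Y: "Y \<in> gsets G" and f: "f \<in> BZ G X Y" and c: "c \<in> coeffs G B Y"
  shows "(\<lambda>b\<in>B. bz_comp X (c b) f) \<in> coeffs G B X"
    and "mor A X Y f (combine A a B Y c) = combine A a B X (\<lambda>b\<in>B. bz_comp X (c b) f)"
proof -
  interpret comm_group "ob A X" using comm_group_ob X .
  have z: "bz_comp X (bz_zero Y) f = bz_zero X"
    by (rule BZ_eqI[of _ G X Y]) (use X Y f in \<open>auto simp: BZ_keys_of bz_comp_in[OF f]\<close>)
  show 1: "(\<lambda>b\<in>B. bz_comp X (c b) f) \<in> coeffs G B X"
  proof (rule coeffsI)
    show "finite {b \<in> B. bz_comp X (c b) f \<noteq> bz_zero X}"
      by (rule finite_subset[OF _ coeffs_finite[OF c]]) (use z in auto)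
  qed (use c X f coeffs_in bz_comp_in in blast)
  have "mor A X Y f (combine A a B Y c) = gfinprod (ob A X) (\<lambda>b. mor A X Y f (mor A Y (fst b) (c b) (a b))) B"
    unfolding combine_def
    by (rule hom_gfinprod[OF comm_group_ob[OF Y] comm_group_ob[OF X] mor_hom[OF X Y f]])
      (use term_in term_finite c Y in auto)
  also have "\<dots> = combine A a B X (\<lambda>b\<in>B. bz_comp X (c b) f)"
    unfolding combine_def
    by (rule gfinprod_cong)
      (use term_in[OF X 1] mor_comp[OF X Y B f coeffs_in[OF c] a] in \<open>auto simp: simp_implies_def\<close>)
  finally show "mor A X Y f (combine A a B Y c) = combine A a B X (\<lambda>b\<in>B. bz_comp X (c b) f)" .
qed

lemma combine_zhom:
  assumes A': "zmodule G A'" and \<beta>: "\<beta> \<in> zhom G A A'" and Y: "Y \<in> gsets G" and c: "c \<in> coeffs G B Y"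
  shows "\<beta> Y (combine A a B Y c) = combine A' (\<lambda>b. \<beta> (fst b) (a b)) B Y c"
proof -
  interpret A': zmodule G A' by fact
  have "\<beta> Y (combine A a B Y c) = gfinprod (ob A' Y) (\<lambda>b. \<beta> Y (mor A Y (fst b) (c b) (a b))) B"
    unfolding combine_def
    by (rule hom_gfinprod[OF comm_group_ob[OF Y] A'.comm_group_ob[OF Y] zhom_hom[OF \<beta> Y]])
      (use term_in term_finite c Y in auto)
  also have "\<dots> = combine A' (\<lambda>b. \<beta> (fst b) (a b)) B Y c"
    unfolding combine_def
    by (rule comm_monoid.gfinprod_cong[OF comm_group.axioms(1)[OF A'.comm_group_ob[OF Y]]])
      (use zhom_natural[OF \<beta> Y B coeffs_in[OF c] a] A'.mor_closed[OF Y B coeffs_in[OF c]] zhom_closed[OF \<beta> B a]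
        in \<open>auto simp: simp_implies_def\<close>)
  finally show ?thesis .
qed

end

lemma free_mod_iff:
  "free_mod G P \<longleftrightarrow> zmodule G P \<and> (\<exists>B \<subseteq> {(X, e). X \<in> gsets G \<and> e \<in> carrier (ob P X)}.
    \<forall>Y\<in>gsets G. bij_betw (combine P snd B Y) (coeffs G B Y) (carrier (ob P Y)))"
proof -
  have "combine P snd B Y = (\<lambda>c. gfinprod (ob P Y) (\<lambda>(X, e). mor P Y X (c (X, e)) e) B)" for B Y
    by (rule ext) (simp add: combine_def case_prod_unfold)
  then show ?thesis by (simp add: free_mod_def coeffs_def)
qed

text \<open>Preimages are chosen for the images of the basis and combined with the coordinates of
  the argument; uniqueness of coordinates gives additivity and naturality. The condition is that
  \<alpha> lands in the image of \<beta>, because \<beta> will usually be a boundary map and not a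
  surjection.\<close>

lemma free_lift:
  assumes P: "free_mod G P" and A: "zmodule G A" and A': "zmodule G A'"
    and \<alpha>: "\<alpha> \<in> zhom G P A'" and \<beta>: "\<beta> \<in> zhom G A A'"
    and im: "\<And>X p. \<lbrakk>X \<in> gsets G; p \<in> carrier (ob P X)\<rbrakk> \<Longrightarrow> \<alpha> X p \<in> \<beta> X ` carrier (ob A X)"
  shows "\<exists>\<gamma>\<in>zhom G P A. \<forall>X\<in>gsets G. \<forall>p\<in>carrier (ob P X). \<beta> X (\<gamma> X p) = \<alpha> X p"
proof -
  obtain B where B: "B \<subseteq> {(X, e). X \<in> gsets G \<and> e \<in> carrier (ob P X)}"
    and bij: "\<And>Y. Y \<in> gsets G \<Longrightarrow> bij_betw (combine P snd B Y) (coeffs G B Y) (carrier (ob P Y))"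
    using P by (auto simp: free_mod_iff)
  have Pz: "zmodule G P" using P by (simp add: free_mod_def)
  have "\<exists>y\<in>carrier (ob A (fst b)). \<beta> (fst b) y = \<alpha> (fst b) (snd b)" if "b \<in> B" for b
    using im[of "fst b" "snd b"] B that by force
  then obtain a where a: "\<And>b. b \<in> B \<Longrightarrow> a b \<in> carrier (ob A (fst b))" "\<And>b. b \<in> B \<Longrightarrow> \<beta> (fst b) (a b) = \<alpha> (fst b) (snd b)"
    by metis
  interpret p: combination G P B snd
    using Pz B by (auto simp: combination_def combination_axioms_def)
  interpret q: combination G A B a
    using A B a by (auto simp: combination_def combination_axioms_def)
  define co where "co Y = inv_into (coeffs G B Y) (combine P snd B Y)" for Y
  have co: "co Y p \<in> coeffs G B Y" "combine P snd B Y (co Y p) = p" if "Y \<in> gsets G" "p \<in> carrier (ob P Y)" for Y p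
    unfolding co_def using bij_betwE[OF bij_betw_inv_into[OF bij]] bij_betw_inv_into_right[OF bij] that by blast+
  have coI: "co Y p = c" if "Y \<in> gsets G" "c \<in> coeffs G B Y" "combine P snd B Y c = p" for Y p c
    unfolding co_def using bij_betw_inv_into_left[OF bij] that by blast
  let ?\<gamma> = "\<lambda>Y p. combine A a B Y (co Y p)"
  have "zrestrict G P ?\<gamma> \<in> zhom G P A"
  proof (rule zrestrict_in[OF Pz])
    fix X m m' assume h: "X \<in> gsets G" "m \<in> carrier (ob P X)" "m' \<in> carrier (ob P X)"
    have "co X (m \<otimes>\<^bsub>ob P X\<^esub> m') = (\<lambda>b\<in>B. bz_add X (co X m b) (co X m' b))"
      by (rule coI) (use p.combine_add[OF h(1) co(1) co(1)] h co(2) in auto)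
    then show "?\<gamma> X (m \<otimes>\<^bsub>ob P X\<^esub> m') = ?\<gamma> X m \<otimes>\<^bsub>ob A X\<^esub> ?\<gamma> X m'"
      using q.combine_add(2)[OF h(1) co(1) co(1)] h by simp
  next
    fix X Y f m assume h: "X \<in> gsets G" "Y \<in> gsets G" "f \<in> BZ G X Y" "m \<in> carrier (ob P Y)"
    have "co X (mor P X Y f m) = (\<lambda>b\<in>B. bz_comp X (co Y m b) f)"
      by (rule coI) (use p.combine_natural[OF h(1-3) co(1)] h co(2) in auto)
    then show "?\<gamma> X (mor P X Y f m) = mor A X Y f (?\<gamma> Y m)"
      using q.combine_natural(2)[OF h(1-3) co(1)] h by simp
  qed (auto intro: q.combine_in co)
  moreover have "\<beta> X (?\<gamma> X p) = \<alpha> X p" if h: "X \<in> gsets G" "p \<in> carrier (ob P X)" for X p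
  proof -
    have "\<beta> X (?\<gamma> X p) = combine A' (\<lambda>b. \<beta> (fst b) (a b)) B X (co X p)"
      using q.combine_zhom[OF A' \<beta> h(1) co(1)] h by simp
    also have "\<dots> = combine A' (\<lambda>b. \<alpha> (fst b) (snd b)) B X (co X p)"
      unfolding combine_def
      by (rule comm_monoid.gfinprod_cong[OF comm_group.axioms(1)[OF zmodule.comm_group_ob[OF A' h(1)]]])
        (use a zmodule.mor_closed[OF A' h(1) p.B coeffs_in[OF co(1)[OF h]]] zhom_closed[OF \<alpha> p.B p.a]
          in \<open>auto simp: simp_implies_def\<close>)
    also have "\<dots> = \<alpha> X p"
      using p.combine_zhom[OF A' \<alpha> h(1) co(1)] co(2) h by simp
    finally show ?thesis .
  qed
  ultimately show ?thesis by (intro bexI[of _ "zrestrict G P ?\<gamma>"]) auto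
qed

text \<open>The universal element alone is a basis: a coefficient family on a singleton is one
  morphism, and combining is the Yoneda bijection.\<close>

lemma (in represented) free: "free_mod G M"
  unfolding free_mod_iff
proof (intro conjI exI ballI)
  let ?B = "{(S, e)}"
  show "?B \<subseteq> {(X, e). X \<in> gsets G \<and> e \<in> carrier (ob M X)}" using S e by simp
  fix Y assume Y: "Y \<in> gsets G"
  interpret comm_group "ob M Y" using comm_group_ob Y .
  have c: "combine M snd ?B Y c = mor M Y S (c (S, e)) e" if "c (S, e) \<in> BZ G Y S" for c
    using mor_closed[OF Y S that e] by (simp add: combine_def finprod_singleton)
  have co: "coeffs G ?B Y = (\<Pi>\<^sub>E b\<in>?B. BZ G Y S)" by (auto simp: coeffs_def)
  have "inj_on (combine M snd ?B Y) (coeffs G ?B Y)"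
  proof (rule inj_onI)
    fix c c' assume h: "c \<in> coeffs G ?B Y" "c' \<in> coeffs G ?B Y" "combine M snd ?B Y c = combine M snd ?B Y c'"
    then have i: "c (S, e) \<in> BZ G Y S" "c' (S, e) \<in> BZ G Y S" by (auto simp: co PiE_iff)
    then have "mor M Y S (c (S, e)) e = mor M Y S (c' (S, e)) e" using h(3) c[of c, OF i(1)] c[of c', OF i(2)] by simp
    then have "crd Y (mor M Y S (c (S, e)) e) = crd Y (mor M Y S (c' (S, e)) e)" by (rule arg_cong)
    then have ce: "c (S, e) = c' (S, e)" by (simp only: crd_mor[OF Y i(1)] crd_mor[OF Y i(2)])
    have x: "c \<in> extensional ?B" "c' \<in> extensional ?B" using h(1,2) by (auto simp: co PiE_iff)
    show "c = c'" by (rule extensionalityI[OF x]) (simp only: ce singleton_iff)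
  qed
  moreover have "combine M snd ?B Y ` coeffs G ?B Y = carrier (ob M Y)"
  proof (intro equalityI subsetI)
    fix m assume m: "m \<in> carrier (ob M Y)"
    have "(\<lambda>b\<in>?B. crd Y m) \<in> coeffs G ?B Y" using crd_in[OF Y m] by (auto simp: co)
    moreover have "combine M snd ?B Y (\<lambda>b\<in>?B. crd Y m) = m"
      using c[of "\<lambda>b\<in>?B. crd Y m"] crd_in[OF Y m] mor_crd[OF Y m] by simp
    ultimately show "m \<in> combine M snd ?B Y ` coeffs G ?B Y" by (intro image_eqI) auto
  next
    fix m assume "m \<in> combine M snd ?B Y ` coeffs G ?B Y"
    then obtain d where d: "d \<in> coeffs G ?B Y" "m = combine M snd ?B Y d" by blast
    then have "d (S, e) \<in> BZ G Y S" by (auto simp: co PiE_iff)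
    then show "m \<in> carrier (ob M Y)" using c[of d] mor_closed[OF Y S _ e, of "d (S, e)"] d by simp
  qed
  ultimately show "bij_betw (combine M snd ?B Y) (coeffs G ?B Y) (carrier (ob M Y))" by (simp add: bij_betw_def)
qed (use zmodule_axioms in simp)

section \<open>The internal hom\<close>

lemma zhom_mult_in:
  assumes M: "zmodule G M" and N: "zmodule G N" and h: "\<eta> \<in> zhom G M N" "\<theta> \<in> zhom G M N"
  shows "zrestrict G M (\<lambda>X m. \<eta> X m \<otimes>\<^bsub>ob N X\<^esub> \<theta> X m) \<in> zhom G M N"
proof (rule zrestrict_in[OF M])
  fix X m m' assume X: "X \<in> gsets G" "m \<in> carrier (ob M X)" "m' \<in> carrier (ob M X)"
  interpret comm_group "ob N X" using zmodule.comm_group_ob[OF N X(1)] .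
  note c = zhom_closed[OF h(1) X(1,2)] zhom_closed[OF h(1) X(1,3)] zhom_closed[OF h(2) X(1,2)] zhom_closed[OF h(2) X(1,3)]
  show "\<eta> X (m \<otimes>\<^bsub>ob M X\<^esub> m') \<otimes>\<^bsub>ob N X\<^esub> \<theta> X (m \<otimes>\<^bsub>ob M X\<^esub> m')
    = \<eta> X m \<otimes>\<^bsub>ob N X\<^esub> \<theta> X m \<otimes>\<^bsub>ob N X\<^esub> (\<eta> X m' \<otimes>\<^bsub>ob N X\<^esub> \<theta> X m')"
    unfolding zhom_mult[OF h(1) X] zhom_mult[OF h(2) X] using c by (simp add: m_ac)
next
  fix X Y f m assume X: "X \<in> gsets G" "Y \<in> gsets G" "f \<in> BZ G X Y" "m \<in> carrier (ob M Y)"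
  show "\<eta> X (mor M X Y f m) \<otimes>\<^bsub>ob N X\<^esub> \<theta> X (mor M X Y f m) = mor N X Y f (\<eta> Y m \<otimes>\<^bsub>ob N Y\<^esub> \<theta> Y m)"
    using zmodule.mor_mult[OF N X(1-3) zhom_closed[OF h(1) X(2,4)] zhom_closed[OF h(2) X(2,4)]]
    by (simp add: zhom_natural[OF h(1) X] zhom_natural[OF h(2) X])
next
  fix X m assume X: "X \<in> gsets G" "m \<in> carrier (ob M X)"
  interpret comm_group "ob N X" using zmodule.comm_group_ob[OF N X(1)] .
  show "\<eta> X m \<otimes>\<^bsub>ob N X\<^esub> \<theta> X m \<in> carrier (ob N X)"
    using zhom_closed[OF h(1) X] zhom_closed[OF h(2) X] by simp
qed

lemma zhom_inv_in:
  assumes M: "zmodule G M" and N: "zmodule G N" and h: "\<eta> \<in> zhom G M N"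
  shows "zrestrict G M (\<lambda>X m. inv\<^bsub>ob N X\<^esub> (\<eta> X m)) \<in> zhom G M N"
proof (rule zrestrict_in[OF M])
  fix X m m' assume X: "X \<in> gsets G" "m \<in> carrier (ob M X)" "m' \<in> carrier (ob M X)"
  interpret comm_group "ob N X" using zmodule.comm_group_ob[OF N X(1)] .
  show "inv\<^bsub>ob N X\<^esub> (\<eta> X (m \<otimes>\<^bsub>ob M X\<^esub> m')) = inv\<^bsub>ob N X\<^esub> \<eta> X m \<otimes>\<^bsub>ob N X\<^esub> inv\<^bsub>ob N X\<^esub> \<eta> X m'"
    unfolding zhom_mult[OF h(1) X] using zhom_closed[OF h X(1,2)] zhom_closed[OF h X(1,3)] by (simp add: inv_mult)
next
  fix X Y f m assume X: "X \<in> gsets G" "Y \<in> gsets G" "f \<in> BZ G X Y" "m \<in> carrier (ob M Y)"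
  interpret group_hom "ob N Y" "ob N X" "mor N X Y f"
    using zmodule.group_ob[OF N X(1)] zmodule.group_ob[OF N X(2)] zmodule.mor_hom[OF N X(1-3)]
    by (simp add: group_hom_def group_hom_axioms_def)
  show "inv\<^bsub>ob N X\<^esub> (\<eta> X (mor M X Y f m)) = mor N X Y f (inv\<^bsub>ob N Y\<^esub> (\<eta> Y m))"
    using hom_inv[OF zhom_closed[OF h X(2,4)]] by (simp add: zhom_natural[OF h X])
next
  fix X m assume X: "X \<in> gsets G" "m \<in> carrier (ob M X)"
  interpret comm_group "ob N X" using zmodule.comm_group_ob[OF N X(1)] .
  show "inv\<^bsub>ob N X\<^esub> (\<eta> X m) \<in> carrier (ob N X)" using zhom_closed[OF h X] by simp
qed

lemma zhom_one_in:
  assumes M: "zmodule G M" and N: "zmodule G N"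
  shows "zrestrict G M (\<lambda>X m. \<one>\<^bsub>ob N X\<^esub>) \<in> zhom G M N"
proof (rule zrestrict_in[OF M])
  fix X m m' assume X: "X \<in> gsets G" "m \<in> carrier (ob M X)"
  interpret comm_group "ob N X" using zmodule.comm_group_ob[OF N X(1)] .
  show "\<one>\<^bsub>ob N X\<^esub> \<in> carrier (ob N X)" "\<one>\<^bsub>ob N X\<^esub> = \<one>\<^bsub>ob N X\<^esub> \<otimes>\<^bsub>ob N X\<^esub> \<one>\<^bsub>ob N X\<^esub>" by simp_all
qed (simp add: zmodule.mor_one[OF N])

lemma zhom_group_simps:
  "carrier (zhom_group G M N) = zhom G M N"
  "\<eta> \<otimes>\<^bsub>zhom_group G M N\<^esub> \<theta> = zrestrict G M (\<lambda>X m. \<eta> X m \<otimes>\<^bsub>ob N X\<^esub> \<theta> X m)"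
  "\<one>\<^bsub>zhom_group G M N\<^esub> = zrestrict G M (\<lambda>X m. \<one>\<^bsub>ob N X\<^esub>)"
  by (simp_all add: zhom_group_def zrestrict_def)

lemma comm_group_zhom_group:
  assumes M: "zmodule G M" and N: "zmodule G N"
  shows "comm_group (zhom_group G M N)"
proof (rule comm_groupI, unfold zhom_group_simps)
  fix \<eta> \<theta> \<zeta> assume h: "\<eta> \<in> zhom G M N" "\<theta> \<in> zhom G M N" "\<zeta> \<in> zhom G M N"
  show "zrestrict G M (\<lambda>X m. \<eta> X m \<otimes>\<^bsub>ob N X\<^esub> \<theta> X m) \<in> zhom G M N" using zhom_mult_in M N h by blast
  show "zrestrict G M (\<lambda>X m. zrestrict G M (\<lambda>X m. \<eta> X m \<otimes>\<^bsub>ob N X\<^esub> \<theta> X m) X m \<otimes>\<^bsub>ob N X\<^esub> \<zeta> X m)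
    = zrestrict G M (\<lambda>X m. \<eta> X m \<otimes>\<^bsub>ob N X\<^esub> zrestrict G M (\<lambda>X m. \<theta> X m \<otimes>\<^bsub>ob N X\<^esub> \<zeta> X m) X m)"
  proof (rule zhom_eqI[where G = G and M = M and N = N])
    fix X m assume X: "X \<in> gsets G" "m \<in> carrier (ob M X)"
    interpret comm_group "ob N X" using zmodule.comm_group_ob[OF N X(1)] .
    show "zrestrict G M (\<lambda>X m. zrestrict G M (\<lambda>X m. \<eta> X m \<otimes>\<^bsub>ob N X\<^esub> \<theta> X m) X m \<otimes>\<^bsub>ob N X\<^esub> \<zeta> X m) X m
      = zrestrict G M (\<lambda>X m. \<eta> X m \<otimes>\<^bsub>ob N X\<^esub> zrestrict G M (\<lambda>X m. \<theta> X m \<otimes>\<^bsub>ob N X\<^esub> \<zeta> X m) X m) X m"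
      using X zhom_closed[OF h(1) X] zhom_closed[OF h(2) X] zhom_closed[OF h(3) X] by (simp add: m_assoc)
  qed (intro zhom_mult_in M N h)+
  show "zrestrict G M (\<lambda>X m. \<eta> X m \<otimes>\<^bsub>ob N X\<^esub> \<theta> X m) = zrestrict G M (\<lambda>X m. \<theta> X m \<otimes>\<^bsub>ob N X\<^esub> \<eta> X m)"
  proof (rule zhom_eqI[where G = G and M = M and N = N])
    fix X m assume X: "X \<in> gsets G" "m \<in> carrier (ob M X)"
    interpret comm_group "ob N X" using zmodule.comm_group_ob[OF N X(1)] .
    show "zrestrict G M (\<lambda>X m. \<eta> X m \<otimes>\<^bsub>ob N X\<^esub> \<theta> X m) X m = zrestrict G M (\<lambda>X m. \<theta> X m \<otimes>\<^bsub>ob N X\<^esub> \<eta> X m) X m"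
      using X zhom_closed[OF h(1) X] zhom_closed[OF h(2) X] by (simp add: m_comm)
  qed (intro zhom_mult_in M N h)+
  show "zrestrict G M (\<lambda>X m. zrestrict G M (\<lambda>X m. \<one>\<^bsub>ob N X\<^esub>) X m \<otimes>\<^bsub>ob N X\<^esub> \<eta> X m) = \<eta>"
  proof (rule zhom_eqI[where G = G and M = M and N = N])
    fix X m assume X: "X \<in> gsets G" "m \<in> carrier (ob M X)"
    interpret comm_group "ob N X" using zmodule.comm_group_ob[OF N X(1)] .
    show "zrestrict G M (\<lambda>X m. zrestrict G M (\<lambda>X m. \<one>\<^bsub>ob N X\<^esub>) X m \<otimes>\<^bsub>ob N X\<^esub> \<eta> X m) X m = \<eta> X m"
      using X zhom_closed[OF h(1) X] by simp
  qed (intro zhom_mult_in zhom_one_in M N h)+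
  have "zrestrict G M (\<lambda>X m. zrestrict G M (\<lambda>X m. inv\<^bsub>ob N X\<^esub> (\<eta> X m)) X m \<otimes>\<^bsub>ob N X\<^esub> \<eta> X m)
      = zrestrict G M (\<lambda>X m. \<one>\<^bsub>ob N X\<^esub>)"
  proof (rule zhom_eqI[where G = G and M = M and N = N])
    fix X m assume X: "X \<in> gsets G" "m \<in> carrier (ob M X)"
    interpret comm_group "ob N X" using zmodule.comm_group_ob[OF N X(1)] .
    show "zrestrict G M (\<lambda>X m. zrestrict G M (\<lambda>X m. inv\<^bsub>ob N X\<^esub> (\<eta> X m)) X m \<otimes>\<^bsub>ob N X\<^esub> \<eta> X m) X m
      = zrestrict G M (\<lambda>X m. \<one>\<^bsub>ob N X\<^esub>) X m"
      using X zhom_closed[OF h(1) X] by simp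
  qed (intro zhom_mult_in zhom_inv_in zhom_one_in M N h)+
  then show "\<exists>\<theta>\<in>zhom G M N. zrestrict G M (\<lambda>X m. \<theta> X m \<otimes>\<^bsub>ob N X\<^esub> \<eta> X m) = zrestrict G M (\<lambda>X m. \<one>\<^bsub>ob N X\<^esub>)"
    using zhom_inv_in[OF M N h(1)] by blast
next
  show "zrestrict G M (\<lambda>X m. \<one>\<^bsub>ob N X\<^esub>) \<in> zhom G M N" using zhom_one_in M N by blast
qed

lemma (in box_data) box_zhom_eqI:
  assumes R: "zmodule G R" and h: "\<eta> \<in> zhom G (box G M N) R" "\<theta> \<in> zhom G (box G M N) R"
    and gen: "\<And>X S T \<phi> m n. \<lbrakk>X \<in> gsets G; S \<in> gsets G; T \<in> gsets G; \<phi> \<in> BZ G X (prod_gset S T);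
      m \<in> carrier (ob M S); n \<in> carrier (ob N T)\<rbrakk> \<Longrightarrow> \<eta> X (bx X S T \<phi> m n) = \<theta> X (bx X S T \<phi> m n)"
  shows "\<eta> = \<theta>"
proof (rule zhom_eqI[OF h])
  fix X m assume X: "X \<in> gsets G" and m: "m \<in> carrier (ob (box G M N) X)"
  show "\<eta> X m = \<theta> X m"
    by (rule box_hom_eqI[OF X zmodule.group_ob[OF R X] zhom_hom[OF h(1) X] zhom_hom[OF h(2) X] gen[OF X] m])
qed

lemma rep_map_in:
  assumes X: "X \<in> gsets G" and Y: "Y \<in> gsets G" and f: "f \<in> BZ G X Y"
  shows "rep_map G X Y f \<in> zhom G (rep G X) (rep G Y)"
proof -
  have "rep_map G X Y f = zrestrict G (rep G X) (\<lambda>W \<phi>. bz_comp W f \<phi>)"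
    by (simp add: rep_map_def zrestrict_def rep_def)
  moreover have "\<dots> \<in> zhom G (rep G X) (rep G Y)"
  proof (rule zrestrict_in[OF zmodule_rep[OF X]])
    fix W V g \<phi> assume "W \<in> gsets G" "V \<in> gsets G" "g \<in> BZ G W V" "\<phi> \<in> carrier (ob (rep G X) V)"
    then show "bz_comp W f (mor (rep G X) W V g \<phi>) = mor (rep G Y) W V g (bz_comp V f \<phi>)"
      using bz_comp_assoc[of W G V g \<phi> X f Y] f by (simp add: rep_def)
  qed (use X f in \<open>auto simp: rep_def bz_comp_in[OF _ f] bz_comp_add_right[OF _ X _ _ f]\<close>)
  ultimately show ?thesis by simp
qed

lemma rep_map_apply: "\<lbrakk>W \<in> gsets G; \<phi> \<in> BZ G W X\<rbrakk> \<Longrightarrow> rep_map G X Y f W \<phi> = bz_comp W f \<phi>"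
  by (simp add: rep_map_def)

locale ihom_data = M: zmodule G M + N: zmodule G N
  for G :: "'g monoid" and M :: "('g, 'm) zmod" and N :: "('g, 'n) zmod"
begin

abbreviation "bxr X \<equiv> box_data.bx G (rep G X) M"

lemma box_data_rep: "X \<in> gsets G \<Longrightarrow> box_data G (rep G X) M"
  by (simp add: box_data_def zmodule_rep M.zmodule_axioms)

lemma ob_ihom: "ob (ihom G M N) X = zhom_group G (box G (rep G X) M) N"
  by (simp add: ihom_def)

lemma carrier_ihom: "carrier (ob (ihom G M N) X) = zhom G (box G (rep G X) M) N"
  by (simp add: ob_ihom zhom_group_simps)

lemma comm_group_ihom: "X \<in> gsets G \<Longrightarrow> comm_group (ob (ihom G M N) X)"
  unfolding ob_ihom by (rule comm_group_zhom_group[OF box_data.zmodule_box[OF box_data_rep] N.zmodule_axioms])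

lemma ihom_eqI:
  assumes X: "X \<in> gsets G" and h: "\<eta> \<in> carrier (ob (ihom G M N) X)" "\<theta> \<in> carrier (ob (ihom G M N) X)"
    and gen: "\<And>Y S T \<phi> p m. \<lbrakk>Y \<in> gsets G; S \<in> gsets G; T \<in> gsets G; \<phi> \<in> BZ G Y (prod_gset S T);
      p \<in> BZ G S X; m \<in> carrier (ob M T)\<rbrakk> \<Longrightarrow> \<eta> Y (bxr X Y S T \<phi> p m) = \<theta> Y (bxr X Y S T \<phi> p m)"
  shows "\<eta> = \<theta>"
  by (rule box_data.box_zhom_eqI[OF box_data_rep[OF X] N.zmodule_axioms])
    (use h gen in \<open>auto simp: carrier_ihom rep_def\<close>)

lemma box_map_data_rep: "\<lbrakk>X \<in> gsets G; Y \<in> gsets G; f \<in> BZ G X Y\<rbrakk>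
    \<Longrightarrow> box_map_data G (rep G X) M (rep G Y) M (rep_map G X Y f) (zid G M)"
  using box_data_rep rep_map_in by (simp add: box_map_data_def box_map_data_axioms_def M.zmodule_axioms)

lemma mor_ihom_in:
  "\<lbrakk>X \<in> gsets G; Y \<in> gsets G; f \<in> BZ G X Y; \<eta> \<in> carrier (ob (ihom G M N) Y)\<rbrakk>
    \<Longrightarrow> mor (ihom G M N) X Y f \<eta> \<in> carrier (ob (ihom G M N) X)"
  unfolding carrier_ihom
  using zcomp_in[OF box_map_data.box_map_in[OF box_map_data_rep] _ box_data.zmodule_box[OF box_data_rep]] by (simp add: ihom_def)

lemma bxr_in:
  "\<lbrakk>X \<in> gsets G; Y \<in> gsets G; S \<in> gsets G; T \<in> gsets G; \<phi> \<in> BZ G Y (prod_gset S T); p \<in> BZ G S X; m \<in> carrier (ob M T)\<rbrakk>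
    \<Longrightarrow> bxr X Y S T \<phi> p m \<in> carrier (ob (box G (rep G X) M) Y)"
  by (rule box_data.bx_in[OF box_data_rep]) (auto simp: rep_def)

lemma mor_ihom_bx:
  "\<lbrakk>X \<in> gsets G; X' \<in> gsets G; f \<in> BZ G X X'; \<eta> \<in> carrier (ob (ihom G M N) X');
    Y \<in> gsets G; S \<in> gsets G; T \<in> gsets G; \<phi> \<in> BZ G Y (prod_gset S T); p \<in> BZ G S X; m \<in> carrier (ob M T)\<rbrakk>
    \<Longrightarrow> mor (ihom G M N) X X' f \<eta> Y (bxr X Y S T \<phi> p m) = \<eta> Y (bxr X' Y S T \<phi> (bz_comp S f p) m)"
  using bxr_in[of X Y S T \<phi> p m] box_map_data.box_map_bx[OF box_map_data_rep, of X X' f Y S T \<phi> p m]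
  by (simp add: ihom_def rep_map_apply) (simp add: rep_def)

lemma mult_ihom_bx:
  "\<lbrakk>X \<in> gsets G; Y \<in> gsets G; z \<in> carrier (ob (box G (rep G X) M) Y)\<rbrakk>
    \<Longrightarrow> (\<eta> \<otimes>\<^bsub>ob (ihom G M N) X\<^esub> \<theta>) Y z = \<eta> Y z \<otimes>\<^bsub>ob N Y\<^esub> \<theta> Y z"
  by (simp add: ob_ihom zhom_group_simps)

lemma mult_ihom_in:
  "\<lbrakk>X \<in> gsets G; \<eta> \<in> carrier (ob (ihom G M N) X); \<theta> \<in> carrier (ob (ihom G M N) X)\<rbrakk>
    \<Longrightarrow> \<eta> \<otimes>\<^bsub>ob (ihom G M N) X\<^esub> \<theta> \<in> carrier (ob (ihom G M N) X)"
  using comm_group_ihom by (simp add: comm_group_def comm_monoid_def monoid.m_closed)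

lemma zmodule_ihom: "zmodule G (ihom G M N)"
proof (rule zmodule.intro)
  fix X Y f assume h: "X \<in> gsets G" "Y \<in> gsets G" "f \<in> BZ G X Y"
  show "mor (ihom G M N) X Y f \<in> hom (ob (ihom G M N) Y) (ob (ihom G M N) X)"
  proof (rule homI)
    fix \<eta> \<theta> assume e: "\<eta> \<in> carrier (ob (ihom G M N) Y)" "\<theta> \<in> carrier (ob (ihom G M N) Y)"
    show "mor (ihom G M N) X Y f (\<eta> \<otimes>\<^bsub>ob (ihom G M N) Y\<^esub> \<theta>)
        = mor (ihom G M N) X Y f \<eta> \<otimes>\<^bsub>ob (ihom G M N) X\<^esub> mor (ihom G M N) X Y f \<theta>"
    proof (rule ihom_eqI[OF h(1)])
      fix W S T \<phi> p m assume a: "W \<in> gsets G" "S \<in> gsets G" "T \<in> gsets G" "\<phi> \<in> BZ G W (prod_gset S T)"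
        "p \<in> BZ G S X" "m \<in> carrier (ob M T)"
      note c = bz_comp_in[OF a(5) h(3) a(2)]
      show "mor (ihom G M N) X Y f (\<eta> \<otimes>\<^bsub>ob (ihom G M N) Y\<^esub> \<theta>) W (bxr X W S T \<phi> p m)
        = (mor (ihom G M N) X Y f \<eta> \<otimes>\<^bsub>ob (ihom G M N) X\<^esub> mor (ihom G M N) X Y f \<theta>) W (bxr X W S T \<phi> p m)"
        using h e a c by (simp add: mor_ihom_bx mult_ihom_in mult_ihom_bx bxr_in)
    qed (use h e in \<open>auto intro!: mor_ihom_in mult_ihom_in\<close>)
  qed (use h in \<open>auto intro: mor_ihom_in\<close>)
next
  fix X \<eta> assume h: "X \<in> gsets G" "\<eta> \<in> carrier (ob (ihom G M N) X)"
  have h3: "bz_id X \<in> BZ G X X" using h by simp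
  show "mor (ihom G M N) X X (bz_id X) \<eta> = \<eta>"
    by (rule ihom_eqI[OF h(1) mor_ihom_in[OF h(1,1) h3 h(2)] h(2)])
      (simp add: mor_ihom_bx[OF h(1,1) h3 h(2)] bz_comp_id(1)[OF _ h(1)])
next
  fix X Y Z f g \<eta> assume h: "X \<in> gsets G" "Y \<in> gsets G" "Z \<in> gsets G" "f \<in> BZ G X Y" "g \<in> BZ G Y Z"
    "\<eta> \<in> carrier (ob (ihom G M N) Z)"
  note c = bz_comp_in[OF h(4,5,1)] mor_ihom_in[OF h(2,3,5,6)]
  show "mor (ihom G M N) X Z (bz_comp X g f) \<eta> = mor (ihom G M N) X Y f (mor (ihom G M N) Y Z g \<eta>)"
  proof (rule ihom_eqI[OF h(1)])
    fix W S T \<phi> p m assume a: "W \<in> gsets G" "S \<in> gsets G" "T \<in> gsets G" "\<phi> \<in> BZ G W (prod_gset S T)"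
        "p \<in> BZ G S X" "m \<in> carrier (ob M T)"
    show "mor (ihom G M N) X Z (bz_comp X g f) \<eta> W (bxr X W S T \<phi> p m)
      = mor (ihom G M N) X Y f (mor (ihom G M N) Y Z g \<eta>) W (bxr X W S T \<phi> p m)"
      using bz_comp_assoc[OF a(2) h(1) a(5) h(4,5)] bz_comp_in[OF a(5) h(4) a(2)] h c a by (simp add: mor_ihom_bx)
  qed (use h c in \<open>auto intro!: mor_ihom_in\<close>)
next
  fix X Y f g \<eta> assume h: "X \<in> gsets G" "Y \<in> gsets G" "f \<in> BZ G X Y" "g \<in> BZ G X Y"
    "\<eta> \<in> carrier (ob (ihom G M N) Y)"
  note c = bz_add_in[OF h(3,4,1)]
  show "mor (ihom G M N) X Y (bz_add X f g) \<eta>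
      = mor (ihom G M N) X Y f \<eta> \<otimes>\<^bsub>ob (ihom G M N) X\<^esub> mor (ihom G M N) X Y g \<eta>"
  proof (rule ihom_eqI[OF h(1)])
    fix W S T \<phi> p m assume a: "W \<in> gsets G" "S \<in> gsets G" "T \<in> gsets G" "\<phi> \<in> BZ G W (prod_gset S T)"
        "p \<in> BZ G S X" "m \<in> carrier (ob M T)"
    interpret b: box_data G "rep G Y" M using box_data_rep h by blast
    note d = bz_comp_in[OF a(5) h(3) a(2)] bz_comp_in[OF a(5) h(4) a(2)]
    \<comment> \<open>A sum of morphisms into \<open>Y\<close> enters through the first tensor
      factor \<open>rep G Y\<close>, where additivity is the second family of relations.\<close>
    have "b.bx W S T \<phi> (bz_add S (bz_comp S f p) (bz_comp S g p)) m
      = b.bx W S T \<phi> (bz_comp S f p) m \<otimes>\<^bsub>ob (box G (rep G Y) M) W\<^esub> b.bx W S T \<phi> (bz_comp S g p) m"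
      using b.bx_add2[OF a(1-4) _ _ a(6), of "bz_comp S f p" "bz_comp S g p"] d by (simp add: rep_def)
    then show "mor (ihom G M N) X Y (bz_add X f g) \<eta> W (bxr X W S T \<phi> p m)
      = (mor (ihom G M N) X Y f \<eta> \<otimes>\<^bsub>ob (ihom G M N) X\<^esub> mor (ihom G M N) X Y g \<eta>) W (bxr X W S T \<phi> p m)"
      using h a c d bz_comp_add_left[OF a(2) h(1) a(5) h(3,4)] bxr_in[OF h(2) a(1-4) d(1) a(6)] bxr_in[OF h(2) a(1-4) d(2) a(6)]
      by (simp add: mor_ihom_bx mult_ihom_bx bxr_in zhom_mult[of \<eta> G _ N W] carrier_ihom)
  qed (use h c in \<open>auto intro!: mor_ihom_in mult_ihom_in\<close>)
qed (rule comm_group_ihom)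

end

section \<open>Contravariance of the internal hom\<close>

locale ihom_pre_data = s: ihom_data G M N + t: ihom_data G L N
  for G :: "'g monoid" and M :: "('g, 'm) zmod" and L :: "('g, 'l) zmod" and N :: "('g, 'n) zmod" +
  fixes \<theta> assumes \<theta>: "\<theta> \<in> zhom G M L"
begin

lemma box_map_data_rep: "X \<in> gsets G \<Longrightarrow> box_map_data G (rep G X) M (rep G X) L (zid G (rep G X)) \<theta>"
  using s.box_data_rep[of X] t.box_data_rep[of X] zid_in[OF zmodule_rep[of X G]] \<theta> by (simp add: box_map_data_def box_map_data_axioms_def)

lemma ihom_pre_closed:
  "\<lbrakk>X \<in> gsets G; \<eta> \<in> carrier (ob (ihom G L N) X)\<rbrakk>
    \<Longrightarrow> ihom_pre G M L N \<theta> X \<eta> \<in> carrier (ob (ihom G M N) X)"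
  using zcomp_in[OF box_map_data.box_map_in[OF box_map_data_rep] _ box_data.zmodule_box[OF s.box_data_rep], of X \<eta>]
  by (simp add: ihom_pre_def s.carrier_ihom t.carrier_ihom)

lemma ihom_pre_bx:
  "\<lbrakk>X \<in> gsets G; \<eta> \<in> carrier (ob (ihom G L N) X);
    Y \<in> gsets G; S \<in> gsets G; T \<in> gsets G; \<phi> \<in> BZ G Y (prod_gset S T); p \<in> BZ G S X; m \<in> carrier (ob M T)\<rbrakk>
    \<Longrightarrow> ihom_pre G M L N \<theta> X \<eta> Y (s.bxr X Y S T \<phi> p m) = \<eta> Y (t.bxr X Y S T \<phi> p (\<theta> T m))"
  using s.bxr_in[of X Y S T \<phi> p m] box_map_data.box_map_bx[OF box_map_data_rep, of X Y S T \<phi> p m]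
  by (simp add: ihom_pre_def) (simp add: rep_def zid_def)

lemma ihom_pre_in: "ihom_pre G M L N \<theta> \<in> zhom G (ihom G L N) (ihom G M N)"
proof -
  have "zrestrict G (ihom G L N) (ihom_pre G M L N \<theta>) \<in> zhom G (ihom G L N) (ihom G M N)"
  proof (rule zrestrict_in[OF t.zmodule_ihom])
    fix X \<eta> \<eta>' assume h: "X \<in> gsets G" "\<eta> \<in> carrier (ob (ihom G L N) X)" "\<eta>' \<in> carrier (ob (ihom G L N) X)"
    show "ihom_pre G M L N \<theta> X (\<eta> \<otimes>\<^bsub>ob (ihom G L N) X\<^esub> \<eta>')
      = ihom_pre G M L N \<theta> X \<eta> \<otimes>\<^bsub>ob (ihom G M N) X\<^esub> ihom_pre G M L N \<theta> X \<eta>'"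
      by (rule s.ihom_eqI[OF h(1)])
        (use h in \<open>auto intro!: ihom_pre_closed s.mult_ihom_in t.mult_ihom_in
          simp: ihom_pre_bx t.mult_ihom_in t.mult_ihom_bx s.mult_ihom_bx s.bxr_in t.bxr_in zhom_closed[OF \<theta>]\<close>)
  next
    fix X Y f \<eta> assume h: "X \<in> gsets G" "Y \<in> gsets G" "f \<in> BZ G X Y" "\<eta> \<in> carrier (ob (ihom G L N) Y)"
    note c = t.mor_ihom_in[OF h] ihom_pre_closed[OF h(2,4)]
    show "ihom_pre G M L N \<theta> X (mor (ihom G L N) X Y f \<eta>) = mor (ihom G M N) X Y f (ihom_pre G M L N \<theta> Y \<eta>)"
    proof (rule s.ihom_eqI[OF h(1)])
      fix W S T \<phi> p m assume a: "W \<in> gsets G" "S \<in> gsets G" "T \<in> gsets G" "\<phi> \<in> BZ G W (prod_gset S T)"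
          "p \<in> BZ G S X" "m \<in> carrier (ob M T)"
      show "ihom_pre G M L N \<theta> X (mor (ihom G L N) X Y f \<eta>) W (s.bxr X W S T \<phi> p m)
        = mor (ihom G M N) X Y f (ihom_pre G M L N \<theta> Y \<eta>) W (s.bxr X W S T \<phi> p m)"
        using ihom_pre_bx[OF h(1) c(1) a] s.mor_ihom_bx[OF h(1-3) c(2) a]
          t.mor_ihom_bx[OF h a(1-5) zhom_closed[OF \<theta> a(3,6)]]
          ihom_pre_bx[OF h(2,4) a(1-4) bz_comp_in[OF a(5) h(3) a(2)] a(6)] by simp
    qed (use h c in \<open>auto intro!: ihom_pre_closed s.mor_ihom_in\<close>)
  qed (auto intro: ihom_pre_closed)
  moreover have "zrestrict G (ihom G L N) (ihom_pre G M L N \<theta>) = ihom_pre G M L N \<theta>"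
    by (auto simp: zrestrict_def ihom_pre_def fun_eq_iff)
  ultimately show ?thesis by simp
qed

end

section \<open>Comparison of free resolutions\<close>

locale free_res =
  fixes G :: "'g monoid" and M :: "('g, 'm) zmod" and P :: "nat \<Rightarrow> ('g, 'p) zmod"
    and d :: "nat \<Rightarrow> ('g, 'p, 'p) nat_trans" and \<epsilon> :: "('g, 'p, 'm) nat_trans"
  assumes M: "zmodule G M" and res: "free_resolution G M P d \<epsilon>"
begin

lemma free: "free_mod G (P k)" and d: "d k \<in> zhom G (P (Suc k)) (P k)" and \<epsilon>: "\<epsilon> \<in> zhom G (P 0) M"
  using res by (auto simp: free_resolution_def)

lemma zmod: "zmodule G (P k)"
  using free by (simp add: free_mod_def)

lemma exact:
  assumes "X \<in> gsets G"
  shows "\<epsilon> X ` carrier (ob (P 0) X) = carrier (ob M X)"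
    "d 0 X ` carrier (ob (P (Suc 0)) X) = kernel (ob (P 0) X) (ob M X) (\<epsilon> X)"
    "d (Suc k) X ` carrier (ob (P (Suc (Suc k))) X) = kernel (ob (P (Suc k)) X) (ob (P k) X) (d k X)"
  using res assms by (auto simp: free_resolution_def)

lemma \<epsilon>_d: "\<lbrakk>X \<in> gsets G; m \<in> carrier (ob (P (Suc 0)) X)\<rbrakk> \<Longrightarrow> \<epsilon> X (d 0 X m) = \<one>\<^bsub>ob M X\<^esub>"
  using exact(2)[of X] by (force simp: kernel_def)

lemma d_d: "\<lbrakk>X \<in> gsets G; m \<in> carrier (ob (P (Suc (Suc k))) X)\<rbrakk> \<Longrightarrow> d k X (d (Suc k) X m) = \<one>\<^bsub>ob (P k) X\<^esub>"
  using exact(3)[of X k] by (force simp: kernel_def)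

end

definition chain_map where
  "chain_map G P d Q d' f \<longleftrightarrow> (\<forall>k. f k \<in> zhom G (P k) (Q k)) \<and>
    (\<forall>k. \<forall>X\<in>gsets G. \<forall>m\<in>carrier (ob (P (Suc k)) X). d' k X (f (Suc k) X m) = f k X (d k X m))"

text \<open>In additive notation: \<open>h\<close> is the identity plus d s + s d, the last term
  being absent in degree 0.\<close>

definition homotopic_id where
  "homotopic_id G P d h \<longleftrightarrow> (\<exists>s. (\<forall>k. s k \<in> zhom G (P k) (P (Suc k))) \<and>
    (\<forall>X\<in>gsets G. \<forall>m\<in>carrier (ob (P 0) X). h 0 X m = m \<otimes>\<^bsub>ob (P 0) X\<^esub> d 0 X (s 0 X m)) \<and>
    (\<forall>k. \<forall>X\<in>gsets G. \<forall>m\<in>carrier (ob (P (Suc k)) X). h (Suc k) X m =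
      m \<otimes>\<^bsub>ob (P (Suc k)) X\<^esub> d (Suc k) X (s (Suc k) X m) \<otimes>\<^bsub>ob (P (Suc k)) X\<^esub> s k X (d k X m)))"

lemma lift_chain_map:
  assumes P: "free_res G M P d \<epsilon>" and Q: "free_res G M Q d' \<epsilon>'"
  shows "\<exists>f. chain_map G P d Q d' f \<and> (\<forall>X\<in>gsets G. \<forall>m\<in>carrier (ob (P 0) X). \<epsilon>' X (f 0 X m) = \<epsilon> X m)"
proof -
  interpret P: free_res G M P d \<epsilon> by fact
  interpret Q: free_res G M Q d' \<epsilon>' by fact
  have "\<exists>f0\<in>zhom G (P 0) (Q 0). \<forall>X\<in>gsets G. \<forall>p\<in>carrier (ob (P 0) X). \<epsilon>' X (f0 X p) = \<epsilon> X p"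
    by (rule free_lift[OF P.free Q.zmod P.M P.\<epsilon> Q.\<epsilon>]) (auto simp: Q.exact(1) zhom_closed[OF P.\<epsilon>])
  then obtain f0 where f0: "f0 \<in> zhom G (P 0) (Q 0)"
    "\<And>X p. \<lbrakk>X \<in> gsets G; p \<in> carrier (ob (P 0) X)\<rbrakk> \<Longrightarrow> \<epsilon>' X (f0 X p) = \<epsilon> X p" by blast
  \<comment> \<open>\<open>?S\<close> is the invariant that allows the construction to go on: f d
    must land in the image of the next boundary. The clause for k = 0 pins down the first map, whose
    compatibility with the augmentations is not recorded elsewhere. \<open>?R\<close> links
    consecutive maps; together they feed dependent choice.\<close>
  let ?S = "\<lambda>k f. f \<in> zhom G (P k) (Q k) \<and> (k = 0 \<longrightarrow> f = f0) \<and>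
    (\<forall>X\<in>gsets G. \<forall>m\<in>carrier (ob (P (Suc k)) X). f X (d k X m) \<in> d' k X ` carrier (ob (Q (Suc k)) X))"
  let ?R = "\<lambda>k f f'. \<forall>X\<in>gsets G. \<forall>m\<in>carrier (ob (P (Suc k)) X). d' k X (f' X m) = f X (d k X m)"
  have S0: "?S 0 f0"
    using f0 P.\<epsilon>_d zhom_closed[OF f0(1)] zhom_closed[OF P.d] by (auto simp: Q.exact(2) kernel_def)
  have step: "\<exists>f'. ?S (Suc k) f' \<and> ?R k f f'" if S: "?S k f" for k f
  proof -
    have fz: "f \<in> zhom G (P k) (Q k)" using S by blast
    have "zcomp G (P (Suc k)) f (d k) \<in> zhom G (P (Suc k)) (Q k)"
      using zcomp_in[OF P.d fz P.zmod] .
    then have "\<exists>f'\<in>zhom G (P (Suc k)) (Q (Suc k)). \<forall>X\<in>gsets G. \<forall>p\<in>carrier (ob (P (Suc k)) X).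
        d' k X (f' X p) = zcomp G (P (Suc k)) f (d k) X p"
      by (rule free_lift[OF P.free Q.zmod Q.zmod _ Q.d]) (use S in auto)
    then obtain f' where f': "f' \<in> zhom G (P (Suc k)) (Q (Suc k))"
      "\<And>X p. \<lbrakk>X \<in> gsets G; p \<in> carrier (ob (P (Suc k)) X)\<rbrakk> \<Longrightarrow> d' k X (f' X p) = f X (d k X p)" by auto
    have "f' X (d (Suc k) X m) \<in> d' (Suc k) X ` carrier (ob (Q (Suc (Suc k))) X)"
      if h: "X \<in> gsets G" "m \<in> carrier (ob (P (Suc (Suc k))) X)" for X m
      using h zhom_closed[OF P.d h] zhom_closed[OF f'(1) h(1)] P.d_d[OF h] f'(2)[OF h(1) zhom_closed[OF P.d h]]
        zhom_one[OF fz h(1) P.zmod Q.zmod]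
      by (simp add: Q.exact(3) kernel_def)
    then show ?thesis using f' by auto
  qed
  have "\<exists>f. \<forall>k. ?S k (f k) \<and> ?R k (f k) (f (Suc k))"
  proof (rule dependent_nat_choice)
    show "\<exists>f. ?S 0 f" using S0 by blast
  qed (rule step)
  then obtain f where f: "\<And>k. ?S k (f k)" "\<And>k. ?R k (f k) (f (Suc k))" by blast
  then have "f 0 = f0" by blast
  then show ?thesis using f f0 by (intro exI[of _ f]) (auto simp: chain_map_def)
qed

lemma lift_homotopy:
  assumes P: "free_res G M P d \<epsilon>" and h: "chain_map G P d P d h"
    and \<epsilon>h: "\<forall>X\<in>gsets G. \<forall>m\<in>carrier (ob (P 0) X). \<epsilon> X (h 0 X m) = \<epsilon> X m"
  shows "homotopic_id G P d h"
proof -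
  interpret P: free_res G M P d \<epsilon> by fact
  have hz: "h k \<in> zhom G (P k) (P k)" for k using h by (simp add: chain_map_def)
  have hd: "d k X (h (Suc k) X m) = h k X (d k X m)" if "X \<in> gsets G" "m \<in> carrier (ob (P (Suc k)) X)" for k X m
    using h that by (simp add: chain_map_def)
  have grp: "comm_group (ob (P k) X)" if "X \<in> gsets G" for k X
    using zmodule.comm_group_ob[OF P.zmod that] .
  have diff: "zrestrict G (P k) (\<lambda>X m. \<alpha> X m \<otimes>\<^bsub>ob (P l) X\<^esub> inv\<^bsub>ob (P l) X\<^esub> \<beta> X m) \<in> zhom G (P k) (P l)"
    if "\<alpha> \<in> zhom G (P k) (P l)" "\<beta> \<in> zhom G (P k) (P l)" for \<alpha> \<beta> k l
  proof -
    have "zrestrict G (P k) (\<lambda>X m. \<alpha> X m \<otimes>\<^bsub>ob (P l) X\<^esub> inv\<^bsub>ob (P l) X\<^esub> \<beta> X m)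
      = zrestrict G (P k) (\<lambda>X m. \<alpha> X m \<otimes>\<^bsub>ob (P l) X\<^esub> zrestrict G (P k) (\<lambda>X m. inv\<^bsub>ob (P l) X\<^esub> \<beta> X m) X m)"
      by (auto simp: zrestrict_def fun_eq_iff)
    then show ?thesis using zhom_mult_in[OF P.zmod P.zmod that(1) zhom_inv_in[OF P.zmod P.zmod that(2)]] by simp
  qed
  let ?\<alpha> = "zrestrict G (P 0) (\<lambda>X m. h 0 X m \<otimes>\<^bsub>ob (P 0) X\<^esub> inv\<^bsub>ob (P 0) X\<^esub> zid G (P 0) X m)"
  have "\<exists>s0\<in>zhom G (P 0) (P (Suc 0)). \<forall>X\<in>gsets G. \<forall>p\<in>carrier (ob (P 0) X). d 0 X (s0 X p) = ?\<alpha> X p"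
  proof (rule free_lift[OF P.free P.zmod P.zmod diff[OF hz zid_in[OF P.zmod]] P.d])
    fix X p assume X: "X \<in> gsets G" "p \<in> carrier (ob (P 0) X)"
    interpret comm_group "ob (P 0) X" using grp X(1) .
    interpret m: group "ob M X" using zmodule.group_ob[OF P.M X(1)] .
    note c = zhom_closed[OF hz X] zhom_closed[OF P.\<epsilon> X]
    have "\<epsilon> X (h 0 X p \<otimes>\<^bsub>ob (P 0) X\<^esub> inv\<^bsub>ob (P 0) X\<^esub> p) = \<one>\<^bsub>ob M X\<^esub>"
      using X c \<epsilon>h by (simp add: zhom_mult[OF P.\<epsilon>] zhom_inv[OF P.\<epsilon> _ P.zmod P.M])
    then show "?\<alpha> X p \<in> d 0 X ` carrier (ob (P (Suc 0)) X)"
      using X c by (simp add: P.exact(2) kernel_def)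
  qed
  then obtain s0 where s0: "s0 \<in> zhom G (P 0) (P (Suc 0))"
    and s0d': "\<And>X p. \<lbrakk>X \<in> gsets G; p \<in> carrier (ob (P 0) X)\<rbrakk> \<Longrightarrow> d 0 X (s0 X p) = h 0 X p \<otimes>\<^bsub>ob (P 0) X\<^esub> inv\<^bsub>ob (P 0) X\<^esub> p"
    by auto
  have s0d: "h 0 X p = p \<otimes>\<^bsub>ob (P 0) X\<^esub> d 0 X (s0 X p)" if X: "X \<in> gsets G" "p \<in> carrier (ob (P 0) X)" for X p
  proof -
    interpret comm_group "ob (P 0) X" using grp X(1) .
    show ?thesis using X zhom_closed[OF hz X] by (simp add: s0d' m_lcomm[of p])
  qed
  \<comment> \<open>The invariant says h = 1 + d s on boundaries. This is what makes h - 1 - s d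
    take values in cycles one degree higher.\<close>
  let ?S = "\<lambda>k s. s \<in> zhom G (P k) (P (Suc k)) \<and> (k = 0 \<longrightarrow> s = s0) \<and>
    (\<forall>X\<in>gsets G. \<forall>m\<in>carrier (ob (P (Suc k)) X). h k X (d k X m) = d k X m \<otimes>\<^bsub>ob (P k) X\<^esub> d k X (s X (d k X m)))"
  let ?R = "\<lambda>k s s'. \<forall>X\<in>gsets G. \<forall>m\<in>carrier (ob (P (Suc k)) X). h (Suc k) X m =
      m \<otimes>\<^bsub>ob (P (Suc k)) X\<^esub> d (Suc k) X (s' X m) \<otimes>\<^bsub>ob (P (Suc k)) X\<^esub> s X (d k X m)"
  have S0: "?S 0 s0" using s0 s0d zhom_closed[OF P.d] by auto
  have step: "\<exists>s'. ?S (Suc k) s' \<and> ?R k s s'" if S: "?S k s" for k s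
  proof -
    have sz: "s \<in> zhom G (P k) (P (Suc k))" using S by blast
    let ?\<alpha>1 = "zrestrict G (P (Suc k)) (\<lambda>X m. h (Suc k) X m \<otimes>\<^bsub>ob (P (Suc k)) X\<^esub> inv\<^bsub>ob (P (Suc k)) X\<^esub> zid G (P (Suc k)) X m)"
    \<comment> \<open>This is h - 1 - s d. Its boundary h d - d - d s d is trivial by the invariant,
      so exactness lets it be lifted through the next boundary map.\<close>
    let ?\<alpha> = "zrestrict G (P (Suc k)) (\<lambda>X m. ?\<alpha>1 X m \<otimes>\<^bsub>ob (P (Suc k)) X\<^esub>
        inv\<^bsub>ob (P (Suc k)) X\<^esub> zcomp G (P (Suc k)) s (d k) X m)"
    have \<alpha>z: "?\<alpha> \<in> zhom G (P (Suc k)) (P (Suc k))"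
      by (rule diff[OF diff[OF hz zid_in[OF P.zmod]] zcomp_in[OF P.d sz P.zmod]])
    have \<alpha>: "?\<alpha> X m = h (Suc k) X m \<otimes>\<^bsub>ob (P (Suc k)) X\<^esub> inv\<^bsub>ob (P (Suc k)) X\<^esub> m
        \<otimes>\<^bsub>ob (P (Suc k)) X\<^esub> inv\<^bsub>ob (P (Suc k)) X\<^esub> s X (d k X m)"
      if "X \<in> gsets G" "m \<in> carrier (ob (P (Suc k)) X)" for X m
      using that by simp
    have "\<exists>s'\<in>zhom G (P (Suc k)) (P (Suc (Suc k))). \<forall>X\<in>gsets G. \<forall>p\<in>carrier (ob (P (Suc k)) X).
        d (Suc k) X (s' X p) = ?\<alpha> X p"
    proof (rule free_lift[OF P.free P.zmod P.zmod \<alpha>z P.d])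
      fix X p assume X: "X \<in> gsets G" "p \<in> carrier (ob (P (Suc k)) X)"
      interpret comm_group "ob (P (Suc k)) X" using grp X(1) .
      interpret k: comm_group "ob (P k) X" using grp X(1) .
      note c = zhom_closed[OF hz X] zhom_closed[OF P.d X] zhom_closed[OF sz X(1) zhom_closed[OF P.d X]]
      note c' = zhom_closed[OF P.d X(1) c(3)]
      have "d k X (?\<alpha> X p) = h k X (d k X p) \<otimes>\<^bsub>ob (P k) X\<^esub> inv\<^bsub>ob (P k) X\<^esub> (d k X p)
          \<otimes>\<^bsub>ob (P k) X\<^esub> inv\<^bsub>ob (P k) X\<^esub> (d k X (s X (d k X p)))"
        unfolding \<alpha>[OF X] using X c
        by (simp add: zhom_mult[OF P.d] zhom_inv[OF P.d _ P.zmod P.zmod] hd)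
      also have "h k X (d k X p) = d k X p \<otimes>\<^bsub>ob (P k) X\<^esub> d k X (s X (d k X p))" using S X by blast
      also have "d k X p \<otimes>\<^bsub>ob (P k) X\<^esub> d k X (s X (d k X p)) \<otimes>\<^bsub>ob (P k) X\<^esub> inv\<^bsub>ob (P k) X\<^esub> (d k X p)
          \<otimes>\<^bsub>ob (P k) X\<^esub> inv\<^bsub>ob (P k) X\<^esub> (d k X (s X (d k X p))) = \<one>\<^bsub>ob (P k) X\<^esub>"
        using c c' by (simp add: k.m_ac k.inv_mult[symmetric])
      finally show "?\<alpha> X p \<in> d (Suc k) X ` carrier (ob (P (Suc (Suc k))) X)"
        using zhom_closed[OF \<alpha>z X] by (simp add: P.exact(3)[OF X(1)] kernel_def)
    qed
    then obtain s' where s': "s' \<in> zhom G (P (Suc k)) (P (Suc (Suc k)))"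
      and s'd: "\<And>X p. \<lbrakk>X \<in> gsets G; p \<in> carrier (ob (P (Suc k)) X)\<rbrakk> \<Longrightarrow> d (Suc k) X (s' X p) = ?\<alpha> X p" by blast
    have R: "h (Suc k) X m = m \<otimes>\<^bsub>ob (P (Suc k)) X\<^esub> d (Suc k) X (s' X m) \<otimes>\<^bsub>ob (P (Suc k)) X\<^esub> s X (d k X m)"
      if X: "X \<in> gsets G" "m \<in> carrier (ob (P (Suc k)) X)" for X m
    proof -
      interpret comm_group "ob (P (Suc k)) X" using grp X(1) .
      note c = zhom_closed[OF hz X] zhom_closed[OF sz X(1) zhom_closed[OF P.d X]]
      show ?thesis unfolding s'd[OF X] \<alpha>[OF X] using X c by (simp add: m_assoc m_lcomm[of m])
    qed
    \<comment> \<open>The invariant in the next degree: on boundaries the term s d drops out because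
      d d is trivial.\<close>
    have "h (Suc k) X (d (Suc k) X m) = d (Suc k) X m \<otimes>\<^bsub>ob (P (Suc k)) X\<^esub> d (Suc k) X (s' X (d (Suc k) X m))"
      if X: "X \<in> gsets G" "m \<in> carrier (ob (P (Suc (Suc k))) X)" for X m
    proof -
      interpret comm_group "ob (P (Suc k)) X" using grp X(1) .
      note c = zhom_closed[OF P.d X] zhom_closed[OF P.d X(1) zhom_closed[OF s' X(1) zhom_closed[OF P.d X]]]
      show ?thesis using R[OF X(1) c(1)] c by (simp add: P.d_d[OF X] zhom_one[OF sz X(1) P.zmod P.zmod])
    qed
    then show ?thesis using s' R by blast
  qed
  have "\<exists>s. \<forall>k. ?S k (s k) \<and> ?R k (s k) (s (Suc k))"
  proof (rule dependent_nat_choice)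
    show "\<exists>f. ?S 0 f" using S0 by blast
  qed (rule step)
  then obtain s where s: "\<And>k. ?S k (s k)" "\<And>k. ?R k (s k) (s (Suc k))" by blast
  then have "s 0 = s0" by blast
  then show ?thesis unfolding homotopic_id_def using s s0d by (intro exI[of _ s]) auto
qed

lemma resolutions_homotopy_equivalent:
  assumes P: "free_res G M P d \<epsilon>" and Q: "free_res G M Q d' \<epsilon>'"
  obtains f g where "chain_map G P d Q d' f" "chain_map G Q d' P d g"
    "homotopic_id G P d (\<lambda>k. zcomp G (P k) (g k) (f k))"
    "homotopic_id G Q d' (\<lambda>k. zcomp G (Q k) (f k) (g k))"
proof -
  interpret P: free_res G M P d \<epsilon> by fact
  interpret Q: free_res G M Q d' \<epsilon>' by fact
  obtain f where f: "chain_map G P d Q d' f" "\<forall>X\<in>gsets G. \<forall>m\<in>carrier (ob (P 0) X). \<epsilon>' X (f 0 X m) = \<epsilon> X m"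
    using lift_chain_map[OF P Q] by blast
  obtain g where g: "chain_map G Q d' P d g" "\<forall>X\<in>gsets G. \<forall>m\<in>carrier (ob (Q 0) X). \<epsilon> X (g 0 X m) = \<epsilon>' X m"
    using lift_chain_map[OF Q P] by blast
  have fz: "f k \<in> zhom G (P k) (Q k)" and gz: "g k \<in> zhom G (Q k) (P k)" for k
    using f g by (auto simp: chain_map_def)
  have "chain_map G P d P d (\<lambda>k. zcomp G (P k) (g k) (f k))"
    using f(1) g(1) zcomp_in[OF fz gz P.zmod] zhom_closed[OF P.d] zhom_closed[OF fz] by (simp add: chain_map_def)
  moreover have "chain_map G Q d' Q d' (\<lambda>k. zcomp G (Q k) (f k) (g k))"
    using f(1) g(1) zcomp_in[OF gz fz Q.zmod] zhom_closed[OF Q.d] zhom_closed[OF gz] by (simp add: chain_map_def)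
  ultimately show thesis
    using that[OF f(1) g(1)] lift_homotopy[OF P] lift_homotopy[OF Q] f(2) g(2) zhom_closed[OF fz] zhom_closed[OF gz]
    by simp
qed

section \<open>Tor and Ext do not depend on the resolution\<close>

text \<open>Maps that are mutually inverse modulo the denominators satisfy the criterion of
  \<open>subquot_iso\<close>: the round trip on \<open>M\<close> shows that membership in
  \<open>B\<close> is reflected, the round trip on \<open>M'\<close> provides preimages.\<close>

lemma subquot_iso_inverse:
  assumes M: "zmodule G M" "submodule_of G M Z" "submodule_of G M B" "\<And>X. X \<in> gsets G \<Longrightarrow> B X \<subseteq> Z X"
    and M': "zmodule G M'" "submodule_of G M' Z'" "submodule_of G M' B'" "\<And>X. X \<in> gsets G \<Longrightarrow> B' X \<subseteq> Z' X"
    and \<eta>: "\<eta> \<in> zhom G M M'" and \<theta>: "\<theta> \<in> zhom G M' M"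
    and m1: "\<And>X z. \<lbrakk>X \<in> gsets G; z \<in> Z X\<rbrakk> \<Longrightarrow> \<eta> X z \<in> Z' X"
    and m2: "\<And>X z. \<lbrakk>X \<in> gsets G; z \<in> B X\<rbrakk> \<Longrightarrow> \<eta> X z \<in> B' X"
    and m3: "\<And>X z. \<lbrakk>X \<in> gsets G; z \<in> Z' X\<rbrakk> \<Longrightarrow> \<theta> X z \<in> Z X"
    and m4: "\<And>X z. \<lbrakk>X \<in> gsets G; z \<in> B' X\<rbrakk> \<Longrightarrow> \<theta> X z \<in> B X"
    and i1: "\<And>X z. \<lbrakk>X \<in> gsets G; z \<in> Z X\<rbrakk> \<Longrightarrow> \<exists>b\<in>B X. \<theta> X (\<eta> X z) = z \<otimes>\<^bsub>ob M X\<^esub> b"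
    and i2: "\<And>X z. \<lbrakk>X \<in> gsets G; z \<in> Z' X\<rbrakk> \<Longrightarrow> \<exists>b\<in>B' X. \<eta> X (\<theta> X z) = z \<otimes>\<^bsub>ob M' X\<^esub> b"
  shows "zmod_iso G (subquot M Z B) (subquot M' Z' B')"
proof (rule subquot_iso[OF M M' \<eta> m1])
  fix X z assume h: "X \<in> gsets G" "z \<in> Z X"
  interpret comm_group "ob M X" using zmodule.comm_group_ob[OF M(1) h(1)] .
  interpret B: subgroup "B X" "ob M X" using M(3) h by (simp add: submodule_of_def)
  interpret Z: subgroup "Z X" "ob M X" using M(2) h by (simp add: submodule_of_def)
  show "\<eta> X z \<in> B' X \<longleftrightarrow> z \<in> B X"
  proof
    assume "\<eta> X z \<in> B' X"
    then have a: "\<theta> X (\<eta> X z) \<in> B X" using m4 h by blast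
    obtain b where b: "b \<in> B X" "\<theta> X (\<eta> X z) = z \<otimes>\<^bsub>ob M X\<^esub> b" using i1[OF h] by blast
    then have "z = \<theta> X (\<eta> X z) \<otimes>\<^bsub>ob M X\<^esub> inv\<^bsub>ob M X\<^esub> b" using h by (simp add: m_assoc)
    then show "z \<in> B X" using a b B.m_closed B.m_inv_closed by metis
  qed (use m2 h in blast)
next
  fix X z assume h: "X \<in> gsets G" "z \<in> Z' X"
  interpret comm_group "ob M' X" using zmodule.comm_group_ob[OF M'(1) h(1)] .
  interpret B: subgroup "B' X" "ob M' X" using M'(3) h by (simp add: submodule_of_def)
  interpret Z: subgroup "Z' X" "ob M' X" using M'(2) h by (simp add: submodule_of_def)
  obtain b where b: "b \<in> B' X" "\<eta> X (\<theta> X z) = z \<otimes>\<^bsub>ob M' X\<^esub> b" using i2[OF h] by blast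
  then have "\<eta> X (\<theta> X z) \<otimes>\<^bsub>ob M' X\<^esub> inv\<^bsub>ob M' X\<^esub> z = b" using h by (simp add: m_comm[of z] m_assoc)
  then show "\<exists>w\<in>Z X. \<eta> X w \<otimes>\<^bsub>ob M' X\<^esub> inv\<^bsub>ob M' X\<^esub> z \<in> B' X" using m3[OF h] b by (intro bexI[of _ "\<theta> X z"]) simp_all
qed

section \<open>Homology and chain homotopy\<close>

locale chain_complex =
  fixes G :: "'g monoid" and C :: "nat \<Rightarrow> ('g, 'c) zmod" and \<delta> :: "nat \<Rightarrow> ('g, 'c, 'c) nat_trans"
  assumes zmod: "zmodule G (C k)" and \<delta>: "\<delta> k \<in> zhom G (C (Suc k)) (C k)"
    and \<delta>\<delta>: "\<lbrakk>X \<in> gsets G; z \<in> carrier (ob (C (Suc (Suc k))) X)\<rbrakk> \<Longrightarrow> \<delta> k X (\<delta> (Suc k) X z) = \<one>\<^bsub>ob (C k) X\<^esub>"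
begin

definition "Z i X = (case i of 0 \<Rightarrow> carrier (ob (C 0) X) | Suc k \<Rightarrow> kernel (ob (C (Suc k)) X) (ob (C k) X) (\<delta> k X))"
definition "B i X = \<delta> i X ` carrier (ob (C (Suc i)) X)"

lemma homology_subquot: "chain_homology C \<delta> i = subquot (C i) (Z i) (B i)"
  unfolding chain_homology_def Z_def B_def ..

lemma Z_sub: "submodule_of G (C i) (Z i)"
proof (cases i)
  case 0
  then show ?thesis using submodule_carrier[OF zmod] by (simp add: Z_def[abs_def])
next
  case (Suc k)
  then show ?thesis using submodule_kernel[OF zmod zmod \<delta>] by (simp add: Z_def[abs_def])
qed

lemma B_sub: "submodule_of G (C i) (B i)"
  unfolding B_def[abs_def] by (rule submodule_image[OF zmod zmod \<delta>])

lemma B_le_Z: "X \<in> gsets G \<Longrightarrow> B i X \<subseteq> Z i X"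
  by (cases i) (auto simp: Z_def B_def kernel_def zhom_closed[OF \<delta>] \<delta>\<delta>)

lemma Z_carrier: "z \<in> Z i X \<Longrightarrow> z \<in> carrier (ob (C i) X)"
  by (cases i) (auto simp: Z_def kernel_def)

end

text \<open>Half of a homotopy equivalence, the half in which \<open>g\<close> after
  \<open>f\<close> is homotopic to the identity. An equivalence consists of two such data with the
  roles of \<open>f\<close> and \<open>g\<close> exchanged.\<close>

locale chain_retract = C: chain_complex G C \<delta> + C': chain_complex G C' \<delta>'
  for G :: "'g monoid" and C :: "nat \<Rightarrow> ('g, 'c) zmod" and \<delta> and C' :: "nat \<Rightarrow> ('g, 'd) zmod" and \<delta>' +
  fixes f g
  assumes f: "chain_map G C \<delta> C' \<delta>' f" and g: "chain_map G C' \<delta>' C \<delta> g"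
    and gf: "homotopic_id G C \<delta> (\<lambda>k. zcomp G (C k) (g k) (f k))"
begin

lemma f_in: "f k \<in> zhom G (C k) (C' k)" using f by (simp add: chain_map_def)

lemma f_Z:
  assumes X: "X \<in> gsets G" and z: "z \<in> C.Z i X" shows "f i X z \<in> C'.Z i X"
proof (cases i)
  case 0
  then show ?thesis using X z zhom_closed[OF f_in X] by (auto simp: C.Z_def C'.Z_def)
next
  case (Suc k)
  then have z': "z \<in> carrier (ob (C (Suc k)) X)" "\<delta> k X z = \<one>\<^bsub>ob (C k) X\<^esub>" using z by (auto simp: C.Z_def kernel_def)
  have "\<delta>' k X (f (Suc k) X z) = f k X (\<delta> k X z)" using f X z' by (simp add: chain_map_def)
  then show ?thesis
    using Suc z' zhom_closed[OF f_in X z'(1)] zhom_one[OF f_in X C.zmod C'.zmod] by (simp add: C'.Z_def kernel_def)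
qed

lemma f_B: "\<lbrakk>X \<in> gsets G; z \<in> C.B i X\<rbrakk> \<Longrightarrow> f i X z \<in> C'.B i X"
proof -
  assume X: "X \<in> gsets G" and "z \<in> C.B i X"
  then obtain w where w: "w \<in> carrier (ob (C (Suc i)) X)" "z = \<delta> i X w" by (auto simp: C.B_def)
  then have "f i X z = \<delta>' i X (f (Suc i) X w)" using f X by (simp add: chain_map_def)
  then show ?thesis using zhom_closed[OF f_in X w(1)] by (auto simp: C'.B_def)
qed

text \<open>On a cycle the term s d vanishes and d s is a boundary.\<close>

lemma gf_Z:
  assumes X: "X \<in> gsets G" and z: "z \<in> C.Z i X"
  shows "\<exists>b\<in>C.B i X. g i X (f i X z) = z \<otimes>\<^bsub>ob (C i) X\<^esub> b"
proof -
  obtain s where S: "\<forall>k. s k \<in> zhom G (C k) (C (Suc k))"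
    "\<forall>X\<in>gsets G. \<forall>m\<in>carrier (ob (C 0) X). zcomp G (C 0) (g 0) (f 0) X m = m \<otimes>\<^bsub>ob (C 0) X\<^esub> \<delta> 0 X (s 0 X m)"
    "\<forall>k. \<forall>X\<in>gsets G. \<forall>m\<in>carrier (ob (C (Suc k)) X). zcomp G (C (Suc k)) (g (Suc k)) (f (Suc k)) X m =
      m \<otimes>\<^bsub>ob (C (Suc k)) X\<^esub> \<delta> (Suc k) X (s (Suc k) X m) \<otimes>\<^bsub>ob (C (Suc k)) X\<^esub> s k X (\<delta> k X m)"
    using gf unfolding homotopic_id_def by blast
  have s: "\<And>k. s k \<in> zhom G (C k) (C (Suc k))" using S(1) by blast
  have s0: "\<And>m. m \<in> carrier (ob (C 0) X) \<Longrightarrow> g 0 X (f 0 X m) = m \<otimes>\<^bsub>ob (C 0) X\<^esub> \<delta> 0 X (s 0 X m)"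
    using S(2) X zcomp_apply by metis
  have sk: "\<And>k m. m \<in> carrier (ob (C (Suc k)) X) \<Longrightarrow> g (Suc k) X (f (Suc k) X m) =
      m \<otimes>\<^bsub>ob (C (Suc k)) X\<^esub> \<delta> (Suc k) X (s (Suc k) X m) \<otimes>\<^bsub>ob (C (Suc k)) X\<^esub> s k X (\<delta> k X m)"
    using S(3) X zcomp_apply by metis
  note zc = C.Z_carrier[OF z]
  have b: "\<delta> i X (s i X z) \<in> C.B i X" using zhom_closed[OF s X zc] by (auto simp: C.B_def)
  have "g i X (f i X z) = z \<otimes>\<^bsub>ob (C i) X\<^esub> \<delta> i X (s i X z)"
  proof (cases i)
    case 0
    then show ?thesis using s0 zc by simp
  next
    case (Suc k)
    interpret group "ob (C (Suc k)) X" using zmodule.group_ob[OF C.zmod X] .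
    have z': "z \<in> carrier (ob (C (Suc k)) X)" "\<delta> k X z = \<one>\<^bsub>ob (C k) X\<^esub>" using z Suc by (auto simp: C.Z_def kernel_def)
    have "\<delta> (Suc k) X (s (Suc k) X z) \<in> carrier (ob (C (Suc k)) X)"
      using zhom_closed[OF C.\<delta> X zhom_closed[OF s X z'(1)]] .
    then show ?thesis using sk[OF z'(1)] z' Suc zhom_one[OF s X C.zmod C.zmod] by simp
  qed
  then show ?thesis using b by blast
qed

end

lemma chain_homology_iso:
  assumes "chain_retract G C \<delta> C' \<delta>' f g" and "chain_retract G C' \<delta>' C \<delta> g f"
  shows "zmod_iso G (chain_homology C \<delta> i) (chain_homology C' \<delta>' i)"
proof -
  interpret r: chain_retract G C \<delta> C' \<delta>' f g by fact
  interpret r': chain_retract G C' \<delta>' C \<delta> g f by fact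
  show ?thesis
    unfolding r.C.homology_subquot r.C'.homology_subquot
    by (rule subquot_iso_inverse[OF r.C.zmod r.C.Z_sub r.C.B_sub r.C.B_le_Z r.C'.zmod r.C'.Z_sub r.C'.B_sub r.C'.B_le_Z
        r.f_in r'.f_in r.f_Z r.f_B r'.f_Z r'.f_B r.gf_Z r'.gf_Z])
qed

section \<open>Cohomology and cochain homotopy\<close>

definition cochain_map where
  "cochain_map G C \<delta> C' \<delta>' f \<longleftrightarrow> (\<forall>k. f k \<in> zhom G (C k) (C' k)) \<and>
    (\<forall>k. \<forall>X\<in>gsets G. \<forall>m\<in>carrier (ob (C k) X). f (Suc k) X (\<delta> k X m) = \<delta>' k X (f k X m))"

definition cohomotopic_id where
  "cohomotopic_id G C \<delta> h \<longleftrightarrow> (\<exists>s. (\<forall>k. s k \<in> zhom G (C (Suc k)) (C k)) \<and>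
    (\<forall>X\<in>gsets G. \<forall>m\<in>carrier (ob (C 0) X). h 0 X m = m \<otimes>\<^bsub>ob (C 0) X\<^esub> s 0 X (\<delta> 0 X m)) \<and>
    (\<forall>k. \<forall>X\<in>gsets G. \<forall>m\<in>carrier (ob (C (Suc k)) X). h (Suc k) X m =
      m \<otimes>\<^bsub>ob (C (Suc k)) X\<^esub> s (Suc k) X (\<delta> (Suc k) X m) \<otimes>\<^bsub>ob (C (Suc k)) X\<^esub> \<delta> k X (s k X m)))"

locale cochain_complex =
  fixes G :: "'g monoid" and C :: "nat \<Rightarrow> ('g, 'c) zmod" and \<delta> :: "nat \<Rightarrow> ('g, 'c, 'c) nat_trans"
  assumes zmod: "zmodule G (C k)" and \<delta>: "\<delta> k \<in> zhom G (C k) (C (Suc k))"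
    and \<delta>\<delta>: "\<lbrakk>X \<in> gsets G; z \<in> carrier (ob (C k) X)\<rbrakk> \<Longrightarrow> \<delta> (Suc k) X (\<delta> k X z) = \<one>\<^bsub>ob (C (Suc (Suc k))) X\<^esub>"
begin

definition "Z i X = kernel (ob (C i) X) (ob (C (Suc i)) X) (\<delta> i X)"
definition "B i X = (case i of 0 \<Rightarrow> {\<one>\<^bsub>ob (C 0) X\<^esub>} | Suc k \<Rightarrow> \<delta> k X ` carrier (ob (C k) X))"

lemma cohomology_subquot: "cochain_cohomology C \<delta> i = subquot (C i) (Z i) (B i)"
  unfolding cochain_cohomology_def Z_def B_def ..

lemma Z_sub: "submodule_of G (C i) (Z i)"
  unfolding Z_def[abs_def] by (rule submodule_kernel[OF zmod zmod \<delta>])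

lemma B_sub: "submodule_of G (C i) (B i)"
proof (cases i)
  case 0
  then show ?thesis using submodule_trivial[OF zmod] by (simp add: B_def[abs_def])
next
  case (Suc k)
  then show ?thesis using submodule_image[OF zmod zmod \<delta>] by (simp add: B_def[abs_def])
qed

lemma B_le_Z: "X \<in> gsets G \<Longrightarrow> B i X \<subseteq> Z i X"
proof (cases i)
  case 0
  assume X: "X \<in> gsets G"
  interpret group "ob (C 0) X" using zmodule.group_ob[OF zmod X] .
  show ?thesis using zhom_one[OF \<delta> X zmod zmod] 0 by (simp add: Z_def B_def kernel_def)
qed (auto simp: Z_def B_def kernel_def zhom_closed[OF \<delta>] \<delta>\<delta>)

end

locale cochain_retract = C: cochain_complex G C \<delta> + C': cochain_complex G C' \<delta>'
  for G :: "'g monoid" and C :: "nat \<Rightarrow> ('g, 'c) zmod" and \<delta> and C' :: "nat \<Rightarrow> ('g, 'd) zmod" and \<delta>' +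
  fixes f g
  assumes f: "cochain_map G C \<delta> C' \<delta>' f" and g: "cochain_map G C' \<delta>' C \<delta> g"
    and gf: "cohomotopic_id G C \<delta> (\<lambda>k. zcomp G (C k) (g k) (f k))"
begin

lemma f_in: "f k \<in> zhom G (C k) (C' k)" using f by (simp add: cochain_map_def)

lemma f_Z:
  assumes X: "X \<in> gsets G" and z: "z \<in> C.Z i X" shows "f i X z \<in> C'.Z i X"
proof -
  have z': "z \<in> carrier (ob (C i) X)" "\<delta> i X z = \<one>\<^bsub>ob (C (Suc i)) X\<^esub>" using z by (auto simp: C.Z_def kernel_def)
  have "\<delta>' i X (f i X z) = f (Suc i) X (\<delta> i X z)"
    using f X z'(1) unfolding cochain_map_def by metis
  then show ?thesis
    using z' zhom_closed[OF f_in X z'(1)] zhom_one[OF f_in X C.zmod C'.zmod] by (simp add: C'.Z_def kernel_def)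
qed

lemma f_B: "\<lbrakk>X \<in> gsets G; z \<in> C.B i X\<rbrakk> \<Longrightarrow> f i X z \<in> C'.B i X"
proof (cases i)
  case 0
  assume "X \<in> gsets G" "z \<in> C.B i X"
  then show ?thesis using 0 zhom_one[OF f_in _ C.zmod C'.zmod] by (simp add: C.B_def C'.B_def)
next
  case (Suc k)
  assume X: "X \<in> gsets G" and "z \<in> C.B i X"
  then obtain w where w: "w \<in> carrier (ob (C k) X)" "z = \<delta> k X w" using Suc by (auto simp: C.B_def)
  then have "f i X z = \<delta>' k X (f k X w)" using f X Suc by (simp add: cochain_map_def)
  then show ?thesis using zhom_closed[OF f_in X w(1)] Suc by (auto simp: C'.B_def)
qed

lemma gf_Z:
  assumes X: "X \<in> gsets G" and z: "z \<in> C.Z i X"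
  shows "\<exists>b\<in>C.B i X. g i X (f i X z) = z \<otimes>\<^bsub>ob (C i) X\<^esub> b"
proof -
  obtain s where S: "\<forall>k. s k \<in> zhom G (C (Suc k)) (C k)"
    "\<forall>X\<in>gsets G. \<forall>m\<in>carrier (ob (C 0) X). zcomp G (C 0) (g 0) (f 0) X m = m \<otimes>\<^bsub>ob (C 0) X\<^esub> s 0 X (\<delta> 0 X m)"
    "\<forall>k. \<forall>X\<in>gsets G. \<forall>m\<in>carrier (ob (C (Suc k)) X). zcomp G (C (Suc k)) (g (Suc k)) (f (Suc k)) X m =
      m \<otimes>\<^bsub>ob (C (Suc k)) X\<^esub> s (Suc k) X (\<delta> (Suc k) X m) \<otimes>\<^bsub>ob (C (Suc k)) X\<^esub> \<delta> k X (s k X m)"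
    using gf unfolding cohomotopic_id_def by blast
  have s: "\<And>k. s k \<in> zhom G (C (Suc k)) (C k)" using S(1) by blast
  have s0: "\<And>m. m \<in> carrier (ob (C 0) X) \<Longrightarrow> g 0 X (f 0 X m) = m \<otimes>\<^bsub>ob (C 0) X\<^esub> s 0 X (\<delta> 0 X m)"
    using S(2) X zcomp_apply by metis
  have sk: "\<And>k m. m \<in> carrier (ob (C (Suc k)) X) \<Longrightarrow> g (Suc k) X (f (Suc k) X m) =
      m \<otimes>\<^bsub>ob (C (Suc k)) X\<^esub> s (Suc k) X (\<delta> (Suc k) X m) \<otimes>\<^bsub>ob (C (Suc k)) X\<^esub> \<delta> k X (s k X m)"
    using S(3) X zcomp_apply by metis
  have z': "z \<in> carrier (ob (C i) X)" "\<delta> i X z = \<one>\<^bsub>ob (C (Suc i)) X\<^esub>" using z by (auto simp: C.Z_def kernel_def)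
  interpret group "ob (C i) X" using zmodule.group_ob[OF C.zmod X] .
  show ?thesis
  proof (cases i)
    case 0
    then show ?thesis using s0 z' zhom_one[OF s X C.zmod C.zmod] by (auto simp: C.B_def)
  next
    case (Suc k)
    have "\<delta> k X (s k X z) \<in> C.B i X" using zhom_closed[OF s X] z' Suc by (auto simp: C.B_def)
    moreover have "g i X (f i X z) = z \<otimes>\<^bsub>ob (C i) X\<^esub> \<delta> k X (s k X z)"
      using sk[of z k] z' Suc zhom_one[OF s X C.zmod C.zmod] r_one[OF z'(1)] by simp
    ultimately show ?thesis by blast
  qed
qed

end

lemma cochain_cohomology_iso:
  assumes "cochain_retract G C \<delta> C' \<delta>' f g" and "cochain_retract G C' \<delta>' C \<delta> g f"
  shows "zmod_iso G (cochain_cohomology C \<delta> i) (cochain_cohomology C' \<delta>' i)"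
proof -
  interpret r: cochain_retract G C \<delta> C' \<delta>' f g by fact
  interpret r': cochain_retract G C' \<delta>' C \<delta> g f by fact
  show ?thesis
    unfolding r.C.cohomology_subquot r.C'.cohomology_subquot
    by (rule subquot_iso_inverse[OF r.C.zmod r.C.Z_sub r.C.B_sub r.C.B_le_Z r.C'.zmod r.C'.Z_sub r.C'.B_sub r.C'.B_le_Z
        r.f_in r'.f_in r.f_Z r.f_B r'.f_Z r'.f_B r.gf_Z r'.gf_Z])
qed

section \<open>Box product and internal hom with a fixed module\<close>

context box_data begin

lemma bx_one2:
  assumes "X \<in> gsets G" "S \<in> gsets G" "T \<in> gsets G" "\<phi> \<in> BZ G X (prod_gset S T)" "n \<in> carrier (ob N T)"
  shows "bx X S T \<phi> \<one>\<^bsub>ob M S\<^esub> n = \<one>\<^bsub>ob (box G M N) X\<^esub>"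
proof -
  interpret B: comm_group "ob (box G M N) X" using comm_group_box assms(1) .
  interpret S: group "ob M S" using M.group_ob assms(2) .
  show ?thesis using bx_add2[OF assms(1-4) S.one_closed S.one_closed assms(5)] bx_in[OF assms(1-4) S.one_closed assms(5)]
    by simp
qed

lemma bx_one3:
  assumes "X \<in> gsets G" "S \<in> gsets G" "T \<in> gsets G" "\<phi> \<in> BZ G X (prod_gset S T)" "m \<in> carrier (ob M S)"
  shows "bx X S T \<phi> m \<one>\<^bsub>ob N T\<^esub> = \<one>\<^bsub>ob (box G M N) X\<^esub>"
proof -
  interpret B: comm_group "ob (box G M N) X" using comm_group_box assms(1) .
  interpret T: group "ob N T" using N.group_ob assms(3) .
  show ?thesis using bx_add3[OF assms(1-5) T.one_closed T.one_closed] bx_in[OF assms(1-5) T.one_closed]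
    by simp
qed

end

locale tensor_map = s: box_data G M N + t: box_data G K N
  for G :: "'g monoid" and M :: "('g, 'm) zmod" and K :: "('g, 'k) zmod" and N :: "('g, 'n) zmod" +
  fixes f assumes f: "f \<in> zhom G M K"
begin

abbreviation "T \<equiv> box_map G M N K N f (zid G N)"

sublocale box_map_data G M N K N f "zid G N"
  by unfold_locales (use f s.N.zmodule_axioms in auto)

lemma T_in: "T \<in> zhom G (box G M N) (box G K N)"
  by (rule box_map_in)

lemma T_bx:
  "\<lbrakk>X \<in> gsets G; S \<in> gsets G; U \<in> gsets G; \<phi> \<in> BZ G X (prod_gset S U); m \<in> carrier (ob M S); n \<in> carrier (ob N U)\<rbrakk>
    \<Longrightarrow> T X (s.bx X S U \<phi> m n) = t.bx X S U \<phi> (f S m) n"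
  by (simp add: box_map_bx)

end

locale additive_tensor =
  fixes G :: "'g monoid" and N :: "('g, 'n) zmod"
  assumes N: "zmodule G N"
begin

abbreviation "T P P' f \<equiv> box_map G P N P' N f (zid G N)"

lemma tensor_map_data: "\<lbrakk>zmodule G P; zmodule G P'; f \<in> zhom G P P'\<rbrakk> \<Longrightarrow> tensor_map G P P' N f"
  using N by (simp add: tensor_map_def tensor_map_axioms_def box_data_def)

lemmas T_in = tensor_map.T_in[OF tensor_map_data]
lemmas T_bx = tensor_map.T_bx[OF tensor_map_data]
lemma box_data_left: "zmodule G P \<Longrightarrow> box_data G P N" using N by (simp add: box_data_def)
lemmas zb = box_data.zmodule_box[OF box_data_left]

text \<open>A commuting square is the shape that a chain map provides. Both composites are natural
  transformations out of a box product, so generators decide.\<close>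

lemma T_comp:
  assumes z: "zmodule G P" "zmodule G P1" "zmodule G P2" "zmodule G P3"
    and h: "f \<in> zhom G P P1" "f' \<in> zhom G P1 P3" "g \<in> zhom G P P2" "g' \<in> zhom G P2 P3"
    and eq: "\<And>X m. \<lbrakk>X \<in> gsets G; m \<in> carrier (ob P X)\<rbrakk> \<Longrightarrow> f' X (f X m) = g' X (g X m)"
    and X: "X \<in> gsets G" "c \<in> carrier (ob (box G P N) X)"
  shows "T P1 P3 f' X (T P P1 f X c) = T P2 P3 g' X (T P P2 g X c)"
proof -
  have E: "zcomp G (box G P N) (T P1 P3 f') (T P P1 f) = zcomp G (box G P N) (T P2 P3 g') (T P P2 g)"
    by (rule box_data.box_zhom_eqI[OF box_data_left[OF z(1)] zb[OF z(4)]
          zcomp_in[OF T_in[OF z(1,2) h(1)] T_in[OF z(2,4) h(2)] zb[OF z(1)]]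
          zcomp_in[OF T_in[OF z(1,3) h(3)] T_in[OF z(3,4) h(4)] zb[OF z(1)]]])
      (simp add: box_data.bx_in[OF box_data_left] z T_bx h zhom_closed[OF h(1)] zhom_closed[OF h(3)] eq)
  show ?thesis using arg_cong[OF E, of "\<lambda>h. h X c"] X by simp
qed

lemma T_zero:
  assumes z: "zmodule G P" "zmodule G P1" "zmodule G P3"
    and h: "f \<in> zhom G P P1" "f' \<in> zhom G P1 P3"
    and eq: "\<And>X m. \<lbrakk>X \<in> gsets G; m \<in> carrier (ob P X)\<rbrakk> \<Longrightarrow> f' X (f X m) = \<one>\<^bsub>ob P3 X\<^esub>"
    and X: "X \<in> gsets G" "c \<in> carrier (ob (box G P N) X)"
  shows "T P1 P3 f' X (T P P1 f X c) = \<one>\<^bsub>ob (box G P3 N) X\<^esub>"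
proof -
  have E: "zcomp G (box G P N) (T P1 P3 f') (T P P1 f) = zrestrict G (box G P N) (\<lambda>X c. \<one>\<^bsub>ob (box G P3 N) X\<^esub>)"
    by (rule box_data.box_zhom_eqI[OF box_data_left[OF z(1)] zb[OF z(3)]
          zcomp_in[OF T_in[OF z(1,2) h(1)] T_in[OF z(2,3) h(2)] zb[OF z(1)]] zhom_one_in[OF zb[OF z(1)] zb[OF z(3)]]])
      (simp add: box_data.bx_in[OF box_data_left] z T_bx h zhom_closed[OF h(1)] eq box_data.bx_one2[OF box_data_left])
  show ?thesis using arg_cong[OF E, of "\<lambda>h. h X c"] X by simp
qed

lemma T_homotopy0:
  assumes z: "zmodule G P" "zmodule G P1" "zmodule G P2"
    and h: "f \<in> zhom G P P1" "g \<in> zhom G P1 P" "s \<in> zhom G P P2" "d \<in> zhom G P2 P"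
    and eq: "\<And>X m. \<lbrakk>X \<in> gsets G; m \<in> carrier (ob P X)\<rbrakk> \<Longrightarrow> g X (f X m) = m \<otimes>\<^bsub>ob P X\<^esub> d X (s X m)"
    and X: "X \<in> gsets G" "c \<in> carrier (ob (box G P N) X)"
  shows "T P1 P g X (T P P1 f X c) = c \<otimes>\<^bsub>ob (box G P N) X\<^esub> T P2 P d X (T P P2 s X c)"
proof -
  let ?r = "zrestrict G (box G P N) (\<lambda>X c. zid G (box G P N) X c \<otimes>\<^bsub>ob (box G P N) X\<^esub>
      zcomp G (box G P N) (T P2 P d) (T P P2 s) X c)"
  have i: "zcomp G (box G P N) (T P2 P d) (T P P2 s) \<in> zhom G (box G P N) (box G P N)"
    using zcomp_in[OF T_in[OF z(1,3) h(3)] T_in[OF z(3,1) h(4)] zb[OF z(1)]] .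
  have E: "zcomp G (box G P N) (T P1 P g) (T P P1 f) = ?r"
    by (rule box_data.box_zhom_eqI[OF box_data_left[OF z(1)] zb[OF z(1)]
          zcomp_in[OF T_in[OF z(1,2) h(1)] T_in[OF z(2,1) h(2)] zb[OF z(1)]]
          zhom_mult_in[OF zb[OF z(1)] zb[OF z(1)] zid_in[OF zb[OF z(1)]] i]])
      (simp add: box_data.bx_in[OF box_data_left] z T_bx h zhom_closed[OF h(1)] zhom_closed[OF h(3)] zhom_closed[OF h(4)]
        eq box_data.bx_add2[OF box_data_left])
  show ?thesis using arg_cong[OF E, of "\<lambda>h. h X c"] X by simp
qed

text \<open>A class is additive in its first module entry, so the identity g f = 1 + d s + s' d'
  passes through on each generator.\<close>

lemma T_homotopy:
  assumes z: "zmodule G P" "zmodule G P1" "zmodule G P2" "zmodule G P3"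
    and h: "f \<in> zhom G P P1" "g \<in> zhom G P1 P" "s \<in> zhom G P P2" "d \<in> zhom G P2 P"
      "d' \<in> zhom G P P3" "s' \<in> zhom G P3 P"
    and eq: "\<And>X m. \<lbrakk>X \<in> gsets G; m \<in> carrier (ob P X)\<rbrakk>
      \<Longrightarrow> g X (f X m) = m \<otimes>\<^bsub>ob P X\<^esub> d X (s X m) \<otimes>\<^bsub>ob P X\<^esub> s' X (d' X m)"
    and X: "X \<in> gsets G" "c \<in> carrier (ob (box G P N) X)"
  shows "T P1 P g X (T P P1 f X c) = c \<otimes>\<^bsub>ob (box G P N) X\<^esub> T P2 P d X (T P P2 s X c)
    \<otimes>\<^bsub>ob (box G P N) X\<^esub> T P3 P s' X (T P P3 d' X c)"
proof -
  let ?r = "zrestrict G (box G P N) (\<lambda>X c. zid G (box G P N) X c \<otimes>\<^bsub>ob (box G P N) X\<^esub>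
      zcomp G (box G P N) (T P2 P d) (T P P2 s) X c)"
  let ?q = "zrestrict G (box G P N) (\<lambda>X c. ?r X c \<otimes>\<^bsub>ob (box G P N) X\<^esub> zcomp G (box G P N) (T P3 P s') (T P P3 d') X c)"
  have i: "zcomp G (box G P N) (T P2 P d) (T P P2 s) \<in> zhom G (box G P N) (box G P N)"
    using zcomp_in[OF T_in[OF z(1,3) h(3)] T_in[OF z(3,1) h(4)] zb[OF z(1)]] .
  have j: "zcomp G (box G P N) (T P3 P s') (T P P3 d') \<in> zhom G (box G P N) (box G P N)"
    using zcomp_in[OF T_in[OF z(1,4) h(5)] T_in[OF z(4,1) h(6)] zb[OF z(1)]] .
  have E: "zcomp G (box G P N) (T P1 P g) (T P P1 f) = ?q"
    by (rule box_data.box_zhom_eqI[OF box_data_left[OF z(1)] zb[OF z(1)]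
          zcomp_in[OF T_in[OF z(1,2) h(1)] T_in[OF z(2,1) h(2)] zb[OF z(1)]]
          zhom_mult_in[OF zb[OF z(1)] zb[OF z(1)] zhom_mult_in[OF zb[OF z(1)] zb[OF z(1)] zid_in[OF zb[OF z(1)]] i] j]])
      (simp add: box_data.bx_in[OF box_data_left] z T_bx h zhom_closed[OF h(1)] zhom_closed[OF h(3)] zhom_closed[OF h(4)]
        zhom_closed[OF h(5)] zhom_closed[OF h(6)] eq box_data.bx_add2[OF box_data_left] box_data.M_mult[OF box_data_left])
  show ?thesis using arg_cong[OF E, of "\<lambda>h. h X c"] X by simp
qed

end

locale additive_ihom =
  fixes G :: "'g monoid" and N :: "('g, 'n) zmod"
  assumes N: "zmodule G N"
begin

lemma ihom_data_N: "zmodule G P \<Longrightarrow> ihom_data G P N"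
  using N by (simp add: ihom_data_def)

lemma ihom_pre_data_N: "\<lbrakk>zmodule G P; zmodule G P'; f \<in> zhom G P P'\<rbrakk> \<Longrightarrow> ihom_pre_data G P P' N f"
  using N by (simp add: ihom_pre_data_def ihom_pre_data_axioms_def ihom_data_def)

lemmas E_in = ihom_pre_data.ihom_pre_in[OF ihom_pre_data_N]
lemmas E_closed = ihom_pre_data.ihom_pre_closed[OF ihom_pre_data_N]
lemmas E_bx = ihom_pre_data.ihom_pre_bx[OF ihom_pre_data_N]
lemmas zmodule_ihom_N = ihom_data.zmodule_ihom[OF ihom_data_N]

lemma one_bx:
  assumes "zmodule G P" "X \<in> gsets G" "Y \<in> gsets G" "z \<in> carrier (ob (box G (rep G X) P) Y)"
  shows "\<one>\<^bsub>ob (ihom G P N) X\<^esub> Y z = \<one>\<^bsub>ob N Y\<^esub>"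
  using assms by (simp add: ihom_data.ob_ihom[OF ihom_data_N[OF assms(1)]] zhom_group_simps)

lemma one_in: "\<lbrakk>zmodule G P; X \<in> gsets G\<rbrakk> \<Longrightarrow> \<one>\<^bsub>ob (ihom G P N) X\<^esub> \<in> carrier (ob (ihom G P N) X)"
  using zmodule.group_ob[OF zmodule_ihom_N] group.is_monoid monoid.one_closed by blast

lemma E_comp:
  assumes z: "zmodule G P" "zmodule G P1" "zmodule G P2" "zmodule G P3"
    and h: "f \<in> zhom G P P1" "f' \<in> zhom G P1 P3" "g \<in> zhom G P P2" "g' \<in> zhom G P2 P3"
    and eq: "\<And>X m. \<lbrakk>X \<in> gsets G; m \<in> carrier (ob P X)\<rbrakk> \<Longrightarrow> f' X (f X m) = g' X (g X m)"
    and X: "X \<in> gsets G" "\<eta> \<in> carrier (ob (ihom G P3 N) X)"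
  shows "ihom_pre G P P1 N f X (ihom_pre G P1 P3 N f' X \<eta>) = ihom_pre G P P2 N g X (ihom_pre G P2 P3 N g' X \<eta>)"
proof (rule ihom_data.ihom_eqI[OF ihom_data_N[OF z(1)] X(1)])
  note c = E_closed[OF z(2,4) h(2) X] E_closed[OF z(3,4) h(4) X]
  show "ihom_pre G P P1 N f X (ihom_pre G P1 P3 N f' X \<eta>) \<in> carrier (ob (ihom G P N) X)"
    "ihom_pre G P P2 N g X (ihom_pre G P2 P3 N g' X \<eta>) \<in> carrier (ob (ihom G P N) X)"
    using E_closed[OF z(1,2) h(1) X(1) c(1)] E_closed[OF z(1,3) h(3) X(1) c(2)] .
  fix Y S T \<phi> p m assume a: "Y \<in> gsets G" "S \<in> gsets G" "T \<in> gsets G" "\<phi> \<in> BZ G Y (prod_gset S T)"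
    "p \<in> BZ G S X" "m \<in> carrier (ob P T)"
  show "ihom_pre G P P1 N f X (ihom_pre G P1 P3 N f' X \<eta>) Y (box_data.bx G (rep G X) P Y S T \<phi> p m)
    = ihom_pre G P P2 N g X (ihom_pre G P2 P3 N g' X \<eta>) Y (box_data.bx G (rep G X) P Y S T \<phi> p m)"
    using E_bx[OF z(1,2) h(1) X(1) c(1) a] E_bx[OF z(1,3) h(3) X(1) c(2) a]
      E_bx[OF z(2,4) h(2) X a(1-5) zhom_closed[OF h(1) a(3,6)]]
      E_bx[OF z(3,4) h(4) X a(1-5) zhom_closed[OF h(3) a(3,6)]] eq[OF a(3,6)] by simp
qed

text \<open>A generator whose second module entry is the identity has trivial class, and a natural
  transformation preserves the identity.\<close>

lemma E_zero:
  assumes z: "zmodule G P" "zmodule G P1" "zmodule G P3"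
    and h: "f \<in> zhom G P P1" "f' \<in> zhom G P1 P3"
    and eq: "\<And>X m. \<lbrakk>X \<in> gsets G; m \<in> carrier (ob P X)\<rbrakk> \<Longrightarrow> f' X (f X m) = \<one>\<^bsub>ob P3 X\<^esub>"
    and X: "X \<in> gsets G" "\<eta> \<in> carrier (ob (ihom G P3 N) X)"
  shows "ihom_pre G P P1 N f X (ihom_pre G P1 P3 N f' X \<eta>) = \<one>\<^bsub>ob (ihom G P N) X\<^esub>"
proof (rule ihom_data.ihom_eqI[OF ihom_data_N[OF z(1)] X(1)])
  note c = E_closed[OF z(2,3) h(2) X]
  show "ihom_pre G P P1 N f X (ihom_pre G P1 P3 N f' X \<eta>) \<in> carrier (ob (ihom G P N) X)"
    using E_closed[OF z(1,2) h(1) X(1) c] .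
  show "\<one>\<^bsub>ob (ihom G P N) X\<^esub> \<in> carrier (ob (ihom G P N) X)" using one_in z X by blast
  fix Y S T \<phi> p m assume a: "Y \<in> gsets G" "S \<in> gsets G" "T \<in> gsets G" "\<phi> \<in> BZ G Y (prod_gset S T)"
    "p \<in> BZ G S X" "m \<in> carrier (ob P T)"
  interpret b: box_data G "rep G X" P3 using ihom_data.box_data_rep[OF ihom_data_N[OF z(3)] X(1)] .
  have "p \<in> carrier (ob (rep G X) S)" using a by (simp add: rep_def)
  moreover have "\<eta> \<in> zhom G (box G (rep G X) P3) N" using X ihom_data.carrier_ihom[OF ihom_data_N[OF z(3)]] by blast
  ultimately have "\<eta> Y (b.bx Y S T \<phi> p \<one>\<^bsub>ob P3 T\<^esub>) = \<one>\<^bsub>ob N Y\<^esub>"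
    using b.bx_one3[OF a(1-4)] zhom_one[OF _ a(1) b.zmodule_box N] by simp
  then show "ihom_pre G P P1 N f X (ihom_pre G P1 P3 N f' X \<eta>) Y (box_data.bx G (rep G X) P Y S T \<phi> p m)
    = \<one>\<^bsub>ob (ihom G P N) X\<^esub> Y (box_data.bx G (rep G X) P Y S T \<phi> p m)"
    using E_bx[OF z(1,2) h(1) X(1) c a] E_bx[OF z(2,3) h(2) X a(1-5) zhom_closed[OF h(1) a(3,6)]] eq[OF a(3,6)]
      one_bx[OF z(1) X(1) a(1) ihom_data.bxr_in[OF ihom_data_N[OF z(1)] X(1) a]] by simp
qed

lemma E_homotopy0:
  assumes z: "zmodule G P" "zmodule G P1" "zmodule G P2"
    and h: "f \<in> zhom G P P1" "g \<in> zhom G P1 P" "s \<in> zhom G P P2" "d \<in> zhom G P2 P"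
    and eq: "\<And>X m. \<lbrakk>X \<in> gsets G; m \<in> carrier (ob P X)\<rbrakk> \<Longrightarrow> g X (f X m) = m \<otimes>\<^bsub>ob P X\<^esub> d X (s X m)"
    and X: "X \<in> gsets G" "\<eta> \<in> carrier (ob (ihom G P N) X)"
  shows "ihom_pre G P P1 N f X (ihom_pre G P1 P N g X \<eta>)
    = \<eta> \<otimes>\<^bsub>ob (ihom G P N) X\<^esub> ihom_pre G P P2 N s X (ihom_pre G P2 P N d X \<eta>)"
proof (rule ihom_data.ihom_eqI[OF ihom_data_N[OF z(1)] X(1)])
  note c = E_closed[OF z(2,1) h(2) X] E_closed[OF z(3,1) h(4) X]
  note e = E_closed[OF z(1,2) h(1) X(1) c(1)] E_closed[OF z(1,3) h(3) X(1) c(2)]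
  show "ihom_pre G P P1 N f X (ihom_pre G P1 P N g X \<eta>) \<in> carrier (ob (ihom G P N) X)" using e by simp
  show "\<eta> \<otimes>\<^bsub>ob (ihom G P N) X\<^esub> ihom_pre G P P2 N s X (ihom_pre G P2 P N d X \<eta>) \<in> carrier (ob (ihom G P N) X)"
    using ihom_data.mult_ihom_in[OF ihom_data_N[OF z(1)] X e(2)] .
  fix Y S T \<phi> p m assume a: "Y \<in> gsets G" "S \<in> gsets G" "T \<in> gsets G" "\<phi> \<in> BZ G Y (prod_gset S T)"
    "p \<in> BZ G S X" "m \<in> carrier (ob P T)"
  interpret b: box_data G "rep G X" P using ihom_data.box_data_rep[OF ihom_data_N[OF z(1)] X(1)] .
  have p: "p \<in> carrier (ob (rep G X) S)" using a by (simp add: rep_def)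
  note sm = zhom_closed[OF h(3) a(3,6)]
  note m' = zhom_closed[OF h(4) a(3) sm]
  have "\<eta> \<in> zhom G (box G (rep G X) P) N" using X ihom_data.carrier_ihom[OF ihom_data_N[OF z(1)]] by blast
  then have "\<eta> Y (b.bx Y S T \<phi> p (m \<otimes>\<^bsub>ob P T\<^esub> d T (s T m))) = \<eta> Y (b.bx Y S T \<phi> p m) \<otimes>\<^bsub>ob N Y\<^esub> \<eta> Y (b.bx Y S T \<phi> p (d T (s T m)))"
    using b.bx_add3[OF a(1-4) p a(6) m'] zhom_mult[OF _ a(1) b.bx_in[OF a(1-4) p a(6)] b.bx_in[OF a(1-4) p m']] by simp
  then show "ihom_pre G P P1 N f X (ihom_pre G P1 P N g X \<eta>) Y (b.bx Y S T \<phi> p m)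
    = (\<eta> \<otimes>\<^bsub>ob (ihom G P N) X\<^esub> ihom_pre G P P2 N s X (ihom_pre G P2 P N d X \<eta>)) Y (b.bx Y S T \<phi> p m)"
    using E_bx[OF z(1,2) h(1) X(1) c(1) a] E_bx[OF z(2,1) h(2) X a(1-5) zhom_closed[OF h(1) a(3,6)]] eq[OF a(3,6)]
      E_bx[OF z(1,3) h(3) X(1) c(2) a] E_bx[OF z(3,1) h(4) X a(1-5) sm]
      ihom_data.mult_ihom_bx[OF ihom_data_N[OF z(1)] X(1) a(1) b.bx_in[OF a(1-4) p a(6)]] by simp
qed

text \<open>Contravariance reverses each composite. The sum now stands in the second module entry of
  a generator, where the third family of relations splits it before \<eta> is applied.\<close>

lemma E_homotopy:
  assumes z: "zmodule G P" "zmodule G P1" "zmodule G P2" "zmodule G P3"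
    and h: "f \<in> zhom G P P1" "g \<in> zhom G P1 P" "s \<in> zhom G P P2" "d \<in> zhom G P2 P"
      "d' \<in> zhom G P P3" "s' \<in> zhom G P3 P"
    and eq: "\<And>X m. \<lbrakk>X \<in> gsets G; m \<in> carrier (ob P X)\<rbrakk>
      \<Longrightarrow> g X (f X m) = m \<otimes>\<^bsub>ob P X\<^esub> d X (s X m) \<otimes>\<^bsub>ob P X\<^esub> s' X (d' X m)"
    and X: "X \<in> gsets G" "\<eta> \<in> carrier (ob (ihom G P N) X)"
  shows "ihom_pre G P P1 N f X (ihom_pre G P1 P N g X \<eta>)
    = \<eta> \<otimes>\<^bsub>ob (ihom G P N) X\<^esub> ihom_pre G P P2 N s X (ihom_pre G P2 P N d X \<eta>)
      \<otimes>\<^bsub>ob (ihom G P N) X\<^esub> ihom_pre G P P3 N d' X (ihom_pre G P3 P N s' X \<eta>)"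
proof (rule ihom_data.ihom_eqI[OF ihom_data_N[OF z(1)] X(1)])
  note c = E_closed[OF z(2,1) h(2) X] E_closed[OF z(3,1) h(4) X] E_closed[OF z(4,1) h(6) X]
  note e = E_closed[OF z(1,2) h(1) X(1) c(1)] E_closed[OF z(1,3) h(3) X(1) c(2)] E_closed[OF z(1,4) h(5) X(1) c(3)]
  note e' = ihom_data.mult_ihom_in[OF ihom_data_N[OF z(1)] X e(2)]
  show "ihom_pre G P P1 N f X (ihom_pre G P1 P N g X \<eta>) \<in> carrier (ob (ihom G P N) X)" using e by simp
  show "\<eta> \<otimes>\<^bsub>ob (ihom G P N) X\<^esub> ihom_pre G P P2 N s X (ihom_pre G P2 P N d X \<eta>)
      \<otimes>\<^bsub>ob (ihom G P N) X\<^esub> ihom_pre G P P3 N d' X (ihom_pre G P3 P N s' X \<eta>) \<in> carrier (ob (ihom G P N) X)"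
    using ihom_data.mult_ihom_in[OF ihom_data_N[OF z(1)] X(1) e' e(3)] .
  fix Y S T \<phi> p m assume a: "Y \<in> gsets G" "S \<in> gsets G" "T \<in> gsets G" "\<phi> \<in> BZ G Y (prod_gset S T)"
    "p \<in> BZ G S X" "m \<in> carrier (ob P T)"
  interpret b: box_data G "rep G X" P using ihom_data.box_data_rep[OF ihom_data_N[OF z(1)] X(1)] .
  have p: "p \<in> carrier (ob (rep G X) S)" using a by (simp add: rep_def)
  note sm = zhom_closed[OF h(3) a(3,6)]
  note dm = zhom_closed[OF h(5) a(3,6)]
  note m' = zhom_closed[OF h(4) a(3) sm]
  note m'' = zhom_closed[OF h(6) a(3) dm]
  note mm = b.N_mult[OF a(3,6) m']
  have ez: "\<eta> \<in> zhom G (box G (rep G X) P) N" using X ihom_data.carrier_ihom[OF ihom_data_N[OF z(1)]] by blast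
  have "\<eta> Y (b.bx Y S T \<phi> p (m \<otimes>\<^bsub>ob P T\<^esub> d T (s T m) \<otimes>\<^bsub>ob P T\<^esub> s' T (d' T m)))
      = \<eta> Y (b.bx Y S T \<phi> p m) \<otimes>\<^bsub>ob N Y\<^esub> \<eta> Y (b.bx Y S T \<phi> p (d T (s T m))) \<otimes>\<^bsub>ob N Y\<^esub> \<eta> Y (b.bx Y S T \<phi> p (s' T (d' T m)))"
    using b.bx_add3[OF a(1-4) p mm m''] zhom_mult[OF ez a(1) b.bx_in[OF a(1-4) p mm] b.bx_in[OF a(1-4) p m'']]
      b.bx_add3[OF a(1-4) p a(6) m'] zhom_mult[OF ez a(1) b.bx_in[OF a(1-4) p a(6)] b.bx_in[OF a(1-4) p m']] by simp
  then show "ihom_pre G P P1 N f X (ihom_pre G P1 P N g X \<eta>) Y (b.bx Y S T \<phi> p m)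
    = (\<eta> \<otimes>\<^bsub>ob (ihom G P N) X\<^esub> ihom_pre G P P2 N s X (ihom_pre G P2 P N d X \<eta>)
      \<otimes>\<^bsub>ob (ihom G P N) X\<^esub> ihom_pre G P P3 N d' X (ihom_pre G P3 P N s' X \<eta>)) Y (b.bx Y S T \<phi> p m)"
    using E_bx[OF z(1,2) h(1) X(1) c(1) a] E_bx[OF z(2,1) h(2) X a(1-5) zhom_closed[OF h(1) a(3,6)]] eq[OF a(3,6)]
      E_bx[OF z(1,3) h(3) X(1) c(2) a] E_bx[OF z(3,1) h(4) X a(1-5) sm]
      E_bx[OF z(1,4) h(5) X(1) c(3) a] E_bx[OF z(4,1) h(6) X a(1-5) dm]
      ihom_data.mult_ihom_bx[OF ihom_data_N[OF z(1)] X(1) a(1) b.bx_in[OF a(1-4) p a(6)]] by simp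
qed

end

section \<open>Independence of the resolution\<close>

context additive_tensor begin

lemma chain_complex:
  assumes "free_res G M P d \<epsilon>"
  shows "chain_complex G (\<lambda>k. box G (P k) N) (\<lambda>k. T (P (Suc k)) (P k) (d k))"
proof -
  interpret P: free_res G M P d \<epsilon> by fact
  show ?thesis
  proof (rule chain_complex.intro)
    fix k X z
    show "zmodule G (box G (P k) N)" by (rule zb[OF P.zmod])
    show "T (P (Suc k)) (P k) (d k) \<in> zhom G (box G (P (Suc k)) N) (box G (P k) N)"
      by (rule T_in[OF P.zmod P.zmod P.d])
    assume a: "X \<in> gsets G" "z \<in> carrier (ob (box G (P (Suc (Suc k))) N) X)"
    show "T (P (Suc k)) (P k) (d k) X (T (P (Suc (Suc k))) (P (Suc k)) (d (Suc k)) X z) = \<one>\<^bsub>ob (box G (P k) N) X\<^esub>"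
      by (rule T_zero[OF P.zmod P.zmod P.zmod P.d P.d _ a]) (rule P.d_d)
  qed
qed

lemma chain_map:
  assumes "free_res G M P d \<epsilon>" "free_res G M Q d' \<epsilon>'" and f: "chain_map G P d Q d' f"
  shows "chain_map G (\<lambda>k. box G (P k) N) (\<lambda>k. T (P (Suc k)) (P k) (d k))
    (\<lambda>k. box G (Q k) N) (\<lambda>k. T (Q (Suc k)) (Q k) (d' k)) (\<lambda>k. T (P k) (Q k) (f k))"
proof -
  interpret P: free_res G M P d \<epsilon> by fact
  interpret Q: free_res G M Q d' \<epsilon>' by fact
  have fz: "f k \<in> zhom G (P k) (Q k)" for k using f by (simp add: chain_map_def)
  have fd: "d' k X (f (Suc k) X m) = f k X (d k X m)" if "X \<in> gsets G" "m \<in> carrier (ob (P (Suc k)) X)" for k X m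
    using f that by (simp add: chain_map_def)
  show ?thesis
    unfolding chain_map_def
    using T_in[OF P.zmod Q.zmod fz] T_comp[OF P.zmod Q.zmod P.zmod Q.zmod fz Q.d P.d fz fd] by blast
qed

lemma homotopic_id:
  assumes "free_res G M P d \<epsilon>" and Q: "\<And>k. zmodule G (Q k)"
    and f: "\<And>k. f k \<in> zhom G (P k) (Q k)" and g: "\<And>k. g k \<in> zhom G (Q k) (P k)"
    and h: "homotopic_id G P d (\<lambda>k. zcomp G (P k) (g k) (f k))"
  shows "homotopic_id G (\<lambda>k. box G (P k) N) (\<lambda>k. T (P (Suc k)) (P k) (d k))
    (\<lambda>k. zcomp G (box G (P k) N) (T (Q k) (P k) (g k)) (T (P k) (Q k) (f k)))"
proof -
  interpret P: free_res G M P d \<epsilon> by fact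
  obtain s where s: "\<forall>k. s k \<in> zhom G (P k) (P (Suc k))"
    and s0: "\<forall>X\<in>gsets G. \<forall>m\<in>carrier (ob (P 0) X). zcomp G (P 0) (g 0) (f 0) X m = m \<otimes>\<^bsub>ob (P 0) X\<^esub> d 0 X (s 0 X m)"
    and sk: "\<forall>k. \<forall>X\<in>gsets G. \<forall>m\<in>carrier (ob (P (Suc k)) X). zcomp G (P (Suc k)) (g (Suc k)) (f (Suc k)) X m =
      m \<otimes>\<^bsub>ob (P (Suc k)) X\<^esub> d (Suc k) X (s (Suc k) X m) \<otimes>\<^bsub>ob (P (Suc k)) X\<^esub> s k X (d k X m)"
    using h unfolding homotopic_id_def by blast
  have sz: "s k \<in> zhom G (P k) (P (Suc k))" for k using s by blast
  have e0: "g 0 X (f 0 X m) = m \<otimes>\<^bsub>ob (P 0) X\<^esub> d 0 X (s 0 X m)"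
    if "X \<in> gsets G" "m \<in> carrier (ob (P 0) X)" for X m
    using s0[rule_format, OF that] that by simp
  have ek: "g (Suc k) X (f (Suc k) X m) =
      m \<otimes>\<^bsub>ob (P (Suc k)) X\<^esub> d (Suc k) X (s (Suc k) X m) \<otimes>\<^bsub>ob (P (Suc k)) X\<^esub> s k X (d k X m)"
    if "X \<in> gsets G" "m \<in> carrier (ob (P (Suc k)) X)" for X m k
    using sk[rule_format, OF that] that by simp
  show ?thesis
    unfolding homotopic_id_def
  proof (intro exI[of _ "\<lambda>k. T (P k) (P (Suc k)) (s k)"] conjI allI ballI)
    fix k show "T (P k) (P (Suc k)) (s k) \<in> zhom G (box G (P k) N) (box G (P (Suc k)) N)"
      by (rule T_in[OF P.zmod P.zmod sz])
  next
    fix X m assume X: "X \<in> gsets G" "m \<in> carrier (ob (box G (P 0) N) X)"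
    then show "zcomp G (box G (P 0) N) (T (Q 0) (P 0) (g 0)) (T (P 0) (Q 0) (f 0)) X m =
      m \<otimes>\<^bsub>ob (box G (P 0) N) X\<^esub> T (P (Suc 0)) (P 0) (d 0) X (T (P 0) (P (Suc 0)) (s 0) X m)"
      using T_homotopy0[OF P.zmod Q P.zmod f g sz P.d e0 X] by simp
  next
    fix k X m assume X: "X \<in> gsets G" "m \<in> carrier (ob (box G (P (Suc k)) N) X)"
    then show "zcomp G (box G (P (Suc k)) N) (T (Q (Suc k)) (P (Suc k)) (g (Suc k))) (T (P (Suc k)) (Q (Suc k)) (f (Suc k))) X m =
      m \<otimes>\<^bsub>ob (box G (P (Suc k)) N) X\<^esub> T (P (Suc (Suc k))) (P (Suc k)) (d (Suc k)) X (T (P (Suc k)) (P (Suc (Suc k))) (s (Suc k)) X m)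
      \<otimes>\<^bsub>ob (box G (P (Suc k)) N) X\<^esub> T (P k) (P (Suc k)) (s k) X (T (P (Suc k)) (P k) (d k) X m)"
      using T_homotopy[OF P.zmod Q P.zmod P.zmod f g sz P.d P.d sz ek X] by simp
  qed
qed

lemma homology_independent:
  assumes P: "free_res G M P d \<epsilon>" and Q: "free_res G M Q d' \<epsilon>'"
  shows "zmod_iso G (chain_homology (\<lambda>k. box G (P k) N) (\<lambda>k. T (P (Suc k)) (P k) (d k)) i)
    (chain_homology (\<lambda>k. box G (Q k) N) (\<lambda>k. T (Q (Suc k)) (Q k) (d' k)) i)"
proof -
  obtain f g where f: "chain_map G P d Q d' f" and g: "chain_map G Q d' P d g"
    and gf: "homotopic_id G P d (\<lambda>k. zcomp G (P k) (g k) (f k))"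
    and fg: "homotopic_id G Q d' (\<lambda>k. zcomp G (Q k) (f k) (g k))"
    using resolutions_homotopy_equivalent[OF P Q] .
  have fz: "f k \<in> zhom G (P k) (Q k)" "g k \<in> zhom G (Q k) (P k)" for k using f g by (auto simp: chain_map_def)
  show ?thesis
    by (rule chain_homology_iso[of G _ _ _ _ "\<lambda>k. T (P k) (Q k) (f k)" "\<lambda>k. T (Q k) (P k) (g k)"])
      (auto simp: chain_retract_def chain_retract_axioms_def chain_complex[OF P] chain_complex[OF Q]
        chain_map[OF P Q f] chain_map[OF Q P g] homotopic_id[OF P free_res.zmod[OF Q] fz gf]
        homotopic_id[OF Q free_res.zmod[OF P] fz(2,1) fg])
qed

end

context additive_ihom begin

lemma cochain_complex:
  assumes "free_res G M P d \<epsilon>"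
  shows "cochain_complex G (\<lambda>k. ihom G (P k) N) (\<lambda>k. ihom_pre G (P (Suc k)) (P k) N (d k))"
proof -
  interpret P: free_res G M P d \<epsilon> by fact
  show ?thesis
  proof (rule cochain_complex.intro)
    fix k X z
    show "zmodule G (ihom G (P k) N)" by (rule zmodule_ihom_N[OF P.zmod])
    show "ihom_pre G (P (Suc k)) (P k) N (d k) \<in> zhom G (ihom G (P k) N) (ihom G (P (Suc k)) N)"
      by (rule E_in[OF P.zmod P.zmod P.d])
    assume a: "X \<in> gsets G" "z \<in> carrier (ob (ihom G (P k) N) X)"
    show "ihom_pre G (P (Suc (Suc k))) (P (Suc k)) N (d (Suc k)) X (ihom_pre G (P (Suc k)) (P k) N (d k) X z)
        = \<one>\<^bsub>ob (ihom G (P (Suc (Suc k))) N) X\<^esub>"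
      by (rule E_zero[OF P.zmod P.zmod P.zmod P.d P.d _ a]) (rule P.d_d)
  qed
qed

lemma cochain_map:
  assumes "free_res G M P d \<epsilon>" "free_res G M Q d' \<epsilon>'" and f: "chain_map G P d Q d' f"
  shows "cochain_map G (\<lambda>k. ihom G (Q k) N) (\<lambda>k. ihom_pre G (Q (Suc k)) (Q k) N (d' k))
    (\<lambda>k. ihom G (P k) N) (\<lambda>k. ihom_pre G (P (Suc k)) (P k) N (d k)) (\<lambda>k. ihom_pre G (P k) (Q k) N (f k))"
proof -
  interpret P: free_res G M P d \<epsilon> by fact
  interpret Q: free_res G M Q d' \<epsilon>' by fact
  have fz: "f k \<in> zhom G (P k) (Q k)" for k using f by (simp add: chain_map_def)
  have fd: "d' k X (f (Suc k) X m) = f k X (d k X m)" if "X \<in> gsets G" "m \<in> carrier (ob (P (Suc k)) X)" for k X m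
    using f that by (simp add: chain_map_def)
  show ?thesis
    unfolding cochain_map_def
    using E_in[OF P.zmod Q.zmod fz] E_comp[OF P.zmod Q.zmod P.zmod Q.zmod fz Q.d P.d fz fd] by blast
qed

lemma cohomotopic_id:
  assumes "free_res G M P d \<epsilon>" and Q: "\<And>k. zmodule G (Q k)"
    and f: "\<And>k. f k \<in> zhom G (P k) (Q k)" and g: "\<And>k. g k \<in> zhom G (Q k) (P k)"
    and h: "homotopic_id G P d (\<lambda>k. zcomp G (P k) (g k) (f k))"
  shows "cohomotopic_id G (\<lambda>k. ihom G (P k) N) (\<lambda>k. ihom_pre G (P (Suc k)) (P k) N (d k))
    (\<lambda>k. zcomp G (ihom G (P k) N) (ihom_pre G (P k) (Q k) N (f k)) (ihom_pre G (Q k) (P k) N (g k)))"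
proof -
  interpret P: free_res G M P d \<epsilon> by fact
  obtain s where s: "\<forall>k. s k \<in> zhom G (P k) (P (Suc k))"
    and s0: "\<forall>X\<in>gsets G. \<forall>m\<in>carrier (ob (P 0) X). zcomp G (P 0) (g 0) (f 0) X m = m \<otimes>\<^bsub>ob (P 0) X\<^esub> d 0 X (s 0 X m)"
    and sk: "\<forall>k. \<forall>X\<in>gsets G. \<forall>m\<in>carrier (ob (P (Suc k)) X). zcomp G (P (Suc k)) (g (Suc k)) (f (Suc k)) X m =
      m \<otimes>\<^bsub>ob (P (Suc k)) X\<^esub> d (Suc k) X (s (Suc k) X m) \<otimes>\<^bsub>ob (P (Suc k)) X\<^esub> s k X (d k X m)"
    using h unfolding homotopic_id_def by blast
  have sz: "s k \<in> zhom G (P k) (P (Suc k))" for k using s by blast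
  have e0: "g 0 X (f 0 X m) = m \<otimes>\<^bsub>ob (P 0) X\<^esub> d 0 X (s 0 X m)"
    if "X \<in> gsets G" "m \<in> carrier (ob (P 0) X)" for X m
    using s0[rule_format, OF that] that by simp
  have ek: "g (Suc k) X (f (Suc k) X m) =
      m \<otimes>\<^bsub>ob (P (Suc k)) X\<^esub> d (Suc k) X (s (Suc k) X m) \<otimes>\<^bsub>ob (P (Suc k)) X\<^esub> s k X (d k X m)"
    if "X \<in> gsets G" "m \<in> carrier (ob (P (Suc k)) X)" for X m k
    using sk[rule_format, OF that] that by simp
  show ?thesis
    unfolding cohomotopic_id_def
  proof (intro exI[of _ "\<lambda>k. ihom_pre G (P k) (P (Suc k)) N (s k)"] conjI allI ballI)
    fix k show "ihom_pre G (P k) (P (Suc k)) N (s k) \<in> zhom G (ihom G (P (Suc k)) N) (ihom G (P k) N)"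
      by (rule E_in[OF P.zmod P.zmod sz])
  next
    fix X m assume X: "X \<in> gsets G" "m \<in> carrier (ob (ihom G (P 0) N) X)"
    then show "zcomp G (ihom G (P 0) N) (ihom_pre G (P 0) (Q 0) N (f 0)) (ihom_pre G (Q 0) (P 0) N (g 0)) X m =
      m \<otimes>\<^bsub>ob (ihom G (P 0) N) X\<^esub> ihom_pre G (P 0) (P (Suc 0)) N (s 0) X (ihom_pre G (P (Suc 0)) (P 0) N (d 0) X m)"
      using E_homotopy0[OF P.zmod Q P.zmod f g sz P.d e0 X] by simp
  next
    fix k X m assume X: "X \<in> gsets G" "m \<in> carrier (ob (ihom G (P (Suc k)) N) X)"
    then show "zcomp G (ihom G (P (Suc k)) N) (ihom_pre G (P (Suc k)) (Q (Suc k)) N (f (Suc k))) (ihom_pre G (Q (Suc k)) (P (Suc k)) N (g (Suc k))) X m =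
      m \<otimes>\<^bsub>ob (ihom G (P (Suc k)) N) X\<^esub> ihom_pre G (P (Suc k)) (P (Suc (Suc k))) N (s (Suc k)) X (ihom_pre G (P (Suc (Suc k))) (P (Suc k)) N (d (Suc k)) X m)
      \<otimes>\<^bsub>ob (ihom G (P (Suc k)) N) X\<^esub> ihom_pre G (P (Suc k)) (P k) N (d k) X (ihom_pre G (P k) (P (Suc k)) N (s k) X m)"
      using E_homotopy[OF P.zmod Q P.zmod P.zmod f g sz P.d P.d sz ek X] by simp
  qed
qed

lemma cohomology_independent:
  assumes P: "free_res G M P d \<epsilon>" and Q: "free_res G M Q d' \<epsilon>'"
  shows "zmod_iso G (cochain_cohomology (\<lambda>k. ihom G (P k) N) (\<lambda>k. ihom_pre G (P (Suc k)) (P k) N (d k)) i)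
    (cochain_cohomology (\<lambda>k. ihom G (Q k) N) (\<lambda>k. ihom_pre G (Q (Suc k)) (Q k) N (d' k)) i)"
proof -
  obtain f g where f: "chain_map G P d Q d' f" and g: "chain_map G Q d' P d g"
    and gf: "homotopic_id G P d (\<lambda>k. zcomp G (P k) (g k) (f k))"
    and fg: "homotopic_id G Q d' (\<lambda>k. zcomp G (Q k) (f k) (g k))"
    using resolutions_homotopy_equivalent[OF P Q] .
  have fz: "f k \<in> zhom G (P k) (Q k)" "g k \<in> zhom G (Q k) (P k)" for k using f g by (auto simp: chain_map_def)
  show ?thesis
    \<comment> \<open>Contravariance exchanges the roles of \<open>f\<close> and \<open>g\<close>:
      the map from the complex of \<open>P\<close> to that of \<open>Q\<close> is induced by
      \<open>g\<close>.\<close>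
    by (rule cochain_cohomology_iso[of G _ _ _ _ "\<lambda>k. ihom_pre G (Q k) (P k) N (g k)" "\<lambda>k. ihom_pre G (P k) (Q k) N (f k)"])
      (auto simp: cochain_retract_def cochain_retract_axioms_def cochain_complex[OF P] cochain_complex[OF Q]
        cochain_map[OF P Q f] cochain_map[OF Q P g] cohomotopic_id[OF P free_res.zmod[OF Q] fz gf]
        cohomotopic_id[OF Q free_res.zmod[OF P] fz(2,1) fg])
qed

end

text \<open>\<open>SOME\<close> is known to give a resolution only after one with the same element
  type has been exhibited. Therefore \<open>Q\<close> is required in exactly that type.\<close>

lemma some_resolution:
  fixes Q :: "nat \<Rightarrow> ('g, 'm \<times> nat \<Rightarrow> int) zmod" and M :: "('g, 'm) zmod"
  assumes "zmodule G M" "free_resolution G M Q d' \<epsilon>'"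
  obtains P d \<epsilon> where "some_resolution G M = (P, d)" "free_res G M P d \<epsilon>"
proof -
  obtain P d where Pd: "some_resolution G M = (P, d)" by (cases "some_resolution G M")
  have "case_prod (\<lambda>P d. \<exists>\<epsilon>. free_resolution G M P d \<epsilon>) (Q, d')" using assms(2) by auto
  then have "case_prod (\<lambda>P d. \<exists>\<epsilon>. free_resolution G M P d \<epsilon>) (some_resolution G M)"
    unfolding some_resolution_def by (rule someI[of "case_prod (\<lambda>P d. \<exists>\<epsilon>. free_resolution G M P d \<epsilon>)"])
  then show thesis using that Pd assms(1) by (auto simp: free_res_def)
qed

lemma Tor_iso:
  fixes Q :: "nat \<Rightarrow> ('g, 'm \<times> nat \<Rightarrow> int) zmod" and M :: "('g, 'm) zmod"
  assumes M: "zmodule G M" and N: "zmodule G N" and Q: "free_resolution G M Q d' \<epsilon>'"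
  shows "zmod_iso G (Tor G i M N) (chain_homology (\<lambda>k. box G (Q k) N)
    (\<lambda>k. box_map G (Q (Suc k)) N (Q k) N (d' k) (zid G N)) i)"
proof -
  obtain P d \<epsilon> where P: "some_resolution G M = (P, d)" "free_res G M P d \<epsilon>" using some_resolution[OF M Q] .
  have "free_res G M Q d' \<epsilon>'" using M Q by (simp add: free_res_def)
  moreover have "additive_tensor G N" using N by (simp add: additive_tensor_def)
  ultimately show ?thesis using additive_tensor.homology_independent[OF _ P(2)] by (simp add: Tor_def P(1))
qed

lemma Ext_iso:
  fixes Q :: "nat \<Rightarrow> ('g, 'm \<times> nat \<Rightarrow> int) zmod" and M :: "('g, 'm) zmod"
  assumes M: "zmodule G M" and N: "zmodule G N" and Q: "free_resolution G M Q d' \<epsilon>'"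
  shows "zmod_iso G (Ext G i M N) (cochain_cohomology (\<lambda>k. ihom G (Q k) N)
    (\<lambda>k. ihom_pre G (Q (Suc k)) (Q k) N (d' k)) i)"
proof -
  obtain P d \<epsilon> where P: "some_resolution G M = (P, d)" "free_res G M P d \<epsilon>" using some_resolution[OF M Q] .
  have "free_res G M Q d' \<epsilon>'" using M Q by (simp add: free_res_def)
  moreover have "additive_ihom G N" using N by (simp add: additive_ihom_def)
  ultimately show ?thesis using additive_ihom.cohomology_independent[OF _ P(2)] by (simp add: Ext_def P(1))
qed

section \<open>Divisibility\<close>

text \<open>If \<open>x\<close> has stabilizer \<open>H\<close> and orbit of size \<open>p\<close>, then \<open>weight b p\<close> is the index of
  \<open>H \<inter> K\<close> in \<open>H\<close>, where \<open>K\<close> is the subgroup of order \<open>n div b\<close>. The convention \<open>weight 0 p = 0\<close>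
  makes the constant module the quotient belonging to \<open>b = 0\<close>.\<close>

definition weight :: "nat \<Rightarrow> nat \<Rightarrow> nat" where
  "weight b p = b div gcd b p"

text \<open>After cancelling gcd(b, p) the cofactor of p is coprime to the modulus; for b = 0 both
  sides say t = 0. This turns congruences with varying moduli \<open>weight b p\<close> into
  congruences modulo the single number b.\<close>

lemma weight_dvd_iff:
  assumes "p > 0"
  shows "int (weight b p) dvd t \<longleftrightarrow> int b dvd int p * t"
proof (cases "b = 0")
  case True
  then show ?thesis using assms by (simp add: weight_def)
next
  case False
  define g where "g = gcd b p"
  obtain b' p' where bp: "b = b' * g" "p = p' * g" "coprime b' p'"
    using gcd_coprime_exists[of b p] False unfolding g_def by auto
  have g: "g > 0" using False by (simp add: g_def)
  have "int b dvd int p * t \<longleftrightarrow> int g * int b' dvd int g * (int p' * t)"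
    by (simp add: bp(1,2) mult_ac)
  also have "\<dots> \<longleftrightarrow> int b' dvd int p' * t" using g by simp
  also have "\<dots> \<longleftrightarrow> int b' dvd t" using bp(3) by (simp add: coprime_dvd_mult_right_iff)
  also have "b' = weight b p" unfolding weight_def using g bp(1) g_def by (metis nonzero_mult_div_cancel_right gr_implies_not0)
  finally show ?thesis by simp
qed

lemma mult_weight: "p * weight a p = lcm a p"
  by (simp add: weight_def lcm_nat_def div_mult_swap mult.commute)

lemma mult_weight_int: "int p * int (weight a p) = int (lcm a p)"
  using mult_weight[of p a] by (simp flip: of_nat_mult)

lemma lcm_pos: "a > 0 \<Longrightarrow> p > 0 \<Longrightarrow> lcm a p > (0::nat)"
  by (simp add: lcm_pos_nat)

text \<open>Both sides say that b divides lcm(a, p) * t, because p * \<open>weight a p\<close> =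
  lcm(a, p). It passes from the modulus over X to the modulus over S x X.\<close>

lemma weight_transfer:
  assumes "a > 0" "p > 0"
  shows "int (weight b p) dvd int (weight a p) * t \<longleftrightarrow> int (weight b (lcm a p)) dvd t"
  using assms by (simp add: weight_dvd_iff lcm_pos mult_weight_int mult.assoc[symmetric] del: of_nat_mult)

text \<open>b divides lcm(a, b) = a * \<open>weight b a\<close>, and a divides lcm(a, p). So
  multiples of \<open>weight b a\<close> lie in the kernel in degree 3.\<close>

lemma weight_lcm_dvd:
  assumes "a > 0" "p > 0" shows "int (weight b (lcm a p)) dvd int (weight b a) * u"
proof -
  have "int b dvd int a * int (weight b a)" by (simp add: mult_weight_int)
  moreover have "int a dvd int (lcm a p)" by simp
  ultimately have "int b dvd int (lcm a p) * int (weight b a)"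
    by (meson dvd_trans mult_dvd_mono dvd_refl)
  then show ?thesis using assms by (simp add: weight_dvd_iff lcm_pos mult.assoc[symmetric])
qed

lemma linear_congruence:
  "(\<exists>q. (b::int) dvd c - m * q) \<longleftrightarrow> gcd b m dvd c"
proof
  assume "gcd b m dvd c"
  then obtain k where k: "c = gcd b m * k" by auto
  obtain u v where "u * b + v * m = gcd b m" using bezout_int by blast
  then have "c - m * (v * k) = b * (u * k)" by (simp add: k algebra_simps flip: distrib_left) (metis distrib_right mult.commute mult.assoc)
  then show "\<exists>q. b dvd c - m * q" by (metis dvd_triv_left)
next
  assume "\<exists>q. b dvd c - m * q"
  then obtain q where "b dvd c - m * q" ..
  then have "gcd b m dvd (c - m * q) + m * q" by (intro dvd_add) (auto intro: dvd_trans)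
  then show "gcd b m dvd c" by simp
qed

text \<open>Multiplied by p, the question is whether p u is a multiple of lcm(a, p) modulo b, that
  is, whether gcd(b, lcm(a, p)) divides p u. By distributivity this gcd is lcm(gcd(b, a), gcd(b,
  p)), and its second part divides p u anyway. The cokernel of the transfer is thereby the quotient
  for gcd(a, b).\<close>

lemma weight_split:
  assumes p: "p > 0" and a: "a > 0"
  shows "(\<exists>q. int (weight b p) dvd u - int (weight a p) * q) \<longleftrightarrow> int (weight (gcd a b) p) dvd u"
proof -
  have "(\<exists>q. int (weight b p) dvd u - int (weight a p) * q) \<longleftrightarrow> (\<exists>q. int b dvd int p * u - int (lcm a p) * q)"
    using p by (simp add: weight_dvd_iff right_diff_distrib mult.assoc[symmetric] mult_weight_int)
  also have "\<dots> \<longleftrightarrow> gcd (int b) (int (lcm a p)) dvd int p * u" by (rule linear_congruence)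
  also have "gcd (int b) (int (lcm a p)) = int (lcm (gcd b a) (gcd b p))"
    by (simp add: gcd_lcm_distrib[symmetric])
  also have "\<dots> dvd int p * u \<longleftrightarrow> int (gcd a b) dvd int p * u"
    by (auto simp: gcd.commute[of b a] simp flip: lcm_int_int_eq intro: dvd_trans)
  finally show ?thesis using p by (simp add: weight_dvd_iff)
qed

text \<open>b = \<open>weight b a\<close> * gcd(a, b), and the first factor cancels. This finds the
  kernel of multiplication by b / gcd(a, b).\<close>

lemma weight_kernel:
  assumes p: "p > 0" and a: "a > 0" and b: "b > 0"
  shows "int (weight b p) dvd int (weight b a) * u \<longleftrightarrow> int (weight (gcd a b) p) dvd u"
proof -
  define g where "g = gcd a b"
  have g: "g > 0" using a by (simp add: g_def)
  have bg: "b = weight b a * g" by (simp add: weight_def g_def gcd.commute)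
  then have w: "weight b a > 0" using b by (cases "weight b a") auto
  have "int (weight b p) dvd int (weight b a) * u \<longleftrightarrow> int (weight b a) * int g dvd int (weight b a) * (int p * u)"
    using p bg by (simp add: weight_dvd_iff mult_ac flip: of_nat_mult)
  also have "\<dots> \<longleftrightarrow> int g dvd int p * u" using w by simp
  finally show ?thesis using p by (simp add: weight_dvd_iff g_def)
qed

text \<open>Put g = gcd(a, b). The hypothesis times gcd(a, p) says b * gcd(a, p) divides a p u, so b
  * gcd(p, g) divides both a p u and b p u, hence g p u by Bezout. Cancelling g leaves
  \<open>weight b a\<close> * gcd(p, g) = gcd(b, p * \<open>weight b a\<close>) dividing p u, which
  is the criterion of \<open>linear_congruence\<close>. It makes multiplication by b / gcd(a, b)
  reach the whole kernel in degree 3.\<close>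

lemma weight_lift:
  assumes p: "p > 0" and a: "a > 0" and b: "b > 0" and u: "int (weight b (lcm a p)) dvd u"
  shows "\<exists>u'. int (weight b p) dvd u - int (weight b a) * u'"
proof -
  define g where "g = gcd a b"
  have g: "g > 0" using a by (simp add: g_def)
  have bg: "b = weight b a * g" by (simp add: weight_def g_def gcd.commute)
  have "int b dvd int (lcm a p) * u" using u a p by (simp add: weight_dvd_iff lcm_pos)
  then have "int b * int (gcd a p) dvd int (gcd a p) * (int (lcm a p) * u)" by (simp add: mult.commute)
  also have "\<dots> = int a * (int p * u)" by (simp add: mult.assoc[symmetric] flip: of_nat_mult)
  finally have "int b * int (gcd p g) dvd int a * (int p * u)"
  proof (rule dvd_trans[rotated])
    have "gcd p g dvd gcd a p" unfolding g_def by (metis gcd.assoc gcd.commute gcd_dvd1)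
    then show "int b * int (gcd p g) dvd int b * int (gcd a p)" by simp
  qed
  moreover have "int b * int (gcd p g) dvd int b * (int p * u)" by (auto intro!: mult_dvd_mono)
  moreover obtain x y where "x * int a + y * int b = int g"
    using bezout_int[of "int a" "int b"] by (auto simp: g_def)
  then have "int g * (int p * u) = x * (int a * (int p * u)) + y * (int b * (int p * u))"
    by (simp add: algebra_simps flip: \<open>x * int a + y * int b = int g\<close>)
  ultimately have "int b * int (gcd p g) dvd int g * (int p * u)" by simp
  then have "int g * (int (weight b a) * int (gcd p g)) dvd int g * (int p * u)"
    by (subst (asm) bg) (simp add: mult_ac)
  then have "int (weight b a) * int (gcd p g) dvd int p * u" using g by simp
  also have "int (weight b a) * int (gcd p g) = gcd (int b) (int p * int (weight b a))"
  proof -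
    have "weight b a * gcd p g = gcd b (p * weight b a)"
      using gcd_mult_distrib_nat[of "weight b a" g p] bg by (metis gcd.commute mult.commute)
    then show ?thesis by (simp flip: of_nat_mult)
  qed
  finally have "\<exists>q. int b dvd int p * u - (int p * int (weight b a)) * q" by (simp only: linear_congruence)
  then show ?thesis using p by (simp add: weight_dvd_iff algebra_simps)
qed

section \<open>Periodic sequences\<close>

lemma periodic_gcd:
  fixes f :: "nat \<Rightarrow> 'a"
  assumes "\<And>j. f (j + a) = f j" "\<And>j. f (j + p) = f j" "a > 0"
  shows "f (j + gcd a p) = f j"
proof -
  have m: "f (j + a * k) = f j" "f (j + p * k) = f j" for j k
    by (induction k) (use assms(1,2) in \<open>auto simp: add.assoc[symmetric] add.commute[of a] add.commute[of p]\<close>)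
  obtain x y where "a * x = p * y + gcd a p" using bezout_nat[of a p] assms(3) by auto
  then have "f (j + gcd a p + p * y) = f (j + a * x)" by (simp add: add_ac)
  then show ?thesis using m by simp
qed

lemma periodic_mod:
  fixes f :: "nat \<Rightarrow> 'a"
  assumes "\<And>j. f (j + e) = f j" shows "f (j mod e) = f j"
proof -
  have "f (j + e * k) = f j" for j k
    by (induction k) (use assms in \<open>auto simp: add.assoc[symmetric] add.commute[of e]\<close>)
  from this[of "j mod e" "j div e"] show ?thesis by simp
qed

lemma periodic_sum:
  fixes f :: "nat \<Rightarrow> int"
  assumes "\<And>j. f (j + e) = f j" shows "(\<Sum>j<q * e. f j) = int q * (\<Sum>j<e. f j)"
proof (induction q)
  case 0
  then show ?case by simp
next
  case (Suc q)
  have "(\<Sum>j<m + e. f j) = (\<Sum>j<m. f j) + (\<Sum>j<e. f (m + j))" for m e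
    by (induction e) auto
  from this[of "q * e" e] have "(\<Sum>j<Suc q * e. f j) = (\<Sum>j<q * e. f j) + (\<Sum>j<e. f (q * e + j))"
    by (simp add: add.commute)
  moreover have "f (q * e + j) = f j" for j
    using periodic_mod[of f e, OF assms] by (metis mod_mult_self3)
  ultimately show ?case using Suc by (simp add: algebra_simps)
qed

section \<open>Finite sets with an action of a cyclic group\<close>

locale cyc = group G for G :: "'g monoid" (structure) +
  fixes c
  assumes c [simp]: "c \<in> carrier G" and fin: "finite (carrier G)" and gen: "carrier G = range (\<lambda>k::nat. c [^] k)"
begin

definition n where "n = order G"

lemma n_pos: "n > 0"
  using fin order_gt_0_iff_finite by (simp add: n_def)

lemma c_n: "c [^] n = \<one>"
  using pow_order_eq_1[OF c] by (simp add: n_def)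

lemma ord_c: "ord c = n"
proof -
  have "generate G {c} = carrier G"
    unfolding generate_pow_on_finite_carrier[OF fin c] gen by auto
  then show ?thesis using generate_pow_card[OF c] by (simp add: n_def order_def)
qed

abbreviation tau where "tau X k x \<equiv> act X (c [^] (k::nat)) x"

lemma tau_0: "\<lbrakk>X \<in> gsets G; x \<in> pts X\<rbrakk> \<Longrightarrow> tau X 0 x = x"
  by (simp add: act_one)

lemma tau_in: "\<lbrakk>X \<in> gsets G; x \<in> pts X\<rbrakk> \<Longrightarrow> tau X k x \<in> pts X"
  by (simp add: act_closed)

lemma tau_add: "\<lbrakk>X \<in> gsets G; x \<in> pts X\<rbrakk> \<Longrightarrow> tau X (j + k) x = tau X j (tau X k x)"
  using act_mult[of X G "c [^] j" "c [^] k" x] by (simp add: nat_pow_mult)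

lemma tau_Suc: "\<lbrakk>X \<in> gsets G; x \<in> pts X\<rbrakk> \<Longrightarrow> tau X (Suc k) x = act X c (tau X k x)"
  using tau_add[of X x 1 k] by simp

lemma tau_n: "\<lbrakk>X \<in> gsets G; x \<in> pts X\<rbrakk> \<Longrightarrow> tau X n x = x"
  by (simp add: c_n act_one)

lemma invariant_iff:
  assumes X: "X \<in> gsets G"
  shows "(\<forall>g\<in>carrier G. \<forall>x\<in>pts X. U (act X g x) = U x) \<longleftrightarrow> (\<forall>x\<in>pts X. U (act X c x) = U x)"
proof
  assume h: "\<forall>x\<in>pts X. U (act X c x) = U x"
  have "U (tau X k x) = U x" if x: "x \<in> pts X" for k x
  proof (induction k)
    case 0
    show ?case by (simp only: tau_0[OF X x])
  next
    case (Suc k)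
    then show ?case using h tau_in[OF X x] by (simp only: tau_Suc[OF X x])
  qed
  then show "\<forall>g\<in>carrier G. \<forall>x\<in>pts X. U (act X g x) = U x" using gen by auto
qed auto

text \<open>The number of points in the orbit of \<open>x\<close>, equally the index of its
  stabilizer.\<close>

definition per where "per X x = (LEAST p. p > 0 \<and> tau X p x = x)"

lemma per: assumes "X \<in> gsets G" "x \<in> pts X"
  shows "per X x > 0" "tau X (per X x) x = x"
  using LeastI[of "\<lambda>p. p > 0 \<and> tau X p x = x" n] n_pos tau_n assms by (auto simp: per_def)

lemma per_iff:
  assumes X: "X \<in> gsets G" and x: "x \<in> pts X"
  shows "tau X k x = x \<longleftrightarrow> per X x dvd k"
proof -
  let ?p = "per X x"
  have m: "tau X (j + ?p * q) x = tau X j x" for j q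
    by (induction q) (use X x in \<open>auto simp: per tau_add add.assoc[symmetric] simp flip: add.commute[of "?p * _" ?p]\<close>)
  have "tau X k x = tau X (k mod ?p) x" using m[of "k mod ?p" "k div ?p"] by simp
  moreover have "tau X (k mod ?p) x = x \<longleftrightarrow> k mod ?p = 0"
  proof
    assume h: "tau X (k mod ?p) x = x"
    show "k mod ?p = 0"
    proof (rule ccontr)
      assume "k mod ?p \<noteq> 0"
      then have "?p \<le> k mod ?p" unfolding per_def using h by (intro Least_le) (auto simp: per_def)
      then show False using per(1)[OF X x] by (meson mod_less_divisor not_le)
    qed
  qed (use X x in \<open>auto simp: act_one\<close>)
  ultimately show ?thesis by (auto simp: dvd_eq_mod_eq_0)
qed

lemma per_eqI:
  assumes "X \<in> gsets G" "x \<in> pts X" "\<And>k. tau X k x = x \<longleftrightarrow> p dvd k"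
  shows "per X x = p"
  using per_iff[OF assms(1,2)] assms(3) by (meson dvd_antisym dvd_refl)

lemma tau_eq_iff:
  assumes X: "X \<in> gsets G" and x: "x \<in> pts X"
  shows "tau X i x = tau X j x \<longleftrightarrow> i mod per X x = j mod per X x"
proof -
  have "tau X i x = tau X j x \<longleftrightarrow> i mod per X x = j mod per X x" if "i \<le> j" for i j
  proof -
    have e: "tau X j x = tau X i (tau X (j - i) x)" using tau_add[OF X x, of i "j - i"] that by simp
    have "tau X i x = tau X j x \<longleftrightarrow> x = tau X (j - i) x"
      unfolding e using act_inj[OF X nat_pow_closed[OF c] x tau_in[OF X x], of i "j - i"] arg_cong by metis
    also have "\<dots> \<longleftrightarrow> per X x dvd j - i" unfolding per_iff[OF X x, symmetric] by (rule eq_commute)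
    also have "\<dots> \<longleftrightarrow> j mod per X x = i mod per X x" using that by (simp add: mod_eq_dvd_iff_nat)
    finally show ?thesis by (simp only: eq_commute[of "i mod _"])
  qed
  from this[of i j] this[of j i] show ?thesis by (metis nat_le_linear)
qed

lemma per_tau:
  assumes X: "X \<in> gsets G" and x: "x \<in> pts X"
  shows "per X (tau X j x) = per X x"
proof (rule per_eqI[OF X tau_in[OF X x]])
  fix k
  have "tau X k (tau X j x) = tau X j x \<longleftrightarrow> tau X j (tau X k x) = tau X j x"
    using tau_add[OF X x] by (metis add.commute)
  also have "\<dots> \<longleftrightarrow> tau X k x = x" using act_inj[OF X nat_pow_closed[OF c] tau_in[OF X x] x, of j k] by auto
  finally show "tau X k (tau X j x) = tau X j x \<longleftrightarrow> per X x dvd k" using per_iff[OF X x] by simp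
qed

lemma per_act: "\<lbrakk>X \<in> gsets G; x \<in> pts X\<rbrakk> \<Longrightarrow> per X (act X c x) = per X x"
  using per_tau[of X x 1] by simp

text \<open>The stabilizer of a pair is the intersection of the stabilizers, and in a cyclic group
  indices of intersections are least common multiples.\<close>

lemma per_prod:
  assumes "S \<in> gsets G" "X \<in> gsets G" "s \<in> pts S" "x \<in> pts X"
  shows "per (prod_gset S X) (Tup s x) = lcm (per S s) (per X x)"
  by (rule per_eqI) (use assms in \<open>auto simp: per_iff\<close>)

text \<open>A reference point of the orbit. The defining predicate is the same for all points of an
  orbit, so \<open>SOME\<close> returns the same point for each of them; \<open>idx\<close> then
  measures how far a point is from it.\<close>

definition base where "base X x = (SOME z. \<exists>k. z = tau X k x)"
definition idx where "idx X x = (SOME k. tau X k x = base X x)"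

lemma base_idx: "tau X (idx X x) x = base X x"
proof -
  have "\<exists>k. base X x = tau X k x" unfolding base_def by (rule someI_ex) blast
  then have "\<exists>k. tau X k x = base X x" by metis
  then show ?thesis unfolding idx_def by (rule someI_ex)
qed

lemma base_in: "\<lbrakk>X \<in> gsets G; x \<in> pts X\<rbrakk> \<Longrightarrow> base X x \<in> pts X"
  using base_idx tau_in by metis

lemma per_base: "\<lbrakk>X \<in> gsets G; x \<in> pts X\<rbrakk> \<Longrightarrow> per X (base X x) = per X x"
  using base_idx per_tau by metis

lemma base_act:
  assumes X: "X \<in> gsets G" and x: "x \<in> pts X" shows "base X (act X c x) = base X x"
proof -
  have 1: "tau X k (act X c x) = tau X (Suc k) x" for k
    using tau_add[OF X x, of k 1] by simp
  \<comment> \<open>Exponents are natural numbers, so c is undone by its power n - 1. Hence x and c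
    x reach the same points.\<close>
  have "x = tau X (n - 1) (act X c x)" using 1[of "n - 1"] tau_n[OF X x] n_pos by simp
  then have 2: "tau X k x = tau X (k + (n - 1)) (act X c x)" for k
    using tau_add[OF X tau_in[OF X x, of 1], of k "n - 1"] by simp
  have "(\<lambda>z. \<exists>k. z = tau X k (act X c x)) = (\<lambda>z. \<exists>k. z = tau X k x)"
    using 1 2 by (metis (no_types, lifting))
  then show ?thesis by (simp add: base_def)
qed

text \<open>The distance to the reference point is a choice, determined modulo the period only;
  applying c uses up one step of it.\<close>

lemma idx_act:
  assumes X: "X \<in> gsets G" and x: "x \<in> pts X"
  shows "Suc (idx X (act X c x)) mod per X x = idx X x mod per X x"
proof -
  have "tau X (Suc (idx X (act X c x))) x = tau X (idx X (act X c x)) (act X c x)"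
    using tau_add[OF X x, of "idx X (act X c x)" 1] by simp
  also have "\<dots> = tau X (idx X x) x" using base_idx base_act[OF X x] by metis
  finally show ?thesis using tau_eq_iff[OF X x] by blast
qed

end

section \<open>The constant module\<close>

definition ev :: "('a \<Rightarrow> int) \<Rightarrow> ('a \<Rightarrow>\<^sub>0 int) \<Rightarrow> int" where
  "ev U z = (\<Sum>s\<in>Poly_Mapping.keys z. Poly_Mapping.lookup z s * U s)"

lemma ev_superset:
  assumes "Poly_Mapping.keys z \<subseteq> A" "finite A"
  shows "ev U z = (\<Sum>s\<in>A. Poly_Mapping.lookup z s * U s)"
  unfolding ev_def by (rule sum.mono_neutral_left) (use assms in \<open>auto simp: in_keys_iff\<close>)

lemma ev_add: "ev U (y + z) = ev U y + ev U z"
proof -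
  let ?A = "Poly_Mapping.keys y \<union> Poly_Mapping.keys z"
  have "ev U w = (\<Sum>s\<in>?A. Poly_Mapping.lookup w s * U s)" if "w \<in> {y, z, y + z}" for w
    using that keys_add[of y z] by (intro ev_superset) auto
  then show ?thesis by (simp add: lookup_add distrib_right sum.distrib)
qed

lemma ev_simps [simp]:
  "ev U 0 = 0" "ev U (frag_of x) = U x" "ev U (frag_cmul k z) = k * ev U z"
proof -
  show "ev U (frag_cmul k z) = k * ev U z"
    by (simp add: ev_superset[OF keys_cmul finite_keys] ev_def[of U z] sum_distrib_left mult.assoc)
qed (auto simp: ev_def)

lemma ev_minus: "ev U (- z) = - ev U z"
  using ev_simps(3)[of U "-1" z] by simp

lemma ev_diff: "ev U (y - z) = ev U y - ev U z"
  using ev_add[of U y "- z"] by (simp add: ev_minus)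

lemma ev_sum: "ev U (\<Sum>i\<in>I. z i) = (\<Sum>i\<in>I. ev U (z i))"
  by (induction I rule: infinite_finite_induct) (auto simp: ev_add)

lemma ev_cong: "(\<And>s. s \<in> Poly_Mapping.keys z \<Longrightarrow> U s = V s) \<Longrightarrow> ev U z = ev V z"
  by (simp add: ev_def)

lemma ev_extend: "ev U (frag_extend \<phi> z) = ev (\<lambda>x. ev U (\<phi> x)) z"
  by (simp add: frag_extend_def ev_sum ev_def[of _ z])

lemma ev_tensor: "ev U (lin_tensor u v) = ev (\<lambda>s. ev (\<lambda>t. U (Tup s t)) v) u"
  by (simp add: lin_tensor_def ev_extend)

section \<open>Elements of the constant module as invariant functions on points\<close>

definition zc :: "'g gset \<Rightarrow> ('g pt \<Rightarrow> int) \<Rightarrow> ('g pt \<Rightarrow>\<^sub>0 int) \<Rightarrow> int" where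
  "zc X U = (\<lambda>z\<in>carrier (lin X). ev U z)"

lemma zc_apply: "Poly_Mapping.keys z \<subseteq> pts X \<Longrightarrow> zc X U z = ev U z"
  by (simp add: zc_def)

lemma zc_of [simp]: "x \<in> pts X \<Longrightarrow> zc X U (frag_of x) = U x"
  by (simp add: zc_apply)

lemma constZ_carrier:
  "carrier (ob (constZ G) X) = {u \<in> hom (lin X) integer_group \<inter> extensional (carrier (lin X)).
     \<forall>g\<in>carrier G. \<forall>x\<in>carrier (lin X). u (lin_act X g x) = u x}"
  by (simp add: constZ_def)

lemma constZ_ops:
  "monoid.mult (ob (constZ G) X) = (\<lambda>u v. \<lambda>x\<in>carrier (lin X). u x + v x)"
  "\<one>\<^bsub>ob (constZ G) X\<^esub> = (\<lambda>x\<in>carrier (lin X). 0)"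
  "mor (constZ G) X Y f u = compose (carrier (lin X)) u f"
  by (simp_all add: constZ_def)

lemma constZ_ev:
  assumes "u \<in> carrier (ob (constZ G) X)" "Poly_Mapping.keys z \<subseteq> pts X"
  shows "u z = ev (\<lambda>x. u (frag_of x)) z"
proof -
  have h: "u \<in> hom (free_Abelian_group (pts X)) integer_group"
    using assms(1) by (simp add: constZ_carrier lin_def)
  show ?thesis using assms(2)
  proof (induction z rule: lin_induct)
    case zero
    have "u (0 + 0) = u 0 + u 0" using hom_mult[OF h, of 0 0] by simp
    then show ?case by simp
  next
    case (diff y z)
    then show ?case using hom_minus_frag[OF group_integer_group h diff(1,2)] by (simp add: ev_diff)
  qed simp
qed

lemma constZ_eqI:
  assumes "u \<in> carrier (ob (constZ G) X)" "v \<in> carrier (ob (constZ G) X)"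
    and "\<And>x. x \<in> pts X \<Longrightarrow> u (frag_of x) = v (frag_of x)"
  shows "u = v"
proof (rule extensionalityI[of _ "carrier (lin X)"])
  fix z assume "z \<in> carrier (lin X)"
  then have z: "Poly_Mapping.keys z \<subseteq> pts X" by simp
  show "u z = v z"
    unfolding constZ_ev[OF assms(1) z] constZ_ev[OF assms(2) z]
    by (rule ev_cong) (use z assms(3) in auto)
qed (use assms in \<open>auto simp: constZ_carrier\<close>)

lemma constZ_act:
  "\<lbrakk>u \<in> carrier (ob (constZ G) X); g \<in> carrier G; x \<in> pts X\<rbrakk> \<Longrightarrow> u (frag_of (act X g x)) = u (frag_of x)"
  by (force simp: constZ_carrier lin_act_simps(2)[symmetric] simp del: lin_act_simps(2))

lemma zc_in:
  assumes X: "X \<in> gsets G" and U: "\<And>g x. \<lbrakk>g \<in> carrier G; x \<in> pts X\<rbrakk> \<Longrightarrow> U (act X g x) = U x"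
  shows "zc X U \<in> carrier (ob (constZ G) X)"
  unfolding constZ_carrier
proof (intro CollectI IntI conjI ballI)
  show "zc X U \<in> hom (lin X) integer_group"
    by (rule homI) (simp_all add: zc_apply keys_add_subset ev_add)
  show "zc X U \<in> extensional (carrier (lin X))" by (simp add: zc_def)
  fix g z assume g: "g \<in> carrier G" and "z \<in> carrier (lin X)"
  then have z: "Poly_Mapping.keys z \<subseteq> pts X" by simp
  have "ev U (lin_act X g z) = ev U z"
    unfolding lin_act_def ev_extend by (rule ev_cong) (use z U g in auto)
  then show "zc X U (lin_act X g z) = zc X U z"
    using z keys_lin_act[OF X g z] by (simp add: zc_apply)
qed

lemma zc_frag: "u \<in> carrier (ob (constZ G) X) \<Longrightarrow> X \<in> gsets G \<Longrightarrow> zc X (\<lambda>x. u (frag_of x)) = u"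
  by (rule constZ_eqI[of _ G X]) (auto intro!: zc_in simp: constZ_act)

lemma constZ_mult_in:
  assumes X: "X \<in> gsets G" and u: "u \<in> carrier (ob (constZ G) X)" "v \<in> carrier (ob (constZ G) X)"
  shows "u \<otimes>\<^bsub>ob (constZ G) X\<^esub> v \<in> carrier (ob (constZ G) X)"
proof -
  have h: "u \<in> hom (lin X) integer_group" "v \<in> hom (lin X) integer_group" using u by (auto simp: constZ_carrier)
  have "(\<lambda>x\<in>carrier (lin X). u x + v x) \<in> hom (lin X) integer_group"
    by (rule homI) (use h in \<open>simp_all add: keys_add_subset hom_def\<close>)
  then show ?thesis using u keys_lin_act[OF X] by (simp add: constZ_carrier constZ_ops)
qed

lemma constZ_apply:
  "x \<in> pts X \<Longrightarrow> (u \<otimes>\<^bsub>ob (constZ G) X\<^esub> v) (frag_of x) = u (frag_of x) + v (frag_of x)"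
  "x \<in> pts X \<Longrightarrow> \<one>\<^bsub>ob (constZ G) X\<^esub> (frag_of x) = 0"
  "x \<in> pts X \<Longrightarrow> mor (constZ G) X Y f u (frag_of x) = u (f (frag_of x))"
  by (simp_all add: constZ_ops compose_def)

lemma constZ_mult_apply:
  "Poly_Mapping.keys z \<subseteq> pts X \<Longrightarrow> (u \<otimes>\<^bsub>ob (constZ G) X\<^esub> v) z = u z + v z"
  by (simp add: constZ_ops)

lemma constZ_one_in: "X \<in> gsets G \<Longrightarrow> \<one>\<^bsub>ob (constZ G) X\<^esub> \<in> carrier (ob (constZ G) X)"
  by (simp add: constZ_carrier constZ_ops hom_def keys_add_subset keys_lin_act)

lemma constZ_comm_group:
  assumes X: "X \<in> gsets G" shows "comm_group (ob (constZ G) X)"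
proof (rule comm_groupI)
  fix u v w assume h: "u \<in> carrier (ob (constZ G) X)" "v \<in> carrier (ob (constZ G) X)" "w \<in> carrier (ob (constZ G) X)"
  show "u \<otimes>\<^bsub>ob (constZ G) X\<^esub> v \<in> carrier (ob (constZ G) X)" by (rule constZ_mult_in[OF X h(1,2)])
  show "u \<otimes>\<^bsub>ob (constZ G) X\<^esub> v \<otimes>\<^bsub>ob (constZ G) X\<^esub> w = u \<otimes>\<^bsub>ob (constZ G) X\<^esub> (v \<otimes>\<^bsub>ob (constZ G) X\<^esub> w)"
    by (rule constZ_eqI[of _ G X]) (use h X in \<open>auto simp: constZ_apply intro!: constZ_mult_in\<close>)
  show "u \<otimes>\<^bsub>ob (constZ G) X\<^esub> v = v \<otimes>\<^bsub>ob (constZ G) X\<^esub> u"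
    by (rule constZ_eqI[of _ G X]) (use h X in \<open>auto simp: constZ_apply intro!: constZ_mult_in\<close>)
  show "\<one>\<^bsub>ob (constZ G) X\<^esub> \<otimes>\<^bsub>ob (constZ G) X\<^esub> u = u"
    by (rule constZ_eqI[of _ G X]) (use h X in \<open>auto simp: constZ_apply constZ_one_in intro!: constZ_mult_in\<close>)
  have n: "zc X (\<lambda>x. - u (frag_of x)) \<in> carrier (ob (constZ G) X)"
    by (rule zc_in) (use X h in \<open>auto simp: constZ_act\<close>)
  have "zc X (\<lambda>x. - u (frag_of x)) \<otimes>\<^bsub>ob (constZ G) X\<^esub> u = \<one>\<^bsub>ob (constZ G) X\<^esub>"
    by (rule constZ_eqI[of _ G X]) (use h X n in \<open>auto simp: constZ_apply constZ_one_in intro!: constZ_mult_in\<close>)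
  then show "\<exists>v\<in>carrier (ob (constZ G) X). v \<otimes>\<^bsub>ob (constZ G) X\<^esub> u = \<one>\<^bsub>ob (constZ G) X\<^esub>" using n by blast
qed (rule constZ_one_in[OF X])

lemma constZ_mor_in:
  assumes X: "X \<in> gsets G" and f: "f \<in> BZ G X Y" and u: "u \<in> carrier (ob (constZ G) Y)"
  shows "mor (constZ G) X Y f u \<in> carrier (ob (constZ G) X)"
proof -
  have h: "u \<in> hom (lin Y) integer_group" using u by (auto simp: constZ_carrier)
  have "compose (carrier (lin X)) u f \<in> hom (lin X) integer_group"
    by (rule homI) (use h BZ_keys[OF f] BZ_add[OF f] in \<open>simp_all add: compose_def keys_add_subset hom_def\<close>)
  moreover have "f (lin_act X g z) = lin_act Y g (f z)" if "g \<in> carrier G" "Poly_Mapping.keys z \<subseteq> pts X" for g z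
    using f that by (simp add: BZ_def)
  ultimately show ?thesis
    using u keys_lin_act[OF X] BZ_keys[OF f] by (simp add: constZ_carrier constZ_ops compose_def)
qed

lemma zmodule_constZ: "zmodule G (constZ G)"
proof (rule zmodule.intro)
  fix X Y f assume h: "X \<in> gsets G" "Y \<in> gsets G" "f \<in> BZ G X Y"
  show "mor (constZ G) X Y f \<in> hom (ob (constZ G) Y) (ob (constZ G) X)"
  proof (rule homI)
    fix u v assume u: "u \<in> carrier (ob (constZ G) Y)" "v \<in> carrier (ob (constZ G) Y)"
    show "mor (constZ G) X Y f (u \<otimes>\<^bsub>ob (constZ G) Y\<^esub> v) = mor (constZ G) X Y f u \<otimes>\<^bsub>ob (constZ G) X\<^esub> mor (constZ G) X Y f v"
      by (rule constZ_eqI[of _ G X])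
        (use h u BZ_keys_of[OF h(3)] in \<open>auto simp: constZ_apply constZ_mult_apply intro!: constZ_mult_in constZ_mor_in[OF h(1,3)]\<close>)
  qed (rule constZ_mor_in[OF h(1,3)])
next
  fix X u assume h: "X \<in> gsets G" "u \<in> carrier (ob (constZ G) X)"
  show "mor (constZ G) X X (bz_id X) u = u"
    by (rule constZ_eqI[of _ G X]) (use h in \<open>auto simp: constZ_apply intro!: constZ_mor_in\<close>)
next
  fix X Y Z f g u assume h: "X \<in> gsets G" "Y \<in> gsets G" "Z \<in> gsets G" "f \<in> BZ G X Y" "g \<in> BZ G Y Z"
    "u \<in> carrier (ob (constZ G) Z)"
  show "mor (constZ G) X Z (bz_comp X g f) u = mor (constZ G) X Y f (mor (constZ G) Y Z g u)"
    by (rule constZ_eqI[OF constZ_mor_in[OF h(1) bz_comp_in[OF h(4,5,1)] h(6)]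
          constZ_mor_in[OF h(1,4) constZ_mor_in[OF h(2,5,6)]]])
      (use BZ_keys_of[OF h(4)] in \<open>auto simp: constZ_apply\<close>, simp add: constZ_ops compose_def)
next
  fix X Y f g u assume h: "X \<in> gsets G" "Y \<in> gsets G" "f \<in> BZ G X Y" "g \<in> BZ G X Y"
    "u \<in> carrier (ob (constZ G) Y)"
  have u: "u \<in> hom (lin Y) integer_group" using h by (auto simp: constZ_carrier)
  show "mor (constZ G) X Y (bz_add X f g) u = mor (constZ G) X Y f u \<otimes>\<^bsub>ob (constZ G) X\<^esub> mor (constZ G) X Y g u"
    by (rule constZ_eqI[OF constZ_mor_in[OF h(1) bz_add_in[OF h(3,4,1)] h(5)]
          constZ_mult_in[OF h(1) constZ_mor_in[OF h(1,3,5)] constZ_mor_in[OF h(1,4,5)]]])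
      (use BZ_keys_of[OF h(3)] BZ_keys_of[OF h(4)] hom_mult[OF u] in \<open>simp add: constZ_apply\<close>)
qed (rule constZ_comm_group)

section \<open>Orbits\<close>

lemma orbit_gset_pts: "pts (orbit_gset G H) = {Cos (a <#\<^bsub>G\<^esub> H) | a. a \<in> carrier G}"
  by (simp add: orbit_gset_def Let_def)

lemma orbit_gset_act:
  assumes "group G" "subgroup H G" "g \<in> carrier G" "a \<in> carrier G"
  shows "act (orbit_gset G H) g (Cos (a <#\<^bsub>G\<^esub> H)) = Cos ((g \<otimes>\<^bsub>G\<^esub> a) <#\<^bsub>G\<^esub> H)"
  using group.lcos_m_assoc[OF assms(1) subgroup.subset[OF assms(2)] assms(3,4)] assms(4)
  by (auto simp: orbit_gset_def Let_def)

lemma orbit_gset_in: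
  assumes G: "group G" and fin: "finite (carrier G)" and H: "subgroup H G"
  shows "orbit_gset G H \<in> gsets G"
proof -
  interpret group G by fact
  have e: "orbit_gset G H = \<lparr>pts = pts (orbit_gset G H), act = act (orbit_gset G H)\<rparr>" by simp
  show ?thesis
  proof (subst e, rule gsetI[OF G])
    show "finite (pts (orbit_gset G H))" using fin by (simp add: orbit_gset_pts)
    fix g show "act (orbit_gset G H) g \<in> extensional (pts (orbit_gset G H))"
      by (simp add: orbit_gset_def Let_def)
  qed (auto simp: orbit_gset_pts orbit_gset_act[OF G H] m_assoc)
qed

context cyc begin

text \<open>The explicit form of the ideal I_b, to be identified with \<open>ideal_of\<close> for
  divisors of n in \<open>ideal_of_eq\<close>.\<close>

definition J where
  "J b X = {u \<in> carrier (ob (constZ G) X). \<forall>x\<in>pts X. int (weight b (per X x)) dvd u (frag_of x)}"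

lemma zc_inv: "\<lbrakk>X \<in> gsets G; \<And>x. x \<in> pts X \<Longrightarrow> U (act X c x) = U x\<rbrakk> \<Longrightarrow> zc X U \<in> carrier (ob (constZ G) X)"
  using invariant_iff[of X U] by (intro zc_in) auto

lemma constZ_c: "\<lbrakk>u \<in> carrier (ob (constZ G) X); x \<in> pts X\<rbrakk> \<Longrightarrow> u (frag_of (act X c x)) = u (frag_of x)"
  by (simp add: constZ_act)

lemma l_coset_eq_self: "\<lbrakk>subgroup H G; x \<in> carrier G\<rbrakk> \<Longrightarrow> x <# H = H \<longleftrightarrow> x \<in> H"
  using coset_join3[of x H] subgroup.one_closed[of H G] by (force simp: l_coset_def)

lemma per_orbit_iff:
  assumes H: "subgroup H G"
  shows "c [^] k \<in> H \<longleftrightarrow> per (orbit_gset G H) (Cos H) dvd k"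
proof -
  have X: "orbit_gset G H \<in> gsets G" using orbit_gset_in[OF is_group fin H] .
  have o: "\<one> <# H = H" using lcos_mult_one subgroup.subset[OF H] by simp
  then have x: "Cos H \<in> pts (orbit_gset G H)" unfolding orbit_gset_pts by (metis (mono_tags, lifting) mem_Collect_eq one_closed)
  have "tau (orbit_gset G H) k (Cos H) = Cos ((c [^] k) <# H)"
    using orbit_gset_act[OF is_group H, of "c [^] k" \<one>] o by simp
  then show ?thesis using per_iff[OF X x, of k] l_coset_eq_self[OF H, of "c [^] k"] by simp
qed

lemma per_orbit:
  assumes H: "subgroup H G" and x: "x \<in> pts (orbit_gset G H)"
  shows "\<exists>j. x = tau (orbit_gset G H) j (Cos H)" "per (orbit_gset G H) x = per (orbit_gset G H) (Cos H)"
proof -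
  have X: "orbit_gset G H \<in> gsets G" using orbit_gset_in[OF is_group fin H] .
  have o: "\<one> <# H = H" using lcos_mult_one subgroup.subset[OF H] by simp
  then have x0: "Cos H \<in> pts (orbit_gset G H)" unfolding orbit_gset_pts by (metis (mono_tags, lifting) mem_Collect_eq one_closed)
  obtain j :: nat where "x = Cos ((c [^] j) <# H)" using x gen by (auto simp: orbit_gset_pts)
  then have j: "x = tau (orbit_gset G H) j (Cos H)"
    using orbit_gset_act[OF is_group H, of "c [^] j" \<one>] o by simp
  then show "\<exists>j. x = tau (orbit_gset G H) j (Cos H)" by blast
  show "per (orbit_gset G H) x = per (orbit_gset G H) (Cos H)" using per_tau[OF X x0] j by simp
qed

text \<open>With p the orbit size, c^p lies in H, so n divides p * card H, and card H divides n / b;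
  cancelling n / b leaves b dividing p. Thus the unit on G/H satisfies the divisibility conditions
  of I_b, whose weights there are all 1.\<close>

lemma per_family:
  assumes H: "H \<in> family G b" and b: "b dvd n" and x: "x \<in> pts (orbit_gset G H)"
  shows "b dvd per (orbit_gset G H) x"
proof -
  have sH: "subgroup H G" and cH: "card H dvd n div b" using H by (auto simp: family_def n_def)
  let ?p = "per (orbit_gset G H) x"
  have pH: "c [^] ?p \<in> H" using per_orbit_iff[OF sH] per_orbit(2)[OF sH x] by simp
  have "h [^] card H = \<one>" if "h \<in> H" for h
  proof -
    interpret S: group "G\<lparr>carrier := H\<rparr>" using subgroup_imp_group[OF sH] .
    have "h [^]\<^bsub>G\<lparr>carrier := H\<rparr>\<^esub> card H = \<one>" using S.pow_order_eq_1[of h] that by (simp add: order_def)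
    then show ?thesis using nat_pow_consistent by metis
  qed
  from this[OF pH] have "c [^] (?p * card H) = \<one>" by (simp only: nat_pow_pow[OF c])
  then have "n dvd ?p * card H" using pow_eq_id[OF c] by (simp add: ord_c)
  then have "n dvd ?p * (n div b)" using cH by (meson dvd_trans mult_dvd_mono dvd_refl)
  then have "b * (n div b) dvd ?p * (n div b)" using b by simp
  moreover have "n div b \<noteq> 0" using b n_pos by (auto elim!: dvdE)
  ultimately show ?thesis by (simp add: dvd_mult_cancel2)
qed

end

locale cyc_orbit = cyc G c for G :: "'g monoid" (structure) and c +
  fixes a assumes a: "a dvd n"
begin

lemma a_pos: "a > 0"
  using a n_pos by (auto intro!: Nat.gr0I)

definition K where "K = generate G {c [^] a}"
definition S where "S = orbit_gset G K"
text \<open>The points of \<open>S\<close> numbered by all naturals with period \<open>a\<close>, so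
  that shifting an index needs no reduction.\<close>

definition y where "y j = tau S j (Cos K)"

lemma K: "subgroup K G"
  unfolding K_def by (rule generate_is_subgroup) simp

lemma K_family: "K \<in> family G a"
proof -
  have "card K = ord (c [^] a)" unfolding K_def using generate_pow_card[of "c [^] a"] by simp
  also have "\<dots> = n div a" using ord_pow[OF c, of a] a a_pos by (simp add: ord_c)
  finally show ?thesis using K by (simp add: family_def n_def)
qed

lemma S: "S \<in> gsets G"
  unfolding S_def by (rule orbit_gset_in[OF is_group fin K])

lemma Cos_K: "Cos K \<in> pts S"
proof -
  have "\<one> <# K = K" using lcos_mult_one subgroup.subset[OF K] by simp
  then show ?thesis unfolding S_def orbit_gset_pts by (metis (mono_tags, lifting) mem_Collect_eq one_closed)
qed

lemma y_in [simp]: "y j \<in> pts S"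
  unfolding y_def by (rule tau_in[OF S Cos_K])

lemma c_mem_K: "c [^] (k::nat) \<in> K \<longleftrightarrow> a dvd k"
proof
  assume "c [^] k \<in> K"
  then obtain i :: nat where "c [^] k = (c [^] a) [^] i"
    unfolding K_def generate_pow_on_finite_carrier[OF fin nat_pow_closed[OF c]] by auto
  then have "c [^] k = c [^] (a * i)" by (simp add: nat_pow_pow)
  \<comment> \<open>Adding n - 1 further copies of a * i plays the part of subtracting a * i, which
    natural exponents do not permit.\<close>
  then have "c [^] (k + (n - 1) * (a * i)) = c [^] (a * i + (n - 1) * (a * i))"
    by (simp add: nat_pow_mult[symmetric])
  also have "a * i + (n - 1) * (a * i) = n * (a * i)" using n_pos by (cases n) auto
  also have "c [^] (n * (a * i)) = \<one>" by (simp add: c_n flip: nat_pow_pow)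
  finally have "n dvd k + (n - 1) * (a * i)" using pow_eq_id[OF c] by (simp add: ord_c)
  then have "a dvd k + (n - 1) * (a * i)" using a dvd_trans by blast
  then show "a dvd k" by (simp add: dvd_add_left_iff)
next
  assume "a dvd k"
  then obtain i where "k = a * i" ..
  then show "c [^] k \<in> K"
    unfolding K_def generate_pow_on_finite_carrier[OF fin nat_pow_closed[OF c]] by (auto simp: nat_pow_pow)
qed

lemma per_S: "s \<in> pts S \<Longrightarrow> per S s = a"
  using per_orbit(2)[OF K] per_orbit_iff[OF K] c_mem_K unfolding S_def by (metis dvd_antisym dvd_refl)

lemma y_eq_iff: "y i = y j \<longleftrightarrow> i mod a = j mod a"
  unfolding y_def using tau_eq_iff[OF S Cos_K] per_S[OF Cos_K] by simp

lemma act_y: "act S c (y j) = y (Suc j)"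
  unfolding y_def using tau_Suc[OF S Cos_K] by simp

lemma y_surj: "s \<in> pts S \<Longrightarrow> \<exists>j. s = y j"
  unfolding y_def using per_orbit(1)[OF K] by (simp add: S_def)

lemma sum_S: "(\<Sum>s\<in>pts S. f s) = (\<Sum>j<a. f (y j))"
proof (rule sum.reindex_bij_betw[symmetric])
  have "inj_on y {..<a}" by (auto simp: inj_on_def y_eq_iff)
  moreover have "pts S = y ` {..<a}"
  proof (intro equalityI subsetI)
    fix s assume "s \<in> pts S"
    then obtain j where "s = y j" using y_surj by blast
    then have "s = y (j mod a)" by (simp add: y_eq_iff)
    then show "s \<in> y ` {..<a}" using a_pos by simp
  qed auto
  ultimately show "bij_betw y {..<a} (pts S)" by (simp add: bij_betw_def)
qed

definition sidx where "sidx s = (SOME j. s = y j)"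

lemma y_sidx: "s \<in> pts S \<Longrightarrow> y (sidx s) = s"
  unfolding sidx_def using someI_ex[OF y_surj] by metis

lemma sidx_y: "sidx (y j) mod a = j mod a"
  using y_sidx[OF y_in] y_eq_iff by metis

end

section \<open>Invariant functions on products\<close>

context cyc begin

text \<open>\<open>F s x\<close> is the matrix of a map from the permutation module of \<open>X\<close> to that of \<open>T\<close>. Equivariance
  is only required for the generator \<open>c\<close>.\<close>

definition invf where
  "invf T X F \<longleftrightarrow> (\<forall>s\<in>pts T. \<forall>x\<in>pts X. F (act T c s) (act X c x) = (F s x :: int))"

definition bzF where
  "bzF T X F = bzl X (\<lambda>x. \<Sum>s\<in>pts T. frag_cmul (F s x) (frag_of s))"

lemma invf_act:
  assumes T: "T \<in> gsets G" and X: "X \<in> gsets G" and F: "invf T X F"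
    and g: "g \<in> carrier G" and s: "s \<in> pts T" and x: "x \<in> pts X"
  shows "F (act T g s) (act X g x) = F s x"
proof -
  obtain k :: nat where "g = c [^] k" using g gen by auto
  moreover have "F (tau T k s) (tau X k x) = F s x"
  proof (induction k)
    case 0
    show ?case by (simp only: tau_0[OF T s] tau_0[OF X x])
  next
    case (Suc k)
    then show ?case using F tau_in[OF T s] tau_in[OF X x] by (simp only: tau_Suc[OF T s] tau_Suc[OF X x] invf_def)
  qed
  ultimately show ?thesis by simp
qed

lemma lookup_frag_sum:
  "finite A \<Longrightarrow> Poly_Mapping.lookup (\<Sum>s\<in>A. frag_cmul (h s) (frag_of s)) t = (if t \<in> A then h t else 0)"
  by (simp add: lookup_sum lookup_single when_def if_distrib cong: if_cong)

lemma bzF_of: "x \<in> pts X \<Longrightarrow> bzF T X F (frag_of x) = (\<Sum>s\<in>pts T. frag_cmul (F s x) (frag_of s))"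
  by (simp add: bzF_def)

lemma lookup_bzF:
  "\<lbrakk>T \<in> gsets G; x \<in> pts X; s \<in> pts T\<rbrakk> \<Longrightarrow> Poly_Mapping.lookup (bzF T X F (frag_of x)) s = F s x"
  using gsets_finite[of T G] by (simp add: bzF_of lookup_frag_sum)

lemma bzF_in:
  assumes T: "T \<in> gsets G" and X: "X \<in> gsets G" and F: "invf T X F"
  shows "bzF T X F \<in> BZ G X T"
  unfolding bzF_def
proof (rule bzl_in[OF X])
  fix x assume x: "x \<in> pts X"
  show "Poly_Mapping.keys (\<Sum>s\<in>pts T. frag_cmul (F s x) (frag_of s)) \<subseteq> pts T"
    by (rule keys_sum_subset) (use keys_cmul in fastforce)
  fix g assume g: "g \<in> carrier G"
  have "(\<Sum>s\<in>pts T. frag_cmul (F s (act X g x)) (frag_of s))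
      = (\<Sum>s\<in>pts T. frag_cmul (F (act T g s) (act X g x)) (frag_of (act T g s)))"
    by (rule sum_act[OF T g, symmetric])
  also have "\<dots> = (\<Sum>s\<in>pts T. frag_cmul (F s x) (frag_of (act T g s)))"
    by (rule sum.cong) (use invf_act[OF T X F g _ x] in auto)
  finally show "(\<Sum>s\<in>pts T. frag_cmul (F s (act X g x)) (frag_of s))
      = lin_act T g (\<Sum>s\<in>pts T. frag_cmul (F s x) (frag_of s))" by simp
qed

lemma lookup_lin_act:
  assumes T: "T \<in> gsets G" and g: "g \<in> carrier G" and z: "Poly_Mapping.keys z \<subseteq> pts T" and s: "s \<in> pts T"
  shows "Poly_Mapping.lookup (lin_act T g z) (act T g s) = Poly_Mapping.lookup z s"
  using z
proof (induction z rule: lin_induct)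
  case (one x)
  then show ?case using act_inj[OF T g one s] by (auto simp: lookup_single when_def)
qed (auto simp: lookup_minus)

lemma BZ_invf:
  assumes T: "T \<in> gsets G" and X: "X \<in> gsets G" and f: "f \<in> BZ G X T"
  shows "invf T X (\<lambda>s x. Poly_Mapping.lookup (f (frag_of x)) s)"
    and "bzF T X (\<lambda>s x. Poly_Mapping.lookup (f (frag_of x)) s) = f"
proof -
  show i: "invf T X (\<lambda>s x. Poly_Mapping.lookup (f (frag_of x)) s)"
    unfolding invf_def using lookup_lin_act[OF T c BZ_keys_of[OF f]] BZ_act[OF f c] by simp
  show "bzF T X (\<lambda>s x. Poly_Mapping.lookup (f (frag_of x)) s) = f"
    by (rule BZ_eqI[OF bzF_in[OF T X i] f])
      (use frag_sum_expansion[OF BZ_keys_of[OF f] gsets_finite[OF T]] in \<open>simp add: bzF_of\<close>)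
qed

lemma invf_diff: "\<lbrakk>invf T X F; invf T X F'\<rbrakk> \<Longrightarrow> invf T X (\<lambda>s x. F s x - F' s x)"
  by (simp add: invf_def)

end

context cyc_orbit begin

lemma invf_S_iff:
  "invf S X F \<longleftrightarrow> (\<forall>j. \<forall>x\<in>pts X. F (y (Suc j)) (act X c x) = F (y j) x)"
  unfolding invf_def using act_y y_surj y_in by metis

lemma invf_shift:
  assumes F: "invf S X F" and X: "X \<in> gsets G" and x: "x \<in> pts X"
  shows "F (y (j + k)) (tau X k x) = F (y j) x"
proof (induction k)
  case 0
  then show ?case by (simp only: tau_0[OF X x] add_0_right)
next
  case (Suc k)
  then show ?case using F tau_in[OF X x, of k] by (simp only: tau_Suc[OF X x] add_Suc_right invf_S_iff)
qed

lemma invf_base: "\<lbrakk>invf S X F; X \<in> gsets G; x \<in> pts X\<rbrakk> \<Longrightarrow> F (y (j + idx X x)) (base X x) = F (y j) x"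
  using invf_shift[of X F x j "idx X x"] by (simp add: base_idx)

lemma y_periodic: "y (j + a) = y j"
  by (simp add: y_eq_iff)

text \<open>Going once round the orbit of x brings x back and shifts the index in S by
  \<open>per X x\<close>; S itself contributes the period a. Two periods give their gcd.\<close>

lemma invf_periodic:
  assumes F: "invf S X F" and X: "X \<in> gsets G" and x: "x \<in> pts X"
  shows "F (y (j + gcd a (per X x))) x = F (y j) x"
  by (rule periodic_gcd[of "\<lambda>j. F (y j) x"])
    (use invf_shift[OF F X x] per(2)[OF X x] a_pos y_periodic in auto, metis)

text \<open>a = \<open>weight a p\<close> * gcd(a, p), so one turn through S consists of
  \<open>weight a p\<close> copies of a period.\<close>

lemma sum_invf:
  assumes F: "invf S X F" and X: "X \<in> gsets G" and x: "x \<in> pts X"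
  shows "(\<Sum>s\<in>pts S. F s x) = int (weight a (per X x)) * (\<Sum>j<gcd a (per X x). F (y j) x)"
proof -
  have "a = weight a (per X x) * gcd a (per X x)" by (simp add: weight_def)
  then show ?thesis
    using periodic_sum[of "\<lambda>j. F (y j) x", OF invf_periodic[OF F X x], of "weight a (per X x)"] by (simp add: sum_S)
qed

lemma invf_of_periodic:
  assumes p: "\<And>j x. x \<in> pts X \<Longrightarrow> v (j + a) x = v j x" and s: "\<And>j x. x \<in> pts X \<Longrightarrow> v (Suc j) (act X c x) = v j x"
    and X: "X \<in> gsets G"
  defines "F \<equiv> \<lambda>s x. (v (sidx s) x :: int)"
  shows "invf S X F" "\<And>j x. x \<in> pts X \<Longrightarrow> F (y j) x = v j x"
proof -
  show F: "F (y j) x = v j x" if "x \<in> pts X" for j x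
    using periodic_mod[of "\<lambda>j. v j x" a, OF p[OF that], of "sidx (y j)"] periodic_mod[of "\<lambda>j. v j x" a, OF p[OF that], of j]
    by (simp add: F_def sidx_y)
  show "invf S X F" unfolding invf_S_iff using F s act_closed[OF X c] by simp
qed

section \<open>Transfer and difference operator on invariant functions\<close>

lemma sum_shift:
  fixes f :: "nat \<Rightarrow> int"
  assumes "\<And>j. f (j + e) = f j" shows "(\<Sum>j<e. f (j + i)) = (\<Sum>j<e. f j)"
proof (induction i)
  case (Suc i)
  have "(\<Sum>j<e. f (j + Suc i)) + f i = (\<Sum>j<Suc e. f (j + i))"
    by (subst sum.lessThan_Suc_shift) simp
  also have "\<dots> = (\<Sum>j<e. f (j + i)) + f i" using assms[of i] by (simp add: add.commute)
  finally show ?case using Suc by simp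
qed simp

text \<open>A window of length e meets the residue class of -i exactly once.\<close>

lemma sum_residue:
  fixes e i :: nat and q :: int
  shows "e > 0 \<Longrightarrow> (\<Sum>j<e. if e dvd j + i then q else 0) = q"
proof -
  assume e: "e > 0"
  have "(\<Sum>j<e. if e dvd j + i then q else 0) = (\<Sum>j<e. if e dvd j then q else 0)"
    by (rule sum_shift[of "\<lambda>j. if e dvd j then q else 0"]) simp
  also have "\<dots> = (\<Sum>j<e. if j = 0 then q else 0)"
    by (rule sum.cong) (auto dest: dvd_imp_le)
  finally show ?thesis using e by simp
qed

text \<open>Moving both points by c raises j by one and lowers the index of x by one. So j +
  \<open>idx X x\<close> modulo e is a coordinate that is constant along the diagonal action, and
  any function of it is invariant.\<close>

lemma idx_act_mod:
  assumes X: "X \<in> gsets G" and x: "x \<in> pts X" and e: "e dvd per X x"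
  shows "(Suc j + idx X (act X c x)) mod e = (j + idx X x) mod e"
proof -
  have "(Suc (idx X (act X c x)) mod per X x) mod e = (idx X x mod per X x) mod e"
    using idx_act[OF X x] by simp
  then have "Suc (idx X (act X c x)) mod e = idx X x mod e" by (simp only: mod_mod_cancel[OF e])
  from mod_add_cong[OF refl this, of j] show ?thesis by simp
qed

text \<open>For each \<open>x\<close> the witness \<open>F\<close> is supported on one orbit in \<open>S\<close> of the stabilizer of \<open>x\<close>, of
  length \<open>weight a (per X x)\<close>.\<close>

lemma transfer_surj:
  assumes X: "X \<in> gsets G" and U: "\<And>x. x \<in> pts X \<Longrightarrow> U (act X c x) = U x"
    and d: "\<And>x. x \<in> pts X \<Longrightarrow> int (weight (gcd a b) (per X x)) dvd U x"
  shows "\<exists>F. invf S X F \<and> (\<forall>x\<in>pts X. int (weight b (per X x)) dvd U x - (\<Sum>s\<in>pts S. F s x))"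
proof -
  \<comment> \<open>The choice depends on x only through \<open>U x\<close> and
    \<open>per X x\<close>, so it is automatically constant on orbits.\<close>
  define q where "q x = (SOME q. int (weight b (per X x)) dvd U x - int (weight a (per X x)) * q)" for x
  have q: "int (weight b (per X x)) dvd U x - int (weight a (per X x)) * q x" if "x \<in> pts X" for x
    unfolding q_def using weight_split[OF per(1)[OF X that] a_pos] d[OF that] by (metis (no_types, lifting) someI_ex)
  have qc: "q (act X c x) = q x" if "x \<in> pts X" for x
    unfolding q_def by (simp add: per_act[OF X that] U[OF that])
  \<comment> \<open>One residue of the invariant coordinate carries the whole value, so one period
    sums to q and all of S to \<open>weight a p\<close> * q.\<close>
  define v where "v j x = (if gcd a (per X x) dvd j + idx X x then q x else 0)" for j x
  have "v (j + a) x = v j x" for j x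
  proof -
    have "gcd a (per X x) dvd (j + idx X x) + a \<longleftrightarrow> gcd a (per X x) dvd j + idx X x"
      by (simp add: dvd_add_left_iff)
    then show ?thesis by (simp add: v_def add_ac)
  qed
  moreover have "v (Suc j) (act X c x) = v j x" if x: "x \<in> pts X" for j x
  proof -
    have "(Suc j + idx X (act X c x)) mod gcd a (per X x) = (j + idx X x) mod gcd a (per X x)"
      by (rule idx_act_mod[OF X x]) simp
    then show ?thesis by (simp add: v_def per_act[OF X x] qc[OF x] dvd_eq_mod_eq_0)
  qed
  ultimately have F: "invf S X (\<lambda>s x. v (sidx s) x)" "\<And>j x. x \<in> pts X \<Longrightarrow> v (sidx (y j)) x = v j x"
    using invf_of_periodic[of X v] X by blast+
  have "(\<Sum>s\<in>pts S. v (sidx s) x) = int (weight a (per X x)) * q x" if x: "x \<in> pts X" for x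
  proof -
    have "(\<Sum>j<gcd a (per X x). v (sidx (y j)) x) = q x"
      unfolding F(2)[OF x] unfolding v_def by (rule sum_residue) (use a_pos in simp)
    then show ?thesis by (simp add: sum_invf[OF F(1) X x])
  qed
  then show ?thesis using F(1) q by (intro exI[of _ "\<lambda>s x. v (sidx s) x"]) auto
qed

lemma transfer_dvd:
  assumes F: "invf S X F" and X: "X \<in> gsets G" and x: "x \<in> pts X"
    and d: "int (weight b (per X x)) dvd u - (\<Sum>s\<in>pts S. F s x)"
  shows "int (weight (gcd a b) (per X x)) dvd u"
  using weight_split[OF per(1)[OF X x] a_pos] d unfolding sum_invf[OF F X x] by blast

text \<open>Partial sums over a period, measured from the reference point, telescope to
  \<open>F\<close>. Only the step from the end of a period back to its start has a defect, the full
  period sum. The hypothesis bounds \<open>weight a p\<close> times that sum modulo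
  \<open>weight b p\<close>, and \<open>weight_transfer\<close> converts this into divisibility by
  the modulus valid over S x X.\<close>

lemma transfer_kernel:
  assumes F: "invf S X F" and X: "X \<in> gsets G"
    and d: "\<And>x. x \<in> pts X \<Longrightarrow> int (weight b (per X x)) dvd (\<Sum>s\<in>pts S. F s x)"
  shows "\<exists>F'. invf S X F' \<and> (\<forall>s\<in>pts S. \<forall>x\<in>pts X.
    int (weight b (lcm a (per X x))) dvd F s x - (F' s x - F' (act S c s) x))"
proof -
  define e where "e x = gcd a (per X x)" for x
  \<comment> \<open>The minus sign belongs to the convention F' s - F' (c s): passing to the next
    index must subtract the value of \<open>F\<close>. The sum is empty at residue 0, which is where
    the defect appears.\<close>
  define v where "v j x = - (\<Sum>k<(j + idx X x) mod e x. F (y k) (base X x))" for j x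
  have "v (j + a) x = v j x" for j x
  proof -
    have "a mod e x = 0" by (simp add: e_def)
    then have "(j + a + idx X x) mod e x = (j + idx X x) mod e x"
      using mod_add_right_eq[of "j + idx X x" a "e x"] by (simp add: add_ac)
    then show ?thesis by (simp add: v_def)
  qed
  moreover have "v (Suc j) (act X c x) = v j x" if x: "x \<in> pts X" for j x
  proof -
    have "(Suc j + idx X (act X c x)) mod e x = (j + idx X x) mod e x"
      unfolding e_def by (rule idx_act_mod[OF X x]) simp
    moreover have "e (act X c x) = e x" by (simp add: e_def per_act[OF X x])
    ultimately show ?thesis by (simp add: v_def base_act[OF X x])
  qed
  ultimately have F': "invf S X (\<lambda>s x. v (sidx s) x)" "\<And>j x. x \<in> pts X \<Longrightarrow> v (sidx (y j)) x = v j x"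
    using invf_of_periodic[of X v] X by blast+
  have "int (weight b (lcm a (per X x))) dvd F s x - (v (sidx s) x - v (sidx (act S c s)) x)"
    if s: "s \<in> pts S" and x: "x \<in> pts X" for s x
  proof -
    obtain j where j: "s = y j" using y_surj[OF s] by blast
    let ?b = "base X x" let ?m = "(j + idx X x) mod e x"
    have bX: "?b \<in> pts X" using base_in[OF X x] .
    have g: "F (y (k + e x)) ?b = F (y k) ?b" for k
      using invf_periodic[OF F X bX] per_base[OF X x] by (simp add: e_def)
    have Fj: "F (y j) x = F (y ?m) ?b"
      using invf_base[OF F X x, of j] periodic_mod[of "\<lambda>k. F (y k) ?b" "e x", OF g] by simp
    have "e x > 0" using a_pos by (simp add: e_def)
    then have m: "?m < e x" by simp
    have m': "(Suc j + idx X x) mod e x = (if Suc ?m = e x then 0 else Suc ?m)"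
      using mod_Suc[of "j + idx X x" "e x"] by simp
    have "int (weight b (per X x)) dvd int (weight a (per X x)) * (\<Sum>k<e x. F (y k) ?b)"
      using d[OF bX] sum_invf[OF F X bX] per_base[OF X x] by (simp add: e_def)
    then have w: "int (weight b (lcm a (per X x))) dvd (\<Sum>k<e x. F (y k) ?b)"
      using weight_transfer[OF a_pos per(1)[OF X x]] by blast
    have "F (y j) x - (v j x - v (Suc j) x) = (if Suc ?m = e x then (\<Sum>k<e x. F (y k) ?b) else 0)"
    proof (cases "Suc ?m = e x")
      case True
      have "(\<Sum>k<e x. F (y k) ?b) = (\<Sum>k<?m. F (y k) ?b) + F (y ?m) ?b"
        using sum.lessThan_Suc[of "\<lambda>k. F (y k) ?b" ?m] unfolding True .
      then show ?thesis unfolding v_def m' Fj if_P[OF True] by simp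
    next
      case False
      then show ?thesis unfolding v_def m' Fj by simp
    qed
    then show ?thesis using w by (simp add: j act_y F'(2)[OF x])
  qed
  then show ?thesis using F'(1) by (intro exI[of _ "\<lambda>s x. v (sidx s) x"]) auto
qed

text \<open>Consecutive values over a reference point are congruent, hence all are congruent to the
  one at \<open>y 0\<close>. Reading \<open>U\<close> off at the reference point makes it constant
  on orbits.\<close>

lemma difference_kernel:
  assumes F: "invf S X F" and X: "X \<in> gsets G"
    and d: "\<And>s x. \<lbrakk>s \<in> pts S; x \<in> pts X\<rbrakk> \<Longrightarrow> int (weight b (lcm a (per X x))) dvd F s x - F (act S c s) x"
  shows "\<exists>U. (\<forall>x\<in>pts X. U (act X c x) = U x) \<and>
    (\<forall>s\<in>pts S. \<forall>x\<in>pts X. int (weight b (lcm a (per X x))) dvd F s x - U x)"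
proof (intro exI[of _ "\<lambda>x. F (y 0) (base X x)"] conjI ballI)
  fix x assume x: "x \<in> pts X"
  then show "F (y 0) (base X (act X c x)) = F (y 0) (base X x)" by (simp add: base_act[OF X])
  fix s assume "s \<in> pts S"
  then obtain j where j: "s = y j" using y_surj by blast
  let ?b = "base X x" and ?w = "int (weight b (lcm a (per X x)))"
  have bX: "?b \<in> pts X" using base_in[OF X x] .
  have "?w dvd F (y k) ?b - F (y 0) ?b" for k
  proof (induction k)
    case (Suc k)
    have "?w dvd F (y k) ?b - F (y (Suc k)) ?b" using d[OF y_in bX] by (simp add: act_y per_base[OF X x])
    then have "?w dvd (F (y k) ?b - F (y 0) ?b) - (F (y k) ?b - F (y (Suc k)) ?b)" using Suc by (rule dvd_diff[rotated])
    then show ?case by simp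
  qed simp
  from this[of "j + idx X x"] show "?w dvd F s x - F (y 0) ?b"
    using invf_base[OF F X x, of j] by (simp add: j)
qed

text \<open>Transposing the complex replaces the rotation by its inverse.\<close>

lemma transfer_kernel':
  assumes F: "invf S X F" and X: "X \<in> gsets G"
    and d: "\<And>x. x \<in> pts X \<Longrightarrow> int (weight b (per X x)) dvd (\<Sum>s\<in>pts S. F s x)"
  shows "\<exists>F'. invf S X F' \<and> (\<forall>s\<in>pts S. \<forall>x\<in>pts X.
    int (weight b (lcm a (per X x))) dvd F s x - (F' s x - F' (act S (inv c) s) x))"
proof -
  obtain F' where F': "invf S X F'"
    "\<forall>s\<in>pts S. \<forall>x\<in>pts X. int (weight b (lcm a (per X x))) dvd F s x - (F' s x - F' (act S c s) x)"
    using transfer_kernel[OF F X d] by blast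
  \<comment> \<open>F' - F' \<circ> c is the difference with the inverse rotation for the function -
    F' \<circ> c.\<close>
  have "invf S X (\<lambda>s x. - F' (act S c s) x)"
    using F'(1) act_closed[OF S c] by (simp add: invf_def)
  moreover have "F s x - (- F' (act S c s) x - - F' (act S c (act S (inv c) s)) x) = F s x - (F' s x - F' (act S c s) x)"
    if "s \<in> pts S" for s x
    using act_inv(2)[OF S c that] by simp
  ultimately show ?thesis using F'(2) by (intro exI[of _ "\<lambda>s x. - F' (act S c s) x"]) auto
qed

lemma difference_kernel':
  assumes F: "invf S X F" and X: "X \<in> gsets G"
    and d: "\<And>s x. \<lbrakk>s \<in> pts S; x \<in> pts X\<rbrakk> \<Longrightarrow> int (weight b (lcm a (per X x))) dvd F s x - F (act S (inv c) s) x"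
  shows "\<exists>U. (\<forall>x\<in>pts X. U (act X c x) = U x) \<and>
    (\<forall>s\<in>pts S. \<forall>x\<in>pts X. int (weight b (lcm a (per X x))) dvd F s x - U x)"
proof (rule difference_kernel[OF F X])
  fix s x assume h: "s \<in> pts S" "x \<in> pts X"
  have "int (weight b (lcm a (per X x))) dvd F (act S c s) x - F s x"
    using d[OF act_closed[OF S c h(1)] h(2)] act_inv(1)[OF S c h(1)] by simp
  then show "int (weight b (lcm a (per X x))) dvd F s x - F (act S c s) x"
    by (simp add: dvd_diff_commute)
qed

section \<open>The ideals as sets of invariant functions\<close>

lemma one_elt_zc: "one_elt X = zc X (\<lambda>s. 1)"
  by (simp add: one_elt_def zc_def ev_def)

lemma one_elt_in: "X \<in> gsets G \<Longrightarrow> one_elt X \<in> carrier (ob (constZ G) X)"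
  unfolding one_elt_zc by (rule zc_inv) auto

lemma mor_one_elt:
  assumes T: "T \<in> gsets G" and f: "f \<in> BZ G X T" and x: "x \<in> pts X"
  shows "mor (constZ G) X T f (one_elt T) (frag_of x) = (\<Sum>s\<in>pts T. Poly_Mapping.lookup (f (frag_of x)) s)"
  using BZ_keys_of[OF f x] x ev_superset[OF BZ_keys_of[OF f x] gsets_finite[OF T], of "\<lambda>s. 1"]
  by (simp add: constZ_apply one_elt_zc zc_apply)

text \<open>Pulling back the unit of S along a morphism adds up a column of its matrix. So this is
  the transfer from S, and the case b = 0 of \<open>transfer_surj\<close> turns the congruence into
  an equality.\<close>

lemma J_iff: "X \<in> gsets G \<Longrightarrow> u \<in> J a X \<longleftrightarrow> (\<exists>f\<in>BZ G X S. u = mor (constZ G) X S f (one_elt S))"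
proof
  assume X: "X \<in> gsets G" and u: "u \<in> J a X"
  have uc: "u \<in> carrier (ob (constZ G) X)" using u by (simp add: J_def)
  obtain F where F: "invf S X F" "\<forall>x\<in>pts X. int (weight 0 (per X x)) dvd u (frag_of x) - (\<Sum>s\<in>pts S. F s x)"
    using transfer_surj[OF X, of "\<lambda>x. u (frag_of x)" 0] u constZ_c[OF uc] by (auto simp: J_def)
  have f: "bzF S X F \<in> BZ G X S" using bzF_in[OF S X F(1)] .
  have "u = mor (constZ G) X S (bzF S X F) (one_elt S)"
    by (rule constZ_eqI[OF uc constZ_mor_in[OF X f one_elt_in[OF S]]])
      (use F(2) in \<open>simp add: mor_one_elt[OF S f] lookup_bzF[OF S] weight_def\<close>)
  then show "\<exists>f\<in>BZ G X S. u = mor (constZ G) X S f (one_elt S)" using f by blast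
next
  assume X: "X \<in> gsets G" and "\<exists>f\<in>BZ G X S. u = mor (constZ G) X S f (one_elt S)"
  then obtain f where f: "f \<in> BZ G X S" "u = mor (constZ G) X S f (one_elt S)" by blast
  have "int (weight a (per X x)) dvd u (frag_of x)" if x: "x \<in> pts X" for x
    unfolding f(2) mor_one_elt[OF S f(1) x] sum_invf[OF BZ_invf(1)[OF S X f(1)] X x] by simp
  then show "u \<in> J a X" using constZ_mor_in[OF X f(1) one_elt_in[OF S]] f(2) by (simp add: J_def)
qed

lemma constZ_inv_apply:
  assumes X: "X \<in> gsets G" and u: "u \<in> carrier (ob (constZ G) X)" and x: "x \<in> pts X"
  shows "(inv\<^bsub>ob (constZ G) X\<^esub> u) (frag_of x) = - u (frag_of x)"
proof -
  interpret Z: comm_group "ob (constZ G) X" using constZ_comm_group[OF X] .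
  have "(inv\<^bsub>ob (constZ G) X\<^esub> u \<otimes>\<^bsub>ob (constZ G) X\<^esub> u) (frag_of x) = 0"
    using u x by (simp add: constZ_apply(2))
  then show ?thesis using x by (simp add: constZ_apply(1))
qed

text \<open>Stability under morphisms is read off from \<open>J_iff\<close>: a pullback of a
  pullback of the unit of S is again one. No divisibility has to be traced through a
  morphism.\<close>

lemma J_submodule: "submodule_of G (constZ G) (J a)"
  unfolding submodule_of_def
proof (intro conjI ballI)
  fix X assume X: "X \<in> gsets G"
  interpret Z: comm_group "ob (constZ G) X" using constZ_comm_group[OF X] .
  show "subgroup (J a X) (ob (constZ G) X)"
  proof (rule subgroup.intro)
    show "J a X \<subseteq> carrier (ob (constZ G) X)" by (auto simp: J_def)
    show "\<one>\<^bsub>ob (constZ G) X\<^esub> \<in> J a X" by (simp add: J_def constZ_apply(2))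
    fix u assume "u \<in> J a X"
    then have u: "u \<in> carrier (ob (constZ G) X)" "\<And>x. x \<in> pts X \<Longrightarrow> int (weight a (per X x)) dvd u (frag_of x)"
      by (auto simp: J_def)
    then show "inv\<^bsub>ob (constZ G) X\<^esub> u \<in> J a X" by (simp add: J_def constZ_inv_apply[OF X])
    fix v assume "v \<in> J a X"
    then have v: "v \<in> carrier (ob (constZ G) X)" "\<And>x. x \<in> pts X \<Longrightarrow> int (weight a (per X x)) dvd v (frag_of x)"
      by (auto simp: J_def)
    show "u \<otimes>\<^bsub>ob (constZ G) X\<^esub> v \<in> J a X" using u v by (simp add: J_def constZ_apply(1))
  qed
next
  fix X Y f assume h: "X \<in> gsets G" "Y \<in> gsets G" "f \<in> BZ G X Y"
  show "mor (constZ G) X Y f ` J a Y \<subseteq> J a X"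
  proof
    fix v assume "v \<in> mor (constZ G) X Y f ` J a Y"
    then obtain w where w: "w \<in> J a Y" "v = mor (constZ G) X Y f w" by (elim imageE)
    obtain g where "g \<in> BZ G Y S" "w = mor (constZ G) Y S g (one_elt S)" using w(1) unfolding J_iff[OF h(2)] by (elim bexE)
    then have g: "g \<in> BZ G Y S" "v = mor (constZ G) X Y f (mor (constZ G) Y S g (one_elt S))" using w(2) by simp_all
    have "v = mor (constZ G) X S (bz_comp X g f) (one_elt S)"
      unfolding g(2) by (rule zmodule.mor_comp[OF zmodule_constZ h(1,2) S h(3) g(1) one_elt_in[OF S], symmetric])
    then show "v \<in> J a X" unfolding J_iff[OF h(1)] by (rule bexI[OF _ bz_comp_in[OF h(3) g(1) h(1)]])
  qed
qed

text \<open>The units on orbits of the family satisfy the divisibility conditions by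
  \<open>per_family\<close>, which gives one inclusion. Conversely K belongs to the family and every
  element of \<open>J\<close> is a restriction of the unit on G/K.\<close>

lemma ideal_of_eq: "X \<in> gsets G \<Longrightarrow> ideal_of G a X = J a X"
proof
  assume X: "X \<in> gsets G"
  have gens: "{one_elt Y |H. H \<in> family G a \<and> Y = orbit_gset G H} \<subseteq> J a Y" for Y
  proof
    fix u assume "u \<in> {one_elt Y |H. H \<in> family G a \<and> Y = orbit_gset G H}"
    then obtain H where H: "H \<in> family G a" "Y = orbit_gset G H" "u = one_elt Y" by blast
    then have Y: "Y \<in> gsets G" using orbit_gset_in[OF is_group fin, of H] by (simp add: family_def)
    have "weight a (per Y x) = 1" if "x \<in> pts Y" for x
      using per_family[OF H(1) a, of x] that H(2) a_pos by (simp add: weight_def gcd_nat.absorb1)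
    then show "u \<in> J a Y" using one_elt_in[OF Y] H(3) by (simp add: J_def)
  qed
  show "ideal_of G a X \<subseteq> J a X"
    unfolding ideal_of_def gen_submodule_def using J_submodule gens by (intro Inter_lower CollectI exI[of _ "J a"]) auto
  show "J a X \<subseteq> ideal_of G a X"
    unfolding ideal_of_def gen_submodule_def
  proof (intro Inter_greatest subsetI)
    fix B u assume "B \<in> {I X |I. submodule_of G (constZ G) I \<and>
      (\<forall>Y\<in>gsets G. {one_elt Y |H. H \<in> family G a \<and> Y = orbit_gset G H} \<subseteq> I Y)}" and u: "u \<in> J a X"
    then obtain I where I: "B = I X" "submodule_of G (constZ G) I"
      "\<forall>Y\<in>gsets G. {one_elt Y |H. H \<in> family G a \<and> Y = orbit_gset G H} \<subseteq> I Y" by blast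
    have "one_elt S \<in> I S" using I(3) S K_family by (auto simp: S_def)
    moreover obtain f where "f \<in> BZ G X S" "u = mor (constZ G) X S f (one_elt S)"
      using u unfolding J_iff[OF X] by (elim bexE)
    ultimately show "u \<in> B" using submodule_mor[OF I(2) X S] I(1) by blast
  qed
qed

lemma ideal_of_submodule: "submodule_of G (constZ G) (ideal_of G a)"
  using J_submodule ideal_of_eq by (simp add: submodule_of_def)

end

section \<open>Complexes with terms on the point and on an orbit\<close>

text \<open>The empty G-set represents the zero module. With it the resolution has a represented
  term in every degree, including those beyond its length.\<close>

definition empty_gset :: "'g gset" where
  "empty_gset = \<lparr>pts = {}, act = (\<lambda>g. \<lambda>x\<in>{}. x)\<rparr>"

lemma empty_gset [simp]: "pts empty_gset = {}" "group G \<Longrightarrow> empty_gset \<in> gsets G"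
  by (auto simp: empty_gset_def intro!: gsetI)

context cyc begin

definition pt where "pt = orbit_gset G (carrier G)"
definition p0 where "p0 = Cos (carrier G)"

lemma pt [simp]: "pt \<in> gsets G"
  unfolding pt_def by (rule orbit_gset_in[OF is_group fin subgroup_self])

lemma coset_carrier: "x \<in> carrier G \<Longrightarrow> x <# carrier G = carrier G"
  using l_coset_eq_self[OF subgroup_self] by simp

lemma pts_pt [simp]: "pts pt = {p0}"
  unfolding pt_def orbit_gset_pts p0_def using coset_carrier by auto

lemma act_pt [simp]: "g \<in> carrier G \<Longrightarrow> act pt g p0 = p0"
  using act_closed[OF pt, of g p0] by simp

lemma per_pt [simp]: "per pt p0 = 1"
  by (rule per_eqI[OF pt]) simp_all

lemma invf_pt: "invf pt X F \<longleftrightarrow> (\<forall>x\<in>pts X. F p0 (act X c x) = F p0 x)"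
  by (simp add: invf_def)

end

context cyc_orbit begin

definition St where "St k = (if k = 1 \<or> k = 2 then S else if k = 0 \<or> k = 3 then pt else empty_gset)" for k :: nat

lemma St [simp]: "St k \<in> gsets G"
  by (simp add: St_def S is_group)

lemma St_simps [simp]: "St 0 = pt" "St (Suc 0) = S" "St 2 = S" "St (Suc (Suc 0)) = S" "St 3 = pt"
  by (simp_all add: St_def)

end

text \<open>\<open>C k X\<close> presents \<open>A k\<close> at \<open>X\<close> as the invariant functions on \<open>St k \<times> X\<close> modulo the multiples of
  the weights for \<open>b\<close>. The resolution is the case \<open>b = 0\<close>, its box product with \<open>\<int>/I\<^sub>b\<close> and the dual
  complex read backwards are the others.\<close>

locale four_term = cyc_orbit G c a for G :: "'g monoid" (structure) and c a +
  fixes b :: nat and A :: "nat \<Rightarrow> ('g, 'm) zmod" and D :: "nat \<Rightarrow> ('g, 'm, 'm) nat_trans"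
    and C :: "nat \<Rightarrow> 'g gset \<Rightarrow> ('g pt \<Rightarrow> 'g pt \<Rightarrow> int) \<Rightarrow> 'm" and \<sigma>
  assumes \<sigma>: "\<sigma> = c \<or> \<sigma> = inv c"
    and zA: "\<And>k. k \<le> 3 \<Longrightarrow> zmodule G (A k)"
    and D: "\<And>k. k < 3 \<Longrightarrow> D k \<in> zhom G (A (Suc k)) (A k)"
    and C_surj: "\<And>k X. \<lbrakk>k \<le> 3; X \<in> gsets G\<rbrakk> \<Longrightarrow> carrier (ob (A k) X) = C k X ` {F. invf (St k) X F}"
    and C_add: "\<And>k X F F'. \<lbrakk>k \<le> 3; X \<in> gsets G; invf (St k) X F; invf (St k) X F'\<rbrakk>
      \<Longrightarrow> C k X (\<lambda>s x. F s x + F' s x) = C k X F \<otimes>\<^bsub>ob (A k) X\<^esub> C k X F'"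
    and C_ker: "\<And>k X F. \<lbrakk>k \<le> 3; X \<in> gsets G; invf (St k) X F\<rbrakk> \<Longrightarrow> C k X F = \<one>\<^bsub>ob (A k) X\<^esub> \<longleftrightarrow>
      (\<forall>s\<in>pts (St k). \<forall>x\<in>pts X. int (weight b (lcm (per (St k) s) (per X x))) dvd F s x)"
    and C_nat: "\<And>k X Y f F. \<lbrakk>k = 0 \<or> k = 3; X \<in> gsets G; Y \<in> gsets G; f \<in> BZ G X Y; invf pt Y F\<rbrakk>
      \<Longrightarrow> mor (A k) X Y f (C k Y F) = C k X (\<lambda>s x. ev (F s) (f (frag_of x)))"
    and D0: "\<And>X F. \<lbrakk>X \<in> gsets G; invf S X F\<rbrakk> \<Longrightarrow> D 0 X (C 1 X F) = C 0 X (\<lambda>s x. \<Sum>t\<in>pts S. F t x)"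
    and D1: "\<And>X F. \<lbrakk>X \<in> gsets G; invf S X F\<rbrakk> \<Longrightarrow> D 1 X (C 2 X F) = C 1 X (\<lambda>s x. F s x - F (act S \<sigma> s) x)"
    and D2: "\<And>X F. \<lbrakk>X \<in> gsets G; invf pt X F\<rbrakk> \<Longrightarrow> D 2 X (C 3 X F) = C 2 X (\<lambda>s x. F p0 x)"
begin

lemma C_in: "\<lbrakk>k \<le> 3; X \<in> gsets G; invf (St k) X F\<rbrakk> \<Longrightarrow> C k X F \<in> carrier (ob (A k) X)"
  using C_surj by blast

lemma C_eq_iff:
  assumes k: "k \<le> 3" and X: "X \<in> gsets G" and F: "invf (St k) X F" "invf (St k) X F'"
  shows "C k X F = C k X F' \<longleftrightarrow>
    (\<forall>s\<in>pts (St k). \<forall>x\<in>pts X. int (weight b (lcm (per (St k) s) (per X x))) dvd F s x - F' s x)"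
proof -
  have g: "group (ob (A k) X)" using zmodule.group_ob[OF zA[OF k] X] .
  have i: "invf (St k) X (\<lambda>s x. F s x - F' s x)" using invf_diff F .
  have "C k X F = C k X (\<lambda>s x. F s x - F' s x) \<otimes>\<^bsub>ob (A k) X\<^esub> C k X F'"
    using C_add[OF k X i F(2)] by simp
  then have "C k X F = C k X F' \<longleftrightarrow> C k X (\<lambda>s x. F s x - F' s x) = \<one>\<^bsub>ob (A k) X\<^esub>"
    using group.r_cancel_one[OF g C_in[OF k X F(2)] C_in[OF k X i]] by simp
  then show ?thesis using C_ker[OF k X i] by simp
qed

lemma \<sigma>_in: "\<sigma> \<in> carrier G"
  using \<sigma> by auto

lemma invf_\<sigma>: "invf S X F \<Longrightarrow> invf S X (\<lambda>s x. F (act S \<sigma> s) x)"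
proof -
  assume F: "invf S X F"
  have "act S \<sigma> (act S c s) = act S c (act S \<sigma> s)" if "s \<in> pts S" for s
    using \<sigma> act_inv[OF S c that] by auto
  then show ?thesis using F act_closed[OF S \<sigma>_in] by (simp add: invf_def)
qed

lemma invf_sum: "invf S X F \<Longrightarrow> invf pt X (\<lambda>s x. \<Sum>t\<in>pts S. F t x)"
proof -
  assume F: "invf S X F"
  have "(\<Sum>t\<in>pts S. F t (act X c x)) = (\<Sum>t\<in>pts S. F t x)" if "x \<in> pts X" for x
    using sum_act[OF S c, of "\<lambda>t. F t (act X c x)"] F that by (simp add: invf_def)
  then show ?thesis by (simp add: invf_pt)
qed

lemma invf_const: "invf pt X F \<Longrightarrow> invf S X (\<lambda>s x. F p0 x)"
  by (simp add: invf_def)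

section \<open>Homology of a four-term complex\<close>

lemma image_D0:
  assumes X: "X \<in> gsets G" and F: "invf pt X F"
  shows "C 0 X F \<in> D 0 X ` carrier (ob (A 1) X) \<longleftrightarrow>
    (\<forall>x\<in>pts X. int (weight (gcd a b) (per X x)) dvd F p0 x)"
proof -
  have e: "C 0 X F = D 0 X (C 1 X F') \<longleftrightarrow> (\<forall>x\<in>pts X. int (weight b (per X x)) dvd F p0 x - (\<Sum>t\<in>pts S. F' t x))"
    if "invf S X F'" for F'
    unfolding D0[OF X that] using C_eq_iff[of 0 X F, OF _ X _ ] F invf_sum[OF that] by simp
  have "C 0 X F \<in> D 0 X ` carrier (ob (A 1) X) \<longleftrightarrow>
    (\<exists>F'. invf S X F' \<and> (\<forall>x\<in>pts X. int (weight b (per X x)) dvd F p0 x - (\<Sum>t\<in>pts S. F' t x)))"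
    using C_surj[of 1 X] X e by auto
  also have "\<dots> \<longleftrightarrow> (\<forall>x\<in>pts X. int (weight (gcd a b) (per X x)) dvd F p0 x)"
    using transfer_surj[OF X, of "F p0" b] F transfer_dvd[OF _ X] unfolding invf_pt by blast
  finally show ?thesis .
qed

lemma kernel_D0:
  assumes X: "X \<in> gsets G"
  shows "kernel (ob (A 1) X) (ob (A 0) X) (D 0 X) = D 1 X ` carrier (ob (A 2) X)"
proof (intro equalityI subsetI)
  fix m assume "m \<in> kernel (ob (A 1) X) (ob (A 0) X) (D 0 X)"
  then obtain F where F: "invf S X F" "m = C 1 X F" "D 0 X (C 1 X F) = \<one>\<^bsub>ob (A 0) X\<^esub>"
    using C_surj[of 1 X] X by (auto simp: kernel_def)
  have "int (weight b (per X x)) dvd (\<Sum>t\<in>pts S. F t x)" if "x \<in> pts X" for x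
    using F(3) C_ker[of 0 X "\<lambda>s x. \<Sum>t\<in>pts S. F t x"] invf_sum[OF F(1)] X that
    unfolding D0[OF X F(1)] by simp
  then obtain F' where F': "invf S X F'"
    "\<forall>s\<in>pts S. \<forall>x\<in>pts X. int (weight b (lcm a (per X x))) dvd F s x - (F' s x - F' (act S \<sigma> s) x)"
    using transfer_kernel[OF F(1) X, of b] transfer_kernel'[OF F(1) X, of b] \<sigma> by blast
  have "m = D 1 X (C 2 X F')"
    unfolding F(2) D1[OF X F'(1)]
    using C_eq_iff[of 1 X F] F(1) X invf_diff[OF F'(1) invf_\<sigma>[OF F'(1)]] F'(2) by (simp add: per_S)
  moreover have "C 2 X F' \<in> carrier (ob (A 2) X)" using C_in[of 2 X F'] X F'(1) by simp
  ultimately show "m \<in> D 1 X ` carrier (ob (A 2) X)" by blast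
next
  fix m assume "m \<in> D 1 X ` carrier (ob (A 2) X)"
  then obtain F where F: "invf S X F" "m = C 1 X (\<lambda>s x. F s x - F (act S \<sigma> s) x)"
    using C_surj[of 2 X] X D1[OF X] unfolding image_iff by auto
  let ?F = "\<lambda>s x. F s x - F (act S \<sigma> s) x"
  have i: "invf S X ?F" using invf_diff[OF F(1) invf_\<sigma>[OF F(1)]] .
  \<comment> \<open>\<open>\<sigma>\<close> permutes S, so the two sums cancel.\<close>
  have "(\<Sum>t\<in>pts S. ?F t x) = 0" for x
    using sum_act[OF S \<sigma>_in, of "\<lambda>s. F s x"] by (simp add: sum_subtractf)
  then have "D 0 X m = \<one>\<^bsub>ob (A 0) X\<^esub>"
    unfolding F(2) D0[OF X i] using C_ker[of 0 X "\<lambda>s x. \<Sum>t\<in>pts S. ?F t x"] invf_sum[OF i] X by simp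
  then show "m \<in> kernel (ob (A 1) X) (ob (A 0) X) (D 0 X)"
    using C_in[of 1 X ?F] X i F(2) by (simp add: kernel_def)
qed

lemma kernel_D1:
  assumes X: "X \<in> gsets G"
  shows "kernel (ob (A 2) X) (ob (A 1) X) (D 1 X) = D 2 X ` carrier (ob (A 3) X)"
proof (intro equalityI subsetI)
  fix m assume "m \<in> kernel (ob (A 2) X) (ob (A 1) X) (D 1 X)"
  then obtain F where F: "invf S X F" "m = C 2 X F" "D 1 X (C 2 X F) = \<one>\<^bsub>ob (A 1) X\<^esub>"
    using C_surj[of 2 X] X by (auto simp: kernel_def)
  have "int (weight b (lcm a (per X x))) dvd F s x - F (act S \<sigma> s) x" if "s \<in> pts S" "x \<in> pts X" for s x
    using F(3) C_ker[of 1 X "\<lambda>s x. F s x - F (act S \<sigma> s) x"] invf_diff[OF F(1) invf_\<sigma>[OF F(1)]] X that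
    unfolding D1[OF X F(1)] by (simp add: per_S)
  then obtain U where U: "\<forall>x\<in>pts X. U (act X c x) = U x"
    "\<forall>s\<in>pts S. \<forall>x\<in>pts X. int (weight b (lcm a (per X x))) dvd F s x - U x"
    using difference_kernel[OF F(1) X, of b] difference_kernel'[OF F(1) X, of b] \<sigma> by blast
  let ?F = "\<lambda>(s::'g pt) x. U x"
  have i: "invf pt X ?F" using U(1) by (simp add: invf_pt)
  have "m = D 2 X (C 3 X ?F)"
    unfolding F(2) D2[OF X i]
    using C_eq_iff[of 2 X F] F(1) X invf_const[OF i] U(2) by (simp add: per_S)
  moreover have "C 3 X ?F \<in> carrier (ob (A 3) X)" using C_in[of 3 X ?F] X i by simp
  ultimately show "m \<in> D 2 X ` carrier (ob (A 3) X)" by blast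
next
  fix m assume "m \<in> D 2 X ` carrier (ob (A 3) X)"
  then obtain F where F: "invf pt X F" "m = C 2 X (\<lambda>s x. F p0 x)"
    using C_surj[of 3 X] X D2[OF X] unfolding image_iff by auto
  have i: "invf S X (\<lambda>s x. F p0 x)" using invf_const[OF F(1)] .
  have "D 1 X m = \<one>\<^bsub>ob (A 1) X\<^esub>"
    unfolding F(2) D1[OF X i] using C_ker[of 1 X "\<lambda>s x. F p0 x - F p0 x"] X by (simp add: invf_def)
  then show "m \<in> kernel (ob (A 2) X) (ob (A 1) X) (D 1 X)"
    using C_in[of 2 X "\<lambda>s x. F p0 x"] X i F(2) by (simp add: kernel_def)
qed

text \<open>The map repeats a function along the nonempty set S without changing its values. Only
  the modulus changes, from that of p to that of lcm(a, p), and the kernel measures the gap.\<close>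

lemma kernel_D2:
  assumes X: "X \<in> gsets G" and F: "invf pt X F"
  shows "C 3 X F \<in> kernel (ob (A 3) X) (ob (A 2) X) (D 2 X) \<longleftrightarrow>
    (\<forall>x\<in>pts X. int (weight b (lcm a (per X x))) dvd F p0 x)"
proof -
  have "pts S \<noteq> {}" using y_in by blast
  then show ?thesis
    using C_in[of 3 X F] C_ker[of 2 X "\<lambda>s x. F p0 x"] invf_const[OF F] X F
    by (auto simp: kernel_def D2[OF X F] per_S)
qed

text \<open>The comparison maps from the constant module to the end terms. The scalar q will be 1 in
  degree 0 and b / gcd(a, b) in degree 3.\<close>

lemma point_map:
  assumes k: "k = 0 \<or> k = 3"
  shows "zrestrict G (constZ G) (\<lambda>X u. C k X (\<lambda>s x. q * u (frag_of x))) \<in> zhom G (constZ G) (A k)"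
proof -
  have k3: "k \<le> 3" and Stk: "St k = pt" using k by auto
  have i: "invf pt X (\<lambda>s x. q * u (frag_of x))" if "u \<in> carrier (ob (constZ G) X)" for X u
    using constZ_c[OF that] by (simp add: invf_pt)
  show ?thesis
  proof (rule zrestrict_in[OF zmodule_constZ])
    fix X u assume h: "X \<in> gsets G" "u \<in> carrier (ob (constZ G) X)"
    show "C k X (\<lambda>s x. q * u (frag_of x)) \<in> carrier (ob (A k) X)"
      using C_in[OF k3 h(1)] i[OF h(2)] Stk by simp
    fix v assume v: "v \<in> carrier (ob (constZ G) X)"
    have "C k X (\<lambda>s x. q * (u \<otimes>\<^bsub>ob (constZ G) X\<^esub> v) (frag_of x))
        = C k X (\<lambda>s x. q * u (frag_of x) + q * v (frag_of x))"
    proof -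
      have "invf pt X (\<lambda>s x. q * u (frag_of x) + q * v (frag_of x))"
        using constZ_c[OF h(2)] constZ_c[OF v] by (simp add: invf_pt)
      then show ?thesis
        by (subst C_eq_iff[OF k3 h(1)])
          (use i[OF constZ_mult_in[OF h v]] Stk in \<open>simp_all add: constZ_apply(1) algebra_simps\<close>)
    qed
    then show "C k X (\<lambda>s x. q * (u \<otimes>\<^bsub>ob (constZ G) X\<^esub> v) (frag_of x))
        = C k X (\<lambda>s x. q * u (frag_of x)) \<otimes>\<^bsub>ob (A k) X\<^esub> C k X (\<lambda>s x. q * v (frag_of x))"
      using C_add[OF k3 h(1)] i[OF h(2)] i[OF v] Stk by simp
  next
    fix X Y f u assume h: "X \<in> gsets G" "Y \<in> gsets G" "f \<in> BZ G X Y" "u \<in> carrier (ob (constZ G) Y)"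
    have e: "ev (\<lambda>x. q * u (frag_of x)) z = q * u z" if "Poly_Mapping.keys z \<subseteq> pts Y" for z
      unfolding constZ_ev[OF h(4) that] by (simp add: ev_def sum_distrib_left mult_ac)
    have i': "invf pt X (\<lambda>s x. q * mor (constZ G) X Y f u (frag_of x))"
      using i[OF constZ_mor_in[OF h(1,3,4)]] .
    have eq: "ev (\<lambda>x. q * u (frag_of x)) (f (frag_of x)) = q * mor (constZ G) X Y f u (frag_of x)"
      if "x \<in> pts X" for x
      using e[OF BZ_keys_of[OF h(3) that]] that by (simp add: constZ_apply(3))
    have i'': "invf pt X (\<lambda>s x. ev (\<lambda>x. q * u (frag_of x)) (f (frag_of x)))"
      using i' act_closed[OF h(1) c] by (simp add: invf_pt eq)
    have "C k X (\<lambda>s x. q * mor (constZ G) X Y f u (frag_of x))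
        = C k X (\<lambda>s x. ev (\<lambda>x. q * u (frag_of x)) (f (frag_of x)))"
      by (subst C_eq_iff[OF k3 h(1)]) (use i' i'' Stk eq in simp_all)
    then show "C k X (\<lambda>s x. q * mor (constZ G) X Y f u (frag_of x))
        = mor (A k) X Y f (C k Y (\<lambda>s x. q * u (frag_of x)))"
      using C_nat[OF k h(1-3) i[OF h(4)]] by simp
  qed
qed

lemma gcd_orbit: "cyc_orbit G c (gcd a b)"
  by (rule cyc_orbit.intro[OF cyc_axioms cyc_orbit_axioms.intro]) (rule dvd_trans[OF gcd_dvd1 a])

lemmas ideal = cyc_orbit.ideal_of_eq[OF gcd_orbit] cyc_orbit.ideal_of_submodule[OF gcd_orbit]

lemma ideal_iff:
  "\<lbrakk>X \<in> gsets G; u \<in> carrier (ob (constZ G) X)\<rbrakk> \<Longrightarrow>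
    u \<in> ideal_of G (gcd a b) X \<longleftrightarrow> (\<forall>x\<in>pts X. int (weight (gcd a b) (per X x)) dvd u (frag_of x))"
  by (simp add: ideal J_def)

text \<open>The common shape of the two end computations: \<open>subquot_iso\<close> for
  \<open>point_map\<close>, with the scalar, the numerator and the denominator left open.\<close>

lemma Zquot_iso:
  assumes k: "k = 0 \<or> k = 3"
    and Z: "submodule_of G (A k) Z" and B: "submodule_of G (A k) B" and le: "\<And>X. X \<in> gsets G \<Longrightarrow> B X \<subseteq> Z X"
    and map: "\<And>X u. \<lbrakk>X \<in> gsets G; u \<in> carrier (ob (constZ G) X)\<rbrakk> \<Longrightarrow> C k X (\<lambda>s x. q * u (frag_of x)) \<in> Z X"
    and ker: "\<And>X u. \<lbrakk>X \<in> gsets G; u \<in> carrier (ob (constZ G) X)\<rbrakk> \<Longrightarrow> C k X (\<lambda>s x. q * u (frag_of x)) \<in> B X \<longleftrightarrow>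
      (\<forall>x\<in>pts X. int (weight (gcd a b) (per X x)) dvd u (frag_of x))"
    and surj: "\<And>X F. \<lbrakk>X \<in> gsets G; invf pt X F; C k X F \<in> Z X\<rbrakk>
      \<Longrightarrow> \<exists>u\<in>carrier (ob (constZ G) X). C k X (\<lambda>s x. q * u (frag_of x)) = C k X F"
  shows "zmod_iso G (Zquot G (gcd a b)) (subquot (A k) Z B)"
  unfolding Zquot_def quot_def
proof (rule subquot_iso[OF zmodule_constZ submodule_carrier[OF zmodule_constZ] ideal(2) _ _ Z B le point_map[OF k]])
  have k3: "k \<le> 3" and Stk: "St k = pt" using k by auto
  show "zmodule G (A k)" using zA[OF k3] .
  fix X assume X: "X \<in> gsets G"
  show "ideal_of G (gcd a b) X \<subseteq> carrier (ob (constZ G) X)" using X by (auto simp: ideal J_def)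
  fix u assume u: "u \<in> carrier (ob (constZ G) X)"
  show "zrestrict G (constZ G) (\<lambda>X u. C k X (\<lambda>s x. q * u (frag_of x))) X u \<in> Z X"
    using map[OF X u] X u by simp
  show "zrestrict G (constZ G) (\<lambda>X u. C k X (\<lambda>s x. q * u (frag_of x))) X u \<in> B X \<longleftrightarrow> u \<in> ideal_of G (gcd a b) X"
    using ker[OF X u] ideal_iff[OF X u] X u by simp
next
  have k3: "k \<le> 3" and Stk: "St k = pt" using k by auto
  fix X z assume X: "X \<in> gsets G" and z: "z \<in> Z X"
  have zc: "z \<in> carrier (ob (A k) X)" using z Z X by (auto simp: submodule_of_def dest: subgroup.mem_carrier)
  then obtain F where F: "invf pt X F" "z = C k X F" using C_surj[OF k3 X] Stk by auto
  obtain u where u: "u \<in> carrier (ob (constZ G) X)" "C k X (\<lambda>s x. q * u (frag_of x)) = z"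
    using surj[OF X F(1)] z F(2) by blast
  have "z \<otimes>\<^bsub>ob (A k) X\<^esub> inv\<^bsub>ob (A k) X\<^esub> z \<in> B X"
    using group.r_inv[OF zmodule.group_ob[OF zA[OF k3] X] zc] B X by (simp add: submodule_of_def subgroup.one_closed)
  then show "\<exists>u\<in>carrier (ob (constZ G) X). zrestrict G (constZ G) (\<lambda>X u. C k X (\<lambda>s x. q * u (frag_of x))) X u
      \<otimes>\<^bsub>ob (A k) X\<^esub> inv\<^bsub>ob (A k) X\<^esub> z \<in> B X"
    using u X by (intro bexI[of _ u]) simp_all
qed

lemma coker_iso:
  "zmod_iso G (Zquot G (gcd a b)) (subquot (A 0) (\<lambda>X. carrier (ob (A 0) X)) (\<lambda>X. D 0 X ` carrier (ob (A 1) X)))"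
proof (rule Zquot_iso[of 0 _ _ 1])
  have z: "zmodule G (A 0)" "zmodule G (A 1)" and d: "D 0 \<in> zhom G (A 1) (A 0)" using zA[of 0] zA[of 1] D[of 0] by simp_all
  show "submodule_of G (A 0) (\<lambda>X. carrier (ob (A 0) X))" using submodule_carrier[OF z(1)] .
  show "submodule_of G (A 0) (\<lambda>X. D 0 X ` carrier (ob (A 1) X))" using submodule_image[OF z(2,1) d] .
  show "D 0 X ` carrier (ob (A 1) X) \<subseteq> carrier (ob (A 0) X)" if "X \<in> gsets G" for X
    using zhom_closed[OF d that] by blast
  fix X assume X: "X \<in> gsets G"
  show "\<exists>u\<in>carrier (ob (constZ G) X). C 0 X (\<lambda>s x. 1 * u (frag_of x)) = C 0 X F" if F: "invf pt X F" for F
  proof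
    show u: "zc X (F p0) \<in> carrier (ob (constZ G) X)" using zc_inv[OF X, of "F p0"] F by (simp add: invf_pt)
    show "C 0 X (\<lambda>s x. 1 * zc X (F p0) (frag_of x)) = C 0 X F"
      by (subst C_eq_iff[OF _ X]) (use F constZ_c[OF u] in \<open>simp_all add: invf_pt\<close>)
  qed
  fix u assume u: "u \<in> carrier (ob (constZ G) X)"
  have i: "invf pt X (\<lambda>s x. 1 * u (frag_of x))" using constZ_c[OF u] by (simp add: invf_pt)
  show "C 0 X (\<lambda>s x. 1 * u (frag_of x)) \<in> carrier (ob (A 0) X)" using C_in[of 0 X] i X by simp
  show "C 0 X (\<lambda>s x. 1 * u (frag_of x)) \<in> D 0 X ` carrier (ob (A 1) X) \<longleftrightarrow>
      (\<forall>x\<in>pts X. int (weight (gcd a b) (per X x)) dvd u (frag_of x))"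
    using image_D0[OF X i] by simp
qed simp

text \<open>Multiplication by b / gcd(a, b) maps into the kernel by \<open>weight_lcm_dvd\<close>,
  reaches all of it by \<open>weight_lift\<close>, and annihilates exactly the ideal for gcd(a, b)
  by \<open>weight_kernel\<close>.\<close>

lemma kernel_iso:
  assumes b: "b > 0"
  shows "zmod_iso G (Zquot G (gcd a b))
    (subquot (A 3) (\<lambda>X. kernel (ob (A 3) X) (ob (A 2) X) (D 2 X)) (\<lambda>X. {\<one>\<^bsub>ob (A 3) X\<^esub>}))"
proof (rule Zquot_iso[of 3 _ _ "int (weight b a)"])
  have z: "zmodule G (A 3)" "zmodule G (A 2)" and d: "D 2 \<in> zhom G (A 3) (A 2)" using zA[of 3] zA[of 2] D[of 2] by simp_all
  show "submodule_of G (A 3) (\<lambda>X. kernel (ob (A 3) X) (ob (A 2) X) (D 2 X))" using submodule_kernel[OF z d] .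
  show "submodule_of G (A 3) (\<lambda>X. {\<one>\<^bsub>ob (A 3) X\<^esub>})" using submodule_trivial[OF z(1)] .
  show "{\<one>\<^bsub>ob (A 3) X\<^esub>} \<subseteq> kernel (ob (A 3) X) (ob (A 2) X) (D 2 X)" if X: "X \<in> gsets G" for X
    using zhom_one[OF d X z] monoid.one_closed[OF group.is_monoid[OF zmodule.group_ob[OF z(1) X]]] by (simp add: kernel_def)
  fix X assume X: "X \<in> gsets G"
  show "\<exists>u\<in>carrier (ob (constZ G) X). C 3 X (\<lambda>s x. int (weight b a) * u (frag_of x)) = C 3 X F"
    if F: "invf pt X F" and k: "C 3 X F \<in> kernel (ob (A 3) X) (ob (A 2) X) (D 2 X)" for F
  proof
    \<comment> \<open>As with the transfer, the chosen quotient depends only on data that are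
      constant on orbits, so the function is invariant.\<close>
    define U where "U x = (SOME u. int (weight b (per X x)) dvd F p0 x - int (weight b a) * u)" for x
    have U: "int (weight b (per X x)) dvd F p0 x - int (weight b a) * U x" if "x \<in> pts X" for x
    proof -
      have "int (weight b (lcm a (per X x))) dvd F p0 x" using k that unfolding kernel_D2[OF X F] by blast
      from someI_ex[OF weight_lift[OF per(1)[OF X that] a_pos b this]] show ?thesis unfolding U_def .
    qed
    have "U (act X c x) = U x" if "x \<in> pts X" for x
      using F that by (simp add: U_def per_act[OF X that] invf_pt)
    then show u: "zc X U \<in> carrier (ob (constZ G) X)" using zc_inv[OF X, of U] by simp
    have "int (weight b (per X x)) dvd int (weight b a) * U x - F p0 x" if "x \<in> pts X" for x
      using U[OF that] by (subst dvd_diff_commute)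
    then show "C 3 X (\<lambda>s x. int (weight b a) * zc X U (frag_of x)) = C 3 X F"
      by (subst C_eq_iff[OF _ X]) (use F constZ_c[OF u] in \<open>simp_all add: invf_pt\<close>)
  qed
  fix u assume u: "u \<in> carrier (ob (constZ G) X)"
  have i: "invf pt X (\<lambda>s x. int (weight b a) * u (frag_of x))" using constZ_c[OF u] by (simp add: invf_pt)
  show "C 3 X (\<lambda>s x. int (weight b a) * u (frag_of x)) \<in> kernel (ob (A 3) X) (ob (A 2) X) (D 2 X)"
    unfolding kernel_D2[OF X i] using weight_lcm_dvd[OF a_pos per(1)[OF X]] by blast
  show "C 3 X (\<lambda>s x. int (weight b a) * u (frag_of x)) \<in> {\<one>\<^bsub>ob (A 3) X\<^esub>} \<longleftrightarrow>
      (\<forall>x\<in>pts X. int (weight (gcd a b) (per X x)) dvd u (frag_of x))"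
    using C_ker[of 3 X "\<lambda>s x. int (weight b a) * u (frag_of x)"] i X weight_kernel[OF per(1)[OF X] a_pos b] by simp
qed simp

text \<open>For b = 0 all moduli are 0, so passing to lcm(a, p) changes nothing. This gives
  exactness at the left end of the resolution as well as the vanishing of Ext in degree 0 with
  coefficients in \<int>.\<close>

lemma kernel_zero:
  assumes b: "b = 0" and X: "X \<in> gsets G"
  shows "kernel (ob (A 3) X) (ob (A 2) X) (D 2 X) = {\<one>\<^bsub>ob (A 3) X\<^esub>}"
proof -
  have z: "zmodule G (A 3)" "zmodule G (A 2)" and d: "D 2 \<in> zhom G (A 3) (A 2)" using zA[of 3] zA[of 2] D[of 2] by simp_all
  have "m = \<one>\<^bsub>ob (A 3) X\<^esub>" if m: "m \<in> kernel (ob (A 3) X) (ob (A 2) X) (D 2 X)" for m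
  proof -
    obtain F where F: "invf pt X F" "m = C 3 X F" using m C_surj[of 3 X] X by (auto simp: kernel_def)
    have "\<forall>x\<in>pts X. int (weight b (lcm a (per X x))) dvd F p0 x" using m unfolding F(2) kernel_D2[OF X F(1)] .
    then show ?thesis using C_ker[of 3 X F] F X b by (simp add: weight_def)
  qed
  moreover have "\<one>\<^bsub>ob (A 3) X\<^esub> \<in> kernel (ob (A 3) X) (ob (A 2) X) (D 2 X)"
    using zhom_one[OF d X z] monoid.one_closed[OF group.is_monoid[OF zmodule.group_ob[OF z(1) X]]]
    by (simp add: kernel_def)
  ultimately show ?thesis by blast
qed

end

section \<open>Transport of a module along an injection of types\<close>

definition transport :: "('m \<Rightarrow> 'n) \<Rightarrow> ('g, 'm) zmod \<Rightarrow> ('g, 'n) zmod" where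
  "transport enc M =
    \<lparr>ob = (\<lambda>X. \<lparr>carrier = enc ` carrier (ob M X),
       monoid.mult = (\<lambda>u v. enc (inv_into UNIV enc u \<otimes>\<^bsub>ob M X\<^esub> inv_into UNIV enc v)), one = enc \<one>\<^bsub>ob M X\<^esub>\<rparr>),
     mor = (\<lambda>X Y f u. enc (mor M X Y f (inv_into UNIV enc u)))\<rparr>"

lemma transport_simps:
  "carrier (ob (transport enc M) X) = enc ` carrier (ob M X)"
  "\<one>\<^bsub>ob (transport enc M) X\<^esub> = enc \<one>\<^bsub>ob M X\<^esub>"
  "inj enc \<Longrightarrow> enc u \<otimes>\<^bsub>ob (transport enc M) X\<^esub> enc v = enc (u \<otimes>\<^bsub>ob M X\<^esub> v)"
  "inj enc \<Longrightarrow> mor (transport enc M) X Y f (enc u) = enc (mor M X Y f u)"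
  by (simp_all add: transport_def)

lemma zmodule_transport:
  assumes M: "zmodule G M" and enc: "inj enc"
  shows "zmodule G (transport enc M)"
proof -
  interpret zmodule G M by fact
  note s = transport_simps(1,2) transport_simps(3,4)[OF enc]
  show ?thesis
  proof (rule zmodule.intro)
    fix X assume X: "X \<in> gsets G"
    have g: "comm_group (ob M X)" using comm_group_ob[OF X] .
    note m = group.is_monoid[OF group_ob[OF X]]
    show "comm_group (ob (transport enc M) X)"
    proof (rule comm_groupI)
      fix u assume "u \<in> carrier (ob (transport enc M) X)"
      then obtain u' where u: "u = enc u'" "u' \<in> carrier (ob M X)" by (auto simp: s)
      have "enc (inv\<^bsub>ob M X\<^esub> u') \<in> carrier (ob (transport enc M) X)"
        using group.inv_closed[OF group_ob[OF X] u(2)] by (simp add: s)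
      moreover have "enc (inv\<^bsub>ob M X\<^esub> u') \<otimes>\<^bsub>ob (transport enc M) X\<^esub> u = \<one>\<^bsub>ob (transport enc M) X\<^esub>"
        using group.l_inv[OF group_ob[OF X] u(2)] by (simp add: s u(1))
      ultimately show "\<exists>v\<in>carrier (ob (transport enc M) X). v \<otimes>\<^bsub>ob (transport enc M) X\<^esub> u = \<one>\<^bsub>ob (transport enc M) X\<^esub>"
        by blast
      fix v assume "v \<in> carrier (ob (transport enc M) X)"
      then show "u \<otimes>\<^bsub>ob (transport enc M) X\<^esub> v = v \<otimes>\<^bsub>ob (transport enc M) X\<^esub> u"
        using u comm_monoid.m_comm[OF comm_group.axioms(1)[OF g]] by (auto simp: s)
    qed (auto simp: s monoid.m_closed[OF m] monoid.one_closed[OF m] monoid.m_assoc[OF m] monoid.l_one[OF m])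
  qed (auto simp: s hom_def mor_closed mor_mult mor_id mor_comp mor_add)
qed

lemma represented_transport:
  assumes M: "represented G M S e" and enc: "inj enc"
  shows "represented G (transport enc M) S (enc e)"
proof (rule represented.intro[OF _ represented_axioms.intro])
  interpret represented G M S e by fact
  show "zmodule G (transport enc M)" by (rule zmodule_transport[OF zmodule_axioms enc])
  show "S \<in> gsets G" using S .
  show "enc e \<in> carrier (ob (transport enc M) S)" using e by (simp add: transport_simps)
  fix Y assume Y: "Y \<in> gsets G"
  have "bij_betw enc (carrier (ob M Y)) (carrier (ob (transport enc M) Y))"
    unfolding transport_simps(1) using enc by (intro inj_on_imp_bij_betw) (auto intro: inj_on_subset)
  from bij_betw_trans[OF bij[OF Y] this]
  show "bij_betw (\<lambda>f. mor (transport enc M) Y S f (enc e)) (BZ G Y S) (carrier (ob (transport enc M) Y))"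
    by (simp add: transport_simps(4)[OF enc] comp_def)
qed

text \<open>The two functions in the code of \<open>(x, p)\<close> are told apart by their nonzero values.\<close>

definition lmap_code :: "('g pt \<Rightarrow>\<^sub>0 int) \<times> 'g pt \<Rightarrow> (('g pt \<Rightarrow>\<^sub>0 int) \<Rightarrow> int) set" where
  "lmap_code = (\<lambda>(x, p). {\<lambda>z. if z = x then 1 else 0, \<lambda>z. if z = frag_of p then 2 else 0})"

text \<open>A map is recorded by all its integer coefficients, indexed by codes for pairs (argument,
  point). The result has the element type from which \<open>some_resolution\<close> chooses when the
  resolved module is a quotient of \<open>constZ\<close>.\<close>

definition enc_lmap :: "'g lmap \<Rightarrow> (('g pt \<Rightarrow>\<^sub>0 int) \<Rightarrow> int) set \<times> nat \<Rightarrow> int" where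
  "enc_lmap f = (\<lambda>(C, k). case inv_into UNIV lmap_code C of (x, p) \<Rightarrow> Poly_Mapping.lookup (f x) p)"

lemma inj_lmap_code: "inj lmap_code"
proof (rule injI)
  fix v w :: "('g pt \<Rightarrow>\<^sub>0 int) \<times> 'g pt" assume eq: "lmap_code v = lmap_code w"
  obtain x p x' p' where vw: "v = (x, p)" "w = (x', p')" by fastforce
  define A where "A x = (\<lambda>z. if z = x then 1 else 0 :: int)" for x :: "'g pt \<Rightarrow>\<^sub>0 int"
  define B where "B p = (\<lambda>z. if z = frag_of p then 2 else 0 :: int)" for p :: "'g pt"
  have n: "A x \<noteq> B p" for x p
  proof
    assume "A x = B p"
    from fun_cong[OF this, of x] show False by (simp add: A_def B_def split: if_splits)
  qed
  have "A x = A x'" "B p = B p'"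
    using eq n unfolding lmap_code_def vw A_def[symmetric] B_def[symmetric] by (auto simp: doubleton_eq_iff)
  from fun_cong[OF this(1), of x] fun_cong[OF this(2), of "frag_of p"] show "v = w"
    by (auto simp: A_def B_def vw split: if_splits dest: arg_cong[of _ _ Poly_Mapping.keys])
qed

lemma inj_enc_lmap: "inj enc_lmap"
proof (rule injI, rule ext, rule poly_mapping_eqI)
  fix f h :: "'g lmap" and x p assume "enc_lmap f = enc_lmap h"
  from fun_cong[OF this, of "(lmap_code (x, p), 0)"]
  show "Poly_Mapping.lookup (f x) p = Poly_Mapping.lookup (h x) p"
    by (simp add: enc_lmap_def inv_f_f[OF inj_lmap_code])
qed

section \<open>The resolution\<close>

lemma (in represented) yo_mor:
  assumes N: "zmodule G N" and n: "n \<in> carrier (ob N S)" and X: "X \<in> gsets G" and f: "f \<in> BZ G X S"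
  shows "yo N n X (mor M X S f e) = mor N X S f n"
  using zhom_natural[OF yo(1)[OF N n] X S f e] yo(2)[OF N n] by simp

lemma (in represented) mor_eq_one_iff:
  assumes X: "X \<in> gsets G" and f: "f \<in> BZ G X S"
  shows "mor M X S f e = \<one>\<^bsub>ob M X\<^esub> \<longleftrightarrow> f = bz_zero X"
  using inj_on_eq_iff[OF bij_betw_imp_inj_on[OF bij[OF X]] f bz_zero_in[OF X]] mor_zero[OF X S e] by simp

text \<open>Over the empty set the identity and the zero morphism coincide, and the module sends
  them to the identity and the trivial map.\<close>

lemma (in zmodule) trivial_on_empty:
  assumes E: "E \<in> gsets G" "pts E = {}"
  shows "carrier (ob M E) = {\<one>\<^bsub>ob M E\<^esub>}"
proof -
  have "bz_id E = bz_zero E" by (rule BZ_eqI[OF bz_id_in bz_zero_in]) (use E in auto)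
  then have "m = \<one>\<^bsub>ob M E\<^esub>" if "m \<in> carrier (ob M E)" for m
    using mor_id[OF E(1) that] mor_zero[OF E(1,1) that] by simp
  then show ?thesis using monoid.one_closed[OF group.is_monoid[OF group_ob[OF E(1)]]] by blast
qed

context cyc begin

text \<open>The product of the matrix of \<open>h\<close> with the matrix \<open>F\<close>.\<close>

definition push where
  "push T h F s x = (\<Sum>t\<in>pts T. Poly_Mapping.lookup (h (frag_of t)) s * F t x)"

lemma invf_cong: "\<lbrakk>\<And>s x. \<lbrakk>s \<in> pts T; x \<in> pts X\<rbrakk> \<Longrightarrow> F s x = F' s x; T \<in> gsets G; X \<in> gsets G\<rbrakk>
    \<Longrightarrow> invf T X F \<longleftrightarrow> invf T X F'"
  unfolding invf_def using act_closed[OF _ c] by simp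

lemma bzF_cong: "(\<And>s x. \<lbrakk>s \<in> pts T; x \<in> pts X\<rbrakk> \<Longrightarrow> F s x = F' s x) \<Longrightarrow> T \<in> gsets G \<Longrightarrow> X \<in> gsets G
    \<Longrightarrow> invf T X F \<Longrightarrow> bzF T X F = bzF T X F'"
  by (rule BZ_eqI[OF bzF_in bzF_in]) (simp_all add: bzF_of invf_cong[of T X F F'])

lemma BZ_eq_bzF:
  assumes T: "T \<in> gsets G" and X: "X \<in> gsets G" and f: "f \<in> BZ G X T"
    and F: "\<And>s x. \<lbrakk>s \<in> pts T; x \<in> pts X\<rbrakk> \<Longrightarrow> Poly_Mapping.lookup (f (frag_of x)) s = F s x"
  shows "invf T X F" "f = bzF T X F"
proof -
  show "invf T X F" using BZ_invf(1)[OF T X f] invf_cong[OF F T X] by simp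
  show "f = bzF T X F"
    using bzF_cong[OF F T X BZ_invf(1)[OF T X f]] BZ_invf(2)[OF T X f] by simp
qed

lemma bzF_push:
  assumes T': "T' \<in> gsets G" and T: "T \<in> gsets G" and X: "X \<in> gsets G" and h: "h \<in> BZ G T' T" and F: "invf T' X F"
  shows "invf T X (push T' h F)" "bz_comp X h (bzF T' X F) = bzF T X (push T' h F)"
proof -
  have f: "bzF T' X F \<in> BZ G X T'" using bzF_in[OF T' X F] .
  have "Poly_Mapping.lookup (bz_comp X h (bzF T' X F) (frag_of x)) s = push T' h F s x"
    if s: "s \<in> pts T" and x: "x \<in> pts X" for s x
  proof -
    have "h (bzF T' X F (frag_of x)) = (\<Sum>t\<in>pts T'. frag_cmul (F t x) (h (frag_of t)))"
      using BZ_extend[OF h BZ_keys_of[OF f x]] by (simp add: bzF_of[OF x] frag_extend_linear)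
    then show ?thesis using x by (simp add: lookup_sum push_def mult.commute)
  qed
  from BZ_eq_bzF[OF T X bz_comp_in[OF f h X] this]
  show "invf T X (push T' h F)" "bz_comp X h (bzF T' X F) = bzF T X (push T' h F)" by blast+
qed

lemma lookup_frag_extend: "Poly_Mapping.lookup (frag_extend \<phi> z) s = ev (\<lambda>x. Poly_Mapping.lookup (\<phi> x) s) z"
  by (simp add: frag_extend_def lookup_sum ev_def)

lemma bzF_pre:
  assumes T: "T \<in> gsets G" and X: "X \<in> gsets G" and Y: "Y \<in> gsets G" and f: "f \<in> BZ G X Y" and F: "invf T Y F"
  shows "invf T X (\<lambda>s x. ev (F s) (f (frag_of x)))"
    and "bz_comp X (bzF T Y F) f = bzF T X (\<lambda>s x. ev (F s) (f (frag_of x)))"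
proof -
  have h: "bzF T Y F \<in> BZ G Y T" using bzF_in[OF T Y F] .
  have "Poly_Mapping.lookup (bz_comp X (bzF T Y F) f (frag_of x)) s = ev (F s) (f (frag_of x))"
    if s: "s \<in> pts T" and x: "x \<in> pts X" for s x
  proof -
    have k: "Poly_Mapping.keys (f (frag_of x)) \<subseteq> pts Y" using BZ_keys_of[OF f x] .
    have "Poly_Mapping.lookup (bzF T Y F (f (frag_of x))) s
        = ev (\<lambda>y. Poly_Mapping.lookup (bzF T Y F (frag_of y)) s) (f (frag_of x))"
      unfolding BZ_extend[OF h k] lookup_frag_extend ..
    also have "\<dots> = ev (F s) (f (frag_of x))"
      by (rule ev_cong) (use k s lookup_bzF[OF T] in auto)
    finally show ?thesis using x by simp
  qed
  from BZ_eq_bzF[OF T X bz_comp_in[OF f h X] this]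
  show "invf T X (\<lambda>s x. ev (F s) (f (frag_of x)))"
    "bz_comp X (bzF T Y F) f = bzF T X (\<lambda>s x. ev (F s) (f (frag_of x)))" by blast+
qed

lemma bzF_add:
  assumes T: "T \<in> gsets G" and X: "X \<in> gsets G" and F: "invf T X F" "invf T X F'"
  shows "invf T X (\<lambda>s x. F s x + F' s x)" "bzF T X (\<lambda>s x. F s x + F' s x) = bz_add X (bzF T X F) (bzF T X F')"
proof -
  show i: "invf T X (\<lambda>s x. F s x + F' s x)" using F by (simp add: invf_def)
  show "bzF T X (\<lambda>s x. F s x + F' s x) = bz_add X (bzF T X F) (bzF T X F')"
    by (rule BZ_eqI[OF bzF_in[OF T X i] bz_add_in[OF bzF_in[OF T X F(1)] bzF_in[OF T X F(2)] X]])
      (simp add: bzF_of frag_cmul_distrib sum.distrib)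
qed

lemma bzF_eq_zero_iff:
  assumes T: "T \<in> gsets G" and X: "X \<in> gsets G" and F: "invf T X F"
  shows "bzF T X F = bz_zero X \<longleftrightarrow> (\<forall>s\<in>pts T. \<forall>x\<in>pts X. F s x = 0)"
proof
  assume h: "bzF T X F = bz_zero X"
  then have "F s x = 0" if "s \<in> pts T" "x \<in> pts X" for s x
    using lookup_bzF[OF T that(2,1), of F] that by simp
  then show "\<forall>s\<in>pts T. \<forall>x\<in>pts X. F s x = 0" by blast
next
  assume "\<forall>s\<in>pts T. \<forall>x\<in>pts X. F s x = 0"
  then show "bzF T X F = bz_zero X"
    by (intro BZ_eqI[OF bzF_in[OF T X F] bz_zero_in[OF X]]) (simp add: bzF_of)
qed

end

text \<open>The terms are given by what they represent and their element type stays open;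
  \<open>resolution_exists\<close> fixes it afterwards.\<close>

locale resolution_data = cyc_orbit G c a for G :: "'g monoid" (structure) and c a +
  fixes Q :: "nat \<Rightarrow> ('g, 'q) zmod" and e :: "nat \<Rightarrow> 'q"
  assumes rQ: "\<And>k. represented G (Q k) (St k) (e k)"
begin

lemma zmodule_Q: "zmodule G (Q k)"
  using represented.axioms(1)[OF rQ] .

text \<open>The resolution comes from the complex
  \<open>0 \<rightarrow> \<int> \<rightarrow> \<int>\<langle>S\<rangle> \<rightarrow> \<int>\<langle>S\<rangle> \<rightarrow> \<int> \<rightarrow> 0\<close> with norm, \<open>1 - c\<close> and augmentation.\<close>

definition bdry :: "nat \<Rightarrow> 'g lmap" where
  "bdry k = (if k = 0 then bzl S (\<lambda>s. frag_of p0)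
    else if k = 1 then bzl S (\<lambda>s. frag_of s - frag_of (act S c s))
    else if k = 2 then bzl pt (\<lambda>s. \<Sum>t\<in>pts S. frag_of t) else bz_zero (St (Suc k)))"

definition d where
  "d k = represented.yo G (Q (Suc k)) (St (Suc k)) (e (Suc k)) (Q k) (mor (Q k) (St (Suc k)) (St k) (bdry k) (e k))"

lemma carrier_power: "g \<in> carrier G \<Longrightarrow> \<exists>k::nat. g = c [^] k"
  using gen by auto

text \<open>Every group element is a power of c and so commutes with c. Without this 1 - c would not
  be equivariant.\<close>

lemma act_comm:
  assumes g: "g \<in> carrier G" and s: "s \<in> pts S"
  shows "act S g (act S c s) = act S c (act S g s)"
proof -
  obtain k :: nat where k: "g = c [^] k" using carrier_power[OF g] by blast
  show ?thesis
    using tau_Suc[OF S s, of k] tau_add[OF S s, of k 1] by (simp add: k)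
qed

lemma bdry: "bdry k \<in> BZ G (St (Suc k)) (St k)"
proof -
  have "bzl S (\<lambda>s. frag_of p0) \<in> BZ G S pt" by (rule bzl_in[OF S]) simp_all
  moreover have "bzl S (\<lambda>s. frag_of s - frag_of (act S c s)) \<in> BZ G S S"
  proof (rule bzl_in[OF S])
    fix s assume "s \<in> pts S"
    then show "Poly_Mapping.keys (frag_of s - frag_of (act S c s)) \<subseteq> pts S"
      using act_closed[OF S c] by (intro keys_diff_subset) simp_all
  qed (simp add: act_comm)
  moreover have "bzl pt (\<lambda>s. \<Sum>t\<in>pts S. frag_of t) \<in> BZ G pt S"
  proof (rule bzl_in[OF pt])
    show "Poly_Mapping.keys (\<Sum>t\<in>pts S. frag_of t) \<subseteq> pts S" by (rule keys_sum_subset) simp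
    show "(\<Sum>t\<in>pts S. frag_of t) = lin_act S g (\<Sum>t\<in>pts S. frag_of t)" if "g \<in> carrier G" for g
      using sum_act[OF S that, of frag_of] by simp
  qed
  ultimately show ?thesis
    by (auto simp: bdry_def St_def)
qed

lemma bdry_e_in: "mor (Q k) (St (Suc k)) (St k) (bdry k) (e k) \<in> carrier (ob (Q k) (St (Suc k)))"
  using zmodule.mor_closed[OF zmodule_Q St St bdry represented.e[OF rQ]] .

lemma d_in: "d k \<in> zhom G (Q (Suc k)) (Q k)"
  unfolding d_def by (rule represented.yo(1)[OF rQ zmodule_Q bdry_e_in])

lemma d_e: "d k (St (Suc k)) (e (Suc k)) = mor (Q k) (St (Suc k)) (St k) (bdry k) (e k)"
  unfolding d_def by (rule represented.yo(2)[OF rQ zmodule_Q bdry_e_in])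

lemma d_mor:
  assumes X: "X \<in> gsets G" and f: "f \<in> BZ G X (St (Suc k))"
  shows "d k X (mor (Q (Suc k)) X (St (Suc k)) f (e (Suc k))) = mor (Q k) X (St k) (bz_comp X (bdry k) f) (e k)"
  unfolding d_def represented.yo_mor[OF rQ zmodule_Q bdry_e_in X f]
  using zmodule.mor_comp[OF zmodule_Q X St St f bdry represented.e[OF rQ]] by simp

text \<open>The matrix of \<open>bdry k\<close> acts from the left in the resolution and in its box products, and from
  the right in the internal hom.\<close>

lemma push_bdry:
  assumes s: "s \<in> pts S"
  shows "(\<Sum>t\<in>pts S. Poly_Mapping.lookup (bdry 0 (frag_of t)) p0 * h t) = (\<Sum>t\<in>pts S. h t)"
    and "(\<Sum>t\<in>pts S. Poly_Mapping.lookup (bdry 1 (frag_of t)) s * h t) = h s - h (act S (inv c) s)"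
    and "Poly_Mapping.lookup (bdry 2 (frag_of p0)) s = 1"
proof -
  show "(\<Sum>t\<in>pts S. Poly_Mapping.lookup (bdry 0 (frag_of t)) p0 * h t) = (\<Sum>t\<in>pts S. h t)"
    by (rule sum.cong) (simp_all add: bdry_def)
  have "(\<Sum>t\<in>pts S. Poly_Mapping.lookup (bdry 1 (frag_of t)) s * h t)
      = (\<Sum>t\<in>pts S. (if t = s then h t else 0) - (if t = act S (inv c) s then h t else 0))"
  proof (rule sum.cong[OF refl])
    fix t assume t: "t \<in> pts S"
    \<comment> \<open>The basis vector s occurs in t - c t with sign + for t = s and with sign - for
      t = c^-1 s. This is why the inverse rotation appears when the matrix acts from the
      left.\<close>
    have "act S c t = s \<longleftrightarrow> t = act S (inv c) s"
      using act_inv[OF S c t] act_inv[OF S c s] by auto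
    then show "Poly_Mapping.lookup (bdry 1 (frag_of t)) s * h t
        = (if t = s then h t else 0) - (if t = act S (inv c) s then h t else 0)"
      using t by (auto simp: bdry_def lookup_minus lookup_single when_def)
  qed
  also have "\<dots> = h s - h (act S (inv c) s)"
    using gsets_finite[OF S] s act_closed[OF S inv_closed[OF c] s] by (simp add: sum_subtractf)
  finally show "(\<Sum>t\<in>pts S. Poly_Mapping.lookup (bdry 1 (frag_of t)) s * h t) = h s - h (act S (inv c) s)" .
  show "Poly_Mapping.lookup (bdry 2 (frag_of p0)) s = 1"
    using s gsets_finite[OF S] by (simp add: bdry_def lookup_sum lookup_single when_def)
qed

lemma pull_bdry:
  shows "t \<in> pts S \<Longrightarrow> ev h (bdry 0 (frag_of t)) = h p0"
    and "t \<in> pts S \<Longrightarrow> ev h (bdry 1 (frag_of t)) = h t - h (act S c t)"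
    and "ev h (bdry 2 (frag_of p0)) = (\<Sum>t\<in>pts S. h t)"
  by (simp_all add: bdry_def ev_diff ev_sum)

definition CQ where "CQ k X F = mor (Q k) X (St k) (bzF (St k) X F) (e k)"

lemma CQ_cong:
  "\<lbrakk>X \<in> gsets G; invf (St k) X F; \<And>s x. \<lbrakk>s \<in> pts (St k); x \<in> pts X\<rbrakk> \<Longrightarrow> F s x = F' s x\<rbrakk> \<Longrightarrow> CQ k X F = CQ k X F'"
  unfolding CQ_def using bzF_cong[of "St k" X F F'] by simp

lemma d_CQ:
  assumes X: "X \<in> gsets G" and F: "invf (St (Suc k)) X F"
  shows "d k X (CQ (Suc k) X F) = CQ k X (push (St (Suc k)) (bdry k) F)"
  unfolding CQ_def d_mor[OF X bzF_in[OF St X F]] bzF_push(2)[OF St St X bdry F] ..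

lemma push_bdry_invf: "\<lbrakk>X \<in> gsets G; invf (St (Suc k)) X F\<rbrakk> \<Longrightarrow> invf (St k) X (push (St (Suc k)) (bdry k) F)"
  by (rule bzF_push(1)[OF St St _ bdry])

lemma push_bdry_eq:
  "push (St (Suc 0)) (bdry 0) F p0 x = (\<Sum>t\<in>pts S. F t x)"
  "s \<in> pts S \<Longrightarrow> push (St 2) (bdry 1) F s x = F s x - F (act S (inv c) s) x"
  "s \<in> pts S \<Longrightarrow> push (St 3) (bdry 2) F s x = F p0 x"
  using push_bdry[OF y_in] push_bdry by (simp_all add: push_def)

lemma CQ_surj: "X \<in> gsets G \<Longrightarrow> carrier (ob (Q k) X) = CQ k X ` {F. invf (St k) X F}"
proof (intro equalityI subsetI)
  fix m assume X: "X \<in> gsets G" and "m \<in> carrier (ob (Q k) X)"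
  then obtain f where f: "f \<in> BZ G X (St k)" "m = mor (Q k) X (St k) f (e k)"
    using bij_betw_imp_surj_on[OF represented.bij[OF rQ X, of k]] by blast
  then show "m \<in> CQ k X ` {F. invf (St k) X F}"
    using BZ_invf[OF St X f(1)] unfolding CQ_def by (intro image_eqI[of _ _ "\<lambda>s x. Poly_Mapping.lookup (f (frag_of x)) s"]) simp_all
next
  fix m assume X: "X \<in> gsets G" and "m \<in> CQ k X ` {F. invf (St k) X F}"
  then obtain F where F: "invf (St k) X F" "m = CQ k X F" by blast
  show "m \<in> carrier (ob (Q k) X)"
    unfolding F(2) CQ_def by (rule zmodule.mor_closed[OF zmodule_Q X St bzF_in[OF St X F(1)] represented.e[OF rQ]])
qed

text \<open>For b = 0 divisibility by a weight means vanishing, which is the kernel condition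
  because a morphism is determined by its matrix.\<close>

lemma four_term_resolution: "four_term G c a 0 Q d CQ (inv c)"
proof (rule four_term.intro[OF cyc_orbit_axioms four_term_axioms.intro])
  fix k X F assume h: "k \<le> 3" "X \<in> gsets G" "invf (St k) X F"
  show "CQ k X F = \<one>\<^bsub>ob (Q k) X\<^esub> \<longleftrightarrow>
      (\<forall>s\<in>pts (St k). \<forall>x\<in>pts X. int (weight 0 (lcm (per (St k) s) (per X x))) dvd F s x)"
    unfolding CQ_def represented.mor_eq_one_iff[OF rQ h(2) bzF_in[OF St h(2,3)]] bzF_eq_zero_iff[OF St h(2,3)]
    by (simp add: weight_def)
  fix F' assume F': "invf (St k) X F'"
  show "CQ k X (\<lambda>s x. F s x + F' s x) = CQ k X F \<otimes>\<^bsub>ob (Q k) X\<^esub> CQ k X F'"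
    unfolding CQ_def bzF_add(2)[OF St h(2,3) F']
    by (rule zmodule.mor_add[OF zmodule_Q h(2) St bzF_in[OF St h(2,3)] bzF_in[OF St h(2) F'] represented.e[OF rQ]])
next
  fix k :: nat and X Y f F assume h: "k = 0 \<or> k = 3" "X \<in> gsets G" "Y \<in> gsets G" "f \<in> BZ G X Y" "invf pt Y F"
  then have i: "invf (St k) Y F" by auto
  show "mor (Q k) X Y f (CQ k Y F) = CQ k X (\<lambda>s x. ev (F s) (f (frag_of x)))"
    unfolding CQ_def bzF_pre(2)[OF St h(2-4) i, symmetric]
    by (rule zmodule.mor_comp[OF zmodule_Q h(2,3) St h(4) bzF_in[OF St h(3) i] represented.e[OF rQ], symmetric])
next
  fix X F assume X: "X \<in> gsets G" and F: "invf S X F"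
  have "CQ 0 X (push (St (Suc 0)) (bdry 0) F) = CQ 0 X (\<lambda>s x. \<Sum>t\<in>pts S. F t x)"
    by (rule CQ_cong[OF X push_bdry_invf[OF X]]) (use F push_bdry_eq(1) in simp_all)
  then show "d 0 X (CQ 1 X F) = CQ 0 X (\<lambda>s x. \<Sum>t\<in>pts S. F t x)"
    using d_CQ[OF X, of 0 F] F by simp
  have "CQ 1 X (push (St (Suc 1)) (bdry 1) F) = CQ 1 X (\<lambda>s x. F s x - F (act S (inv c) s) x)"
    by (rule CQ_cong[OF X push_bdry_invf[OF X]]) (use F push_bdry_eq(2) in \<open>simp_all add: Suc_1[symmetric] del: Suc_1\<close>)
  then show "d 1 X (CQ 2 X F) = CQ 1 X (\<lambda>s x. F s x - F (act S (inv c) s) x)"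
    using d_CQ[OF X, of 1 F] F unfolding Suc_1 by simp
next
  fix X F assume X: "X \<in> gsets G" and F: "invf pt X F"
  have e: "Suc 2 = 3" by simp
  have "CQ 2 X (push (St (Suc 2)) (bdry 2) F) = CQ 2 X (\<lambda>s x. F p0 x)"
    by (rule CQ_cong[OF X push_bdry_invf[OF X]]) (use F push_bdry_eq(3) in simp_all)
  then show "d 2 X (CQ 3 X F) = CQ 2 X (\<lambda>s x. F p0 x)"
    using d_CQ[OF X, of 2 F] F by simp
qed (simp_all add: zmodule_Q d_in CQ_surj)

sublocale R: four_term G c a 0 Q d CQ "inv c"
  by (rule four_term_resolution)

lemma Q_trivial:
  assumes k: "k \<ge> 4" and X: "X \<in> gsets G"
  shows "carrier (ob (Q k) X) = {\<one>\<^bsub>ob (Q k) X\<^esub>}"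
proof -
  have "bzF (St k) X F = bz_zero X" if "invf (St k) X F" for F
    using bzF_eq_zero_iff[OF St X that] k by (simp add: St_def)
  then have "m = \<one>\<^bsub>ob (Q k) X\<^esub>" if "m \<in> carrier (ob (Q k) X)" for m
    using that zmodule.mor_zero[OF zmodule_Q X St represented.e[OF rQ]] unfolding CQ_surj[OF X] by (auto simp: CQ_def)
  then show ?thesis using monoid.one_closed[OF group.is_monoid[OF zmodule.group_ob[OF zmodule_Q X]]] by blast
qed

definition \<epsilon> where
  "\<epsilon> = represented.yo G (Q 0) pt (e 0) (Zquot G a) (zproj G (constZ G) (ideal_of G a) pt (one_elt pt))"

lemmas Zquot_proj = zproj[OF zmodule_constZ ideal_of_submodule, folded Zquot_def]

lemma represented_Q0: "represented G (Q 0) pt (e 0)"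
  using rQ[of 0] by simp

lemma \<epsilon>: "\<epsilon> \<in> zhom G (Q 0) (Zquot G a)"
  unfolding \<epsilon>_def by (rule represented.yo(1)[OF represented_Q0 Zquot_proj(1) zhom_closed[OF Zquot_proj(2) pt one_elt_in[OF pt]]])

lemma \<epsilon>_CQ:
  assumes X: "X \<in> gsets G" and F: "invf pt X F"
  shows "zc X (F p0) \<in> carrier (ob (constZ G) X)"
    and "\<epsilon> X (CQ 0 X F) = zproj G (constZ G) (ideal_of G a) X (zc X (F p0))"
proof -
  have f: "bzF pt X F \<in> BZ G X pt" using bzF_in[OF pt X F] .
  show z: "zc X (F p0) \<in> carrier (ob (constZ G) X)" using zc_inv[OF X, of "F p0"] F by (simp add: invf_pt)
  have u: "mor (constZ G) X pt (bzF pt X F) (one_elt pt) = zc X (F p0)"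
    by (rule constZ_eqI[OF constZ_mor_in[OF X f one_elt_in[OF pt]] z])
      (simp add: mor_one_elt[OF pt f] lookup_bzF[OF pt])
  have "\<epsilon> X (CQ 0 X F) = mor (Zquot G a) X pt (bzF pt X F) (zproj G (constZ G) (ideal_of G a) pt (one_elt pt))"
    unfolding \<epsilon>_def CQ_def St_simps
    by (rule represented.yo_mor[OF represented_Q0 Zquot_proj(1) zhom_closed[OF Zquot_proj(2) pt one_elt_in[OF pt]] X f])
  also have "\<dots> = zproj G (constZ G) (ideal_of G a) X (zc X (F p0))"
    unfolding zhom_natural[OF Zquot_proj(2) X pt f one_elt_in[OF pt], symmetric] u ..
  finally show "\<epsilon> X (CQ 0 X F) = zproj G (constZ G) (ideal_of G a) X (zc X (F p0))" .
qed

lemma \<epsilon>_surj: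
  assumes X: "X \<in> gsets G"
  shows "\<epsilon> X ` carrier (ob (Q 0) X) = carrier (ob (Zquot G a) X)"
proof
  show "\<epsilon> X ` carrier (ob (Q 0) X) \<subseteq> carrier (ob (Zquot G a) X)" using zhom_closed[OF \<epsilon> X] by blast
  show "carrier (ob (Zquot G a) X) \<subseteq> \<epsilon> X ` carrier (ob (Q 0) X)"
  proof
    fix v assume "v \<in> carrier (ob (Zquot G a) X)"
    then obtain u where u: "u \<in> carrier (ob (constZ G) X)" "v = zproj G (constZ G) (ideal_of G a) X u"
      using Zquot_proj(3)[OF X] by blast
    have i: "invf pt X (\<lambda>s x. u (frag_of x))" using constZ_c[OF u(1)] by (simp add: invf_pt)
    have "v = \<epsilon> X (CQ 0 X (\<lambda>s x. u (frag_of x)))"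
      unfolding \<epsilon>_CQ(2)[OF X i] zc_frag[OF u(1) X] u(2) ..
    moreover have "CQ 0 X (\<lambda>s x. u (frag_of x)) \<in> carrier (ob (Q 0) X)" using R.C_in[of 0 X] X i by simp
    ultimately show "v \<in> \<epsilon> X ` carrier (ob (Q 0) X)" by blast
  qed
qed

text \<open>With b = 0 the image in degree 0 is cut out by the weights for gcd(a, 0) = a, the
  conditions that define the ideal I_a.\<close>

lemma \<epsilon>_kernel:
  assumes X: "X \<in> gsets G"
  shows "d 0 X ` carrier (ob (Q 1) X) = kernel (ob (Q 0) X) (ob (Zquot G a) X) (\<epsilon> X)"
proof -
  have iff: "CQ 0 X F \<in> d 0 X ` carrier (ob (Q 1) X) \<longleftrightarrow> \<epsilon> X (CQ 0 X F) = \<one>\<^bsub>ob (Zquot G a) X\<^esub>"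
    if F: "invf pt X F" for F
    unfolding R.image_D0[OF X F] \<epsilon>_CQ(2)[OF X F] Zquot_proj(4)[OF X \<epsilon>_CQ(1)[OF X F]] ideal_of_eq[OF X] J_def
    using \<epsilon>_CQ(1)[OF X F] by simp
  have F: "\<exists>F. invf pt X F \<and> m = CQ 0 X F" if "m \<in> carrier (ob (Q 0) X)" for m
    using that unfolding CQ_surj[OF X] by auto
  show ?thesis
  proof (intro equalityI subsetI)
    fix m assume m: "m \<in> d 0 X ` carrier (ob (Q 1) X)"
    then have mQ: "m \<in> carrier (ob (Q 0) X)" using zhom_closed[OF d_in[of 0] X] by auto
    obtain F' where F': "invf pt X F'" "m = CQ 0 X F'" using F[OF mQ] by blast
    show "m \<in> kernel (ob (Q 0) X) (ob (Zquot G a) X) (\<epsilon> X)"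
      using m mQ iff[OF F'(1)] unfolding F'(2) kernel_def by blast
  next
    fix m assume m: "m \<in> kernel (ob (Q 0) X) (ob (Zquot G a) X) (\<epsilon> X)"
    then have mQ: "m \<in> carrier (ob (Q 0) X)" by (simp add: kernel_def)
    then obtain F' where F': "invf pt X F'" "m = CQ 0 X F'" using F by blast
    then show "m \<in> d 0 X ` carrier (ob (Q 1) X)" using m iff[OF F'(1)] by (simp add: kernel_def)
  qed
qed

text \<open>Inner exactness is that of any four-term complex, the left end uses b = 0, and in higher
  degrees the terms are zero.\<close>

lemma free_resolution: "free_resolution G (Zquot G a) Q d \<epsilon>"
  unfolding free_resolution_def
proof (intro conjI allI ballI)
  fix k :: nat and X assume X: "X \<in> gsets G"
  show "d 0 X ` carrier (ob (Q (Suc 0)) X) = kernel (ob (Q 0) X) (ob (Zquot G a) X) (\<epsilon> X)"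
    using \<epsilon>_kernel[OF X] by simp
  have "k = 0 \<or> k = 1 \<or> k \<ge> 2" by arith
  then show "d (Suc k) X ` carrier (ob (Q (Suc (Suc k))) X) = kernel (ob (Q (Suc k)) X) (ob (Q k) X) (d k X)"
  proof (elim disjE)
    assume "k = 0" then show ?thesis using R.kernel_D0[OF X] by (simp add: numeral_2_eq_2)
  next
    assume "k = 1" then show ?thesis using R.kernel_D1[OF X] by (simp add: numeral_2_eq_2 numeral_3_eq_3)
  next
    assume k: "k \<ge> 2"
    have im: "d (Suc k) X ` carrier (ob (Q (Suc (Suc k))) X) = {\<one>\<^bsub>ob (Q (Suc k)) X\<^esub>}"
      using Q_trivial[of "Suc (Suc k)", OF _ X] zhom_one[OF d_in X zmodule_Q zmodule_Q] k by simp
    have "kernel (ob (Q (Suc k)) X) (ob (Q k) X) (d k X) = {\<one>\<^bsub>ob (Q (Suc k)) X\<^esub>}"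
    proof (cases "k = 2")
      case True
      then show ?thesis using R.kernel_zero[OF refl X] by (simp add: numeral_2_eq_2 numeral_3_eq_3)
    next
      case False
      then show ?thesis using Q_trivial[of "Suc k", OF _ X] zhom_one[OF d_in X zmodule_Q zmodule_Q, of k] k by (auto simp: kernel_def)
    qed
    then show ?thesis using im by simp
  qed
qed (simp_all add: represented.free[OF rQ] d_in \<epsilon> \<epsilon>_surj)

end

text \<open>Representable modules transported along \<open>enc_lmap\<close> into the element type
  demanded by \<open>some_resolution\<close>.\<close>

lemma (in cyc_orbit) resolution_exists:
  obtains Q :: "nat \<Rightarrow> ('g, (('g pt \<Rightarrow>\<^sub>0 int) \<Rightarrow> int) set \<times> nat \<Rightarrow> int) zmod" and e
  where "resolution_data G c a Q e"
proof
  show "resolution_data G c a (\<lambda>k. transport enc_lmap (rep G (St k))) (\<lambda>k. enc_lmap (bz_id (St k)))"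
    by (rule resolution_data.intro[OF cyc_orbit_axioms resolution_data_axioms.intro])
      (rule represented_transport[OF represented_rep[OF St] inj_enc_lmap])
qed

section \<open>Tor and Ext from the resolution\<close>

definition tf :: "('g pt \<Rightarrow> 'g pt \<Rightarrow> int) \<Rightarrow> 'g pt \<Rightarrow> int" where
  "tf F p = (case p of Cos C \<Rightarrow> 0 | Tup s x \<Rightarrow> F s x)"

lemma tf_Tup [simp]: "tf F (Tup s x) = F s x"
  by (simp add: tf_def)

context cyc begin

lemma zt_in:
  assumes "T \<in> gsets G" "X \<in> gsets G" "invf T X F"
  shows "zc (prod_gset T X) (tf F) \<in> carrier (ob (constZ G) (prod_gset T X))"
  by (rule zc_inv[OF prod_gset_in[OF assms(1,2)]]) (use assms(3) in \<open>auto simp: invf_def\<close>)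

lemma invf_swap: "invf T X F \<Longrightarrow> invf X T (\<lambda>x s. F s x)"
  by (simp add: invf_def)

lemma zt_cong:
  assumes "T \<in> gsets G" "X \<in> gsets G" "invf T X F" "invf T X F'"
    and "\<And>s x. \<lbrakk>s \<in> pts T; x \<in> pts X\<rbrakk> \<Longrightarrow> F s x = F' s x"
  shows "zc (prod_gset T X) (tf F) = zc (prod_gset T X) (tf F')"
  by (rule constZ_eqI[OF zt_in[OF assms(1-3)] zt_in[OF assms(1,2,4)]]) (use assms(5) in auto)

lemma zt_surj:
  assumes T: "T \<in> gsets G" and X: "X \<in> gsets G" and u: "u \<in> carrier (ob (constZ G) (prod_gset T X))"
  shows "invf T X (\<lambda>s x. u (frag_of (Tup s x)))" "zc (prod_gset T X) (tf (\<lambda>s x. u (frag_of (Tup s x)))) = u"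
proof -
  show i: "invf T X (\<lambda>s x. u (frag_of (Tup s x)))"
    unfolding invf_def
  proof (intro ballI)
    fix s x assume "s \<in> pts T" "x \<in> pts X"
    then show "u (frag_of (Tup (act T c s) (act X c x))) = u (frag_of (Tup s x))"
      using constZ_c[OF u, of "Tup s x"] by simp
  qed
  show "zc (prod_gset T X) (tf (\<lambda>s x. u (frag_of (Tup s x)))) = u"
    by (rule constZ_eqI[OF zt_in[OF T X i] u]) auto
qed

lemma zt_add:
  assumes T: "T \<in> gsets G" and X: "X \<in> gsets G" and F: "invf T X F" "invf T X F'"
  shows "zc (prod_gset T X) (tf (\<lambda>s x. F s x + F' s x))
    = zc (prod_gset T X) (tf F) \<otimes>\<^bsub>ob (constZ G) (prod_gset T X)\<^esub> zc (prod_gset T X) (tf F')"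
  by (rule constZ_eqI[OF zt_in[OF T X bzF_add(1)[OF T X F]]
        constZ_mult_in[OF prod_gset_in[OF T X] zt_in[OF T X F(1)] zt_in[OF T X F(2)]]])
    (auto simp: constZ_apply(1))

text \<open>Restriction along f x g evaluates the function on the tensor of the two image vectors,
  and evaluation on a tensor is iterated evaluation.\<close>

lemma zt_mor:
  assumes A: "A \<in> gsets G" "A' \<in> gsets G" and B: "B \<in> gsets G" "B' \<in> gsets G"
    and f: "f \<in> BZ G A A'" and g: "g \<in> BZ G B B'" and F: "invf A' B' F"
  defines "F' \<equiv> \<lambda>s t. ev (\<lambda>s'. ev (F s') (g (frag_of t))) (f (frag_of s))"
  shows "invf A B F'"
    and "mor (constZ G) (prod_gset A B) (prod_gset A' B') (bz_prod A B f g) (zc (prod_gset A' B') (tf F))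
      = zc (prod_gset A B) (tf F')"
proof -
  let ?u = "mor (constZ G) (prod_gset A B) (prod_gset A' B') (bz_prod A B f g) (zc (prod_gset A' B') (tf F))"
  have P: "prod_gset A B \<in> gsets G" using prod_gset_in[OF A(1) B(1)] .
  have h: "bz_prod A B f g \<in> BZ G (prod_gset A B) (prod_gset A' B')" using bz_prod_in[OF f g] A B by simp
  have u: "?u \<in> carrier (ob (constZ G) (prod_gset A B))"
    by (rule constZ_mor_in[OF P h zt_in[OF A(2) B(2) F]])
  have v: "?u (frag_of (Tup s t)) = F' s t" if "s \<in> pts A" "t \<in> pts B" for s t
    using that keys_lin_tensor[OF BZ_keys_of[OF f that(1)] BZ_keys_of[OF g that(2)]]
    by (simp add: constZ_apply(3) zc_apply ev_tensor F'_def)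
  show i: "invf A B F'" using zt_surj(1)[OF A(1) B(1) u] invf_cong[OF v A(1) B(1)] by simp
  show "?u = zc (prod_gset A B) (tf F')"
    by (rule constZ_eqI[OF u zt_in[OF A(1) B(1) i]]) (auto simp: v)
qed

end

lemma (in box_repr) cb_eq_one_iff:
  assumes X: "X \<in> gsets G" and n: "n \<in> carrier (ob N (prod_gset S X))"
  shows "cb X n = \<one>\<^bsub>ob (box G M N) X\<^esub> \<longleftrightarrow> n = \<one>\<^bsub>ob N (prod_gset S X)\<^esub>"
proof -
  have P: "prod_gset S X \<in> gsets G" using prod_gset_in[OF MS.S X] .
  have g: "group (ob N (prod_gset S X))" "group (ob (box G M N) X)"
    using N.group_ob[OF P] zmodule.group_ob[OF zmodule_box X] .
  have "cb X \<one>\<^bsub>ob N (prod_gset S X)\<^esub> = \<one>\<^bsub>ob (box G M N) X\<^esub>" using hom_one[OF cb_hom[OF X] g] .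
  then show ?thesis
    using inj_on_eq_iff[OF cb_inj[OF X] n monoid.one_closed[OF group.is_monoid[OF g(1)]]] by simp
qed

lemma (in box_data) bx_prod:
  assumes h: "S \<in> gsets G" "T \<in> gsets G" "S' \<in> gsets G" "T' \<in> gsets G" "f \<in> BZ G S' S" "g \<in> BZ G T' T"
    "m \<in> carrier (ob M S)" "n \<in> carrier (ob N T)"
  shows "bx (prod_gset S' T') S' T' (bz_id (prod_gset S' T')) (mor M S' S f m) (mor N T' T g n)
    = mor (box G M N) (prod_gset S' T') (prod_gset S T) (bz_prod S' T' f g)
        (bx (prod_gset S T) S T (bz_id (prod_gset S T)) m n)"
proof -
  have P: "prod_gset S T \<in> gsets G" "prod_gset S' T' \<in> gsets G" using h prod_gset_in by blast+
  have fg: "bz_prod S' T' f g \<in> BZ G (prod_gset S' T') (prod_gset S T)" using bz_prod_in[OF h(5,6)] h by simp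
  show ?thesis
    unfolding mor_bx[OF P(2,1) fg h(1,2) bz_id_in[OF P(1)] h(7,8)] bz_comp_id(1)[OF P(2,1) fg]
    using bx_coend[OF P(2) h(1-6) bz_id_in[OF P(2)] h(7,8)] bz_comp_id(2)[OF P(2) fg] by simp
qed

text \<open>Numerators and denominators are known to agree on G-sets only, while a module record
  also has values elsewhere. Hence an isomorphism and not an equality.\<close>

lemma subquot_cong:
  assumes M: "zmodule G M" and Z: "submodule_of G M Z" and B: "submodule_of G M B"
    and Z': "submodule_of G M Z'" and B': "submodule_of G M B'"
    and eq: "\<And>X. X \<in> gsets G \<Longrightarrow> Z X = Z' X" "\<And>X. X \<in> gsets G \<Longrightarrow> B X = B' X" "\<And>X. X \<in> gsets G \<Longrightarrow> B X \<subseteq> Z X"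
  shows "zmod_iso G (subquot M Z B) (subquot M Z' B')"
proof (rule subquot_iso[OF M Z B eq(3) M Z' B' _ zid_in[OF M]])
  interpret zmodule G M by fact
  fix X assume X: "X \<in> gsets G"
  have c: "z \<in> carrier (ob M X)" if "z \<in> Z X" for z
    using Z X that by (auto simp: submodule_of_def dest: subgroup.mem_carrier)
  show "B' X \<subseteq> Z' X" using eq[OF X] by simp
  fix z
  show "zid G M X z \<in> Z' X" if "z \<in> Z X" using eq(1)[OF X] X c that by simp
  show "zid G M X z \<in> B' X \<longleftrightarrow> z \<in> B X" if "z \<in> Z X" using eq(2)[OF X] X c that by simp
  show "\<exists>w\<in>Z X. zid G M X w \<otimes>\<^bsub>ob M X\<^esub> inv\<^bsub>ob M X\<^esub> z \<in> B' X" if z: "z \<in> Z' X"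
  proof
    show "z \<in> Z X" using z eq(1)[OF X] by simp
    then show "zid G M X z \<otimes>\<^bsub>ob M X\<^esub> inv\<^bsub>ob M X\<^esub> z \<in> B' X"
      using c[of z] X B' group.r_inv[OF group_ob[OF X]] by (simp add: submodule_of_def subgroup.one_closed)
  qed
qed

text \<open>Coefficients as a quotient of the constant module by the divisibility conditions for
  \<open>b\<close>. The projection to \<open>Zquot G b\<close> is one instance, the identity of
  \<open>constZ\<close> with b = 0 the other.\<close>

locale coefficients = resolution_data G c a Q e for G :: "'g monoid" (structure) and c a and Q :: "nat \<Rightarrow> ('g, 'q) zmod" and e +
  fixes b :: nat and N :: "('g, 'n) zmod" and \<pi>
  assumes zmodule_N: "zmodule G N" and \<pi>: "\<pi> \<in> zhom G (constZ G) N"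
    and \<pi>_surj: "\<And>X. X \<in> gsets G \<Longrightarrow> \<pi> X ` carrier (ob (constZ G) X) = carrier (ob N X)"
    and \<pi>_ker: "\<And>X u. \<lbrakk>X \<in> gsets G; u \<in> carrier (ob (constZ G) X)\<rbrakk> \<Longrightarrow>
      \<pi> X u = \<one>\<^bsub>ob N X\<^esub> \<longleftrightarrow> (\<forall>x\<in>pts X. int (weight b (per X x)) dvd u (frag_of x))"
begin

definition nt where "nt T X F = \<pi> (prod_gset T X) (zc (prod_gset T X) (tf F))"

lemma nt_in: "\<lbrakk>T \<in> gsets G; X \<in> gsets G; invf T X F\<rbrakk> \<Longrightarrow> nt T X F \<in> carrier (ob N (prod_gset T X))"
  unfolding nt_def by (rule zhom_closed[OF \<pi> prod_gset_in zt_in])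

lemma nt_surj:
  assumes T: "T \<in> gsets G" and X: "X \<in> gsets G" and m: "m \<in> carrier (ob N (prod_gset T X))"
  shows "\<exists>F. invf T X F \<and> m = nt T X F"
proof -
  obtain u where u: "u \<in> carrier (ob (constZ G) (prod_gset T X))" "m = \<pi> (prod_gset T X) u"
    using \<pi>_surj[OF prod_gset_in[OF T X]] m by blast
  then show ?thesis using zt_surj[OF T X u(1)] by (intro exI[of _ "\<lambda>s x. u (frag_of (Tup s x))"]) (simp add: nt_def)
qed

lemma nt_cong:
  "\<lbrakk>T \<in> gsets G; X \<in> gsets G; invf T X F; invf T X F'; \<And>s x. \<lbrakk>s \<in> pts T; x \<in> pts X\<rbrakk> \<Longrightarrow> F s x = F' s x\<rbrakk>
    \<Longrightarrow> nt T X F = nt T X F'"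
  unfolding nt_def using zt_cong[of T X F F'] by simp

lemma nt_add: "\<lbrakk>T \<in> gsets G; X \<in> gsets G; invf T X F; invf T X F'\<rbrakk>
    \<Longrightarrow> nt T X (\<lambda>s x. F s x + F' s x) = nt T X F \<otimes>\<^bsub>ob N (prod_gset T X)\<^esub> nt T X F'"
  unfolding nt_def zt_add by (rule zhom_mult[OF \<pi> prod_gset_in zt_in zt_in])

lemma nt_one_iff:
  assumes T: "T \<in> gsets G" and X: "X \<in> gsets G" and F: "invf T X F"
  shows "nt T X F = \<one>\<^bsub>ob N (prod_gset T X)\<^esub> \<longleftrightarrow>
    (\<forall>s\<in>pts T. \<forall>x\<in>pts X. int (weight b (lcm (per T s) (per X x))) dvd F s x)"
proof -
  have "nt T X F = \<one>\<^bsub>ob N (prod_gset T X)\<^esub> \<longleftrightarrow>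
      (\<forall>p\<in>pts (prod_gset T X). int (weight b (per (prod_gset T X) p)) dvd tf F p)"
    unfolding nt_def \<pi>_ker[OF prod_gset_in[OF T X] zt_in[OF T X F]] by simp
  also have "\<dots> \<longleftrightarrow> (\<forall>s\<in>pts T. \<forall>x\<in>pts X. int (weight b (per (prod_gset T X) (Tup s x))) dvd tf F (Tup s x))"
  proof (intro iffI ballI)
    fix s x assume "\<forall>p\<in>pts (prod_gset T X). int (weight b (per (prod_gset T X) p)) dvd tf F p" "s \<in> pts T" "x \<in> pts X"
    then show "int (weight b (per (prod_gset T X) (Tup s x))) dvd tf F (Tup s x)"
      using Tup_in_prod by blast
  qed auto
  finally show ?thesis using per_prod[OF T X] by simp
qed

lemma nt_mor:
  assumes A: "A \<in> gsets G" "A' \<in> gsets G" and B: "B \<in> gsets G" "B' \<in> gsets G"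
    and f: "f \<in> BZ G A A'" and g: "g \<in> BZ G B B'" and F: "invf A' B' F"
  shows "mor N (prod_gset A B) (prod_gset A' B') (bz_prod A B f g) (nt A' B' F)
    = nt A B (\<lambda>s t. ev (\<lambda>s'. ev (F s') (g (frag_of t))) (f (frag_of s)))"
proof -
  have h: "bz_prod A B f g \<in> BZ G (prod_gset A B) (prod_gset A' B')" using bz_prod_in[OF f g] A B by simp
  show ?thesis
    unfolding nt_def zt_mor(2)[OF A B f g F, symmetric]
    by (rule zhom_natural[OF \<pi> prod_gset_in[OF A(1) B(1)] prod_gset_in[OF A(2) B(2)] h zt_in[OF A(2) B(2) F], symmetric])
qed

section \<open>The complex that computes Tor\<close>

lemma box_repr: "box_repr G (Q k) N (St k) (e k)"
  by (rule box_repr.intro[OF box_data.intro[OF zmodule_Q zmodule_N] rQ])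

lemma zmodule_box_Q: "zmodule G (box G (Q k) N)"
  using box_data.zmodule_box[OF box_data.intro[OF zmodule_Q zmodule_N]] .

definition CT where "CT k X F = box_repr.cb G (Q k) N (St k) (e k) X (nt (St k) X F)"

definition DT where "DT k = box_map G (Q (Suc k)) N (Q k) N (d k) (zid G N)"

lemma box_map_data_d: "box_map_data G (Q (Suc k)) N (Q k) N (d k) (zid G N)"
  by (rule box_map_data.intro[OF box_data.intro[OF zmodule_Q zmodule_N] box_data.intro[OF zmodule_Q zmodule_N] box_map_data_axioms.intro[OF d_in zid_in[OF zmodule_N]]])

lemma DT_in: "DT k \<in> zhom G (box G (Q (Suc k)) N) (box G (Q k) N)"
  unfolding DT_def by (rule box_map_data.box_map_in[OF box_map_data_d])

lemma CT_surj:
  assumes X: "X \<in> gsets G"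
  shows "carrier (ob (box G (Q k) N) X) = CT k X ` {F. invf (St k) X F}"
proof (intro equalityI subsetI)
  fix m assume "m \<in> carrier (ob (box G (Q k) N) X)"
  then obtain n where n: "n \<in> carrier (ob N (prod_gset (St k) X))" "m = box_repr.cb G (Q k) N (St k) (e k) X n"
    using box_repr.cb_surj[OF box_repr X] by blast
  then show "m \<in> CT k X ` {F. invf (St k) X F}" using nt_surj[OF St X n(1)] unfolding CT_def by auto
next
  fix m assume "m \<in> CT k X ` {F. invf (St k) X F}"
  then obtain F where F: "invf (St k) X F" "m = CT k X F" by blast
  show "m \<in> carrier (ob (box G (Q k) N) X)"
    unfolding F(2) CT_def by (rule box_repr.cb_in[OF box_repr X nt_in[OF St X F(1)]])
qed

text \<open>Applying h to the first factor of the sum of t \<otimes> t \<otimes> x and contracting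
  at s leaves the sum of the vectors t \<otimes> x weighted by the entries h(s, t). Restriction
  along \<phi> is therefore a matrix product: self-duality has replaced h by its transpose, and
  restriction transposes once more.\<close>

lemma zt_push:
  assumes T': "T' \<in> gsets G" and T: "T \<in> gsets G" and X: "X \<in> gsets G" and h: "h \<in> BZ G T' T" and F: "invf T' X F"
  defines "\<phi> \<equiv> dual T X (bz_comp X (bz_prod T' (prod_gset T' X) h (bz_id (prod_gset T' X))) (coev T' X))"
  shows "mor N (prod_gset T X) (prod_gset T' X) \<phi> (nt T' X F) = nt T X (push T' h F)"
proof -
  have P: "prod_gset T' X \<in> gsets G" "prod_gset T X \<in> gsets G" using T T' X prod_gset_in by blast+
  have hp: "bz_prod T' (prod_gset T' X) h (bz_id (prod_gset T' X))
      \<in> BZ G (prod_gset T' (prod_gset T' X)) (prod_gset T (prod_gset T' X))"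
    using bz_prod_in[OF h bz_id_in[OF P(1)]] T' P(1) by simp
  have \<psi>: "bz_comp X (bz_prod T' (prod_gset T' X) h (bz_id (prod_gset T' X))) (coev T' X) \<in> BZ G X (prod_gset T (prod_gset T' X))"
    by (rule bz_comp_in[OF coev_in[OF T' X] hp X])
  have \<phi>: "\<phi> \<in> BZ G (prod_gset T X) (prod_gset T' X)"
    unfolding \<phi>_def by (rule dual_in[OF \<psi> T X])
  have p: "invf T X (push T' h F)" using bzF_push(1)[OF T' T X h F] .
  have u: "mor (constZ G) (prod_gset T X) (prod_gset T' X) \<phi> (zc (prod_gset T' X) (tf F)) = zc (prod_gset T X) (tf (push T' h F))"
  proof (rule constZ_eqI[OF constZ_mor_in[OF P(2) \<phi> zt_in[OF T' X F]] zt_in[OF T X p]])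
    fix q assume "q \<in> pts (prod_gset T X)"
    then obtain s x where sx: "q = Tup s x" "s \<in> pts T" "x \<in> pts X" by blast
    have "bz_prod T' (prod_gset T' X) h (bz_id (prod_gset T' X)) (\<Sum>t\<in>pts T'. frag_of (Tup t (Tup t x)))
        = (\<Sum>t\<in>pts T'. lin_tensor (h (frag_of t)) (frag_of (Tup t x)))"
      using sx(3) by (subst BZ_sum[OF hp]) (auto intro!: sum.cong)
    then have "\<phi> (frag_of q) = (\<Sum>t\<in>pts T'. frag_cmul (Poly_Mapping.lookup (h (frag_of t)) s) (frag_of (Tup t x)))"
      using sx by (simp add: \<phi>_def slice_simps slice_tensor)
    moreover have "Poly_Mapping.keys (\<phi> (frag_of q)) \<subseteq> pts (prod_gset T' X)" using BZ_keys_of[OF \<phi>] sx by simp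
    ultimately show "mor (constZ G) (prod_gset T X) (prod_gset T' X) \<phi> (zc (prod_gset T' X) (tf F)) (frag_of q)
        = zc (prod_gset T X) (tf (push T' h F)) (frag_of q)"
      using sx by (simp add: constZ_apply(3) zc_apply ev_sum push_def)
  qed
  show ?thesis
    unfolding nt_def u[symmetric] by (rule zhom_natural[OF \<pi> P(2,1) \<phi> zt_in[OF T' X F], symmetric])
qed

text \<open>d takes the universal element to a restriction along \<open>bdry\<close>; the coend
  relation brings the result back to normal form, and \<open>zt_push\<close> computes what happens
  to n.\<close>

lemma DT_CT:
  assumes X: "X \<in> gsets G" and F: "invf (St (Suc k)) X F"
  shows "DT k X (CT (Suc k) X F) = CT k X (push (St (Suc k)) (bdry k) F)"
proof -
  have P: "prod_gset (St (Suc k)) X \<in> gsets G" using prod_gset_in[OF St X] .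
  have n: "nt (St (Suc k)) X F \<in> carrier (ob N (prod_gset (St (Suc k)) X))" using nt_in[OF St X F] .
  show ?thesis
    unfolding CT_def DT_def box_repr.cb_def[OF box_repr, of "Suc k"]
      box_map_data.box_map_bx[OF box_map_data_d X St P coev_in[OF St X] represented.e[OF rQ] n] zid_apply[OF P n] d_e
      box_repr.bx_eq_cb'[OF box_repr X St P coev_in[OF St X] bdry n] zt_push[OF St St X bdry F] ..
qed

lemma CT_cong:
  "\<lbrakk>X \<in> gsets G; invf (St k) X F; invf (St k) X F'; \<And>s x. \<lbrakk>s \<in> pts (St k); x \<in> pts X\<rbrakk> \<Longrightarrow> F s x = F' s x\<rbrakk>
    \<Longrightarrow> CT k X F = CT k X F'"
  unfolding CT_def using nt_cong[of "St k" X F F'] by simp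

lemma four_term_Tor: "four_term G c a b (\<lambda>k. box G (Q k) N) DT CT (inv c)"
proof (rule four_term.intro[OF cyc_orbit_axioms four_term_axioms.intro])
  fix k X F assume h: "k \<le> 3" "X \<in> gsets G" "invf (St k) X F"
  show "CT k X F = \<one>\<^bsub>ob (box G (Q k) N) X\<^esub> \<longleftrightarrow>
      (\<forall>s\<in>pts (St k). \<forall>x\<in>pts X. int (weight b (lcm (per (St k) s) (per X x))) dvd F s x)"
    unfolding CT_def box_repr.cb_eq_one_iff[OF box_repr h(2) nt_in[OF St h(2,3)]] by (rule nt_one_iff[OF St h(2,3)])
  fix F' assume F': "invf (St k) X F'"
  show "CT k X (\<lambda>s x. F s x + F' s x) = CT k X F \<otimes>\<^bsub>ob (box G (Q k) N) X\<^esub> CT k X F'"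
    unfolding CT_def nt_add[OF St h(2,3) F']
    by (rule box_repr.cb_mult[OF box_repr h(2) nt_in[OF St h(2,3)] nt_in[OF St h(2) F']])
next
  fix k :: nat and X Y f F assume h: "k = 0 \<or> k = 3" "X \<in> gsets G" "Y \<in> gsets G" "f \<in> BZ G X Y" "invf pt Y F"
  then have i: "invf (St k) Y F" by auto
  have "invf (St k) X (\<lambda>s x. ev (\<lambda>s'. ev (F s') (f (frag_of x))) (bz_id (St k) (frag_of s)))"
    by (rule zt_mor(1)[OF St St h(2,3) bz_id_in[OF St] h(4) i])
  then show "mor (box G (Q k) N) X Y f (CT k Y F) = CT k X (\<lambda>s x. ev (F s) (f (frag_of x)))"
    unfolding CT_def box_repr.cb_natural[OF box_repr h(4,2,3) nt_in[OF St h(3) i]]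
      nt_mor[OF St St h(2,3) bz_id_in[OF St] h(4) i]
    using nt_cong[OF St h(2) _ bzF_pre(1)[OF St h(2-4) i]] by simp
next
  fix X F assume X: "X \<in> gsets G" and F: "invf S X F"
  have "CT 0 X (push (St (Suc 0)) (bdry 0) F) = CT 0 X (\<lambda>s x. \<Sum>t\<in>pts S. F t x)"
    by (rule CT_cong[OF X push_bdry_invf[OF X]]) (use F push_bdry_eq(1) R.invf_sum in simp_all)
  then show "DT 0 X (CT 1 X F) = CT 0 X (\<lambda>s x. \<Sum>t\<in>pts S. F t x)"
    using DT_CT[OF X, of 0 F] F by simp
  have "CT 1 X (push (St (Suc 1)) (bdry 1) F) = CT 1 X (\<lambda>s x. F s x - F (act S (inv c) s) x)"
    by (rule CT_cong[OF X push_bdry_invf[OF X]])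
      (use F push_bdry_eq(2) invf_diff[OF F R.invf_\<sigma>[OF F]] in \<open>simp_all add: Suc_1[symmetric] del: Suc_1\<close>)
  then show "DT 1 X (CT 2 X F) = CT 1 X (\<lambda>s x. F s x - F (act S (inv c) s) x)"
    using DT_CT[OF X, of 1 F] F unfolding Suc_1 by simp
next
  fix X F assume X: "X \<in> gsets G" and F: "invf pt X F"
  have e: "Suc 2 = 3" by simp
  have "CT 2 X (push (St (Suc 2)) (bdry 2) F) = CT 2 X (\<lambda>s x. F p0 x)"
    by (rule CT_cong[OF X push_bdry_invf[OF X]]) (use F push_bdry_eq(3) R.invf_const in simp_all)
  then show "DT 2 X (CT 3 X F) = CT 2 X (\<lambda>s x. F p0 x)"
    using DT_CT[OF X, of 2 F] F by simp
qed (simp_all add: zmodule_box_Q DT_in CT_surj)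

interpretation T: four_term G c a b "\<lambda>k. box G (Q k) N" DT CT "inv c"
  by (rule four_term_Tor)

lemma box_trivial:
  assumes k: "k \<ge> 4" and X: "X \<in> gsets G"
  shows "carrier (ob (box G (Q k) N) X) = {\<one>\<^bsub>ob (box G (Q k) N) X\<^esub>}"
proof -
  have P: "prod_gset (St k) X \<in> gsets G" using prod_gset_in[OF St X] .
  have "pts (prod_gset (St k) X) = {}" using k by (simp add: pts_prod St_def)
  then have "nt (St k) X F = \<one>\<^bsub>ob N (prod_gset (St k) X)\<^esub>" if "invf (St k) X F" for F
    using zmodule.trivial_on_empty[OF zmodule_N P] nt_in[OF St X that] by simp
  then have "CT k X F = \<one>\<^bsub>ob (box G (Q k) N) X\<^esub>" if "invf (St k) X F" for F
    unfolding CT_def box_repr.cb_eq_one_iff[OF box_repr X nt_in[OF St X that]] using that by simp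
  then have "carrier (ob (box G (Q k) N) X) \<subseteq> {\<one>\<^bsub>ob (box G (Q k) N) X\<^esub>}" using CT_surj[OF X] by auto
  then show ?thesis using monoid.one_closed[OF group.is_monoid[OF zmodule.group_ob[OF zmodule_box_Q X]]] by blast
qed

lemma kernel_contains_one:
  assumes "\<eta> \<in> zhom G M M'" "X \<in> gsets G" "zmodule G M" "zmodule G M'"
  shows "\<one>\<^bsub>ob M X\<^esub> \<in> kernel (ob M X) (ob M' X) (\<eta> X)"
  using zhom_one[OF assms(1,2,3,4)] monoid.one_closed[OF group.is_monoid[OF zmodule.group_ob[OF assms(3,2)]]]
  by (simp add: kernel_def)

lemma Tor_homology:
  "zmod_iso G (chain_homology (\<lambda>k. box G (Q k) N) DT 0) (Zquot G (gcd a b))"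
  "b > 0 \<Longrightarrow> zmod_iso G (chain_homology (\<lambda>k. box G (Q k) N) DT 3) (Zquot G (gcd a b))"
  "i \<noteq> 0 \<Longrightarrow> i \<noteq> 3 \<Longrightarrow> zmod_iso G (chain_homology (\<lambda>k. box G (Q k) N) DT i) zero_mod"
proof -
  show "zmod_iso G (chain_homology (\<lambda>k. box G (Q k) N) DT 0) (Zquot G (gcd a b))"
    using zmod_iso_sym[OF T.coker_iso] by (simp add: chain_homology_def)
next
  assume b: "b > 0"
  \<comment> \<open>Degree 4 is a zero term, so the boundaries in degree 3 are trivial.
    \<open>kernel_iso\<close> speaks of the trivial subgroup; \<open>subquot_cong\<close> exchanges
    the two denominators.\<close>
  have z: "DT 3 X ` carrier (ob (box G (Q 4) N) X) = {\<one>\<^bsub>ob (box G (Q 3) N) X\<^esub>}" if X: "X \<in> gsets G" for X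
    using box_trivial[of 4, OF _ X] zhom_one[OF DT_in[of 3] X zmodule_box_Q zmodule_box_Q] by simp
  have sk: "submodule_of G (box G (Q 3) N) (\<lambda>X. kernel (ob (box G (Q 3) N) X) (ob (box G (Q 2) N) X) (DT 2 X))"
    using submodule_kernel[OF zmodule_box_Q zmodule_box_Q DT_in[of 2]] by simp
  have si: "submodule_of G (box G (Q 3) N) (\<lambda>X. DT 3 X ` carrier (ob (box G (Q 4) N) X))"
    using submodule_image[OF zmodule_box_Q zmodule_box_Q DT_in[of 3]] by simp
  have k1: "\<one>\<^bsub>ob (box G (Q 3) N) X\<^esub> \<in> kernel (ob (box G (Q 3) N) X) (ob (box G (Q 2) N) X) (DT 2 X)" if X: "X \<in> gsets G" for X
    using sk X by (simp add: submodule_of_def subgroup.one_closed)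
  have "zmod_iso G (subquot (box G (Q 3) N) (\<lambda>X. kernel (ob (box G (Q 3) N) X) (ob (box G (Q 2) N) X) (DT 2 X)) (\<lambda>X. {\<one>\<^bsub>ob (box G (Q 3) N) X\<^esub>}))
      (subquot (box G (Q 3) N) (\<lambda>X. kernel (ob (box G (Q 3) N) X) (ob (box G (Q 2) N) X) (DT 2 X)) (\<lambda>X. DT 3 X ` carrier (ob (box G (Q 4) N) X)))"
    by (rule subquot_cong[OF zmodule_box_Q sk submodule_trivial[OF zmodule_box_Q] sk si]) (use z k1 in auto)
  from zmod_iso_sym[OF zmod_iso_trans[OF T.kernel_iso[OF b] this]]
  show "zmod_iso G (chain_homology (\<lambda>k. box G (Q k) N) DT 3) (Zquot G (gcd a b))"
    by (simp add: chain_homology_def numeral_3_eq_3 numeral_2_eq_2 eval_nat_numeral)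
next
  assume i: "i \<noteq> 0" "i \<noteq> 3"
  then obtain k where k: "i = Suc k" by (cases i) auto
  have "kernel (ob (box G (Q (Suc k)) N) X) (ob (box G (Q k) N) X) (DT k X)
      = DT (Suc k) X ` carrier (ob (box G (Q (Suc (Suc k))) N) X)" if X: "X \<in> gsets G" for X
  proof -
    have "k = 0 \<or> k = 1 \<or> Suc k \<ge> 4" using i k by linarith
    then show ?thesis
    proof (elim disjE)
      assume "k = 0" then show ?thesis using T.kernel_D0[OF X] by (simp add: numeral_2_eq_2)
    next
      assume "k = 1" then show ?thesis using T.kernel_D1[OF X] by (simp add: numeral_2_eq_2 numeral_3_eq_3)
    next
      assume k: "Suc k \<ge> 4"
      have "DT (Suc k) X ` carrier (ob (box G (Q (Suc (Suc k))) N) X) = {\<one>\<^bsub>ob (box G (Q (Suc k)) N) X\<^esub>}"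
        using box_trivial[of "Suc (Suc k)", OF _ X] zhom_one[OF DT_in X zmodule_box_Q zmodule_box_Q] k by simp
      moreover have "kernel (ob (box G (Q (Suc k)) N) X) (ob (box G (Q k) N) X) (DT k X) = {\<one>\<^bsub>ob (box G (Q (Suc k)) N) X\<^esub>}"
        using kernel_contains_one[OF DT_in X zmodule_box_Q zmodule_box_Q, of k] box_trivial[OF k X] by (auto simp: kernel_def)
      ultimately show ?thesis by simp
    qed
  qed
  then show "zmod_iso G (chain_homology (\<lambda>k. box G (Q k) N) DT i) zero_mod"
    unfolding chain_homology_def k nat.case
    by (intro subquot_zero[OF zmodule_box_Q submodule_kernel[OF zmodule_box_Q zmodule_box_Q DT_in]]) simp
qed

text \<open>An element of the internal hom out of a represented module is its value on the generator.\<close>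

definition wt where
  "wt k X = box_data.bx G (rep G X) (Q k) (prod_gset X (St k)) X (St k) (bz_id (prod_gset X (St k))) (bz_id X) (e k)"

definition CX where
  "CX k X F = represented.yo G (box G (rep G X) (Q k)) (prod_gset X (St k)) (wt k X) N (nt X (St k) (\<lambda>x s. F s x))"

definition DX where "DX k = ihom_pre G (Q (Suc k)) (Q k) N (d k)"

lemma box_data_rep: "X \<in> gsets G \<Longrightarrow> box_data G (rep G X) (Q k)"
  by (rule box_data.intro[OF zmodule_rep zmodule_Q])

lemma rep_wt: "X \<in> gsets G \<Longrightarrow> represented G (box G (rep G X) (Q k)) (prod_gset X (St k)) (wt k X)"
  unfolding wt_def by (rule box_data.bx_represented[OF box_data_rep represented_rep rQ])

lemma ihom_data_Q: "ihom_data G (Q k) N"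
  by (rule ihom_data.intro[OF zmodule_Q zmodule_N])

lemma zmodule_ihom_Q: "zmodule G (ihom G (Q k) N)"
  using ihom_data.zmodule_ihom[OF ihom_data_Q] .

lemma ihom_pre_data_d: "ihom_pre_data G (Q (Suc k)) (Q k) N (d k)"
  by (rule ihom_pre_data.intro[OF ihom_data_Q ihom_data_Q ihom_pre_data_axioms.intro[OF d_in]])

lemma DX_in: "DX k \<in> zhom G (ihom G (Q k) N) (ihom G (Q (Suc k)) N)"
  unfolding DX_def by (rule ihom_pre_data.ihom_pre_in[OF ihom_pre_data_d])

lemma nt_swap_in: "\<lbrakk>X \<in> gsets G; invf (St k) X F\<rbrakk> \<Longrightarrow> nt X (St k) (\<lambda>x s. F s x) \<in> carrier (ob N (prod_gset X (St k)))"
  by (rule nt_in[OF _ St invf_swap])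

lemma CX_in: "\<lbrakk>X \<in> gsets G; invf (St k) X F\<rbrakk> \<Longrightarrow> CX k X F \<in> carrier (ob (ihom G (Q k) N) X)"
  unfolding CX_def ihom_data.carrier_ihom[OF ihom_data_Q]
  by (rule represented.yo(1)[OF rep_wt zmodule_N nt_swap_in])

lemma CX_wt: "\<lbrakk>X \<in> gsets G; invf (St k) X F\<rbrakk> \<Longrightarrow> CX k X F (prod_gset X (St k)) (wt k X) = nt X (St k) (\<lambda>x s. F s x)"
  unfolding CX_def by (rule represented.yo(2)[OF rep_wt zmodule_N nt_swap_in])

lemma ihom_eq_wt:
  "\<lbrakk>X \<in> gsets G; \<eta> \<in> carrier (ob (ihom G (Q k) N) X); \<theta> \<in> carrier (ob (ihom G (Q k) N) X);
    \<eta> (prod_gset X (St k)) (wt k X) = \<theta> (prod_gset X (St k)) (wt k X)\<rbrakk> \<Longrightarrow> \<eta> = \<theta>"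
  unfolding ihom_data.carrier_ihom[OF ihom_data_Q] by (rule represented.zhom_rep_eqI[OF rep_wt])

lemma wt_in: "X \<in> gsets G \<Longrightarrow> wt k X \<in> carrier (ob (box G (rep G X) (Q k)) (prod_gset X (St k)))"
  using represented.e[OF rep_wt] .

lemma ihom_one_wt:
  "X \<in> gsets G \<Longrightarrow> \<one>\<^bsub>ob (ihom G (Q k) N) X\<^esub> (prod_gset X (St k)) (wt k X) = \<one>\<^bsub>ob N (prod_gset X (St k))\<^esub>"
  by (rule additive_ihom.one_bx[OF additive_ihom.intro[OF zmodule_N] zmodule_Q _ prod_gset_in[OF _ St] wt_in])

lemma ihom_one_in: "X \<in> gsets G \<Longrightarrow> \<one>\<^bsub>ob (ihom G (Q k) N) X\<^esub> \<in> carrier (ob (ihom G (Q k) N) X)"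
  by (rule additive_ihom.one_in[OF additive_ihom.intro[OF zmodule_N] zmodule_Q])

lemma ihom_wt_in: "\<lbrakk>X \<in> gsets G; \<eta> \<in> carrier (ob (ihom G (Q k) N) X)\<rbrakk>
    \<Longrightarrow> \<eta> (prod_gset X (St k)) (wt k X) \<in> carrier (ob N (prod_gset X (St k)))"
  unfolding ihom_data.carrier_ihom[OF ihom_data_Q] by (rule zhom_closed[OF _ prod_gset_in[OF _ St] wt_in])

lemma CX_surj:
  assumes X: "X \<in> gsets G"
  shows "carrier (ob (ihom G (Q k) N) X) = CX k X ` {F. invf (St k) X F}"
proof (intro equalityI subsetI)
  fix \<eta> assume \<eta>: "\<eta> \<in> carrier (ob (ihom G (Q k) N) X)"
  obtain F where F: "invf X (St k) F" "\<eta> (prod_gset X (St k)) (wt k X) = nt X (St k) F"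
    using nt_surj[OF X St ihom_wt_in[OF X \<eta>]] by blast
  have i: "invf (St k) X (\<lambda>s x. F x s)" using invf_swap[OF F(1)] .
  have "\<eta> = CX k X (\<lambda>s x. F x s)" by (rule ihom_eq_wt[OF X \<eta> CX_in[OF X i]]) (simp only: CX_wt[OF X i] F(2))
  then show "\<eta> \<in> CX k X ` {F. invf (St k) X F}" using i by blast
next
  fix \<eta> assume "\<eta> \<in> CX k X ` {F. invf (St k) X F}"
  then show "\<eta> \<in> carrier (ob (ihom G (Q k) N) X)" using CX_in[OF X] by auto
qed

lemma CX_add:
  assumes X: "X \<in> gsets G" and F: "invf (St k) X F" "invf (St k) X F'"
  shows "CX k X (\<lambda>s x. F s x + F' s x) = CX k X F \<otimes>\<^bsub>ob (ihom G (Q k) N) X\<^esub> CX k X F'"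
proof (rule ihom_eq_wt[OF X CX_in[OF X bzF_add(1)[OF St X F]] ihom_data.mult_ihom_in[OF ihom_data_Q X CX_in[OF X F(1)] CX_in[OF X F(2)]]])
  show "CX k X (\<lambda>s x. F s x + F' s x) (prod_gset X (St k)) (wt k X)
      = (CX k X F \<otimes>\<^bsub>ob (ihom G (Q k) N) X\<^esub> CX k X F') (prod_gset X (St k)) (wt k X)"
    unfolding ihom_data.mult_ihom_bx[OF ihom_data_Q X prod_gset_in[OF X St] wt_in[OF X]]
      CX_wt[OF X bzF_add(1)[OF St X F]] CX_wt[OF X F(1)] CX_wt[OF X F(2)]
    by (rule nt_add[OF X St invf_swap[OF F(1)] invf_swap[OF F(2)]])
qed

lemma CX_one_iff:
  assumes X: "X \<in> gsets G" and F: "invf (St k) X F"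
  shows "CX k X F = \<one>\<^bsub>ob (ihom G (Q k) N) X\<^esub> \<longleftrightarrow>
    (\<forall>s\<in>pts (St k). \<forall>x\<in>pts X. int (weight b (lcm (per (St k) s) (per X x))) dvd F s x)"
proof -
  have "CX k X F = \<one>\<^bsub>ob (ihom G (Q k) N) X\<^esub> \<longleftrightarrow> nt X (St k) (\<lambda>x s. F s x) = \<one>\<^bsub>ob N (prod_gset X (St k))\<^esub>"
    using ihom_eq_wt[OF X CX_in[OF X F] ihom_one_in[OF X]] CX_wt[OF X F] ihom_one_wt[OF X, of k] by metis
  also have "\<dots> \<longleftrightarrow> (\<forall>s\<in>pts (St k). \<forall>x\<in>pts X. int (weight b (lcm (per (St k) s) (per X x))) dvd F s x)"
    unfolding nt_one_iff[OF X St invf_swap[OF F]] by (auto simp: lcm.commute)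
  finally show ?thesis .
qed

text \<open>The classes met in naturality and in the differential are restrictions of the universal
  element \<open>wt\<close>. A natural transformation on them is then determined by its value at
  \<open>wt\<close>.\<close>

lemma wt_mor:
  assumes X: "X \<in> gsets G" and Y: "Y \<in> gsets G" and f: "f \<in> BZ G X Y" and T: "T \<in> gsets G" and h: "h \<in> BZ G T (St k)"
  shows "box_data.bx G (rep G Y) (Q k) (prod_gset X T) X T (bz_id (prod_gset X T)) f (mor (Q k) T (St k) h (e k))
    = mor (box G (rep G Y) (Q k)) (prod_gset X T) (prod_gset Y (St k)) (bz_prod X T f h) (wt k Y)"
proof -
  have m: "mor (rep G Y) X Y f (bz_id Y) = f" using bz_comp_id(1)[OF X Y f] by (simp add: rep_def)
  show ?thesis
    using box_data.bx_prod[OF box_data_rep[OF Y] Y St X T f h, of "bz_id Y" "e k"] represented.e[OF rQ, of k] bz_id_in[OF Y]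
    by (simp add: wt_def m) (simp add: rep_def)
qed

lemma value_mor:
  assumes X: "X \<in> gsets G" and Y: "Y \<in> gsets G" and f: "f \<in> BZ G X Y" and T: "T \<in> gsets G" and h: "h \<in> BZ G T (St k)"
    and F: "invf (St k) Y F"
  shows "CX k Y F (prod_gset X T) (box_data.bx G (rep G Y) (Q k) (prod_gset X T) X T (bz_id (prod_gset X T)) f (mor (Q k) T (St k) h (e k)))
    = nt X T (\<lambda>x t. ev (\<lambda>y. ev (\<lambda>s. F s y) (h (frag_of t))) (f (frag_of x)))"
proof -
  have P: "prod_gset X T \<in> gsets G" "prod_gset Y (St k) \<in> gsets G" using prod_gset_in X Y T St by blast+
  have fh: "bz_prod X T f h \<in> BZ G (prod_gset X T) (prod_gset Y (St k))" using bz_prod_in[OF f h] X Y T by simp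
  have \<eta>: "CX k Y F \<in> zhom G (box G (rep G Y) (Q k)) N" using CX_in[OF Y F] unfolding ihom_data.carrier_ihom[OF ihom_data_Q] .
  show ?thesis
    unfolding wt_mor[OF X Y f T h] zhom_natural[OF \<eta> P fh wt_in[OF Y]] CX_wt[OF Y F]
    by (rule nt_mor[OF X Y T St f h invf_swap[OF F]])
qed

lemma CX_nat:
  assumes X: "X \<in> gsets G" and Y: "Y \<in> gsets G" and f: "f \<in> BZ G X Y" and F: "invf (St k) Y F"
  shows "mor (ihom G (Q k) N) X Y f (CX k Y F) = CX k X (\<lambda>s x. ev (F s) (f (frag_of x)))"
proof (rule ihom_eq_wt[OF X ihom_data.mor_ihom_in[OF ihom_data_Q X Y f CX_in[OF Y F]] CX_in[OF X bzF_pre(1)[OF St X Y f F]]])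
  have P: "prod_gset X (St k) \<in> gsets G" using prod_gset_in[OF X St] .
  have v: "mor (ihom G (Q k) N) X Y f (CX k Y F) (prod_gset X (St k)) (wt k X)
      = CX k Y F (prod_gset X (St k)) (box_data.bx G (rep G Y) (Q k) (prod_gset X (St k)) X (St k)
          (bz_id (prod_gset X (St k))) f (mor (Q k) (St k) (St k) (bz_id (St k)) (e k)))"
    unfolding wt_def ihom_data.mor_ihom_bx[OF ihom_data_Q X Y f CX_in[OF Y F] P X St bz_id_in[OF P] bz_id_in[OF X] represented.e[OF rQ]]
      bz_comp_id(2)[OF X f] zmodule.mor_id[OF zmodule_Q St represented.e[OF rQ]] ..
  have i: "invf X (St k) (\<lambda>x s. ev (\<lambda>y. ev (\<lambda>s. F s y) (bz_id (St k) (frag_of s))) (f (frag_of x)))"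
    by (rule zt_mor(1)[OF X Y St St f bz_id_in[OF St] invf_swap[OF F]])
  show "mor (ihom G (Q k) N) X Y f (CX k Y F) (prod_gset X (St k)) (wt k X)
      = CX k X (\<lambda>s x. ev (F s) (f (frag_of x))) (prod_gset X (St k)) (wt k X)"
    unfolding v value_mor[OF X Y f St bz_id_in[OF St] F] CX_wt[OF X bzF_pre(1)[OF St X Y f F]]
    by (rule nt_cong[OF X St i invf_swap[OF bzF_pre(1)[OF St X Y f F]]]) simp
qed

text \<open>Precomposition with d replaces the universal element by its restriction along
  \<open>bdry\<close>, so \<open>F\<close> is evaluated on the image of a point. The matrix acts
  from the right here, which yields the rotation c itself.\<close>

lemma DX_CX:
  assumes X: "X \<in> gsets G" and F: "invf (St k) X F" and F': "invf (St (Suc k)) X F'"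
    and eq: "\<And>t x. \<lbrakk>t \<in> pts (St (Suc k)); x \<in> pts X\<rbrakk> \<Longrightarrow> ev (\<lambda>s. F s x) (bdry k (frag_of t)) = F' t x"
  shows "DX k X (CX k X F) = CX (Suc k) X F'"
proof (rule ihom_eq_wt[OF X _ CX_in[OF X F']])
  show "DX k X (CX k X F) \<in> carrier (ob (ihom G (Q (Suc k)) N) X)" using zhom_closed[OF DX_in X CX_in[OF X F]] .
  have P: "prod_gset X (St (Suc k)) \<in> gsets G" using prod_gset_in[OF X St] .
  have v: "DX k X (CX k X F) (prod_gset X (St (Suc k))) (wt (Suc k) X)
      = CX k X F (prod_gset X (St (Suc k))) (box_data.bx G (rep G X) (Q k) (prod_gset X (St (Suc k))) X (St (Suc k))
          (bz_id (prod_gset X (St (Suc k)))) (bz_id X) (mor (Q k) (St (Suc k)) (St k) (bdry k) (e k)))"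
    unfolding wt_def DX_def ihom_pre_data.ihom_pre_bx[OF ihom_pre_data_d X CX_in[OF X F] P X St bz_id_in[OF P] bz_id_in[OF X] represented.e[OF rQ]]
      d_e ..
  have i: "invf X (St (Suc k)) (\<lambda>x t. ev (\<lambda>y. ev (\<lambda>s. F s y) (bdry k (frag_of t))) (bz_id X (frag_of x)))"
    by (rule zt_mor(1)[OF X X St St bz_id_in[OF X] bdry invf_swap[OF F]])
  show "DX k X (CX k X F) (prod_gset X (St (Suc k))) (wt (Suc k) X) = CX (Suc k) X F' (prod_gset X (St (Suc k))) (wt (Suc k) X)"
    unfolding v value_mor[OF X X bz_id_in[OF X] St bdry F] CX_wt[OF X F']
    by (rule nt_cong[OF X St i invf_swap[OF F']]) (simp add: eq)
qed

end

context coefficients begin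

section \<open>The dual complex for Ext\<close>

lemma St_rev: "k \<le> 3 \<Longrightarrow> St (3 - k) = St k"
  by (auto simp: St_def)

text \<open>The sequence point, S, S, point is a palindrome, so the dual complex read backwards has
  the same shape: transposition interchanges augmentation and norm and inverts the rotation. The
  truncated differences 3 - k and 2 - k are genuine in the range where the locale constrains
  them.\<close>

lemma four_term_Ext:
  "four_term G c a b (\<lambda>k. ihom G (Q (3 - k)) N) (\<lambda>k. DX (2 - k)) (\<lambda>k. CX (3 - k)) c"
proof (rule four_term.intro[OF cyc_orbit_axioms four_term_axioms.intro])
  fix k :: nat assume "k < 3"
  then have "Suc (2 - k) = 3 - k" "3 - Suc k = 2 - k" by auto
  then show "DX (2 - k) \<in> zhom G (ihom G (Q (3 - Suc k)) N) (ihom G (Q (3 - k)) N)" using DX_in[of "2 - k"] by simp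
next
  fix k :: nat and X assume k: "k \<le> 3" and X: "X \<in> gsets G"
  note r = St_rev[OF k]
  show "carrier (ob (ihom G (Q (3 - k)) N) X) = CX (3 - k) X ` {F. invf (St k) X F}"
    using CX_surj[OF X, of "3 - k"] by (simp only: r)
  fix F assume F: "invf (St k) X F"
  then have F1: "invf (St (3 - k)) X F" by (simp only: r)
  show "CX (3 - k) X F = \<one>\<^bsub>ob (ihom G (Q (3 - k)) N) X\<^esub> \<longleftrightarrow>
      (\<forall>s\<in>pts (St k). \<forall>x\<in>pts X. int (weight b (lcm (per (St k) s) (per X x))) dvd F s x)"
    using CX_one_iff[OF X F1] by (simp only: r)
  fix F' assume "invf (St k) X F'"
  then have F'1: "invf (St (3 - k)) X F'" by (simp only: r)
  show "CX (3 - k) X (\<lambda>s x. F s x + F' s x) = CX (3 - k) X F \<otimes>\<^bsub>ob (ihom G (Q (3 - k)) N) X\<^esub> CX (3 - k) X F'"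
    by (rule CX_add[OF X F1 F'1])
next
  fix k :: nat and X Y f F assume h: "k = 0 \<or> k = 3" "X \<in> gsets G" "Y \<in> gsets G" "f \<in> BZ G X Y" "invf pt Y F"
  then have i: "invf (St (3 - k)) Y F" by auto
  show "mor (ihom G (Q (3 - k)) N) X Y f (CX (3 - k) Y F) = CX (3 - k) X (\<lambda>s x. ev (F s) (f (frag_of x)))"
    by (rule CX_nat[OF h(2-4) i])
next
  have e: "Suc 2 = 3" by simp
  fix X F assume X: "X \<in> gsets G" and F: "invf S X F"
  have "DX 2 X (CX 2 X F) = CX (Suc 2) X (\<lambda>s x. \<Sum>t\<in>pts S. F t x)"
    by (rule DX_CX[OF X]) (use F R.invf_sum[OF F] pull_bdry(3) in simp_all)
  then show "DX (2 - 0) X (CX (3 - 1) X F) = CX (3 - 0) X (\<lambda>s x. \<Sum>t\<in>pts S. F t x)" by simp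
  have "invf S X (\<lambda>s x. F (act S c s) x)"
    using F act_closed[OF S c] by (simp add: invf_def)
  then have "DX 1 X (CX 1 X F) = CX (Suc 1) X (\<lambda>s x. F s x - F (act S c s) x)"
    by (intro DX_CX[OF X]) (use F invf_diff[OF F] pull_bdry(2) in simp_all)
  then show "DX (2 - 1) X (CX (3 - 2) X F) = CX (3 - 1) X (\<lambda>s x. F s x - F (act S c s) x)" by (simp add: numeral_2_eq_2)
next
  fix X F assume X: "X \<in> gsets G" and F: "invf pt X F"
  have "DX 0 X (CX 0 X F) = CX (Suc 0) X (\<lambda>s x. F p0 x)"
    by (rule DX_CX[OF X]) (use F R.invf_const[OF F] pull_bdry(1) in simp_all)
  then show "DX (2 - 2) X (CX (3 - 3) X F) = CX (3 - 2) X (\<lambda>s x. F p0 x)" by simp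
qed (simp_all add: zmodule_ihom_Q)

interpretation E: four_term G c a b "\<lambda>k. ihom G (Q (3 - k)) N" "\<lambda>k. DX (2 - k)" "\<lambda>k. CX (3 - k)" c
  by (rule four_term_Ext)

lemma ihom_trivial:
  assumes k: "k \<ge> 4" and X: "X \<in> gsets G"
  shows "carrier (ob (ihom G (Q k) N) X) = {\<one>\<^bsub>ob (ihom G (Q k) N) X\<^esub>}"
proof -
  have "CX k X F = \<one>\<^bsub>ob (ihom G (Q k) N) X\<^esub>" if "invf (St k) X F" for F
    unfolding CX_one_iff[OF X that] using k by (simp add: St_def)
  then have "carrier (ob (ihom G (Q k) N) X) \<subseteq> {\<one>\<^bsub>ob (ihom G (Q k) N) X\<^esub>}" using CX_surj[OF X] by auto
  then show ?thesis using ihom_one_in[OF X] by blast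
qed

lemma Ext_cohomology:
  "b > 0 \<Longrightarrow> zmod_iso G (cochain_cohomology (\<lambda>k. ihom G (Q k) N) DX 0) (Zquot G (gcd a b))"
  "b = 0 \<Longrightarrow> zmod_iso G (cochain_cohomology (\<lambda>k. ihom G (Q k) N) DX 0) zero_mod"
  "zmod_iso G (cochain_cohomology (\<lambda>k. ihom G (Q k) N) DX 3) (Zquot G (gcd a b))"
  "i \<noteq> 0 \<Longrightarrow> i \<noteq> 3 \<Longrightarrow> zmod_iso G (cochain_cohomology (\<lambda>k. ihom G (Q k) N) DX i) zero_mod"
proof -
  assume b: "b > 0"
  show "zmod_iso G (cochain_cohomology (\<lambda>k. ihom G (Q k) N) DX 0) (Zquot G (gcd a b))"
    using zmod_iso_sym[OF E.kernel_iso[OF b]] by (simp add: cochain_cohomology_def)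
next
  assume b: "b = 0"
  show "zmod_iso G (cochain_cohomology (\<lambda>k. ihom G (Q k) N) DX 0) zero_mod"
    unfolding cochain_cohomology_def nat.case
    by (rule subquot_zero[OF zmodule_ihom_Q submodule_kernel[OF zmodule_ihom_Q zmodule_ihom_Q DX_in]])
      (use E.kernel_zero[OF b] in simp)
next
  let ?I = "\<lambda>X. DX 2 X ` carrier (ob (ihom G (Q 2) N) X)"
  have sk: "submodule_of G (ihom G (Q 3) N) (\<lambda>X. kernel (ob (ihom G (Q 3) N) X) (ob (ihom G (Q 4) N) X) (DX 3 X))"
    using submodule_kernel[OF zmodule_ihom_Q zmodule_ihom_Q DX_in[of 3]] by simp
  have si: "submodule_of G (ihom G (Q 3) N) ?I"
    using submodule_image[OF zmodule_ihom_Q zmodule_ihom_Q DX_in[of 2]] by simp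
  \<comment> \<open>The next term is zero, so everything in degree 3 is a cocycle and the cohomology
    there is the cokernel end of the reversed complex.\<close>
  have k: "kernel (ob (ihom G (Q 3) N) X) (ob (ihom G (Q 4) N) X) (DX 3 X) = carrier (ob (ihom G (Q 3) N) X)"
    if X: "X \<in> gsets G" for X
    using zhom_closed[OF DX_in[of 3] X] ihom_trivial[of 4, OF _ X] by (auto simp: kernel_def)
  have "zmod_iso G (subquot (ihom G (Q 3) N) (\<lambda>X. carrier (ob (ihom G (Q 3) N) X)) ?I)
      (subquot (ihom G (Q 3) N) (\<lambda>X. kernel (ob (ihom G (Q 3) N) X) (ob (ihom G (Q 4) N) X) (DX 3 X)) ?I)"
    by (rule subquot_cong[OF zmodule_ihom_Q submodule_carrier[OF zmodule_ihom_Q] si sk si])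
      (use k zhom_closed[OF DX_in[of 2]] in auto)
  moreover have "zmod_iso G (Zquot G (gcd a b)) (subquot (ihom G (Q 3) N) (\<lambda>X. carrier (ob (ihom G (Q 3) N) X)) ?I)"
    using E.coker_iso by simp
  ultimately have "zmod_iso G (subquot (ihom G (Q 3) N)
      (\<lambda>X. kernel (ob (ihom G (Q 3) N) X) (ob (ihom G (Q 4) N) X) (DX 3 X)) ?I) (Zquot G (gcd a b))"
    using zmod_iso_sym zmod_iso_trans by blast
  then show "zmod_iso G (cochain_cohomology (\<lambda>k. ihom G (Q k) N) DX 3) (Zquot G (gcd a b))"
    by (simp add: cochain_cohomology_def eval_nat_numeral)
next
  assume i: "i \<noteq> 0" "i \<noteq> 3"
  then obtain k where k: "i = Suc k" by (cases i) auto
  have "kernel (ob (ihom G (Q (Suc k)) N) X) (ob (ihom G (Q (Suc (Suc k))) N) X) (DX (Suc k) X)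
      = DX k X ` carrier (ob (ihom G (Q k) N) X)" if X: "X \<in> gsets G" for X
  proof -
    have "k = 0 \<or> k = 1 \<or> Suc k \<ge> 4" using i k by linarith
    then show ?thesis
    proof (elim disjE)
      \<comment> \<open>Cohomological degree i sits at position 3 - i of the reversed complex, so
        degree 1 uses exactness at position 2 and degree 2 that at position 1.\<close>
      assume "k = 0" then show ?thesis using E.kernel_D1[OF X] by (simp add: numeral_2_eq_2 numeral_3_eq_3)
    next
      assume "k = 1" then show ?thesis using E.kernel_D0[OF X] by (simp add: numeral_2_eq_2 numeral_3_eq_3)
    next
      assume k: "Suc k \<ge> 4"
      have "DX k X ` carrier (ob (ihom G (Q k) N) X) = {\<one>\<^bsub>ob (ihom G (Q (Suc k)) N) X\<^esub>}"
      proof -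
        have "DX k X m = \<one>\<^bsub>ob (ihom G (Q (Suc k)) N) X\<^esub>" if "m \<in> carrier (ob (ihom G (Q k) N) X)" for m
          using zhom_closed[OF DX_in[of k] X that] unfolding ihom_trivial[OF k X] by simp
        then show ?thesis using ihom_one_in[OF X, of k] by force
      qed
      moreover have "kernel (ob (ihom G (Q (Suc k)) N) X) (ob (ihom G (Q (Suc (Suc k))) N) X) (DX (Suc k) X)
          = {\<one>\<^bsub>ob (ihom G (Q (Suc k)) N) X\<^esub>}"
        using kernel_contains_one[OF DX_in X zmodule_ihom_Q zmodule_ihom_Q, of "Suc k"] ihom_trivial[OF k X] by (auto simp: kernel_def)
      ultimately show ?thesis by simp
    qed
  qed
  then show "zmod_iso G (cochain_cohomology (\<lambda>k. ihom G (Q k) N) DX i) zero_mod"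
    unfolding cochain_cohomology_def k nat.case
    by (intro subquot_zero[OF zmodule_ihom_Q submodule_kernel[OF zmodule_ihom_Q zmodule_ihom_Q DX_in]]) simp
qed

end

text \<open>The auxiliary resolution and its element type disappear here; only the coefficient map
  \<pi> remains as input. The side conditions on b keep apart the degrees in which the kernel end is
  \<int>/I and those in which it is zero.\<close>

lemma (in cyc_orbit) Tor_Ext:
  fixes N :: "('g, 'n) zmod"
  assumes zmodule_N: "zmodule G N" and \<pi>: "\<pi> \<in> zhom G (constZ G) N"
    and \<pi>_surj: "\<And>X. X \<in> gsets G \<Longrightarrow> \<pi> X ` carrier (ob (constZ G) X) = carrier (ob N X)"
    and \<pi>_ker: "\<And>X u. \<lbrakk>X \<in> gsets G; u \<in> carrier (ob (constZ G) X)\<rbrakk> \<Longrightarrow>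
      \<pi> X u = \<one>\<^bsub>ob N X\<^esub> \<longleftrightarrow> (\<forall>x\<in>pts X. int (weight b (per X x)) dvd u (frag_of x))"
  shows "i = 0 \<or> i = 3 \<and> b > 0 \<Longrightarrow> zmod_iso G (Tor G i (Zquot G a) N) (Zquot G (gcd a b))"
    and "i \<noteq> 0 \<Longrightarrow> i \<noteq> 3 \<Longrightarrow> zmod_iso G (Tor G i (Zquot G a) N) zero_mod"
    and "i = 0 \<and> b > 0 \<or> i = 3 \<Longrightarrow> zmod_iso G (Ext G i (Zquot G a) N) (Zquot G (gcd a b))"
    and "i \<noteq> 3 \<Longrightarrow> i \<noteq> 0 \<or> b = 0 \<Longrightarrow> zmod_iso G (Ext G i (Zquot G a) N) zero_mod"
proof -
  obtain Q :: "nat \<Rightarrow> ('g, (('g pt \<Rightarrow>\<^sub>0 int) \<Rightarrow> int) set \<times> nat \<Rightarrow> int) zmod" and e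
    where r: "resolution_data G c a Q e" using resolution_exists .
  interpret coefficients G c a Q e b N \<pi>
    by (rule coefficients.intro[OF r coefficients_axioms.intro]) (fact zmodule_N \<pi> \<pi>_surj \<pi>_ker)+
  have T: "zmod_iso G (Tor G i (Zquot G a) N) (chain_homology (\<lambda>k. box G (Q k) N) DT i)"
    using Tor_iso[OF Zquot_proj(1) zmodule_N free_resolution] unfolding DT_def[abs_def] .
  have E: "zmod_iso G (Ext G i (Zquot G a) N) (cochain_cohomology (\<lambda>k. ihom G (Q k) N) DX i)"
    using Ext_iso[OF Zquot_proj(1) zmodule_N free_resolution] unfolding DX_def[abs_def] .
  show "i = 0 \<or> i = 3 \<and> b > 0 \<Longrightarrow> zmod_iso G (Tor G i (Zquot G a) N) (Zquot G (gcd a b))"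
    using zmod_iso_trans[OF T] Tor_homology(1,2) by auto
  show "i \<noteq> 0 \<Longrightarrow> i \<noteq> 3 \<Longrightarrow> zmod_iso G (Tor G i (Zquot G a) N) zero_mod"
    by (rule zmod_iso_trans[OF T Tor_homology(3)])
  show "i = 0 \<and> b > 0 \<or> i = 3 \<Longrightarrow> zmod_iso G (Ext G i (Zquot G a) N) (Zquot G (gcd a b))"
    using zmod_iso_trans[OF E] Ext_cohomology(1,3) by auto
  show "i \<noteq> 3 \<Longrightarrow> i \<noteq> 0 \<or> b = 0 \<Longrightarrow> zmod_iso G (Ext G i (Zquot G a) N) zero_mod"
    using zmod_iso_trans[OF E] Ext_cohomology(2,4) by (cases "i = 0") auto
qed

theorem proposition1p1:
  fixes G :: "'g monoid" and n a b :: nat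
  assumes "group G" and "cyclic_group G" and "order G = n" and "n \<ge> 1"
    and "a dvd n" and "b dvd n"
  shows "(\<forall>i. if i = 0 \<or> i = 3
            then zmod_iso G (Tor G i (Zquot G a) (Zquot G b)) (Zquot G (gcd a b))
            else zmod_iso G (Tor G i (Zquot G a) (Zquot G b)) zero_mod)
       \<and> (\<forall>i. if i = 0 \<or> i = 3
            then zmod_iso G (Ext G i (Zquot G a) (Zquot G b)) (Zquot G (gcd a b))
            else zmod_iso G (Ext G i (Zquot G a) (Zquot G b)) zero_mod)
       \<and> (\<forall>i. if i = 3
            then zmod_iso G (Ext G i (Zquot G a) (constZ G)) (Zquot G a)
            else zmod_iso G (Ext G i (Zquot G a) (constZ G)) zero_mod)"
proof -
  interpret group G by fact
  have fin: "finite (carrier G)" using assms(3,4) order_gt_0_iff_finite by simp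
  obtain c where c: "c \<in> carrier G" "carrier G = range (\<lambda>k::int. c [^]\<^bsub>G\<^esub> k)"
    using cyclic_group assms(2) by blast
  \<comment> \<open>\<open>cyclic_group\<close> provides integer powers; finiteness of the group
    reduces them to natural ones.\<close>
  have "carrier G = range (\<lambda>k::nat. c [^]\<^bsub>G\<^esub> k)"
    using generate_pow[OF c(1)] generate_pow_on_finite_carrier[OF fin c(1)] c(2) by (simp add: full_SetCompr_eq)
  then interpret cyc G c using c(1) fin by (intro cyc.intro group_axioms cyc_axioms.intro)
  have n: "order G = local.n" by (simp add: n_def)
  interpret A: cyc_orbit G c a using assms(3,5) n by (intro cyc_orbit.intro cyc_axioms cyc_orbit_axioms.intro) simp
  interpret B: cyc_orbit G c b using assms(3,6) n by (intro cyc_orbit.intro cyc_axioms cyc_orbit_axioms.intro) simp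
  note Zquot_proj = zproj[OF zmodule_constZ B.ideal_of_submodule, folded Zquot_def]
  have k: "zproj G (constZ G) (ideal_of G b) X u = \<one>\<^bsub>ob (Zquot G b) X\<^esub> \<longleftrightarrow>
      (\<forall>x\<in>pts X. int (weight b (per X x)) dvd u (frag_of x))"
    if "X \<in> gsets G" "u \<in> carrier (ob (constZ G) X)" for X u
    using Zquot_proj(4)[OF that] B.ideal_of_eq[OF that(1)] that(2) by (simp add: J_def)
  \<comment> \<open>The constant module as the quotient for b = 0: all weights are 0, so the
    divisibility conditions express that u is trivial.\<close>
  have k0: "zid G (constZ G) X u = \<one>\<^bsub>ob (constZ G) X\<^esub> \<longleftrightarrow>
      (\<forall>x\<in>pts X. int (weight 0 (per X x)) dvd u (frag_of x))"
    if "X \<in> gsets G" "u \<in> carrier (ob (constZ G) X)" for X u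
  proof -
    have "u = \<one>\<^bsub>ob (constZ G) X\<^esub>" if "\<forall>x\<in>pts X. u (frag_of x) = 0"
      by (rule constZ_eqI[OF \<open>u \<in> _\<close> constZ_one_in[OF \<open>X \<in> _\<close>]]) (use that in \<open>simp add: constZ_apply(2)\<close>)
    then show ?thesis using that by (auto simp: weight_def constZ_apply(2))
  qed
  have i: "zid G (constZ G) X ` carrier (ob (constZ G) X) = carrier (ob (constZ G) X)" if "X \<in> gsets G" for X
    using that by force
  have T: "zmod_iso G (Tor G i (Zquot G a) (Zquot G b)) (Zquot G (gcd a b))" if "i = 0 \<or> i = 3" for i
    by (rule A.Tor_Ext(1)[OF Zquot_proj(1-3) k]) (use that B.a_pos in auto)
  have T': "zmod_iso G (Tor G i (Zquot G a) (Zquot G b)) zero_mod" if "i \<noteq> 0" "i \<noteq> 3" for i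
    by (rule A.Tor_Ext(2)[OF Zquot_proj(1-3) k]) (use that in auto)
  have E: "zmod_iso G (Ext G i (Zquot G a) (Zquot G b)) (Zquot G (gcd a b))" if "i = 0 \<or> i = 3" for i
    by (rule A.Tor_Ext(3)[OF Zquot_proj(1-3) k]) (use that B.a_pos in auto)
  have E': "zmod_iso G (Ext G i (Zquot G a) (Zquot G b)) zero_mod" if "i \<noteq> 0" "i \<noteq> 3" for i
    by (rule A.Tor_Ext(4)[OF Zquot_proj(1-3) k]) (use that in auto)
  \<comment> \<open>In the end gcd(a, 0) = a turns this target into \<int>/I_a.\<close>
  have Z: "zmod_iso G (Ext G 3 (Zquot G a) (constZ G)) (Zquot G (gcd a 0))"
    by (rule A.Tor_Ext(3)[OF zmodule_constZ zid_in[OF zmodule_constZ] i k0]) auto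
  have Z': "zmod_iso G (Ext G i (Zquot G a) (constZ G)) zero_mod" if "i \<noteq> 3" for i
    by (rule A.Tor_Ext(4)[OF zmodule_constZ zid_in[OF zmodule_constZ] i k0]) (use that in auto)
  show ?thesis using T T' E E' Z Z' by simp
qed

end
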